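(* Let $\Phi_1\in\mathcal C(A_0B_0,A_1B_1)$, $\Phi_2\in\mathcal C(A'_0B_0,A'_1B_1)$ and $\epsilon\ge0$. The following are equivalent. (i) $\delta_{A|A'}(\Phi_1\|\Phi_2)\le\epsilon$. (ii) For all finite-dimensional systems $R_0,R_1$ and every $\rho\in\mathfrak S(R_0B_0R_1B_1)$, $$\sup_{\Theta\in\mathcal C_2(A',R)}\langle\rho,(\Theta\otimes\mathrm{id}_B)(\Phi_2)\rangle\le\sup_{\Theta\in\mathcal C_2(A,R)}\langle\rho,(\Theta\otimes\mathrm{id}_B)(\Phi_1)\rangle+\frac{\epsilon}{2}\|\rho\|^\diamond_{R_1B_1|R_0B_0}.$$ (iii) For all systems $R_0,R_1$, all $k,l\in\mathbb N$, every ensemble $\mathcal E=\{\lambda_{i,j},\rho_{i,j}\}_{i\le k,j\le l}$ on $R_0B_0R_1B_1$ and every fixed measurement $M\in\mathcal M_l(B_1B_1)$, $$P^{M}_{\Phi_2,k}(\mathcal E)\le P^{M}_{\Phi_1,k}(\mathcal E)+\frac{\epsilon}{2}P_{\rm succ}(\mathcal E).$$ Moreover, (i) is also equivalent to (ii), resp. (iii), required only for $R_0=A'_0$, $R_1=A'_1$.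
   Context: Finite-dimensional systems; $\mathcal C(X,Y)$ channels; $\mathcal M_k(X)$ measurements with $k$ outcomes on $X$; $\|\cdot\|_\diamond$ diamond norm. $B=B_0B_1$ is fixed. For $A=A_0A_1$, $A'=A'_0A'_1$, $\mathcal C_2(A,A')$ is the set of superchannels $\Theta$ given by an ancilla $U$, $\Theta_{\rm pre}\in\mathcal C(A'_0,UA_0)$, $\Theta_{\rm post}\in\mathcal C(UA_1,A'_1)$; for $\Phi\in\mathcal C(A_0B_0,A_1B_1)$, $(\Theta\otimes\mathrm{id}_B)(\Phi)=(\Theta_{\rm post}\otimes\mathrm{id}_{B_1})\circ(\mathrm{id}_U\otimes\Phi)\circ(\Theta_{\rm pre}\otimes\mathrm{id}_{B_0})\in\mathcal C(A'_0B_0,A'_1B_1)$. $\delta_{A|A'}(\Phi_1\|\Phi_2)=\min_{\Theta\in\mathcal C_2(A,A')}\|(\Theta\otimes\mathrm{id}_B)(\Phi_1)-\Phi_2\|_\diamond$. In (ii), $R=R_0R_1$. For $X\in\mathcal B_h(S_0S_1)$ and $\phi\in\mathcal L(S_0,S_1)$, $\langle X,\phi\rangle={\rm Tr}[XC_{\phi^*}]$ with Choi matrix $C_\psi=(\psi\otimes\mathrm{id})(|I\rangle\rangle\langle\langle I|)$ and $\phi^*$ the adjoint; $\|\rho\|^\diamond_{S_1|S_0}=\max_{\alpha\in\mathcal C(S_0,S_1)}\langle\rho,\alpha\rangle$. $P_{\rm succ}(\mathcal E,M)=\sum\lambda_{i}{\rm Tr}[\rho_iM_i]$, $P_{\rm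 succ}(\mathcal E)=\max_MP_{\rm succ}(\mathcal E,M)$. For $\Phi\in\mathcal C(A''_0B_0,A''_1B_1)$, $P^M_{\Phi,k}(\mathcal E)$ is the supremum over ancillas $U$, preprocessings $\alpha\in\mathcal C(R_0,A''_0U)$ and measurements $N\in\mathcal M_k(UA''_1R_1)$ of $\sum_{i,j}\lambda_{i,j}{\rm Tr}\big[\big(((\mathrm{id}_U\otimes\Phi)\circ(\alpha\otimes\mathrm{id}_{B_0}))\otimes\mathrm{id}_{R_1B_1}\big)(\rho_{i,j})\,(N_i\otimes M_j)\big]$, where $\alpha$ acts on the $R_0$ part of the ensemble, $B_0$ of the ensemble is fed into $\Phi$, $N$ measures $UA''_1R_1$ and $M$ measures the output $B_1$ of $\Phi$ together with the $B_1$ part of the ensemble. *)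

theory Defs
  imports Complex_Main "Jordan_Normal_Form.Matrix"
begin

text \<open>Finite-dimensional systems are represented by their (positive) dimensions.
  Operators on a system of dimension n are complex n x n matrices.  Composite
  systems XY have dimension x*y, with row-major (Kronecker) index ordering
  i = i_X * y + i_Y.  Linear maps between operator spaces are HOL functions
  on matrices (only their behaviour on the relevant carrier matters).\<close>

definition kron :: "complex mat \<Rightarrow> complex mat \<Rightarrow> complex mat" where
  "kron A B = mat (dim_row A * dim_row B) (dim_col A * dim_col B)
     (\<lambda>(i,j). A $$ (i div dim_row B, j div dim_col B) * B $$ (i mod dim_row B, j mod dim_col B))"

definition trace :: "complex mat \<Rightarrow> complex" where
  "trace A = (\<Sum>i<dim_row A. A $$ (i,i))"

definition dagger :: "complex mat \<Rightarrow> complex mat" where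
  "dagger U = mat (dim_col U) (dim_row U) (\<lambda>(i,j). cnj (U $$ (j,i)))"

definition psd :: "nat \<Rightarrow> complex mat \<Rightarrow> bool" where
  "psd n A \<longleftrightarrow> A \<in> carrier_mat n n \<and> (\<forall>i<n. \<forall>j<n. A $$ (i,j) = cnj (A $$ (j,i))) \<and>
     (\<forall>v :: nat \<Rightarrow> complex. 0 \<le> Re (\<Sum>i<n. \<Sum>j<n. cnj (v i) * A $$ (i,j) * v j))"

definition density :: "nat \<Rightarrow> complex mat \<Rightarrow> bool" where
  "density n \<rho> \<longleftrightarrow> psd n \<rho> \<and> trace \<rho> = 1"

definition unitary :: "nat \<Rightarrow> complex mat \<Rightarrow> bool" where
  "unitary n U \<longleftrightarrow> U \<in> carrier_mat n n \<and> U * dagger U = 1\<^sub>m n"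

text \<open>Trace norm (Schatten 1-norm), via its dual characterisation by unitaries.\<close>
definition tnorm :: "nat \<Rightarrow> complex mat \<Rightarrow> real" where
  "tnorm n X = Sup {Re (trace (U * X)) | U. unitary n U}"

text \<open>(Phi (x) id_k)(X), Phi : L(C^n) -> L(C^m), X on C^n (x) C^k.\<close>
definition tid_right :: "nat \<Rightarrow> nat \<Rightarrow> nat \<Rightarrow> (complex mat \<Rightarrow> complex mat) \<Rightarrow> complex mat \<Rightarrow> complex mat" where
  "tid_right n m k \<Phi> X = mat (m*k) (m*k) (\<lambda>(i,j).
      \<Phi> (mat n n (\<lambda>(p,q). X $$ (p*k + i mod k, q*k + j mod k))) $$ (i div k, j div k))"

text \<open>(id_k (x) Phi)(X), Phi : L(C^n) -> L(C^m), X on C^k (x) C^n.\<close>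
definition tid_left :: "nat \<Rightarrow> nat \<Rightarrow> nat \<Rightarrow> (complex mat \<Rightarrow> complex mat) \<Rightarrow> complex mat \<Rightarrow> complex mat" where
  "tid_left k n m \<Phi> X = mat (k*m) (k*m) (\<lambda>(i,j).
      \<Phi> (mat n n (\<lambda>(p,q). X $$ ((i div m)*n + p, (j div m)*n + q))) $$ (i mod m, j mod m))"

definition maxent :: "nat \<Rightarrow> complex mat" where
  "maxent n = mat (n*n) (n*n) (\<lambda>(i,j). if i div n = i mod n \<and> j div n = j mod n then 1 else 0)"

definition choi :: "nat \<Rightarrow> nat \<Rightarrow> (complex mat \<Rightarrow> complex mat) \<Rightarrow> complex mat" where
  "choi n m \<psi> = tid_right n m n \<psi> (maxent n)"

definition unitmat :: "nat \<Rightarrow> nat \<Rightarrow> nat \<Rightarrow> complex mat" where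
  "unitmat n a b = mat n n (\<lambda>(i,j). if i = a \<and> j = b then 1 else 0)"

text \<open>Hilbert-Schmidt adjoint phi^* : L(C^m) -> L(C^n) of phi : L(C^n) -> L(C^m),
  characterised by Tr[(phi^* Y)^dagger X] = Tr[Y^dagger phi(X)].\<close>
definition adj_map :: "nat \<Rightarrow> nat \<Rightarrow> (complex mat \<Rightarrow> complex mat) \<Rightarrow> complex mat \<Rightarrow> complex mat" where
  "adj_map n m \<phi> Y = mat n n (\<lambda>(i,j). \<Sum>k<m. \<Sum>l<m. Y $$ (k,l) * cnj (\<phi> (unitmat n i j) $$ (k,l)))"

definition channel :: "nat \<Rightarrow> nat \<Rightarrow> (complex mat \<Rightarrow> complex mat) \<Rightarrow> bool" where
  "channel n m \<Phi> \<longleftrightarrow>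
     (\<forall>X \<in> carrier_mat n n. \<Phi> X \<in> carrier_mat m m) \<and>
     (\<forall>X \<in> carrier_mat n n. \<forall>Y \<in> carrier_mat n n. \<Phi> (X + Y) = \<Phi> X + \<Phi> Y) \<and>
     (\<forall>X \<in> carrier_mat n n. \<forall>c. \<Phi> (c \<cdot>\<^sub>m X) = c \<cdot>\<^sub>m \<Phi> X) \<and>
     (\<forall>X \<in> carrier_mat n n. trace (\<Phi> X) = trace X) \<and>
     psd (m*n) (choi n m \<Phi>)"

definition dnorm :: "nat \<Rightarrow> nat \<Rightarrow> (complex mat \<Rightarrow> complex mat) \<Rightarrow> real" where
  "dnorm n m \<Psi> = Sup {tnorm (m*n) (tid_right n m n \<Psi> Y) | Y.
       Y \<in> carrier_mat (n*n) (n*n) \<and> tnorm (n*n) Y \<le> 1}"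

definition povm :: "nat \<Rightarrow> 'i set \<Rightarrow> ('i \<Rightarrow> complex mat) \<Rightarrow> bool" where
  "povm d I M \<longleftrightarrow> (\<forall>x\<in>I. psd d (M x)) \<and>
     (\<forall>a<d. \<forall>b<d. (\<Sum>x\<in>I. M x $$ (a,b)) = (if a = b then 1 else 0))"

definition superchannel :: "nat \<Rightarrow> nat \<Rightarrow> nat \<Rightarrow> nat \<Rightarrow> nat \<Rightarrow>
    (complex mat \<Rightarrow> complex mat) \<Rightarrow> (complex mat \<Rightarrow> complex mat) \<Rightarrow> bool" where
  "superchannel a0 a1 a0' a1' u pre post \<longleftrightarrow>
     0 < u \<and> channel a0' (u*a0) pre \<and> channel (u*a1) a1' post"

definition apply_sc :: "nat \<Rightarrow> nat \<Rightarrow> nat \<Rightarrow> nat \<Rightarrow> nat \<Rightarrow> nat \<Rightarrow> nat \<Rightarrow>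
    (complex mat \<Rightarrow> complex mat) \<Rightarrow> (complex mat \<Rightarrow> complex mat) \<Rightarrow>
    (complex mat \<Rightarrow> complex mat) \<Rightarrow> complex mat \<Rightarrow> complex mat" where
  "apply_sc a0 a1 a0' a1' b0 b1 u pre post \<Phi> X =
     tid_right (u*a1) a1' b1 post
       (tid_left u (a0*b0) (a1*b1) \<Phi> (tid_right a0' (u*a0) b0 pre X))"

definition delta :: "nat \<Rightarrow> nat \<Rightarrow> nat \<Rightarrow> nat \<Rightarrow> nat \<Rightarrow> nat \<Rightarrow>
    (complex mat \<Rightarrow> complex mat) \<Rightarrow> (complex mat \<Rightarrow> complex mat) \<Rightarrow> real" where
  "delta a0 a1 a0' a1' b0 b1 \<Phi>1 \<Phi>2 = Inf {dnorm (a0'*b0) (a1'*b1)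
       (\<lambda>X. apply_sc a0 a1 a0' a1' b0 b1 u pre post \<Phi>1 X - \<Phi>2 X) | u pre post.
       superchannel a0 a1 a0' a1' u pre post}"

text \<open><X, phi> = Tr[X C_{phi^*}] for X on S0 S1 and phi : L(S0) -> L(S1)
  (real part; it is real for Hermitian X and Hermiticity preserving phi).\<close>
definition pairing :: "nat \<Rightarrow> nat \<Rightarrow> complex mat \<Rightarrow> (complex mat \<Rightarrow> complex mat) \<Rightarrow> real" where
  "pairing s0 s1 X \<phi> = Re (trace (X * choi s1 s0 (adj_map s0 s1 \<phi>)))"

definition dual_dnorm :: "nat \<Rightarrow> nat \<Rightarrow> complex mat \<Rightarrow> real" where
  "dual_dnorm s0 s1 \<rho> = Sup {pairing s0 s1 \<rho> \<alpha> | \<alpha>. channel s0 s1 \<alpha>}"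

definition ensemble :: "nat \<Rightarrow> nat \<Rightarrow> nat \<Rightarrow> (nat \<Rightarrow> nat \<Rightarrow> real) \<Rightarrow> (nat \<Rightarrow> nat \<Rightarrow> complex mat) \<Rightarrow> bool" where
  "ensemble d k l lam rho \<longleftrightarrow> (\<forall>i<k. \<forall>j<l. 0 \<le> lam i j \<and> density d (rho i j)) \<and>
     (\<Sum>i<k. \<Sum>j<l. lam i j) = 1"

definition psucc :: "nat \<Rightarrow> nat \<Rightarrow> nat \<Rightarrow> (nat \<Rightarrow> nat \<Rightarrow> real) \<Rightarrow> (nat \<Rightarrow> nat \<Rightarrow> complex mat) \<Rightarrow> real" where
  "psucc d k l lam rho = Sup {(\<Sum>i<k. \<Sum>j<l. lam i j * Re (trace (rho i j * M (i,j)))) | M.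
       povm d ({..<k} \<times> {..<l}) M}"

text \<open>Reorder a (x) b (x) c (x) d into a (x) c (x) b (x) d.\<close>
definition sw_idx :: "nat \<Rightarrow> nat \<Rightarrow> nat \<Rightarrow> nat \<Rightarrow> nat \<Rightarrow> nat" where
  "sw_idx a b c d i = (let id = i mod d; r = i div d; ib = r mod b; r2 = r div b;
                          ic = r2 mod c; ia = r2 div c in ((ia*b + ib)*c + ic)*d + id)"

definition swap_mid :: "nat \<Rightarrow> nat \<Rightarrow> nat \<Rightarrow> nat \<Rightarrow> complex mat \<Rightarrow> complex mat" where
  "swap_mid a b c d X = mat (a*c*b*d) (a*c*b*d) (\<lambda>(i,j). X $$ (sw_idx a b c d i, sw_idx a b c d j))"

definition pM :: "nat \<Rightarrow> nat \<Rightarrow> nat \<Rightarrow> nat \<Rightarrow> nat \<Rightarrow> nat \<Rightarrow> nat \<Rightarrow> nat \<Rightarrow>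
    (complex mat \<Rightarrow> complex mat) \<Rightarrow> (nat \<Rightarrow> nat \<Rightarrow> real) \<Rightarrow> (nat \<Rightarrow> nat \<Rightarrow> complex mat) \<Rightarrow>
    (nat \<Rightarrow> complex mat) \<Rightarrow> real" where
  "pM a0 a1 b0 b1 r0 r1 k l \<Phi> lam rho M = Sup {(\<Sum>i<k. \<Sum>j<l. lam i j *
       Re (trace (tid_right (r0*b0) (u*a1*b1) (r1*b1)
                    (\<lambda>X. tid_left u (a0*b0) (a1*b1) \<Phi> (tid_right r0 (u*a0) b0 \<alpha> X)) (rho i j)
                  * swap_mid (u*a1) r1 b1 b1 (kron (N i) (M j))))) | u \<alpha> N.
       0 < u \<and> channel r0 (u*a0) \<alpha> \<and> povm (u*a1*r1) {..<k} N}"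

definition cond_ii :: "nat \<Rightarrow> nat \<Rightarrow> nat \<Rightarrow> nat \<Rightarrow> nat \<Rightarrow> nat \<Rightarrow>
    (complex mat \<Rightarrow> complex mat) \<Rightarrow> (complex mat \<Rightarrow> complex mat) \<Rightarrow> real \<Rightarrow> nat \<Rightarrow> nat \<Rightarrow> bool" where
  "cond_ii a0 a1 a0' a1' b0 b1 \<Phi>1 \<Phi>2 \<epsilon> r0 r1 \<longleftrightarrow>
    (\<forall>\<rho>. density (r0*b0*r1*b1) \<rho> \<longrightarrow>
       Sup {pairing (r0*b0) (r1*b1) \<rho> (apply_sc a0' a1' r0 r1 b0 b1 u pre post \<Phi>2) | u pre post.
              superchannel a0' a1' r0 r1 u pre post}
       \<le> Sup {pairing (r0*b0) (r1*b1) \<rho> (apply_sc a0 a1 r0 r1 b0 b1 u pre post \<Phi>1) | u pre post.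
              superchannel a0 a1 r0 r1 u pre post}
         + \<epsilon> / 2 * dual_dnorm (r0*b0) (r1*b1) \<rho>)"

definition cond_iii :: "nat \<Rightarrow> nat \<Rightarrow> nat \<Rightarrow> nat \<Rightarrow> nat \<Rightarrow> nat \<Rightarrow>
    (complex mat \<Rightarrow> complex mat) \<Rightarrow> (complex mat \<Rightarrow> complex mat) \<Rightarrow> real \<Rightarrow> nat \<Rightarrow> nat \<Rightarrow> bool" where
  "cond_iii a0 a1 a0' a1' b0 b1 \<Phi>1 \<Phi>2 \<epsilon> r0 r1 \<longleftrightarrow>
    (\<forall>k l lam rho M. ensemble (r0*b0*r1*b1) k l lam rho \<longrightarrow> povm (b1*b1) {..<l} M \<longrightarrow>
       pM a0' a1' b0 b1 r0 r1 k l \<Phi>2 lam rho M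
       \<le> pM a0 a1 b0 b1 r0 r1 k l \<Phi>1 lam rho M + \<epsilon> / 2 * psucc (r0*b0*r1*b1) k l lam rho)"

end

theory Submission
  imports Defs "Jordan_Normal_Form.Determinant" "HOL-Computational_Algebra.Fundamental_Theorem_Algebra"
begin

text \<open>For channels, \<open>\<parallel>\<Psi> - \<Phi>\<parallel>\<close> at most \<open>2 c\<close> in diamond norm means, up to slack in \<open>c\<close>, that
  \<open>\<Phi> + c \<Gamma>\<^sub>2 = \<Psi> + c \<Gamma>\<^sub>1\<close> for channels \<open>\<Gamma>\<^sub>1\<close>, \<open>\<Gamma>\<^sub>2\<close>. This relation survives superchannels and
  guessing strategies, both of which are linear in the channel, positive, and compose with superchannels; hence (i)
  implies (ii) and (iii) for all \<open>R\<close>. Conversely, if (i) fails, a hyperplane separates \<open>\<Phi>\<^sub>2\<close> from the convex set of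
  all \<open>\<Theta>(\<Phi>\<^sub>1) + c \<Gamma> - P\<close> with \<open>P\<close> completely positive, and its normal is a state \<open>\<rho>\<close> violating (ii) at \<open>R = A'\<close>.
  Applying all Weyl unitaries to the \<open>R\<^sub>1 B\<^sub>1\<close> part of \<open>\<rho>\<close> and measuring \<open>B\<^sub>1 B\<^sub>1\<close> in the Bell basis turns the
  quantities of (ii) into those of (iii), up to the common factor \<open>1 / (dim R\<^sub>1 dim B\<^sub>1)\<close>.\<close>

section \<open>Positive semidefinite kernels\<close>

text \<open>The obstacle is compactness. The ancilla of a superchannel is unbounded, so the images
  of \<open>\<Phi>1\<close> are not known to form a closed set, \<open>delta\<close> is an
  \<open>Inf\<close>, and the values in (ii) and (iii) are \<open>Sup\<close>s. Every implication is
  therefore run with a slightly larger constant: forward, the inequality is shown for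
  \<open>\<epsilon> + \<eta>\<close> and \<open>\<eta>\<close> is sent to 0; backward, the gap
  between two constants buys a uniform distance between a point and a convex set, and this replaces
  closedness. The order relation is preferred to the norm because it passes through positive linear
  constructions with the same constant. The 1/2 in (ii) and (iii) is the 2 in its norm form: each of
  the two channels contributes c. Getting the relation back from the norm is strong duality, which
  costs a second separation. In (iii) the measurement of B1 B1 is prescribed and only the one on U
  A1 R1 is free. Teleportation explains why this suffices: guessing a Weyl label on R1 acts as a
  channel into R1, namely a postprocessing, and the fixed Bell measurement passes B1 through
  unchanged.\<close>

lemma sum_lessThan_mult:
  fixes f :: "nat \<Rightarrow> 'a::comm_monoid_add"
  shows "(\<Sum>i<n*k. f i) = (\<Sum>a<n. \<Sum>b<k. f (a*k + b))"
proof -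
  have "(\<Sum>i<n*k. f i) = (\<Sum>a<n. sum f {a*k..<a*k+k})"
    by (rule sum.nat_group[symmetric])
  also have "\<dots> = (\<Sum>a<n. \<Sum>b<k. f (a*k + b))"
  proof (rule sum.cong[OF refl])
    fix a
    show "sum f {a*k..<a*k+k} = (\<Sum>b<k. f (a*k + b))"
      using sum.shift_bounds_nat_ivl[of f 0 "a*k" k] by (simp add: atLeast0LessThan add.commute)
  qed
  finally show ?thesis .
qed

lemma pair_index_less:
  fixes a b n k :: nat
  assumes "a < n" "b < k"
  shows "a*k + b < n*k"
proof -
  have "a*k + b < (Suc a)*k" using assms by simp
  also have "\<dots> \<le> n*k" using assms by (intro mult_le_mono1) simp
  finally show ?thesis .
qed

lemma pair_index_eq_iff:
  fixes a b a' b' k :: nat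
  assumes "b < k" "b' < k"
  shows "a*k + b = a'*k + b' \<longleftrightarrow> a = a' \<and> b = b'"
proof
  assume h: "a*k + b = a'*k + b'"
  have "a = (a*k+b) div k" "b = (a*k+b) mod k" using assms by auto
  moreover have "a' = (a'*k+b') div k" "b' = (a'*k+b') mod k" using assms by auto
  ultimately show "a = a' \<and> b = b'" using h by metis
qed simp

text \<open>Kernels over an arbitrary index set, so that Choi matrices can be indexed by pairs
  instead of flattened numbers. Hermitian symmetry makes the quadratic form real, so bounding its
  real part says everything.\<close>

definition psd_on :: "'a set \<Rightarrow> ('a \<Rightarrow> 'a \<Rightarrow> complex) \<Rightarrow> bool" where
  "psd_on S K \<longleftrightarrow> (\<forall>i\<in>S. \<forall>j\<in>S. K i j = cnj (K j i)) \<and>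
     (\<forall>v. 0 \<le> Re (\<Sum>i\<in>S. \<Sum>j\<in>S. cnj (v i) * K i j * v j))"

lemma psd_iff_psd_on: "psd n A \<longleftrightarrow> A \<in> carrier_mat n n \<and> psd_on {..<n} (\<lambda>i j. A $$ (i,j))"
  unfolding psd_def psd_on_def by auto

lemma quadratic_form_gram:
  fixes h :: "'r \<Rightarrow> 'a \<Rightarrow> complex"
  shows "(\<Sum>i\<in>S. \<Sum>j\<in>S. cnj (v i) * (\<Sum>r\<in>R. h r i * cnj (h r j)) * v j)
       = (\<Sum>r\<in>R. (\<Sum>i\<in>S. cnj (v i) * h r i) * cnj (\<Sum>i\<in>S. cnj (v i) * h r i))"
proof -
  have "(\<Sum>i\<in>S. \<Sum>j\<in>S. cnj (v i) * (\<Sum>r\<in>R. h r i * cnj (h r j)) * v j)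
      = (\<Sum>i\<in>S. \<Sum>j\<in>S. \<Sum>r\<in>R. (cnj (v i) * h r i) * (v j * cnj (h r j)))"
    by (simp add: sum_distrib_left sum_distrib_right mult_ac)
  also have "\<dots> = (\<Sum>r\<in>R. \<Sum>i\<in>S. \<Sum>j\<in>S. (cnj (v i) * h r i) * (v j * cnj (h r j)))"
    by (rule trans[OF sum.cong[OF refl sum.swap] sum.swap])
  also have "\<dots> = (\<Sum>r\<in>R. (\<Sum>i\<in>S. cnj (v i) * h r i) * cnj (\<Sum>i\<in>S. cnj (v i) * h r i))"
    by (simp add: sum_product)
  finally show ?thesis .
qed

text \<open>Half of the characterisation of positive kernels as Gram kernels;
  \<open>psd_on_decomp\<close> is the other half. Products, congruences and images under maps are
  treated through these two, without eigenvalues.\<close>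

lemma psd_on_gram:
  fixes h :: "'r \<Rightarrow> 'a \<Rightarrow> complex"
  assumes "\<And>i j. i \<in> S \<Longrightarrow> j \<in> S \<Longrightarrow> K i j = (\<Sum>r\<in>R. h r i * cnj (h r j))"
  shows "psd_on S K"
  unfolding psd_on_def
proof (intro conjI ballI allI)
  fix i j assume ij: "i \<in> S" "j \<in> S"
  show "K i j = cnj (K j i)"
    unfolding assms[OF ij] assms[OF ij(2) ij(1)] by (simp add: mult.commute)
next
  fix v
  have "(\<Sum>i\<in>S. \<Sum>j\<in>S. cnj (v i) * K i j * v j)
      = (\<Sum>r\<in>R. (\<Sum>i\<in>S. cnj (v i) * h r i) * cnj (\<Sum>i\<in>S. cnj (v i) * h r i))"
    unfolding quadratic_form_gram[symmetric] using assms by (intro sum.cong refl) auto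
  also have "0 \<le> Re \<dots>"
  proof -
    have "0 \<le> Re (z * cnj z)" for z by simp
    then show ?thesis unfolding Re_sum by (intro sum_nonneg)
  qed
  finally show "0 \<le> Re (\<Sum>i\<in>S. \<Sum>j\<in>S. cnj (v i) * K i j * v j)" by simp
qed

text \<open>Isolates the row and column of one index, for the elimination step in
  \<open>psd_on_decomp\<close>.\<close>

lemma quadratic_form_insert:
  assumes "finite S" "p \<notin> S"
    and herm: "\<And>i j. i \<in> insert p S \<Longrightarrow> j \<in> insert p S \<Longrightarrow> K i j = cnj (K j i)"
  shows "(\<Sum>i\<in>insert p S. \<Sum>j\<in>insert p S. cnj (v i) * K i j * v j)
     = cnj (v p) * K p p * v p + cnj (v p) * (\<Sum>j\<in>S. K p j * v j) + cnj (\<Sum>j\<in>S. K p j * v j) * v p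
       + (\<Sum>i\<in>S. \<Sum>j\<in>S. cnj (v i) * K i j * v j)"
proof -
  have "cnj (\<Sum>j\<in>S. K p j * v j) = (\<Sum>i\<in>S. cnj (v i) * K i p)"
    unfolding cnj_sum
  proof (rule sum.cong[OF refl])
    fix i assume "i \<in> S"
    then show "cnj (K p i * v i) = cnj (v i) * K i p"
      using herm[of i p] by (simp add: mult.commute)
  qed
  then show ?thesis
    using assms(1,2)
    by (simp add: sum.distrib sum_distrib_left sum_distrib_right mult.assoc)
qed

text \<open>Cholesky elimination, one index at a time.\<close>
lemma psd_on_decomp:
  assumes "finite S" "psd_on S K"
  shows "\<exists>h. \<forall>i\<in>S. \<forall>j\<in>S. K i j = (\<Sum>r\<in>S. h r i * cnj (h r j))"
  using assms
proof (induction S arbitrary: K rule: finite_induct)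
  case empty
  then show ?case by simp
next
  case (insert p S)
  have herm: "K i j = cnj (K j i)" if "i \<in> insert p S" "j \<in> insert p S" for i j
    using insert.prems that unfolding psd_on_def by blast
  have pos: "0 \<le> Re (\<Sum>i\<in>insert p S. \<Sum>j\<in>insert p S. cnj (v i) * K i j * v j)" for v
    using insert.prems unfolding psd_on_def by blast
  have quad: "(\<Sum>i\<in>insert p S. \<Sum>j\<in>insert p S. cnj (v i) * K i j * v j)
     = cnj (v p) * K p p * v p + cnj (v p) * (\<Sum>j\<in>S. K p j * v j) + cnj (\<Sum>j\<in>S. K p j * v j) * v p
       + (\<Sum>i\<in>S. \<Sum>j\<in>S. cnj (v i) * K i j * v j)" for v
    by (rule quadratic_form_insert[OF insert.hyps(1,2)]) (rule herm)
  have "K p p = cnj (K p p)" using herm by blast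
  then have im: "Im (K p p) = 0" by (simp add: complex_eq_iff)
  define k where "k = Re (K p p)"
  have kpp: "K p p = of_real k" using im by (simp add: complex_eq_iff k_def)
  have "0 \<le> k"
    using pos[of "\<lambda>i. if i = p then 1 else 0"] insert.hyps unfolding quad
    by (simp add: k_def sum.neutral if_distrib cong: if_cong)
  show ?case
  proof (cases "k = 0")
    case True
    \<comment> \<open>A zero pivot forces its row to vanish. Otherwise take v equal to 1 at j and to
      - t K p j at p: the form is K j j - 2 t |K p j|^2, which the chosen t makes equal to
      -1.\<close>
    have zero: "K p j = 0" if j: "j \<in> S" for j
    proof (rule ccontr)
      assume nz: "K p j \<noteq> 0"
      define t where "t = (Re (K j j) + 1) / (2 * (cmod (K p j))\<^sup>2)"
      define v where "v i = (if i = p then - of_real t * K p j else if i = j then 1 else 0)" for i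
      have jp: "j \<noteq> p" using j insert.hyps by blast
      have b: "(\<Sum>i\<in>S. K p i * v i) = K p j"
      proof -
        have "(\<Sum>i\<in>S. K p i * v i) = (\<Sum>i\<in>S. if i = j then K p j else 0)"
          using insert.hyps by (intro sum.cong) (auto simp: v_def)
        then show ?thesis using insert.hyps j by simp
      qed
      have c: "(\<Sum>i\<in>S. \<Sum>l\<in>S. cnj (v i) * K i l * v l) = K j j"
      proof -
        have "(\<Sum>i\<in>S. \<Sum>l\<in>S. cnj (v i) * K i l * v l)
            = (\<Sum>i\<in>S. \<Sum>l\<in>S. if l = j then if i = j then K j j else 0 else 0)"
          using insert.hyps by (intro sum.cong) (auto simp: v_def)
        then show ?thesis using insert.hyps j by simp
      qed
      have "0 \<le> Re (cnj (v p) * K p j + cnj (K p j) * v p + K j j)"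
        using pos[of v] unfolding quad[of v] b c by (simp only: kpp True) simp
      also have "cnj (v p) * K p j + cnj (K p j) * v p = of_real (- 2 * t * (cmod (K p j))\<^sup>2)"
        unfolding of_real_mult complex_norm_square v_def by (simp add: algebra_simps)
      finally have "2 * t * (cmod (K p j))\<^sup>2 \<le> Re (K j j)" by simp
      moreover have "2 * t * (cmod (K p j))\<^sup>2 = Re (K j j) + 1"
        using nz by (simp add: t_def)
      ultimately show False by simp
    qed
    have "psd_on S K"
      unfolding psd_on_def
    proof (intro conjI allI ballI)
      show "K i j = cnj (K j i)" if "i \<in> S" "j \<in> S" for i j using herm that by blast
      fix v
      show "0 \<le> Re (\<Sum>i\<in>S. \<Sum>j\<in>S. cnj (v i) * K i j * v j)"
        using pos[of v] unfolding quad kpp True by (simp add: zero)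
    qed
    from insert.IH[OF this] obtain h where h: "\<forall>i\<in>S. \<forall>j\<in>S. K i j = (\<Sum>r\<in>S. h r i * cnj (h r j))" by blast
    define g where "g r i = (if r = p \<or> i = p then 0 else h r i)" for r i
    show ?thesis
    proof (intro exI[of _ g] ballI)
      fix i j assume ij: "i \<in> insert p S" "j \<in> insert p S"
      have S: "(\<Sum>r\<in>insert p S. g r i * cnj (g r j)) = (\<Sum>r\<in>S. g r i * cnj (g r j))"
        using insert.hyps by (simp add: g_def)
      show "K i j = (\<Sum>r\<in>insert p S. g r i * cnj (g r j))"
      proof (cases "i = p \<or> j = p")
        case True
        then have "K i j = 0"
          using ij zero herm[of i j] kpp \<open>k = 0\<close> by (metis complex_cnj_zero insertE of_real_0)
        then show ?thesis unfolding S using True by (auto simp: g_def)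
      next
        case False
        then have "i \<in> S" "j \<in> S" using ij by auto
        then have "K i j = (\<Sum>r\<in>S. h r i * cnj (h r j))" using h by blast
        also have "\<dots> = (\<Sum>r\<in>S. g r i * cnj (g r j))"
          using False insert.hyps by (intro sum.cong) (auto simp: g_def)
        finally show ?thesis unfolding S .
      qed
    qed
  next
    case False
    then have kpos: "0 < k" using \<open>0 \<le> k\<close> by simp
    \<comment> \<open>The Schur complement of the pivot. Its form at v is the form of
      \<open>K\<close> at v extended by the minimising pivot coordinate - b / k.\<close>
    define K' where "K' i j = K i j - K i p * K p j / of_real k" for i j
    have "psd_on S K'"
      unfolding psd_on_def
    proof (intro conjI allI ballI)
      show "K' i j = cnj (K' j i)" if "i \<in> S" "j \<in> S" for i j
        using herm[of i j] herm[of i p] herm[of p j] that by (simp add: K'_def mult.commute)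
      fix v :: "'a \<Rightarrow> complex"
      define b where "b = (\<Sum>j\<in>S. K p j * v j)"
      define w where "w = v(p := - b / of_real k)"
      have b': "cnj b = (\<Sum>i\<in>S. cnj (v i) * K i p)"
        unfolding b_def cnj_sum
      proof (rule sum.cong[OF refl])
        fix i assume "i \<in> S"
        then show "cnj (K p i * v i) = cnj (v i) * K i p"
          using herm[of i p] by (simp add: mult.commute)
      qed
      have wS: "w i = v i" if "i \<in> S" for i using that insert.hyps by (auto simp: w_def)
      have s1: "(\<Sum>j\<in>S. K p j * w j) = b" unfolding b_def using wS by simp
      have s2: "(\<Sum>i\<in>S. \<Sum>j\<in>S. cnj (w i) * K i j * w j) = (\<Sum>i\<in>S. \<Sum>j\<in>S. cnj (v i) * K i j * v j)"
        using wS by simp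
      have "0 \<le> Re (cnj (w p) * of_real k * w p + cnj (w p) * b + cnj b * w p
          + (\<Sum>i\<in>S. \<Sum>j\<in>S. cnj (v i) * K i j * v j))"
        using pos[of w] unfolding quad s1 s2 kpp by simp
      also have "cnj (w p) * of_real k * w p + cnj (w p) * b + cnj b * w p = - (cnj b * b / of_real k)"
        using kpos by (simp add: w_def field_simps)
      also have "- (cnj b * b / of_real k) + (\<Sum>i\<in>S. \<Sum>j\<in>S. cnj (v i) * K i j * v j)
          = (\<Sum>i\<in>S. \<Sum>j\<in>S. cnj (v i) * K' i j * v j)"
      proof -
        have "cnj b * b / of_real k = (\<Sum>i\<in>S. \<Sum>j\<in>S. cnj (v i) * (K i p * K p j / of_real k) * v j)"
          unfolding b' unfolding b_def sum_product sum_divide_distrib by (simp add: mult_ac)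
        then show ?thesis by (simp add: K'_def algebra_simps sum_subtractf)
      qed
      finally show "0 \<le> Re (\<Sum>i\<in>S. \<Sum>j\<in>S. cnj (v i) * K' i j * v j)" .
    qed
    from insert.IH[OF this] obtain h where h: "\<forall>i\<in>S. \<forall>j\<in>S. K' i j = (\<Sum>r\<in>S. h r i * cnj (h r j))" by blast
    \<comment> \<open>The new Gram vector is the pivot column divided by sqrt k; all others get
      coordinate 0 at p.\<close>
    define g where "g r i = (if r = p then K i p / of_real (sqrt k) else if i = p then 0 else h r i)" for r i
    show ?thesis
    proof (intro exI[of _ g] ballI)
      fix i j assume ij: "i \<in> insert p S" "j \<in> insert p S"
      have sq: "complex_of_real (sqrt k) * complex_of_real (sqrt k) = of_real k"
        using kpos by (simp flip: of_real_mult)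
      have gp: "g p i * cnj (g p j) = K i p * K p j / of_real k"
        using herm[of p j] ij sq by (simp add: g_def)
      have S: "(\<Sum>r\<in>insert p S. g r i * cnj (g r j)) = K i p * K p j / of_real k + (\<Sum>r\<in>S. g r i * cnj (g r j))"
        using insert.hyps gp by simp
      show "K i j = (\<Sum>r\<in>insert p S. g r i * cnj (g r j))"
      proof (cases "i = p \<or> j = p")
        case True
        then have "(\<Sum>r\<in>S. g r i * cnj (g r j)) = 0"
          using insert.hyps by (intro sum.neutral) (auto simp: g_def)
        then show ?thesis unfolding S using True kpp kpos by auto
      next
        case False
        then have "i \<in> S" "j \<in> S" using ij by auto
        then have "K' i j = (\<Sum>r\<in>S. h r i * cnj (h r j))" using h by blast
        also have "\<dots> = (\<Sum>r\<in>S. g r i * cnj (g r j))"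
          using False insert.hyps by (intro sum.cong) (auto simp: g_def)
        finally show ?thesis unfolding S by (simp add: K'_def algebra_simps)
      qed
    qed
  qed
qed

section \<open>Completely positive maps and tensor products with the identity\<close>

text \<open>Covers Kronecker as well as entrywise products: p and q pick the two coordinates of an
  index, and the Gram vectors of the factors are multiplied.\<close>

lemma psd_on_prod:
  assumes "finite S1" "finite S2" "psd_on S1 K1" "psd_on S2 K2"
    and p: "\<And>x. x \<in> S \<Longrightarrow> p x \<in> S1" and q: "\<And>x. x \<in> S \<Longrightarrow> q x \<in> S2"
  shows "psd_on S (\<lambda>x y. K1 (p x) (p y) * K2 (q x) (q y))"
proof -
  obtain h where h: "\<forall>i\<in>S1. \<forall>j\<in>S1. K1 i j = (\<Sum>r\<in>S1. h r i * cnj (h r j))"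
    using psd_on_decomp[OF assms(1,3)] by blast
  obtain g where g: "\<forall>i\<in>S2. \<forall>j\<in>S2. K2 i j = (\<Sum>r\<in>S2. g r i * cnj (g r j))"
    using psd_on_decomp[OF assms(2,4)] by blast
  show ?thesis
  proof (rule psd_on_gram[where R = "S1 \<times> S2" and h = "\<lambda>rs x. h (fst rs) (p x) * g (snd rs) (q x)"])
    fix x y assume "x \<in> S" "y \<in> S"
    then show "K1 (p x) (p y) * K2 (q x) (q y) =
        (\<Sum>r\<in>S1 \<times> S2. h (fst r) (p x) * g (snd r) (q x) * cnj (h (fst r) (p y) * g (snd r) (q y)))"
      using h g p q by (simp add: sum_product sum.cartesian_product case_prod_unfold mult_ac)
  qed
qed

lemma psd_on_cong:
  assumes "\<And>i j. i \<in> S \<Longrightarrow> j \<in> S \<Longrightarrow> K i j = K' i j"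
  shows "psd_on S K \<longleftrightarrow> psd_on S K'"
proof -
  have "(\<Sum>i\<in>S. \<Sum>j\<in>S. cnj (v i) * K i j * v j) = (\<Sum>i\<in>S. \<Sum>j\<in>S. cnj (v i) * K' i j * v j)" for v
    using assms by (intro sum.cong) auto
  moreover have "(\<forall>i\<in>S. \<forall>j\<in>S. K i j = cnj (K j i)) \<longleftrightarrow> (\<forall>i\<in>S. \<forall>j\<in>S. K' i j = cnj (K' j i))"
    using assms by auto
  ultimately show ?thesis unfolding psd_on_def by simp
qed

lemma psd_on_herm: "psd_on S K \<Longrightarrow> i \<in> S \<Longrightarrow> j \<in> S \<Longrightarrow> cnj (K j i) = K i j"
  unfolding psd_on_def by (rule sym) blast

lemma psd_on_add:
  assumes "psd_on S K" "psd_on S K'"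
  shows "psd_on S (\<lambda>i j. K i j + K' i j)"
  unfolding psd_on_def
proof (intro conjI ballI allI)
  show "K i j + K' i j = cnj (K j i + K' j i)" if "i \<in> S" "j \<in> S" for i j
    using psd_on_herm[OF assms(1) that] psd_on_herm[OF assms(2) that] by simp
  fix v
  have "(\<Sum>i\<in>S. \<Sum>j\<in>S. cnj (v i) * (K i j + K' i j) * v j)
      = (\<Sum>i\<in>S. \<Sum>j\<in>S. cnj (v i) * K i j * v j) + (\<Sum>i\<in>S. \<Sum>j\<in>S. cnj (v i) * K' i j * v j)"
    by (simp add: distrib_left distrib_right sum.distrib)
  moreover have "0 \<le> Re (\<Sum>i\<in>S. \<Sum>j\<in>S. cnj (v i) * K i j * v j)"
    "0 \<le> Re (\<Sum>i\<in>S. \<Sum>j\<in>S. cnj (v i) * K' i j * v j)"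
    using assms unfolding psd_on_def by blast+
  ultimately show "0 \<le> Re (\<Sum>i\<in>S. \<Sum>j\<in>S. cnj (v i) * (K i j + K' i j) * v j)"
    by (simp only: plus_complex.sel add_nonneg_nonneg)
qed

lemma psd_on_scale:
  assumes "psd_on S K" "0 \<le> c"
  shows "psd_on S (\<lambda>i j. of_real c * K i j)"
  unfolding psd_on_def
proof (intro conjI ballI allI)
  show "of_real c * K i j = cnj (of_real c * K j i)" if "i \<in> S" "j \<in> S" for i j
    using psd_on_herm[OF assms(1) that] by simp
  fix v
  have "(\<Sum>i\<in>S. \<Sum>j\<in>S. cnj (v i) * (of_real c * K i j) * v j)
      = of_real c * (\<Sum>i\<in>S. \<Sum>j\<in>S. cnj (v i) * K i j * v j)"
    by (simp add: sum_distrib_left mult_ac)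
  moreover have "0 \<le> Re (\<Sum>i\<in>S. \<Sum>j\<in>S. cnj (v i) * K i j * v j)"
    using assms unfolding psd_on_def by blast
  ultimately show "0 \<le> Re (\<Sum>i\<in>S. \<Sum>j\<in>S. cnj (v i) * (of_real c * K i j) * v j)"
    using assms(2) by (simp only: Re_complex_of_real mult_nonneg_nonneg times_complex.sel Im_complex_of_real) simp
qed

lemma less_mult_indexE:
  fixes i n k :: nat
  assumes "i < n*k"
  obtains a b where "a < n" "b < k" "i = a*k + b"
proof -
  have "0 < k" using assms by (cases k) auto
  then show ?thesis
    using that[of "i div k" "i mod k"] assms by (simp add: less_mult_imp_div_less)
qed

lemma unitmat_carrier[simp]: "unitmat n i j \<in> carrier_mat n n"
  by (simp add: unitmat_def)

lemma tid_right_carrier[simp]: "tid_right n m k f X \<in> carrier_mat (m*k) (m*k)"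
  by (simp add: tid_right_def)

lemma tid_left_carrier[simp]: "tid_left k n m f X \<in> carrier_mat (k*m) (k*m)"
  by (simp add: tid_left_def)

lemma choi_carrier[simp]: "choi n m f \<in> carrier_mat (m*n) (m*n)"
  by (simp add: choi_def)

lemma tid_right_entry:
  assumes "a < m" "b < m" "z < k" "w < k"
  shows "tid_right n m k f X $$ (a*k + z, b*k + w)
     = f (mat n n (\<lambda>(p,q). X $$ (p*k + z, q*k + w))) $$ (a, b)"
  using assms by (simp add: tid_right_def pair_index_less)

lemma tid_left_entry:
  assumes "a < m" "b < m" "z < k" "w < k"
  shows "tid_left k n m f X $$ (z*m + a, w*m + b)
     = f (mat n n (\<lambda>(p,q). X $$ (z*n + p, w*n + q))) $$ (a, b)"
  using assms by (simp add: tid_left_def pair_index_less)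

lemma choi_entry:
  assumes "k < m" "l < m" "i < n" "j < n"
  shows "choi n m f $$ (k*n + i, l*n + j) = f (unitmat n i j) $$ (k, l)"
proof -
  have "mat n n (\<lambda>(p,q). maxent n $$ (p*n + i, q*n + j)) = unitmat n i j"
    using assms by (intro eq_matI) (auto simp: maxent_def unitmat_def pair_index_less)
  then show ?thesis using assms by (simp add: choi_def tid_right_entry)
qed

section \<open>Linear and completely positive maps, and their Kraus form\<close>

definition linmap :: "nat \<Rightarrow> nat \<Rightarrow> (complex mat \<Rightarrow> complex mat) \<Rightarrow> bool" where
  "linmap n m f \<longleftrightarrow> (\<forall>X \<in> carrier_mat n n. f X \<in> carrier_mat m m) \<and>
     (\<forall>X \<in> carrier_mat n n. \<forall>Y \<in> carrier_mat n n. f (X + Y) = f X + f Y) \<and>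
     (\<forall>X \<in> carrier_mat n n. \<forall>c. f (c \<cdot>\<^sub>m X) = c \<cdot>\<^sub>m f X)"

text \<open>Adjoints, block embeddings and scaled maps are completely positive without preserving
  the trace, so positivity is developed apart from \<open>channel\<close>.\<close>

definition cp :: "nat \<Rightarrow> nat \<Rightarrow> (complex mat \<Rightarrow> complex mat) \<Rightarrow> bool" where
  "cp n m f \<longleftrightarrow> linmap n m f \<and> psd (m*n) (choi n m f)"

lemma channel_iff: "channel n m f \<longleftrightarrow> cp n m f \<and> (\<forall>X \<in> carrier_mat n n. trace (f X) = trace X)"
  unfolding channel_def cp_def linmap_def by blast

lemma linmap_carrier: "linmap n m f \<Longrightarrow> X \<in> carrier_mat n n \<Longrightarrow> f X \<in> carrier_mat m m"
  by (simp add: linmap_def)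

text \<open>A map is an arbitrary HOL function outside its carrier; this expansion replaces it by
  the finite table of its values on matrix units. The proof restores the entries of X one position
  at a time.\<close>

lemma linmap_expand:
  assumes f: "linmap n m f" and X: "X \<in> carrier_mat n n" and kl: "k < m" "l < m"
  shows "f X $$ (k,l) = (\<Sum>i<n. \<Sum>j<n. X $$ (i,j) * f (unitmat n i j) $$ (k,l))"
proof -
  define XS where "XS S = mat n n (\<lambda>ij. if ij \<in> S then X $$ ij else 0)" for S
  have XSc: "XS S \<in> carrier_mat n n" for S by (simp add: XS_def)
  have part: "f (XS S) $$ (k,l) = (\<Sum>ij\<in>S. X $$ ij * f (unitmat n (fst ij) (snd ij)) $$ (k,l))"
    if "finite S" "S \<subseteq> {..<n} \<times> {..<n}" for S
    using that
  proof (induction S rule: finite_induct)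
    case empty
    \<comment> \<open>Homogeneity with factor 0 gives the value at the zero matrix.\<close>
    have "XS {} = 0 \<cdot>\<^sub>m XS {}" by (intro eq_matI) (auto simp: XS_def)
    then have "f (XS {}) = 0 \<cdot>\<^sub>m f (XS {})" using f XSc unfolding linmap_def by metis
    moreover have "f (XS {}) \<in> carrier_mat m m" using f XSc by (rule linmap_carrier)
    ultimately have "f (XS {}) $$ (k,l) = 0 * f (XS {}) $$ (k,l)"
      using kl by (metis carrier_matD index_smult_mat(1))
    then show ?case by simp
  next
    case (insert ij S)
    obtain i j where ij: "ij = (i,j)" by force
    with insert.prems have b: "i < n" "j < n" by auto
    have "XS (insert ij S) = XS S + X $$ (i,j) \<cdot>\<^sub>m unitmat n i j"
      using insert.hyps ij by (intro eq_matI) (auto simp: XS_def unitmat_def)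
    then have "f (XS (insert ij S)) = f (XS S) + X $$ (i,j) \<cdot>\<^sub>m f (unitmat n i j)"
      using f XSc unfolding linmap_def by (metis smult_carrier_mat unitmat_carrier)
    moreover have "f (XS S) \<in> carrier_mat m m" "f (unitmat n i j) \<in> carrier_mat m m"
      using f XSc by (auto intro: linmap_carrier)
    ultimately show ?case using insert ij kl by simp
  qed
  have "XS ({..<n} \<times> {..<n}) = X" using X by (intro eq_matI) (auto simp: XS_def)
  then show ?thesis
    using part[of "{..<n} \<times> {..<n}"] by (simp add: sum.cartesian_product case_prod_unfold)
qed

text \<open>One half of Choi's theorem: h r k i is the (k,i) entry of the r-th Kraus operator, and
  the Kraus operators are Gram vectors of the Choi matrix.\<close>

lemma cpI:
  fixes h :: "'r \<Rightarrow> nat \<Rightarrow> nat \<Rightarrow> complex"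
  assumes "linmap n m f"
    and "\<And>k l i j. k < m \<Longrightarrow> l < m \<Longrightarrow> i < n \<Longrightarrow> j < n \<Longrightarrow>
       f (unitmat n i j) $$ (k,l) = (\<Sum>r\<in>R. h r k i * cnj (h r l j))"
  shows "cp n m f"
proof -
  have "psd_on {..<m*n} (\<lambda>x y. choi n m f $$ (x,y))"
  proof (rule psd_on_gram[where R = R and h = "\<lambda>r x. h r (x div n) (x mod n)"])
    fix x y assume "x \<in> {..<m*n}" "y \<in> {..<m*n}"
    then have xy: "x < m*n" "y < m*n" by auto
    obtain k i where ki: "k < m" "i < n" "x = k*n + i" using xy(1) by (rule less_mult_indexE)
    obtain l j where lj: "l < m" "j < n" "y = l*n + j" using xy(2) by (rule less_mult_indexE)
    show "choi n m f $$ (x,y) = (\<Sum>r\<in>R. h r (x div n) (x mod n) * cnj (h r (y div n) (y mod n)))"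
      using assms(2) ki lj by (simp add: choi_entry)
  qed
  then show ?thesis using assms(1) by (simp add: cp_def psd_iff_psd_on)
qed

text \<open>The other half of Choi's theorem. The range m*n is the size of the Choi matrix, whose
  Gram vectors become the Kraus operators.\<close>

lemma cpE:
  assumes "cp n m f"
  obtains h where "\<And>k l i j. k < m \<Longrightarrow> l < m \<Longrightarrow> i < n \<Longrightarrow> j < n \<Longrightarrow>
       f (unitmat n i j) $$ (k,l) = (\<Sum>r<m*n. h r k i * cnj (h r l j))"
proof -
  obtain g where g: "\<forall>x\<in>{..<m*n}. \<forall>y\<in>{..<m*n}. choi n m f $$ (x,y) = (\<Sum>r<m*n. g r x * cnj (g r y))"
    using assms psd_on_decomp[of "{..<m*n}" "\<lambda>x y. choi n m f $$ (x,y)"]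
    unfolding cp_def psd_iff_psd_on by blast
  show ?thesis
  proof (rule that[of "\<lambda>r k i. g r (k*n + i)"])
    fix k l i j assume b: "k < m" "l < m" "i < n" "j < n"
    then show "f (unitmat n i j) $$ (k,l) = (\<Sum>r<m*n. g r (k*n+i) * cnj (g r (l*n+j)))"
      using g[rule_format, of "k*n+i" "l*n+j"] by (simp add: choi_entry pair_index_less)
  qed
qed

lemma cp_linmap: "cp n m f \<Longrightarrow> linmap n m f"
  by (simp add: cp_def)

lemma linmap_cong:
  assumes "linmap n m f" "\<And>X. X \<in> carrier_mat n n \<Longrightarrow> g X = f X"
  shows "linmap n m g"
  using assms unfolding linmap_def by simp

lemma cp_cong:
  assumes "cp n m f" "\<And>X. X \<in> carrier_mat n n \<Longrightarrow> g X = f X"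
  shows "cp n m g"
proof -
  obtain h where "\<And>k l i j. k < m \<Longrightarrow> l < m \<Longrightarrow> i < n \<Longrightarrow> j < n \<Longrightarrow>
       f (unitmat n i j) $$ (k,l) = (\<Sum>r<m*n. h r k i * cnj (h r l j))"
    using cpE[OF assms(1)] by blast
  then show ?thesis
    using assms(2)
    by (intro cpI[OF linmap_cong[OF cp_linmap[OF assms(1)]], where R = "{..<m*n}" and h = h]) auto
qed

lemma channel_cong:
  assumes "channel n m f" "\<And>X. X \<in> carrier_mat n n \<Longrightarrow> g X = f X"
  shows "channel n m g"
  using assms cp_cong[of n m f g] unfolding channel_iff by simp

lemma linmap_tid_right:
  assumes "linmap n m f"
  shows "linmap (n*K) (m*K) (tid_right n m K f)"
  unfolding linmap_def
proof (intro conjI ballI allI)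
  let ?B = "\<lambda>X z w. mat n n (\<lambda>(p,q). X $$ (p*K + z, q*K + w))"
  have c: "f (?B X z w) \<in> carrier_mat m m" for X z w
    using assms by (simp add: linmap_carrier)
  show "tid_right n m K f X \<in> carrier_mat (m*K) (m*K)" for X by simp
  fix X :: "complex mat" assume X: "X \<in> carrier_mat (n*K) (n*K)"
  show "tid_right n m K f (X + Y) = tid_right n m K f X + tid_right n m K f Y"
    if Y: "Y \<in> carrier_mat (n*K) (n*K)" for Y
  proof (rule eq_matI)
    fix x y assume "x < dim_row (tid_right n m K f X + tid_right n m K f Y)"
      "y < dim_col (tid_right n m K f X + tid_right n m K f Y)"
    then have xy: "x < m*K" "y < m*K" by (auto simp: tid_right_def)
    obtain a z where az: "a < m" "z < K" "x = a*K + z" using xy(1) by (rule less_mult_indexE)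
    obtain b w where bw: "b < m" "w < K" "y = b*K + w" using xy(2) by (rule less_mult_indexE)
    have "?B (X + Y) z w = ?B X z w + ?B Y z w"
      using X Y az bw by (intro eq_matI) (auto simp: pair_index_less)
    then have "f (?B (X + Y) z w) = f (?B X z w) + f (?B Y z w)"
      using assms unfolding linmap_def by simp
    then show "tid_right n m K f (X + Y) $$ (x,y) = (tid_right n m K f X + tid_right n m K f Y) $$ (x,y)"
      using az bw xy c[of X z w] c[of Y z w] by (simp add: tid_right_entry carrier_matD[OF tid_right_carrier])
  qed (simp_all add: tid_right_def)
  show "tid_right n m K f (c \<cdot>\<^sub>m X) = c \<cdot>\<^sub>m tid_right n m K f X" for c
  proof (rule eq_matI)
    fix x y assume "x < dim_row (c \<cdot>\<^sub>m tid_right n m K f X)"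
      "y < dim_col (c \<cdot>\<^sub>m tid_right n m K f X)"
    then have xy: "x < m*K" "y < m*K" by (auto simp: tid_right_def)
    obtain a z where az: "a < m" "z < K" "x = a*K + z" using xy(1) by (rule less_mult_indexE)
    obtain b w where bw: "b < m" "w < K" "y = b*K + w" using xy(2) by (rule less_mult_indexE)
    have "?B (c \<cdot>\<^sub>m X) z w = c \<cdot>\<^sub>m ?B X z w"
      using X az bw by (intro eq_matI) (auto simp: pair_index_less)
    then have "f (?B (c \<cdot>\<^sub>m X) z w) = c \<cdot>\<^sub>m f (?B X z w)"
      using assms unfolding linmap_def by simp
    then show "tid_right n m K f (c \<cdot>\<^sub>m X) $$ (x,y) = (c \<cdot>\<^sub>m tid_right n m K f X) $$ (x,y)"
      using az bw xy c[of X z w] by (simp add: tid_right_entry carrier_matD[OF tid_right_carrier])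
  qed (simp_all add: tid_right_def)
qed

lemma linmap_tid_left:
  assumes "linmap n m f"
  shows "linmap (K*n) (K*m) (tid_left K n m f)"
  unfolding linmap_def
proof (intro conjI ballI allI)
  let ?B = "\<lambda>X z w. mat n n (\<lambda>(p,q). X $$ (z*n + p, w*n + q))"
  have c: "f (?B X z w) \<in> carrier_mat m m" for X z w
    using assms by (simp add: linmap_carrier)
  show "tid_left K n m f X \<in> carrier_mat (K*m) (K*m)" for X by simp
  fix X :: "complex mat" assume X: "X \<in> carrier_mat (K*n) (K*n)"
  show "tid_left K n m f (X + Y) = tid_left K n m f X + tid_left K n m f Y"
    if Y: "Y \<in> carrier_mat (K*n) (K*n)" for Y
  proof (rule eq_matI)
    fix x y assume "x < dim_row (tid_left K n m f X + tid_left K n m f Y)"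
      "y < dim_col (tid_left K n m f X + tid_left K n m f Y)"
    then have xy: "x < K*m" "y < K*m" by (auto simp: tid_left_def)
    obtain z a where az: "z < K" "a < m" "x = z*m + a" using xy(1) by (rule less_mult_indexE)
    obtain w b where bw: "w < K" "b < m" "y = w*m + b" using xy(2) by (rule less_mult_indexE)
    have "?B (X + Y) z w = ?B X z w + ?B Y z w"
      using X Y az bw by (intro eq_matI) (auto simp: pair_index_less)
    then have "f (?B (X + Y) z w) = f (?B X z w) + f (?B Y z w)"
      using assms unfolding linmap_def by simp
    then show "tid_left K n m f (X + Y) $$ (x,y) = (tid_left K n m f X + tid_left K n m f Y) $$ (x,y)"
      using az bw xy c[of X z w] c[of Y z w] by (simp add: tid_left_entry carrier_matD[OF tid_left_carrier])
  qed (simp_all add: tid_left_def)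
  show "tid_left K n m f (c \<cdot>\<^sub>m X) = c \<cdot>\<^sub>m tid_left K n m f X" for c
  proof (rule eq_matI)
    fix x y assume "x < dim_row (c \<cdot>\<^sub>m tid_left K n m f X)"
      "y < dim_col (c \<cdot>\<^sub>m tid_left K n m f X)"
    then have xy: "x < K*m" "y < K*m" by (auto simp: tid_left_def)
    obtain z a where az: "z < K" "a < m" "x = z*m + a" using xy(1) by (rule less_mult_indexE)
    obtain w b where bw: "w < K" "b < m" "y = w*m + b" using xy(2) by (rule less_mult_indexE)
    have "?B (c \<cdot>\<^sub>m X) z w = c \<cdot>\<^sub>m ?B X z w"
      using X az bw by (intro eq_matI) (auto simp: pair_index_less)
    then have "f (?B (c \<cdot>\<^sub>m X) z w) = c \<cdot>\<^sub>m f (?B X z w)"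
      using assms unfolding linmap_def by simp
    then show "tid_left K n m f (c \<cdot>\<^sub>m X) $$ (x,y) = (c \<cdot>\<^sub>m tid_left K n m f X) $$ (x,y)"
      using az bw xy c[of X z w] by (simp add: tid_left_entry carrier_matD[OF tid_left_carrier])
  qed (simp_all add: tid_left_def)
qed

lemma linmap_comp: "linmap n m f \<Longrightarrow> linmap m p g \<Longrightarrow> linmap n p (\<lambda>X. g (f X))"
  unfolding linmap_def by simp

lemma linmap_zero:
  assumes "linmap n m f"
  shows "f (0\<^sub>m n n) = 0\<^sub>m m m"
proof (rule eq_matI)
  have c: "f (0\<^sub>m n n) \<in> carrier_mat m m" using assms by (simp add: linmap_carrier)
  show "dim_row (f (0\<^sub>m n n)) = dim_row (0\<^sub>m m m)" "dim_col (f (0\<^sub>m n n)) = dim_col (0\<^sub>m m m)"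
    using c by auto
  fix i j assume "i < dim_row (0\<^sub>m m m :: complex mat)" "j < dim_col (0\<^sub>m m m :: complex mat)"
  then show "f (0\<^sub>m n n) $$ (i,j) = 0\<^sub>m m m $$ (i,j)"
    using linmap_expand[OF assms, of "0\<^sub>m n n" i j] by simp
qed

text \<open>Tensoring with the identity multiplies each Kraus operator by a Kronecker delta.\<close>
lemma cp_tid_right:
  assumes "cp n m f"
  shows "cp (n*K) (m*K) (tid_right n m K f)"
proof -
  obtain h where h: "\<And>k l i j. k < m \<Longrightarrow> l < m \<Longrightarrow> i < n \<Longrightarrow> j < n \<Longrightarrow>
       f (unitmat n i j) $$ (k,l) = (\<Sum>r<m*n. h r k i * cnj (h r l j))"
    using cpE[OF assms] by blast
  note lin = cp_linmap[OF assms]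
  show ?thesis
  proof (rule cpI[OF linmap_tid_right[OF lin], where R = "{..<m*n}" and
        h = "\<lambda>r x x'. if x mod K = x' mod K then h r (x div K) (x' div K) else 0"])
    fix k l i j assume klij: "k < m*K" "l < m*K" "i < n*K" "j < n*K"
    obtain k1 k2 where k: "k1 < m" "k2 < K" "k = k1*K + k2" using klij(1) by (rule less_mult_indexE)
    obtain l1 l2 where l: "l1 < m" "l2 < K" "l = l1*K + l2" using klij(2) by (rule less_mult_indexE)
    obtain i1 i2 where i: "i1 < n" "i2 < K" "i = i1*K + i2" using klij(3) by (rule less_mult_indexE)
    obtain j1 j2 where j: "j1 < n" "j2 < K" "j = j1*K + j2" using klij(4) by (rule less_mult_indexE)
    note b = k l i j
    have e: "mat n n (\<lambda>(p,q). unitmat (n*K) i j $$ (p*K + k2, q*K + l2))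
        = (if i2 = k2 \<and> j2 = l2 then unitmat n i1 j1 else 0\<^sub>m n n)"
      using b by (intro eq_matI) (auto simp: unitmat_def pair_index_less pair_index_eq_iff)
    show "tid_right n m K f (unitmat (n*K) i j) $$ (k,l) =
      (\<Sum>r<m*n. (if k mod K = i mod K then h r (k div K) (i div K) else 0) *
        cnj (if l mod K = j mod K then h r (l div K) (j div K) else 0))"
      unfolding b(3) b(6) tid_right_entry[OF b(1,4,2,5)] e
      using b h by (auto simp: linmap_zero[OF lin])
  qed
qed

lemma cp_tid_left:
  assumes "cp n m f"
  shows "cp (K*n) (K*m) (tid_left K n m f)"
proof -
  obtain h where h: "\<And>k l i j. k < m \<Longrightarrow> l < m \<Longrightarrow> i < n \<Longrightarrow> j < n \<Longrightarrow>
       f (unitmat n i j) $$ (k,l) = (\<Sum>r<m*n. h r k i * cnj (h r l j))"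
    using cpE[OF assms] by blast
  note lin = cp_linmap[OF assms]
  show ?thesis
  proof (rule cpI[OF linmap_tid_left[OF lin], where R = "{..<m*n}" and
        h = "\<lambda>r x x'. if x div m = x' div n then h r (x mod m) (x' mod n) else 0"])
    fix k l i j assume klij: "k < K*m" "l < K*m" "i < K*n" "j < K*n"
    obtain k2 k1 where k: "k2 < K" "k1 < m" "k = k2*m + k1" using klij(1) by (rule less_mult_indexE)
    obtain l2 l1 where l: "l2 < K" "l1 < m" "l = l2*m + l1" using klij(2) by (rule less_mult_indexE)
    obtain i2 i1 where i: "i2 < K" "i1 < n" "i = i2*n + i1" using klij(3) by (rule less_mult_indexE)
    obtain j2 j1 where j: "j2 < K" "j1 < n" "j = j2*n + j1" using klij(4) by (rule less_mult_indexE)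
    note b = k l i j
    have e: "mat n n (\<lambda>(p,q). unitmat (K*n) i j $$ (k2*n + p, l2*n + q))
        = (if i2 = k2 \<and> j2 = l2 then unitmat n i1 j1 else 0\<^sub>m n n)"
      using b by (intro eq_matI) (auto simp: unitmat_def pair_index_less pair_index_eq_iff)
    show "tid_left K n m f (unitmat (K*n) i j) $$ (k,l) =
      (\<Sum>r<m*n. (if k div m = i div n then h r (k mod m) (i mod n) else 0) *
        cnj (if l div m = j div n then h r (l mod m) (j mod n) else 0))"
      unfolding b(3) b(6) tid_left_entry[OF b(2,5,1,4)] e
      using b h by (auto simp: linmap_zero[OF lin])
  qed
qed

text \<open>A Kraus operator a_r sends the rank one term with vectors g_s, h_s to the one with
  vectors a_r g_s, a_r h_s. Keeping g and h distinct covers arguments that are not positive, as in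
  \<open>tnorm_cp_le\<close>.\<close>

lemma kraus_sum:
  "(\<Sum>i<n. \<Sum>j<n. (\<Sum>s\<in>S. g s i * cnj (h s j)) * (\<Sum>r\<in>R. a r k i * cnj (a r l j)))
   = (\<Sum>rs\<in>R \<times> S. (\<Sum>i<n. a (fst rs) k i * g (snd rs) i) * cnj (\<Sum>i<n. a (fst rs) l i * h (snd rs) i))"
proof -
  have "(\<Sum>i<n. \<Sum>j<n. (\<Sum>s\<in>S. g s i * cnj (h s j)) * (\<Sum>r\<in>R. a r k i * cnj (a r l j)))
      = (\<Sum>i<n. \<Sum>j<n. \<Sum>rs\<in>R \<times> S. (a (fst rs) k i * g (snd rs) i) * cnj (a (fst rs) l j * h (snd rs) j))"
  proof (intro sum.cong refl)
    fix i j
    have "(\<Sum>r\<in>R. a r k i * cnj (a r l j)) * (\<Sum>s\<in>S. g s i * cnj (h s j)) =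
      (\<Sum>rs\<in>R \<times> S. (a (fst rs) k i * cnj (a (fst rs) l j)) * (g (snd rs) i * cnj (h (snd rs) j)))"
      unfolding sum_product sum.cartesian_product case_prod_unfold ..
    then show "(\<Sum>s\<in>S. g s i * cnj (h s j)) * (\<Sum>r\<in>R. a r k i * cnj (a r l j)) =
      (\<Sum>rs\<in>R \<times> S. (a (fst rs) k i * g (snd rs) i) * cnj (a (fst rs) l j * h (snd rs) j))"
      by (simp add: mult_ac)
  qed
  also have "\<dots> = (\<Sum>rs\<in>R \<times> S. \<Sum>i<n. \<Sum>j<n. (a (fst rs) k i * g (snd rs) i) * cnj (a (fst rs) l j * h (snd rs) j))"
    by (rule trans[OF sum.cong[OF refl sum.swap] sum.swap])
  also have "\<dots> = (\<Sum>rs\<in>R \<times> S. (\<Sum>i<n. a (fst rs) k i * g (snd rs) i) * cnj (\<Sum>i<n. a (fst rs) l i * h (snd rs) i))"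
    by (simp add: sum_product)
  finally show ?thesis .
qed

lemma psd_cp:
  assumes "cp n m f" "psd n X"
  shows "psd m (f X)"
proof -
  obtain h where h: "\<And>k l i j. k < m \<Longrightarrow> l < m \<Longrightarrow> i < n \<Longrightarrow> j < n \<Longrightarrow>
       f (unitmat n i j) $$ (k,l) = (\<Sum>r<m*n. h r k i * cnj (h r l j))"
    using cpE[OF assms(1)] by blast
  note lin = cp_linmap[OF assms(1)]
  have X: "X \<in> carrier_mat n n" using assms(2) by (simp add: psd_def)
  obtain g where g: "\<forall>i\<in>{..<n}. \<forall>j\<in>{..<n}. X $$ (i,j) = (\<Sum>s<n. g s i * cnj (g s j))"
    using assms(2) psd_on_decomp[of "{..<n}"] unfolding psd_iff_psd_on by blast
  have "psd_on {..<m} (\<lambda>k l. f X $$ (k,l))"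
  proof (rule psd_on_gram[where R = "{..<m*n} \<times> {..<n}" and h = "\<lambda>rs k. \<Sum>i<n. h (fst rs) k i * g (snd rs) i"])
    fix k l assume kl: "k \<in> {..<m}" "l \<in> {..<m}"
    have "f X $$ (k,l) = (\<Sum>i<n. \<Sum>j<n. (\<Sum>s<n. g s i * cnj (g s j)) * (\<Sum>r<m*n. h r k i * cnj (h r l j)))"
      using linmap_expand[OF lin X, of k l] g h kl by simp
    then show "f X $$ (k,l) = (\<Sum>rs\<in>{..<m*n} \<times> {..<n}. (\<Sum>i<n. h (fst rs) k i * g (snd rs) i) *
        cnj (\<Sum>i<n. h (fst rs) l i * g (snd rs) i))"
      unfolding kraus_sum .
  qed
  then show ?thesis using linmap_carrier[OF lin X] by (simp add: psd_iff_psd_on)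
qed

section \<open>Exchange rules for tensoring with identity maps\<close>

lemma tid_right_comp:
  assumes "\<And>X. X \<in> carrier_mat n n \<Longrightarrow> f X \<in> carrier_mat m m"
  shows "tid_right m p K g (tid_right n m K f X) = tid_right n p K (\<lambda>X. g (f X)) X"
proof (rule eq_matI)
  fix x y assume "x < dim_row (tid_right n p K (\<lambda>X. g (f X)) X)" "y < dim_col (tid_right n p K (\<lambda>X. g (f X)) X)"
  then have xy: "x < p*K" "y < p*K" by (auto simp: tid_right_def)
  obtain a z where az: "a < p" "z < K" "x = a*K + z" using xy(1) by (rule less_mult_indexE)
  obtain b w where bw: "b < p" "w < K" "y = b*K + w" using xy(2) by (rule less_mult_indexE)
  let ?B = "mat n n (\<lambda>(p,q). X $$ (p*K + z, q*K + w))"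
  have "mat m m (\<lambda>(p,q). tid_right n m K f X $$ (p*K + z, q*K + w)) = f ?B"
    using az bw assms[of ?B] by (intro eq_matI) (auto simp: tid_right_entry)
  then show "tid_right m p K g (tid_right n m K f X) $$ (x,y) = tid_right n p K (\<lambda>X. g (f X)) X $$ (x,y)"
    using az bw by (simp add: tid_right_entry)
qed (auto simp: tid_right_def)

lemma tid_left_comp:
  assumes "\<And>X. X \<in> carrier_mat n n \<Longrightarrow> f X \<in> carrier_mat m m"
  shows "tid_left K m p g (tid_left K n m f X) = tid_left K n p (\<lambda>X. g (f X)) X"
proof (rule eq_matI)
  fix x y assume "x < dim_row (tid_left K n p (\<lambda>X. g (f X)) X)" "y < dim_col (tid_left K n p (\<lambda>X. g (f X)) X)"
  then have xy: "x < K*p" "y < K*p" by (auto simp: tid_left_def)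
  obtain z a where az: "z < K" "a < p" "x = z*p + a" using xy(1) by (rule less_mult_indexE)
  obtain w b where bw: "w < K" "b < p" "y = w*p + b" using xy(2) by (rule less_mult_indexE)
  let ?B = "mat n n (\<lambda>(p,q). X $$ (z*n + p, w*n + q))"
  have "mat m m (\<lambda>(p,q). tid_left K n m f X $$ (z*m + p, w*m + q)) = f ?B"
    using az bw assms[of ?B] by (intro eq_matI) (auto simp: tid_left_entry)
  then show "tid_left K m p g (tid_left K n m f X) $$ (x,y) = tid_left K n p (\<lambda>X. g (f X)) X $$ (x,y)"
    using az bw by (simp add: tid_left_entry)
qed (auto simp: tid_left_def)

text \<open>Row-major indexing makes the regrouping of systems a literal equality: both sides place
  s, t, a at (s*v+t)*m+a. This and the next two rules are the algebra by which superchannels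
  compose.\<close>

lemma tid_left_tid_left:
  "tid_left u (v*n) (v*m) (tid_left v n m f) X = tid_left (u*v) n m f X"
proof (rule eq_matI)
  fix x y assume "x < dim_row (tid_left (u*v) n m f X)" "y < dim_col (tid_left (u*v) n m f X)"
  then have xy: "x < (u*v)*m" "y < (u*v)*m" by (auto simp: tid_left_def)
  obtain c a where ca: "c < u*v" "a < m" "x = c*m + a" using xy(1) by (rule less_mult_indexE)
  obtain s t where st: "s < u" "t < v" "c = s*v + t" using ca(1) by (rule less_mult_indexE)
  obtain d b where db: "d < u*v" "b < m" "y = d*m + b" using xy(2) by (rule less_mult_indexE)
  obtain s' t' where st': "s' < u" "t' < v" "d = s'*v + t'" using db(1) by (rule less_mult_indexE)
  have x: "x = s*(v*m) + (t*m + a)" using ca st by (simp add: algebra_simps)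
  have y: "y = s'*(v*m) + (t'*m + b)" using db st' by (simp add: algebra_simps)
  have "tid_left u (v*n) (v*m) (tid_left v n m f) X $$ (x,y)
      = tid_left v n m f (mat (v*n) (v*n) (\<lambda>(p,q). X $$ (s*(v*n) + p, s'*(v*n) + q))) $$ (t*m+a, t'*m+b)"
    unfolding x y using st st' ca db by (intro tid_left_entry) (auto simp: pair_index_less)
  also have "\<dots> = f (mat n n (\<lambda>(p,q). mat (v*n) (v*n) (\<lambda>(p,q). X $$ (s*(v*n) + p, s'*(v*n) + q)) $$ (t*n+p, t'*n+q))) $$ (a,b)"
    using st st' ca db by (intro tid_left_entry) auto
  also have "mat n n (\<lambda>(p,q). mat (v*n) (v*n) (\<lambda>(p,q). X $$ (s*(v*n) + p, s'*(v*n) + q)) $$ (t*n+p, t'*n+q))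
      = mat n n (\<lambda>(p,q). X $$ (c*n + p, d*n + q))"
    using st st' by (intro eq_matI) (simp_all add: pair_index_less add_mult_distrib mult.assoc add.assoc)
  also have "f \<dots> $$ (a,b) = tid_left (u*v) n m f X $$ (x,y)"
    unfolding ca(3) db(3) using ca db by (intro tid_left_entry[symmetric]) auto
  finally show "tid_left u (v*n) (v*m) (tid_left v n m f) X $$ (x,y) = tid_left (u*v) n m f X $$ (x,y)" .
qed (auto simp: tid_left_def mult.assoc)

lemma tid_right_tid_right:
  "tid_right (n*K) (m*K) L (tid_right n m K f) X = tid_right n m (K*L) f X"
proof (rule eq_matI)
  fix x y assume "x < dim_row (tid_right n m (K*L) f X)" "y < dim_col (tid_right n m (K*L) f X)"
  then have xy: "x < m*(K*L)" "y < m*(K*L)" by (auto simp: tid_right_def)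
  obtain a c where ca: "a < m" "c < K*L" "x = a*(K*L) + c" using xy(1) by (rule less_mult_indexE)
  obtain s t where st: "s < K" "t < L" "c = s*L + t" using ca(2) by (rule less_mult_indexE)
  obtain b d where db: "b < m" "d < K*L" "y = b*(K*L) + d" using xy(2) by (rule less_mult_indexE)
  obtain s' t' where st': "s' < K" "t' < L" "d = s'*L + t'" using db(2) by (rule less_mult_indexE)
  have x: "x = (a*K + s)*L + t" using ca st by (simp add: algebra_simps)
  have y: "y = (b*K + s')*L + t'" using db st' by (simp add: algebra_simps)
  have "tid_right (n*K) (m*K) L (tid_right n m K f) X $$ (x,y)
      = tid_right n m K f (mat (n*K) (n*K) (\<lambda>(p,q). X $$ (p*L + t, q*L + t'))) $$ (a*K + s, b*K + s')"
    unfolding x y using st st' ca db by (intro tid_right_entry) (auto simp: pair_index_less)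
  also have "\<dots> = f (mat n n (\<lambda>(p,q). mat (n*K) (n*K) (\<lambda>(p,q). X $$ (p*L + t, q*L + t')) $$ (p*K + s, q*K + s'))) $$ (a,b)"
    using st st' ca db by (intro tid_right_entry) auto
  also have "mat n n (\<lambda>(p,q). mat (n*K) (n*K) (\<lambda>(p,q). X $$ (p*L + t, q*L + t')) $$ (p*K + s, q*K + s'))
      = mat n n (\<lambda>(p,q). X $$ (p*(K*L) + c, q*(K*L) + d))"
    using st st' by (intro eq_matI) (simp_all add: pair_index_less add_mult_distrib mult.assoc add.assoc)
  also have "f \<dots> $$ (a,b) = tid_right n m (K*L) f X $$ (x,y)"
    unfolding ca(3) db(3) using ca db by (intro tid_right_entry[symmetric]) auto
  finally show "tid_right (n*K) (m*K) L (tid_right n m K f) X $$ (x,y) = tid_right n m (K*L) f X $$ (x,y)" .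
qed (auto simp: tid_right_def mult.assoc)

lemma tid_left_tid_right:
  "tid_left u (n*K) (m*K) (tid_right n m K f) X = tid_right (u*n) (u*m) K (tid_left u n m f) X"
proof (rule eq_matI)
  fix x y assume "x < dim_row (tid_right (u*n) (u*m) K (tid_left u n m f) X)"
    "y < dim_col (tid_right (u*n) (u*m) K (tid_left u n m f) X)"
  then have xy: "x < (u*m)*K" "y < (u*m)*K" by (auto simp: tid_right_def)
  obtain c t where ca: "c < u*m" "t < K" "x = c*K + t" using xy(1) by (rule less_mult_indexE)
  obtain s a where st: "s < u" "a < m" "c = s*m + a" using ca(1) by (rule less_mult_indexE)
  obtain d t' where db: "d < u*m" "t' < K" "y = d*K + t'" using xy(2) by (rule less_mult_indexE)
  obtain s' b where st': "s' < u" "b < m" "d = s'*m + b" using db(1) by (rule less_mult_indexE)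
  have x: "x = s*(m*K) + (a*K + t)" using ca st by (simp add: algebra_simps)
  have y: "y = s'*(m*K) + (b*K + t')" using db st' by (simp add: algebra_simps)
  have "tid_left u (n*K) (m*K) (tid_right n m K f) X $$ (x,y)
     = tid_right n m K f (mat (n*K) (n*K) (\<lambda>(p,q). X $$ (s*(n*K) + p, s'*(n*K) + q))) $$ (a*K+t, b*K+t')"
    unfolding x y using st st' ca db by (intro tid_left_entry) (auto simp: pair_index_less)
  also have "\<dots> = f (mat n n (\<lambda>(p,q). mat (n*K) (n*K) (\<lambda>(p,q). X $$ (s*(n*K) + p, s'*(n*K) + q)) $$ (p*K+t, q*K+t'))) $$ (a,b)"
    using st st' ca db by (intro tid_right_entry) auto
  also have "mat n n (\<lambda>(p,q). mat (n*K) (n*K) (\<lambda>(p,q). X $$ (s*(n*K) + p, s'*(n*K) + q)) $$ (p*K+t, q*K+t'))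
     = mat n n (\<lambda>(p,q). mat (u*n) (u*n) (\<lambda>(p,q). X $$ (p*K+t, q*K+t')) $$ (s*n+p, s'*n+q))"
    using st st' ca db by (intro eq_matI) (simp_all add: pair_index_less add_mult_distrib mult.assoc add.assoc)
  also have "f \<dots> $$ (a,b) = tid_left u n m f (mat (u*n) (u*n) (\<lambda>(p,q). X $$ (p*K+t, q*K+t'))) $$ (c,d)"
    unfolding st(3) st'(3) using st st' by (intro tid_left_entry[symmetric]) auto
  also have "\<dots> = tid_right (u*n) (u*m) K (tid_left u n m f) X $$ (x,y)"
    unfolding ca(3) db(3) using ca db by (intro tid_right_entry[symmetric]) auto
  finally show "tid_left u (n*K) (m*K) (tid_right n m K f) X $$ (x,y) =
      tid_right (u*n) (u*m) K (tid_left u n m f) X $$ (x,y)" .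
qed (auto simp: tid_left_def tid_right_def mult.assoc)

text \<open>The Choi matrix of the composite is the image of the Choi matrix of f under g tensored
  with the identity.\<close>

lemma cp_comp:
  assumes "cp n m f" "cp m p g"
  shows "cp n p (\<lambda>X. g (f X))"
proof -
  have "choi n p (\<lambda>X. g (f X)) = tid_right m p n g (choi n m f)"
    unfolding choi_def using linmap_carrier[OF cp_linmap[OF assms(1)]] by (rule tid_right_comp[symmetric])
  moreover have "psd (p*n) (tid_right m p n g (choi n m f))"
    using psd_cp[OF cp_tid_right[OF assms(2)]] assms(1) unfolding cp_def by blast
  ultimately show ?thesis
    using linmap_comp[OF cp_linmap cp_linmap] assms unfolding cp_def by simp
qed

lemma trace_tid_right:
  assumes "\<And>X. X \<in> carrier_mat n n \<Longrightarrow> f X \<in> carrier_mat m m"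
    and "\<And>X. X \<in> carrier_mat n n \<Longrightarrow> trace (f X) = trace X" and X: "X \<in> carrier_mat (n*K) (n*K)"
  shows "trace (tid_right n m K f X) = trace X"
proof -
  let ?B = "\<lambda>z. mat n n (\<lambda>(p,q). X $$ (p*K + z, q*K + z))"
  have "trace (tid_right n m K f X) = (\<Sum>a<m. \<Sum>z<K. f (?B z) $$ (a,a))"
    unfolding trace_def by (simp add: carrier_matD[OF tid_right_carrier] sum_lessThan_mult tid_right_entry)
  also have "\<dots> = (\<Sum>z<K. \<Sum>a<m. f (?B z) $$ (a,a))" by (rule sum.swap)
  also have "\<dots> = (\<Sum>z<K. trace (?B z))"
  proof (rule sum.cong[OF refl])
    fix z
    have "trace (f (?B z)) = (\<Sum>a<m. f (?B z) $$ (a,a))"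
      unfolding trace_def using assms(1)[of "?B z"] by simp
    then show "(\<Sum>a<m. f (?B z) $$ (a,a)) = trace (?B z)" using assms(2) by simp
  qed
  also have "\<dots> = (\<Sum>z<K. \<Sum>a<n. X $$ (a*K+z, a*K+z))"
    unfolding trace_def by simp
  also have "\<dots> = trace X"
    unfolding trace_def using X by (subst sum.swap) (simp add: sum_lessThan_mult)
  finally show ?thesis .
qed

lemma trace_tid_left:
  assumes "\<And>X. X \<in> carrier_mat n n \<Longrightarrow> f X \<in> carrier_mat m m"
    and "\<And>X. X \<in> carrier_mat n n \<Longrightarrow> trace (f X) = trace X" and X: "X \<in> carrier_mat (K*n) (K*n)"
  shows "trace (tid_left K n m f X) = trace X"
proof -
  let ?B = "\<lambda>z. mat n n (\<lambda>(p,q). X $$ (z*n + p, z*n + q))"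
  have "trace (tid_left K n m f X) = (\<Sum>z<K. \<Sum>a<m. f (?B z) $$ (a,a))"
    unfolding trace_def by (simp add: carrier_matD[OF tid_left_carrier] sum_lessThan_mult tid_left_entry)
  also have "\<dots> = (\<Sum>z<K. trace (?B z))"
  proof (rule sum.cong[OF refl])
    fix z
    have "trace (f (?B z)) = (\<Sum>a<m. f (?B z) $$ (a,a))"
      unfolding trace_def using assms(1)[of "?B z"] by simp
    then show "(\<Sum>a<m. f (?B z) $$ (a,a)) = trace (?B z)" using assms(2) by simp
  qed
  also have "\<dots> = trace X"
    unfolding trace_def using X by (simp add: sum_lessThan_mult)
  finally show ?thesis .
qed

lemma channel_carrier: "channel n m f \<Longrightarrow> X \<in> carrier_mat n n \<Longrightarrow> f X \<in> carrier_mat m m"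
  by (simp add: channel_def)

lemma channel_cp: "channel n m f \<Longrightarrow> cp n m f"
  by (simp add: channel_iff)

lemma channel_linmap: "channel n m f \<Longrightarrow> linmap n m f"
  by (simp add: channel_iff cp_def)

lemma channel_trace: "channel n m f \<Longrightarrow> X \<in> carrier_mat n n \<Longrightarrow> trace (f X) = trace X"
  by (simp add: channel_def)

lemma channel_tid_right:
  assumes "channel n m f"
  shows "channel (n*K) (m*K) (tid_right n m K f)"
  unfolding channel_iff
  using cp_tid_right[OF channel_cp[OF assms]] trace_tid_right[OF channel_carrier[OF assms] channel_trace[OF assms]]
  by blast

lemma channel_tid_left:
  assumes "channel n m f"
  shows "channel (K*n) (K*m) (tid_left K n m f)"
  unfolding channel_iff
  using cp_tid_left[OF channel_cp[OF assms]] trace_tid_left[OF channel_carrier[OF assms] channel_trace[OF assms]]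
  by blast

lemma channel_comp:
  assumes "channel n m f" "channel m p g"
  shows "channel n p (\<lambda>X. g (f X))"
  unfolding channel_iff
  using cp_comp[OF assms[THEN channel_cp]] channel_carrier[OF assms(1)] channel_trace[OF assms(1)] channel_trace[OF assms(2)]
  by simp

lemma channel_apply_sc:
  assumes "superchannel a0 a1 r0 r1 u pre post" "channel (a0*b0) (a1*b1) \<Phi>"
  shows "channel (r0*b0) (r1*b1) (apply_sc a0 a1 r0 r1 b0 b1 u pre post \<Phi>)"
proof -
  have 1: "channel (r0*b0) (u*(a0*b0)) (tid_right r0 (u*a0) b0 pre)"
    using channel_tid_right[of r0 "u*a0" pre b0] assms(1) by (simp add: superchannel_def mult.assoc)
  have 2: "channel (u*(a0*b0)) (u*(a1*b1)) (tid_left u (a0*b0) (a1*b1) \<Phi>)"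
    by (rule channel_tid_left[OF assms(2)])
  have 3: "channel (u*(a1*b1)) (r1*b1) (tid_right (u*a1) r1 b1 post)"
    using channel_tid_right[of "u*a1" r1 post b1] assms(1) by (simp add: superchannel_def mult.assoc)
  have "channel (r0*b0) (r1*b1) (\<lambda>X. tid_right (u*a1) r1 b1 post
       (tid_left u (a0*b0) (a1*b1) \<Phi> (tid_right r0 (u*a0) b0 pre X)))"
    by (rule channel_comp[OF channel_comp[OF 1 2] 3])
  then show ?thesis by (rule channel_cong) (simp add: apply_sc_def)
qed

section \<open>Trace duality and separation of convex sets\<close>

lemma mult_entry:
  assumes "A \<in> carrier_mat n m" "B \<in> carrier_mat m p" "i < n" "j < p"
  shows "(A * B) $$ (i,j) = (\<Sum>k<m. A $$ (i,k) * B $$ (k,j))"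
  using assms by (auto simp: scalar_prod_def atLeast0LessThan intro!: sum.cong)

lemma trace_mult:
  assumes "A \<in> carrier_mat n m" "B \<in> carrier_mat m n"
  shows "trace (A * B) = (\<Sum>i<n. \<Sum>j<m. A $$ (i,j) * B $$ (j,i))"
proof -
  have "trace (A * B) = (\<Sum>i<n. (A * B) $$ (i,i))" using assms by (simp add: trace_def)
  also have "\<dots> = (\<Sum>i<n. \<Sum>j<m. A $$ (i,j) * B $$ (j,i))"
    using assms by (intro sum.cong refl) (simp only: mult_entry lessThan_iff)
  finally show ?thesis .
qed

lemma psd_carrier: "psd n A \<Longrightarrow> A \<in> carrier_mat n n"
  by (simp add: psd_def)

lemma psd_decomp:
  assumes "psd n A"
  obtains h where "\<And>i j. i < n \<Longrightarrow> j < n \<Longrightarrow> A $$ (i,j) = (\<Sum>r<n. h r i * cnj (h r j))"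
proof -
  have "psd_on {..<n} (\<lambda>i j. A $$ (i,j))" using assms by (simp add: psd_iff_psd_on)
  from psd_on_decomp[OF finite_lessThan this] show ?thesis using that by auto
qed

lemma psd_gram:
  assumes "A \<in> carrier_mat n n"
    and "\<And>i j. i < n \<Longrightarrow> j < n \<Longrightarrow> A $$ (i,j) = (\<Sum>r\<in>R. h r i * cnj (h r j))"
  shows "psd n A"
  unfolding psd_iff_psd_on using assms by (auto intro!: psd_on_gram[where R = R and h = h])

lemma psd_quadratic_form:
  assumes "psd n A"
  shows "0 \<le> Re (\<Sum>i<n. \<Sum>j<n. cnj (v i) * A $$ (i,j) * v j)"
  using assms unfolding psd_def by blast

lemma psd_herm: "psd n A \<Longrightarrow> i < n \<Longrightarrow> j < n \<Longrightarrow> cnj (A $$ (j,i)) = A $$ (i,j)"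
  unfolding psd_def by (rule sym) blast

text \<open>Expanding A in Gram vectors turns the trace into a sum of values of the quadratic form
  of B.\<close>

lemma trace_mult_psd_nonneg:
  assumes "psd n A" "psd n B"
  shows "0 \<le> Re (trace (A * B))"
proof -
  obtain h where h: "\<And>i j. i < n \<Longrightarrow> j < n \<Longrightarrow> A $$ (i,j) = (\<Sum>r<n. h r i * cnj (h r j))"
    using psd_decomp[OF assms(1)] by blast
  have "trace (A * B) = (\<Sum>i<n. \<Sum>j<n. A $$ (i,j) * B $$ (j,i))"
    using assms by (intro trace_mult psd_carrier)
  also have "\<dots> = (\<Sum>i<n. \<Sum>j<n. \<Sum>r<n. cnj (h r j) * B $$ (j,i) * h r i)"
    by (intro sum.cong refl) (simp add: h sum_distrib_left sum_distrib_right mult_ac)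
  also have "\<dots> = (\<Sum>r<n. \<Sum>i<n. \<Sum>j<n. cnj (h r j) * B $$ (j,i) * h r i)"
    by (rule trans[OF sum.cong[OF refl sum.swap] sum.swap])
  also have "\<dots> = (\<Sum>r<n. \<Sum>j<n. \<Sum>i<n. cnj (h r j) * B $$ (j,i) * h r i)"
    by (rule sum.cong[OF refl sum.swap])
  also have "0 \<le> Re \<dots>"
    by (subst Re_sum) (intro sum_nonneg psd_quadratic_form[OF assms(2)])
  finally show ?thesis .
qed

lemma trace_add:
  assumes "A \<in> carrier_mat n n" "B \<in> carrier_mat n n"
  shows "trace (A + B) = trace A + trace B"
  using assms by (simp add: trace_def sum.distrib)

lemma trace_smult:
  assumes "A \<in> carrier_mat n n"
  shows "trace (c \<cdot>\<^sub>m A) = c * trace A"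
  using assms by (simp add: trace_def sum_distrib_left)

text \<open>The adjoint with respect to the bilinear form tr(XY), which unlike adj_map involves no conjugation.\<close>
definition dual_map :: "nat \<Rightarrow> nat \<Rightarrow> (complex mat \<Rightarrow> complex mat) \<Rightarrow> complex mat \<Rightarrow> complex mat" where
  "dual_map n m f Z = mat n n (\<lambda>(b,a). \<Sum>k<m. \<Sum>l<m. f (unitmat n a b) $$ (k,l) * Z $$ (l,k))"

lemma linmap_dual_map: "linmap m n (dual_map n m f)"
  unfolding linmap_def
proof (intro conjI ballI allI)
  fix X :: "complex mat" assume X: "X \<in> carrier_mat m m"
  show "dual_map n m f X \<in> carrier_mat n n" by (simp add: dual_map_def)
  show "dual_map n m f (X + Y) = dual_map n m f X + dual_map n m f Y" if "Y \<in> carrier_mat m m" for Y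
    using X that by (intro eq_matI) (auto simp: dual_map_def distrib_left sum.distrib)
  show "dual_map n m f (c \<cdot>\<^sub>m X) = c \<cdot>\<^sub>m dual_map n m f X" for c
    using X by (intro eq_matI) (auto simp: dual_map_def sum_distrib_left mult_ac)
qed

lemma trace_dual_map:
  assumes f: "linmap n m f" and X: "X \<in> carrier_mat n n" and Z: "Z \<in> carrier_mat m m"
  shows "trace (f X * Z) = trace (X * dual_map n m f Z)"
proof -
  have "trace (f X * Z) = (\<Sum>k<m. \<Sum>l<m. f X $$ (k,l) * Z $$ (l,k))"
    using linmap_carrier[OF f X] Z by (rule trace_mult)
  also have "\<dots> = (\<Sum>k<m. \<Sum>l<m. \<Sum>(i,j)\<in>{..<n} \<times> {..<n}. X $$ (i,j) * f (unitmat n i j) $$ (k,l) * Z $$ (l,k))"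
    by (intro sum.cong refl) (simp add: linmap_expand[OF f X] sum_distrib_right sum.cartesian_product case_prod_unfold)
  also have "\<dots> = (\<Sum>(i,j)\<in>{..<n} \<times> {..<n}. \<Sum>k<m. \<Sum>l<m. X $$ (i,j) * f (unitmat n i j) $$ (k,l) * Z $$ (l,k))"
    unfolding case_prod_unfold by (rule trans[OF sum.cong[OF refl sum.swap] sum.swap])
  also have "\<dots> = (\<Sum>i<n. \<Sum>j<n. X $$ (i,j) * dual_map n m f Z $$ (j,i))"
    by (subst sum.cartesian_product[symmetric])
      (intro sum.cong refl, simp add: dual_map_def sum_distrib_left mult.assoc)
  also have "\<dots> = trace (X * dual_map n m f Z)"
    using X linmap_carrier[OF linmap_dual_map Z] by (intro trace_mult[symmetric])
  finally show ?thesis .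
qed

text \<open>The Kraus operators of the dual are the adjoints of those of f.\<close>

lemma cp_dual_map:
  assumes "cp n m f"
  shows "cp m n (dual_map n m f)"
proof -
  obtain h where h: "\<And>k l i j. k < m \<Longrightarrow> l < m \<Longrightarrow> i < n \<Longrightarrow> j < n \<Longrightarrow>
       f (unitmat n i j) $$ (k,l) = (\<Sum>r<m*n. h r k i * cnj (h r l j))"
    using cpE[OF assms] by blast
  show ?thesis
  proof (rule cpI[OF linmap_dual_map, where R = "{..<m*n}" and h = "\<lambda>r b k. cnj (h r k b)"])
    fix b a k l assume bd: "b < n" "a < n" "k < m" "l < m"
    have "dual_map n m f (unitmat m k l) $$ (b,a)
        = (\<Sum>x<m. \<Sum>y<m. f (unitmat n a b) $$ (x,y) * (if y = k \<and> x = l then 1 else 0))"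
      using bd by (simp add: dual_map_def unitmat_def)
    also have "\<dots> = (\<Sum>x<m. \<Sum>y<m. if y = k then if x = l then f (unitmat n a b) $$ (x,y) else 0 else 0)"
      by (intro sum.cong refl) auto
    also have "\<dots> = f (unitmat n a b) $$ (l,k)" using bd by simp
    finally show "dual_map n m f (unitmat m k l) $$ (b,a) = (\<Sum>r<m*n. cnj (h r k b) * cnj (cnj (h r l a)))"
      using h bd by (simp add: mult.commute)
  qed
qed

text \<open>Heisenberg picture with a spectator: moves a channel from states to measurement
  operators. In the trace, block (z,w) of Y meets block (w,z) of Z, so \<open>trace_dual_map\<close>
  applies block by block.\<close>

lemma trace_tid_right_dual:
  assumes f: "linmap n m f" and Y: "Y \<in> carrier_mat (n*K) (n*K)" and Z: "Z \<in> carrier_mat (m*K) (m*K)"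
  shows "trace (tid_right n m K f Y * Z) = trace (Y * tid_right m n K (dual_map n m f) Z)"
proof -
  define By where "By z w = mat n n (\<lambda>(p,q). Y $$ (p*K + z, q*K + w))" for z w
  define Bz where "Bz z w = mat m m (\<lambda>(p,q). Z $$ (p*K + z, q*K + w))" for z w
  have c: "By z w \<in> carrier_mat n n" "Bz z w \<in> carrier_mat m m" for z w by (auto simp: By_def Bz_def)
  have reorder: "(\<Sum>a<p. \<Sum>z<K. \<Sum>b<p. \<Sum>w<K. F a z b w) = (\<Sum>z<K. \<Sum>w<K. \<Sum>a<p. \<Sum>b<p. F a z b w)"
    for p :: nat and F :: "nat \<Rightarrow> nat \<Rightarrow> nat \<Rightarrow> nat \<Rightarrow> complex"
  proof -
    have "(\<Sum>a<p. \<Sum>z<K. \<Sum>b<p. \<Sum>w<K. F a z b w) = (\<Sum>z<K. \<Sum>a<p. \<Sum>b<p. \<Sum>w<K. F a z b w)"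
      by (rule sum.swap)
    also have "\<dots> = (\<Sum>z<K. \<Sum>a<p. \<Sum>w<K. \<Sum>b<p. F a z b w)"
      by (intro sum.cong[OF refl] sum.swap)
    also have "\<dots> = (\<Sum>z<K. \<Sum>w<K. \<Sum>a<p. \<Sum>b<p. F a z b w)"
      by (intro sum.cong[OF refl] sum.swap)
    finally show ?thesis .
  qed
  have "trace (tid_right n m K f Y * Z) = (\<Sum>a<m. \<Sum>z<K. \<Sum>b<m. \<Sum>w<K. f (By z w) $$ (a,b) * Bz w z $$ (b,a))"
    unfolding trace_mult[OF tid_right_carrier Z] sum_lessThan_mult
    by (intro sum.cong refl) (simp add: tid_right_entry By_def Bz_def)
  also have "\<dots> = (\<Sum>z<K. \<Sum>w<K. trace (f (By z w) * Bz w z))"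
    unfolding reorder trace_mult[OF linmap_carrier[OF f c(1)] c(2)] ..
  also have "\<dots> = (\<Sum>z<K. \<Sum>w<K. trace (By z w * dual_map n m f (Bz w z)))"
    by (simp add: trace_dual_map[OF f c])
  also have "\<dots> = (\<Sum>a<n. \<Sum>z<K. \<Sum>b<n. \<Sum>w<K. By z w $$ (a,b) * dual_map n m f (Bz w z) $$ (b,a))"
    unfolding reorder trace_mult[OF c(1) linmap_carrier[OF linmap_dual_map c(2)]] ..
  also have "\<dots> = trace (Y * tid_right m n K (dual_map n m f) Z)"
    unfolding trace_mult[OF Y tid_right_carrier] sum_lessThan_mult
    by (intro sum.cong refl) (simp add: tid_right_entry By_def Bz_def)
  finally show ?thesis .
qed

lemma eq_one_if_trace_mult:
  assumes E: "E \<in> carrier_mat n n" and "\<And>X. X \<in> carrier_mat n n \<Longrightarrow> trace (X * E) = trace X"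
  shows "E = 1\<^sub>m n"
proof (rule eq_matI)
  fix i j assume "i < dim_row (1\<^sub>m n :: complex mat)" "j < dim_col (1\<^sub>m n :: complex mat)"
  then have ij: "i < n" "j < n" by auto
  have "trace (unitmat n j i * E) = (\<Sum>a<n. \<Sum>b<n. if b = i then if a = j then E $$ (b,a) else 0 else 0)"
    unfolding trace_mult[OF unitmat_carrier E] by (intro sum.cong refl) (auto simp: unitmat_def)
  also have "\<dots> = E $$ (i,j)" using ij by simp
  also have "trace (unitmat n j i * E) = trace (unitmat n j i)" using assms by simp
  also have "\<dots> = (\<Sum>a<n. if a = j then if i = j then 1 else 0 else 0)"
    unfolding trace_def by (intro sum.cong) (auto simp: unitmat_def)
  also have "\<dots> = 1\<^sub>m n $$ (i,j)" using ij by auto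
  finally show "E $$ (i,j) = 1\<^sub>m n $$ (i,j)" by simp
qed (use E in auto)

lemma dual_map_unital:
  assumes "channel n m f"
  shows "dual_map n m f (1\<^sub>m m) = 1\<^sub>m n"
proof (rule eq_one_if_trace_mult)
  show "dual_map n m f (1\<^sub>m m) \<in> carrier_mat n n" by (simp add: dual_map_def)
  fix X :: "complex mat" assume X: "X \<in> carrier_mat n n"
  have "trace (X * dual_map n m f (1\<^sub>m m)) = trace (f X * 1\<^sub>m m)"
    using trace_dual_map[OF channel_linmap[OF assms] X, of "1\<^sub>m m"] by simp
  also have "f X * 1\<^sub>m m = f X" using channel_carrier[OF assms X] by simp
  also have "trace (f X) = trace X" using channel_trace[OF assms X] .
  finally show "trace (X * dual_map n m f (1\<^sub>m m)) = trace X" .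
qed

lemma tid_right_unital:
  assumes f: "linmap n m f" and "f (1\<^sub>m n) = 1\<^sub>m m"
  shows "tid_right n m K f (1\<^sub>m (n*K)) = 1\<^sub>m (m*K)"
proof (rule eq_matI)
  fix x y assume "x < dim_row (1\<^sub>m (m*K) :: complex mat)" "y < dim_col (1\<^sub>m (m*K) :: complex mat)"
  then have xy: "x < m*K" "y < m*K" by auto
  obtain a z where az: "a < m" "z < K" "x = a*K + z" using xy(1) by (rule less_mult_indexE)
  obtain b w where bw: "b < m" "w < K" "y = b*K + w" using xy(2) by (rule less_mult_indexE)
  have "mat n n (\<lambda>(p,q). (1\<^sub>m (n*K) :: complex mat) $$ (p*K + z, q*K + w)) = (if z = w then 1\<^sub>m n else 0\<^sub>m n n)"
    using az bw by (intro eq_matI) (auto simp: pair_index_less pair_index_eq_iff)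
  then show "tid_right n m K f (1\<^sub>m (n*K)) $$ (x,y) = 1\<^sub>m (m*K) $$ (x,y)"
    using az bw assms(2) by (auto simp: tid_right_entry linmap_zero[OF f] pair_index_less pair_index_eq_iff)
qed (auto simp: tid_right_def)

text \<open>A real inner product on complex vectors, conjugate in the first argument so that
  \<open>rdot I x x\<close> is the squared length.\<close>

definition rdot :: "'i set \<Rightarrow> ('i \<Rightarrow> complex) \<Rightarrow> ('i \<Rightarrow> complex) \<Rightarrow> real" where
  "rdot I w x = (\<Sum>i\<in>I. Re (cnj (w i) * x i))"

lemma rdot_diff_right: "rdot I w (\<lambda>i. x i - y i) = rdot I w x - rdot I w y"
  by (simp add: rdot_def sum_subtractf algebra_simps)

lemma rdot_self: "rdot I x x = (\<Sum>i\<in>I. (cmod (x i))\<^sup>2)"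
  unfolding rdot_def by (intro sum.cong refl) (simp add: cmod_power2, simp add: power2_eq_square)

text \<open>Projection onto the closure of a convex set: a minimising sequence is Cauchy by the parallelogram law.\<close>
lemma convex_separation:
  fixes z :: "'i \<Rightarrow> complex"
  assumes fin: "finite I" and ne: "x0 \<in> C"
    and conv: "\<And>x y t. x \<in> C \<Longrightarrow> y \<in> C \<Longrightarrow> 0 \<le> t \<Longrightarrow> t \<le> 1 \<Longrightarrow>
      (\<lambda>i. of_real (1 - t) * x i + of_real t * y i) \<in> C"
    and far: "0 < \<eta>" "\<And>x. x \<in> C \<Longrightarrow> \<exists>i\<in>I. \<eta> \<le> cmod (z i - x i)"
  shows "\<exists>w \<beta>. 0 < \<beta> \<and> (\<forall>x\<in>C. rdot I w x + \<beta> \<le> rdot I w z)"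
proof -
  define N where "N x = rdot I x x" for x
  define D where "D x = N (\<lambda>i. z i - x i)" for x
  define d where "d = Inf (D ` C)"
  have Nexp: "N (\<lambda>i. x i - of_real t * y i) = N x - 2 * t * rdot I x y + t\<^sup>2 * N y" for x y t
    unfolding N_def rdot_def
    by (simp add: sum_subtractf sum.distrib sum_distrib_left algebra_simps power2_eq_square)
  have Dge: "\<eta>\<^sup>2 \<le> D x" if "x \<in> C" for x
  proof -
    obtain i where i: "i \<in> I" "\<eta> \<le> cmod (z i - x i)" using far(2)[OF \<open>x \<in> C\<close>] by blast
    have "\<eta>\<^sup>2 \<le> (cmod (z i - x i))\<^sup>2" using i far(1) by (intro power_mono) auto
    also have "\<dots> \<le> D x"
      unfolding D_def N_def rdot_self using fin i by (intro member_le_sum) auto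
    finally show ?thesis .
  qed
  have bdd: "bdd_below (D ` C)" using Dge by (intro bdd_belowI2)
  have dD: "d \<le> D x" if "x \<in> C" for x
    unfolding d_def using bdd that by (intro cInf_lower) auto
  have d0: "0 < d"
  proof -
    have "\<eta>\<^sup>2 \<le> d" unfolding d_def using ne Dge by (intro cInf_greatest) auto
    then show ?thesis using far(1) by (meson less_le_trans zero_less_power)
  qed
  have "\<exists>x\<in>C. D x < d + 1 / real (Suc n)" for n
  proof -
    have "Inf (D ` C) < d + 1 / real (Suc n)" unfolding d_def by simp
    then show ?thesis using cInf_lessD[of "D ` C"] ne by blast
  qed
  then obtain x where x: "\<And>n. x n \<in> C" "\<And>n. D (x n) < d + 1 / real (Suc n)" by metis
  \<comment> \<open>Parallelogram law around z. The midpoint is spelled as the convex combination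
    with t = 1/2 so that \<open>conv\<close> places it in C.\<close>
  have para: "N (\<lambda>i. a i - b i) = 2 * D a + 2 * D b - 4 * D (\<lambda>i. of_real (1 - 1/2) * a i + of_real (1/2) * b i)" for a b
    unfolding D_def N_def rdot_def sum_distrib_left sum.distrib[symmetric] sum_subtractf[symmetric]
    by (intro sum.cong refl) (simp add: field_simps)
  have close: "N (\<lambda>i. x n i - x m i) \<le> 4 / real (Suc M)" if "M \<le> n" "M \<le> m" for n m M
  proof -
    have "N (\<lambda>i. x n i - x m i) \<le> 2 * D (x n) + 2 * D (x m) - 4 * d"
      unfolding para using dD[OF conv[OF x(1)[of n] x(1)[of m], of "1/2"]] by simp
    also have "\<dots> \<le> 2 * (1 / real (Suc n)) + 2 * (1 / real (Suc m))" using x(2)[of n] x(2)[of m] by simp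
    also have "\<dots> \<le> 2 * (1 / real (Suc M)) + 2 * (1 / real (Suc M))"
      using that by (intro add_mono mult_left_mono divide_left_mono) auto
    finally show ?thesis by simp
  qed
  have "Cauchy (\<lambda>n. x n i)" if i: "i \<in> I" for i
    unfolding Cauchy_def dist_norm
  proof (intro allI impI)
    fix e :: real assume e: "0 < e"
    obtain M where M: "4 / e\<^sup>2 < real M" using reals_Archimedean2 by blast
    show "\<exists>M. \<forall>m\<ge>M. \<forall>n\<ge>M. cmod (x m i - x n i) < e"
    proof (intro exI[of _ M] allI impI)
      fix m n assume mn: "M \<le> m" "M \<le> n"
      have "(cmod (x m i - x n i))\<^sup>2 \<le> N (\<lambda>i. x m i - x n i)"
        unfolding N_def rdot_self using fin i by (intro member_le_sum) auto
      also have "\<dots> \<le> 4 / real (Suc M)" using close mn by blast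
      also have "\<dots> < e\<^sup>2"
      proof -
        have "4 < real (Suc M) * e\<^sup>2" using M e by (simp add: field_simps) (smt (verit) zero_less_power)
        then show ?thesis by (simp add: field_simps)
      qed
      finally show "cmod (x m i - x n i) < e" using e by (meson less_eq_real_def power_less_imp_less_base)
    qed
  qed
  then have "\<forall>i\<in>I. \<exists>l. (\<lambda>n. x n i) \<longlonglongrightarrow> l"
    by (simp add: Cauchy_convergent flip: convergent_def)
  from bchoice[OF this] obtain p where p: "\<And>i. i \<in> I \<Longrightarrow> (\<lambda>n. x n i) \<longlonglongrightarrow> p i" by blast
  \<comment> \<open>The limit p may lie outside C, so every inequality at p is a limit of
    inequalities along the minimising sequence.\<close>
  have limD: "(\<lambda>n. D (\<lambda>i. of_real (1 - t) * x n i + of_real t * y i))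
      \<longlonglongrightarrow> D (\<lambda>i. of_real (1 - t) * p i + of_real t * y i)" for t y
    unfolding D_def N_def rdot_def by (intro tendsto_intros p)
  have Dp: "D p \<le> d"
  proof (rule LIMSEQ_le)
    show "(\<lambda>n. D (x n)) \<longlonglongrightarrow> D p" using limD[of 0] by simp
    show "(\<lambda>n. d + 1 / real (Suc n)) \<longlonglongrightarrow> d"
      using tendsto_add[OF tendsto_const LIMSEQ_Suc[OF lim_1_over_n]] by simp
    show "\<exists>N. \<forall>n\<ge>N. D (x n) \<le> d + 1 / real (Suc n)" using x(2) less_imp_le by blast
  qed
  define w where "w i = z i - p i" for i
  have Nw: "N w = D p" by (simp add: D_def w_def[abs_def])
  \<comment> \<open>The margin is d: optimality of p to first order says that w has inner product at
    most 0 with y - p, and w = z - p has squared length at least d.\<close>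
  have "rdot I w y + d \<le> rdot I w z" if y: "y \<in> C" for y
  proof -
    define q where "q i = y i - p i" for i
    have ge: "d \<le> D (\<lambda>i. of_real (1 - t) * p i + of_real t * y i)" if "0 \<le> t" "t \<le> 1" for t
      by (rule LIMSEQ_le_const[OF limD]) (use dD[OF conv[OF x(1) y that]] in blast)
    have ge': "2 * rdot I w q \<le> t * N q" if t: "0 < t" "t \<le> 1" for t
    proof -
      have "(\<lambda>i. z i - (of_real (1 - t) * p i + of_real t * y i)) = (\<lambda>i. w i - of_real t * q i)"
        by (simp add: w_def q_def algebra_simps fun_eq_iff)
      then have "d \<le> N w - 2 * t * rdot I w q + t\<^sup>2 * N q"
        using ge[of t] t unfolding D_def by (simp add: Nexp)
      then have "t * (2 * rdot I w q) \<le> t * (t * N q)"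
        using Dp Nw by (simp add: power2_eq_square mult_ac)
      then show ?thesis using t by simp
    qed
    have "2 * rdot I w q \<le> 0"
    proof (rule ccontr)
      assume "\<not> 2 * rdot I w q \<le> 0"
      then have pos: "0 < rdot I w q" by simp
      then have Nq: "0 < N q" using ge'[of 1] by simp
      define t where "t = min 1 (rdot I w q / N q)"
      have t: "0 < t" "t \<le> 1" using pos Nq by (auto simp: t_def)
      have "t * N q \<le> rdot I w q" using Nq by (simp add: t_def min_def field_simps)
      then show False using ge'[OF t] pos by linarith
    qed
    moreover have "rdot I w q = rdot I w y - rdot I w p" unfolding q_def by (rule rdot_diff_right)
    moreover have "N w = rdot I w z - rdot I w p"
      unfolding N_def w_def[abs_def] by (rule rdot_diff_right)
    moreover have "d \<le> N w" using ge[of 0] Nw by simp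
    ultimately show ?thesis by linarith
  qed
  then show ?thesis using d0 by blast
qed

section \<open>The trace norm\<close>

lemma dagger_carrier[simp]: "U \<in> carrier_mat n m \<Longrightarrow> dagger U \<in> carrier_mat m n"
  by (simp add: dagger_def)

lemma unitary_iff:
  "unitary n U \<longleftrightarrow> U \<in> carrier_mat n n \<and>
     (\<forall>i<n. \<forall>j<n. (\<Sum>k<n. U $$ (i,k) * cnj (U $$ (j,k))) = (if i = j then 1 else 0))"
proof (cases "U \<in> carrier_mat n n")
  case True
  have e: "(U * dagger U) $$ (i,j) = (\<Sum>k<n. U $$ (i,k) * cnj (U $$ (j,k)))" if "i < n" "j < n" for i j
    unfolding mult_entry[OF True dagger_carrier[OF True] that]
    using True that by (intro sum.cong) (auto simp: dagger_def)
  have "U * dagger U = 1\<^sub>m n \<longleftrightarrow> (\<forall>i<n. \<forall>j<n. (U * dagger U) $$ (i,j) = (if i = j then 1 else 0))"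
  proof
    assume "U * dagger U = 1\<^sub>m n"
    then show "\<forall>i<n. \<forall>j<n. (U * dagger U) $$ (i,j) = (if i = j then 1 else 0)" by simp
  next
    assume "\<forall>i<n. \<forall>j<n. (U * dagger U) $$ (i,j) = (if i = j then 1 else 0)"
    then show "U * dagger U = 1\<^sub>m n" using True by (intro eq_matI) (auto simp: dagger_def)
  qed
  then show ?thesis using True e by (simp add: unitary_def)
qed (simp add: unitary_def)

text \<open>The passage from rows to columns uses that a right inverse of a square matrix is a left
  inverse.\<close>

lemma unitary_cols:
  assumes "unitary n U" "i < n" "j < n"
  shows "(\<Sum>k<n. cnj (U $$ (k,i)) * U $$ (k,j)) = (if i = j then 1 else 0)"
proof -
  have U: "U \<in> carrier_mat n n" using assms by (simp add: unitary_def)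
  have "dagger U * U = 1\<^sub>m n"
    using mat_mult_left_right_inverse[OF U dagger_carrier[OF U]] assms(1) by (simp add: unitary_def)
  then have "(dagger U * U) $$ (i,j) = (if i = j then 1 else 0)" using assms by simp
  moreover have "(dagger U * U) $$ (i,j) = (\<Sum>k<n. cnj (U $$ (k,i)) * U $$ (k,j))"
    unfolding mult_entry[OF dagger_carrier[OF U] U assms(2,3)]
    using U assms by (intro sum.cong) (auto simp: dagger_def)
  ultimately show ?thesis by simp
qed

lemma unitary_entry_le:
  assumes "unitary n U" "i < n" "j < n"
  shows "cmod (U $$ (i,j)) \<le> 1"
proof -
  have "(\<Sum>k<n. U $$ (i,k) * cnj (U $$ (i,k))) = 1"
    using assms by (simp add: unitary_iff)
  then have "complex_of_real (\<Sum>k<n. (cmod (U $$ (i,k)))\<^sup>2) = of_real 1"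
    unfolding of_real_sum complex_norm_square by simp
  then have "(\<Sum>k<n. (cmod (U $$ (i,k)))\<^sup>2) = 1" unfolding of_real_eq_iff .
  moreover have "(cmod (U $$ (i,j)))\<^sup>2 \<le> (\<Sum>k<n. (cmod (U $$ (i,k)))\<^sup>2)"
    using assms by (intro member_le_sum) auto
  ultimately show ?thesis by (simp add: power2_le_imp_le abs_square_le_1)
qed

lemma norm_sum_isometry:
  fixes n :: nat
  assumes "\<And>j k. j < n \<Longrightarrow> k < n \<Longrightarrow> (\<Sum>i<n. cnj (A i j) * A i k) = (if j = k then 1 else 0)"
  shows "(\<Sum>i<n. (cmod (\<Sum>j<n. A i j * v j))\<^sup>2) = (\<Sum>j<n. (cmod (v j))\<^sup>2)"
proof -
  have "complex_of_real (\<Sum>i<n. (cmod (\<Sum>j<n. A i j * v j))\<^sup>2)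
      = (\<Sum>i<n. \<Sum>j<n. \<Sum>k<n. cnj (v j) * v k * (cnj (A i j) * A i k))"
    unfolding of_real_sum complex_norm_square
  proof (intro sum.cong refl)
    fix i
    have "cnj (\<Sum>j<n. A i j * v j) * (\<Sum>j<n. A i j * v j)
        = (\<Sum>j<n. \<Sum>k<n. cnj (v j) * v k * (cnj (A i j) * A i k))"
      unfolding cnj_sum sum_product by (simp add: mult_ac)
    then show "(\<Sum>j<n. A i j * v j) * cnj (\<Sum>j<n. A i j * v j)
        = (\<Sum>j<n. \<Sum>k<n. cnj (v j) * v k * (cnj (A i j) * A i k))"
      by (simp add: mult.commute)
  qed
  also have "\<dots> = (\<Sum>j<n. \<Sum>i<n. \<Sum>k<n. cnj (v j) * v k * (cnj (A i j) * A i k))"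
    by (rule sum.swap)
  also have "\<dots> = (\<Sum>j<n. \<Sum>k<n. \<Sum>i<n. cnj (v j) * v k * (cnj (A i j) * A i k))"
    by (rule sum.cong[OF refl sum.swap])
  also have "\<dots> = (\<Sum>j<n. \<Sum>k<n. cnj (v j) * v k * (if j = k then 1 else 0))"
    by (intro sum.cong refl) (simp only: sum_distrib_left[symmetric] assms lessThan_iff)
  also have "\<dots> = (\<Sum>j<n. \<Sum>k<n. if k = j then cnj (v j) * v k else 0)"
    by (intro sum.cong refl) auto
  also have "\<dots> = (\<Sum>j<n. cnj (v j) * v j)" by (intro sum.cong refl) simp
  also have "\<dots> = complex_of_real (\<Sum>j<n. (cmod (v j))\<^sup>2)"
    unfolding of_real_sum complex_norm_square by (simp add: mult.commute)
  finally show ?thesis unfolding of_real_eq_iff .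
qed

text \<open>Compactness of a polydisc, extracting a subsequence for one coordinate after
  another.\<close>

lemma bounded_functions_convergent_subseq:
  fixes f :: "nat \<Rightarrow> 'i \<Rightarrow> complex"
  assumes "finite I" "\<And>n i. i \<in> I \<Longrightarrow> cmod (f n i) \<le> B"
  shows "\<exists>r l. strict_mono r \<and> (\<forall>i\<in>I. (\<lambda>n. f (r n) i) \<longlonglongrightarrow> l i)"
  using assms
proof (induction I rule: finite_induct)
  case empty
  show ?case using strict_mono_id by (auto simp: id_def)
next
  case (insert p I)
  then obtain r l where r: "strict_mono (r :: nat \<Rightarrow> nat)" "\<forall>i\<in>I. (\<lambda>n. f (r n) i) \<longlonglongrightarrow> l i" by auto
  have "\<forall>n. cmod (f (r n) p) \<le> B" using insert.prems by simp
  from Bolzano_Weierstrass_complex_disc[OF this] obtain s z where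
    s: "strict_mono (s :: nat \<Rightarrow> nat)" "\<forall>e>0. \<exists>N. \<forall>n\<ge>N. cmod (f (r (s n)) p - z) < e" by blast
  have z: "(\<lambda>n. f (r (s n)) p) \<longlonglongrightarrow> z"
    using s(2) by (simp add: LIMSEQ_def dist_norm)
  show ?case
  proof (intro exI[of _ "r \<circ> s"] exI[of _ "l(p := z)"] conjI ballI)
    show "strict_mono (r \<circ> s)" using r s by (simp add: strict_mono_o)
    fix i assume "i \<in> insert p I"
    then show "(\<lambda>n. f ((r \<circ> s) n) i) \<longlonglongrightarrow> (l(p := z)) i"
      using z LIMSEQ_subseq_LIMSEQ[OF _ s(1)] r(2) insert.hyps by (auto simp: o_def)
  qed
qed

lemma unitary_one: "unitary n (1\<^sub>m n)"
proof -
  have "dagger (1\<^sub>m n) = 1\<^sub>m n" by (intro eq_matI) (auto simp: dagger_def)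
  then show ?thesis by (simp add: unitary_def)
qed

lemma unitary_trace_bounded:
  assumes "unitary n U" "X \<in> carrier_mat n n"
  shows "Re (trace (U * X)) \<le> (\<Sum>i<n. \<Sum>j<n. cmod (X $$ (j,i)))"
proof -
  have "Re (trace (U * X)) = (\<Sum>i<n. \<Sum>j<n. Re (U $$ (i,j) * X $$ (j,i)))"
    using assms by (simp add: trace_mult[of _ n n] unitary_def del: times_complex.sel)
  also have "\<dots> \<le> (\<Sum>i<n. \<Sum>j<n. cmod (X $$ (j,i)))"
  proof (intro sum_mono)
    fix i j assume "i \<in> {..<n}" "j \<in> {..<n}"
    then have "cmod (U $$ (i,j)) \<le> 1" using unitary_entry_le[OF assms(1)] by simp
    then have "cmod (U $$ (i,j)) * cmod (X $$ (j,i)) \<le> 1 * cmod (X $$ (j,i))"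
      by (rule mult_right_mono) simp
    then show "Re (U $$ (i,j) * X $$ (j,i)) \<le> cmod (X $$ (j,i))"
      using complex_Re_le_cmod[of "U $$ (i,j) * X $$ (j,i)"] by (simp add: norm_mult)
  qed
  finally show ?thesis .
qed

lemma tnorm_upper:
  assumes "unitary n U" "X \<in> carrier_mat n n"
  shows "Re (trace (U * X)) \<le> tnorm n X"
  unfolding tnorm_def
proof (rule cSup_upper)
  show "Re (trace (U * X)) \<in> {Re (trace (U * X)) |U. unitary n U}" using assms by blast
  show "bdd_above {Re (trace (U * X)) |U. unitary n U}"
    using unitary_trace_bounded[OF _ assms(2)] by (intro bdd_aboveI) blast
qed

lemma tnorm_least:
  assumes "\<And>U. unitary n U \<Longrightarrow> Re (trace (U * X)) \<le> B"
  shows "tnorm n X \<le> B"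
  unfolding tnorm_def using unitary_one assms by (intro cSup_least) auto

text \<open>Compactness of the unitary group: a maximising sequence converges entrywise along a
  subsequence, and the equations for unitarity pass to the limit.\<close>

lemma tnorm_attained:
  assumes X: "X \<in> carrier_mat n n"
  shows "\<exists>U. unitary n U \<and> Re (trace (U * X)) = tnorm n X"
proof -
  have "\<exists>U. unitary n U \<and> tnorm n X - 1 / real (Suc m) < Re (trace (U * X))" for m
  proof (rule ccontr)
    assume "\<nexists>U. unitary n U \<and> tnorm n X - 1 / real (Suc m) < Re (trace (U * X))"
    then have "tnorm n X \<le> tnorm n X - 1 / real (Suc m)" by (intro tnorm_least) force
    then show False by simp
  qed
  then obtain U where U: "\<And>m. unitary n (U m)" "\<And>m. tnorm n X - 1 / real (Suc m) < Re (trace (U m * X))"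
    by metis
  have Uc: "U m \<in> carrier_mat n n" for m using U(1) by (simp add: unitary_def)
  have "\<exists>r l. strict_mono r \<and> (\<forall>ij\<in>{..<n} \<times> {..<n}. (\<lambda>m. U (r m) $$ ij) \<longlonglongrightarrow> l ij)"
    by (rule bounded_functions_convergent_subseq[where B = 1]) (use unitary_entry_le[OF U(1)] in auto)
  then obtain r l where r: "strict_mono (r :: nat \<Rightarrow> nat)"
    and l: "\<forall>ij\<in>{..<n} \<times> {..<n}. (\<lambda>m. U (r m) $$ ij) \<longlonglongrightarrow> l ij"
    by blast
  have l': "(\<lambda>m. U (r m) $$ (i,j)) \<longlonglongrightarrow> l (i,j)" if "i < n" "j < n" for i j using l that by simp
  define V where "V = mat n n l"
  have Vc: "V \<in> carrier_mat n n" by (simp add: V_def)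
  have V: "unitary n V"
    unfolding unitary_iff
  proof (intro conjI allI impI Vc)
    fix i j assume ij: "i < n" "j < n"
    have "(\<lambda>m. \<Sum>k<n. U (r m) $$ (i,k) * cnj (U (r m) $$ (j,k))) \<longlonglongrightarrow> (\<Sum>k<n. l (i,k) * cnj (l (j,k)))"
      by (intro tendsto_intros l') (use ij in auto)
    moreover have "(\<Sum>k<n. U (r m) $$ (i,k) * cnj (U (r m) $$ (j,k))) = (if i = j then 1 else 0)" for m
      using U(1)[of "r m"] ij unfolding unitary_iff by blast
    ultimately have "(\<lambda>m. if i = j then 1 else 0) \<longlonglongrightarrow> (\<Sum>k<n. l (i,k) * cnj (l (j,k)))" by simp
    then show "(\<Sum>k<n. V $$ (i,k) * cnj (V $$ (j,k))) = (if i = j then 1 else 0)"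
      using LIMSEQ_unique[OF _ tendsto_const] ij by (auto simp: V_def)
  qed
  have "(\<lambda>m. Re (\<Sum>i<n. \<Sum>j<n. U (r m) $$ (i,j) * X $$ (j,i))) \<longlonglongrightarrow> Re (\<Sum>i<n. \<Sum>j<n. l (i,j) * X $$ (j,i))"
    by (intro tendsto_intros l') auto
  then have lim: "(\<lambda>m. Re (trace (U (r m) * X))) \<longlonglongrightarrow> Re (trace (V * X))"
    unfolding trace_mult[OF Uc X] trace_mult[OF Vc X] by (simp add: V_def)
  have "tnorm n X \<le> Re (trace (V * X))"
  proof (rule LIMSEQ_le[OF _ lim])
    show "(\<lambda>m. tnorm n X - 1 / real (Suc (r m))) \<longlonglongrightarrow> tnorm n X"
      using tendsto_diff[OF tendsto_const LIMSEQ_subseq_LIMSEQ[OF LIMSEQ_Suc[OF lim_1_over_n] r]]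
      by (simp add: o_def)
    show "\<exists>N. \<forall>m\<ge>N. tnorm n X - 1 / real (Suc (r m)) \<le> Re (trace (U (r m) * X))"
      using U(2) less_imp_le by blast
  qed
  then show ?thesis using tnorm_upper[OF V X] V by (intro exI[of _ V]) auto
qed

lemma unitary_mult:
  assumes "unitary n U" "unitary n V"
  shows "unitary n (U * V)"
proof -
  have c: "U \<in> carrier_mat n n" "V \<in> carrier_mat n n" using assms by (auto simp: unitary_def)
  have "dagger (U * V) = dagger V * dagger U"
  proof (rule eq_matI)
    fix i j assume "i < dim_row (dagger V * dagger U)" "j < dim_col (dagger V * dagger U)"
    then have ij: "i < n" "j < n" using c by (auto simp: dagger_def)
    have "dagger (U * V) $$ (i,j) = cnj ((U * V) $$ (j,i))" using ij c by (simp add: dagger_def)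
    also have "\<dots> = (\<Sum>k<n. dagger V $$ (i,k) * dagger U $$ (k,j))"
      unfolding mult_entry[OF c ij(2,1)] using ij c by (simp add: dagger_def mult.commute)
    also have "\<dots> = (dagger V * dagger U) $$ (i,j)"
      unfolding mult_entry[OF dagger_carrier[OF c(2)] dagger_carrier[OF c(1)] ij] ..
    finally show "dagger (U * V) $$ (i,j) = (dagger V * dagger U) $$ (i,j)" .
  qed (use c in \<open>auto simp: dagger_def\<close>)
  then have "(U * V) * dagger (U * V) = U * (V * dagger V) * dagger U"
    using c by (simp add: assoc_mult_mat[of _ n n _ n _ n] mult_carrier_mat[of _ n n _ n])
  then show ?thesis using assms c by (simp add: unitary_def)
qed

text \<open>At a maximiser \<open>U\<close> of \<open>Re (tr (U X))\<close> the matrix \<open>U X\<close> is positive: perturb \<open>U\<close> by the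
  unitaries \<open>1 - c v v\<^sup>*\<close> with \<open>\<bar>1 - c\<bar> = 1\<close>.\<close>
lemma psd_if_trace_maximal:
  assumes H: "H \<in> carrier_mat n n"
    and max: "\<And>W. unitary n W \<Longrightarrow> Re (trace (W * H)) \<le> Re (trace H)"
  shows "psd n H"
proof -
  define q where "q v = (\<Sum>i<n. \<Sum>j<n. cnj (v i) * H $$ (i,j) * v j)" for v
  have q: "Im (q v) = 0 \<and> 0 \<le> Re (q v)" for v
  proof (cases "(\<Sum>i<n. (cmod (v i))\<^sup>2) = 0")
    case True
    then have "v i = 0" if "i < n" for i using that by (simp add: sum_nonneg_eq_0_iff)
    then show ?thesis by (simp add: q_def)
  next
    case False
    define N where "N = (\<Sum>i<n. (cmod (v i))\<^sup>2)"
    have Nsum: "(\<Sum>i<n. cnj (v i) * v i) = of_real N"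
      unfolding N_def of_real_sum complex_norm_square by (simp add: mult.commute)
    have N: "0 < N" using False sum_nonneg[of "{..<n}" "\<lambda>i. (cmod (v i))\<^sup>2"] by (auto simp: N_def less_le)
    have key: "0 \<le> 2 * t\<^sup>2 * Re (q v) + 2 * t * Im (q v)" for t :: real
    proof -
      \<comment> \<open>c = 2 t (t - i) / (1 + t^2) runs through the circle |1 - c| = 1, and Re (c
        q) is a positive multiple of t^2 Re q + t Im q. Dividing by N allows v to be
        unnormalised.\<close>
      define c where "c = Complex (2 * t\<^sup>2 / (1 + t\<^sup>2)) (- 2 * t / (1 + t\<^sup>2))"
      have pos: "1 + t\<^sup>2 > 0" by (smt (verit) zero_le_power2)
      have cc: "c + cnj c = c * cnj c"
        using pos by (simp add: c_def complex_eq_iff divide_simps) (simp add: power2_eq_square power4_eq_xxxx algebra_simps)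
      define c' where "c' = c / of_real N"
      have cc': "c' + cnj c' = c' * cnj c' * of_real N"
      proof -
        have "c' + cnj c' = (c + cnj c) / of_real N" by (simp add: c'_def add_divide_distrib)
        then show ?thesis using N by (simp add: cc c'_def)
      qed
      define W where "W = mat n n (\<lambda>(i,j). (if i = j then 1 else 0) - c' * v i * cnj (v j))"
      have Wc: "W \<in> carrier_mat n n" by (simp add: W_def)
      have "unitary n W"
        unfolding unitary_iff
      proof (intro conjI allI impI Wc)
        fix i j assume ij: "i < n" "j < n"
        have "(\<Sum>k<n. W $$ (i,k) * cnj (W $$ (j,k)))
          = (\<Sum>k<n. (if k = i then if i = j then 1 else 0 else 0) - (if k = i then cnj c' * cnj (v j) * v i else 0)
              - (if k = j then c' * v i * cnj (v j) else 0) + c' * cnj c' * v i * cnj (v j) * (cnj (v k) * v k))"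
          using ij by (intro sum.cong refl) (auto simp: W_def algebra_simps)
        also have "\<dots> = (if i = j then 1 else 0) - cnj c' * cnj (v j) * v i - c' * v i * cnj (v j)
            + c' * cnj c' * v i * cnj (v j) * of_real N"
          using ij by (simp add: sum.distrib sum_subtractf Nsum flip: sum_distrib_left)
        also have "\<dots> = (if i = j then 1 else 0) - v i * cnj (v j) * ((c' + cnj c') - c' * cnj c' * of_real N)"
          by (simp add: algebra_simps)
        finally show "(\<Sum>k<n. W $$ (i,k) * cnj (W $$ (j,k))) = (if i = j then 1 else 0)"
          unfolding cc' by simp
      qed
      have "trace (W * H) = (\<Sum>i<n. \<Sum>j<n. (if j = i then H $$ (i,i) else 0) - c' * (cnj (v j) * H $$ (j,i) * v i))"
        unfolding trace_mult[OF Wc H] by (intro sum.cong refl) (auto simp: W_def algebra_simps)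
      also have "\<dots> = (\<Sum>i<n. H $$ (i,i)) - c' * (\<Sum>i<n. \<Sum>j<n. cnj (v j) * H $$ (j,i) * v i)"
        by (simp add: sum_subtractf sum_distrib_left)
      also have "(\<Sum>i<n. \<Sum>j<n. cnj (v j) * H $$ (j,i) * v i) = q v"
        unfolding q_def by (rule sum.swap)
      also have "(\<Sum>i<n. H $$ (i,i)) = trace H" using H by (simp add: trace_def)
      finally have "0 \<le> Re (c' * q v)" using max[OF \<open>unitary n W\<close>] by simp
      also have "c' * q v = of_real (1 / N) * (c * q v)" by (simp add: c'_def)
      finally have "0 \<le> Re (c * q v)" using N by (simp only: times_complex.sel Re_complex_of_real Im_complex_of_real) (simp add: zero_le_divide_iff)
      then have "0 \<le> (2 * t\<^sup>2 * Re (q v) + 2 * t * Im (q v)) / (1 + t\<^sup>2)"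
        by (simp add: c_def add_divide_distrib)
      then show ?thesis using pos by (simp add: zero_le_divide_iff)
    qed
    have "Im (q v) = 0"
    proof (rule ccontr)
      assume nz: "Im (q v) \<noteq> 0"
      \<comment> \<open>For small t the linear term dominates; this t makes the bound equal to - (Im
        q)^2 / (2 (|Re q| + 1)).\<close>
      define t where "t = - Im (q v) / (2 * (\<bar>Re (q v)\<bar> + 1))"
      have "2 * t\<^sup>2 * Re (q v) + 2 * t * Im (q v) \<le> 2 * t\<^sup>2 * (\<bar>Re (q v)\<bar> + 1) + 2 * t * Im (q v)"
        by (intro add_right_mono mult_left_mono) auto
      also have "\<dots> = t * (2 * t * (\<bar>Re (q v)\<bar> + 1) + 2 * Im (q v))"
        by (simp add: algebra_simps power2_eq_square)
      also have "2 * t * (\<bar>Re (q v)\<bar> + 1) = - Im (q v)"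
        using abs_ge_zero[of "Re (q v)"] by (simp add: t_def field_simps)
      also have "t * (- Im (q v) + 2 * Im (q v)) = - ((Im (q v))\<^sup>2 / (2 * (\<bar>Re (q v)\<bar> + 1)))"
        by (simp add: t_def power2_eq_square)
      also have "\<dots> < 0" using nz by (simp add: zero_less_divide_iff add_nonneg_pos)
      finally show False using key[of t] by simp
    qed
    then show ?thesis using key[of 1] by simp
  qed
  \<comment> \<open>Polarisation: the form is real at e_a, e_b, e_a + e_b and e_a + i e_b, which
    forces the two entries to be conjugate.\<close>
  have "H $$ (a,b) = cnj (H $$ (b,a))" if ab: "a < n" "b < n" for a b
  proof -
    have qe: "q (\<lambda>i. (if i = a then x else 0) + (if i = b then y else 0))
        = cnj x * x * H $$ (a,a) + cnj x * y * H $$ (a,b) + cnj y * x * H $$ (b,a) + cnj y * y * H $$ (b,b)" for x y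
    proof -
      have "q (\<lambda>i. (if i = a then x else 0) + (if i = b then y else 0))
        = (\<Sum>i<n. \<Sum>j<n. (if j = a then if i = a then cnj x * x * H $$ (a,a) else 0 else 0)
            + (if j = b then if i = a then cnj x * y * H $$ (a,b) else 0 else 0)
            + (if j = a then if i = b then cnj y * x * H $$ (b,a) else 0 else 0)
            + (if j = b then if i = b then cnj y * y * H $$ (b,b) else 0 else 0))"
        unfolding q_def by (intro sum.cong refl) (auto simp: algebra_simps)
      also have "\<dots> = cnj x * x * H $$ (a,a) + cnj x * y * H $$ (a,b) + cnj y * x * H $$ (b,a) + cnj y * y * H $$ (b,b)"
        using ab by (simp add: sum.distrib)
      finally show ?thesis .
    qed
    have 01: "Im (H $$ (a,a)) = 0"
      using q[of "\<lambda>i. (if i = a then 1 else 0) + (if i = b then 0 else 0)"] unfolding qe[of 1 0] by simp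
    have 02: "Im (H $$ (b,b)) = 0"
      using q[of "\<lambda>i. (if i = a then 0 else 0) + (if i = b then 1 else 0)"] unfolding qe[of 0 1] by simp
    note 0 = 01 02
    have 1: "Im (H $$ (a,b) + H $$ (b,a)) = 0"
      using q[of "\<lambda>i. (if i = a then 1 else 0) + (if i = b then 1 else 0)"] unfolding qe[of 1 1] by (simp add: 0)
    have 2: "Re (H $$ (a,b)) = Re (H $$ (b,a))"
      using q[of "\<lambda>i. (if i = a then 1 else 0) + (if i = b then \<i> else 0)"] unfolding qe[of 1 \<i>] by (simp add: 0)
    show ?thesis using 1 2 by (simp add: complex_eq_iff)
  qed
  then show ?thesis using H q unfolding psd_def q_def by blast
qed


lemma Re_cnj_mult_le: "Re (cnj a * b) \<le> ((cmod a)\<^sup>2 + (cmod b)\<^sup>2) / 2"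
proof -
  have "0 \<le> (cmod (a - b))\<^sup>2" by simp
  also have "\<dots> = (cmod a)\<^sup>2 + (cmod b)\<^sup>2 - 2 * Re (cnj a * b)"
    unfolding cmod_power2 by (simp add: power2_eq_square algebra_simps)
  finally show ?thesis by simp
qed

text \<open>A singular value decomposition with unnormalised vectors, read off the polar decomposition.\<close>
lemma tnorm_decomp:
  assumes X: "X \<in> carrier_mat n n"
  obtains g h where "\<And>i j. i < n \<Longrightarrow> j < n \<Longrightarrow> X $$ (i,j) = (\<Sum>s<n. g s i * cnj (h s j))"
    and "\<And>s. (\<Sum>i<n. (cmod (g s i))\<^sup>2) = (\<Sum>i<n. (cmod (h s i))\<^sup>2)"
    and "(\<Sum>s<n. \<Sum>i<n. (cmod (h s i))\<^sup>2) = tnorm n X"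
proof -
  obtain U where U: "unitary n U" and tU: "Re (trace (U * X)) = tnorm n X"
    using tnorm_attained[OF X] by blast
  have Uc: "U \<in> carrier_mat n n" using U by (simp add: unitary_def)
  define H where "H = U * X"
  have Hc: "H \<in> carrier_mat n n" using Uc X by (simp add: H_def)
  have "psd n H"
  proof (rule psd_if_trace_maximal[OF Hc])
    fix W assume W: "unitary n W"
    then have "W * H = (W * U) * X"
      using Uc X by (simp add: H_def unitary_def assoc_mult_mat[of _ n n _ n _ n])
    then show "Re (trace (W * H)) \<le> Re (trace H)"
      using tnorm_upper[OF unitary_mult[OF W U] X] tU by (simp add: H_def)
  qed
  then obtain h where h: "\<And>i j. i < n \<Longrightarrow> j < n \<Longrightarrow> H $$ (i,j) = (\<Sum>r<n. h r i * cnj (h r j))"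
    using psd_decomp by blast
  \<comment> \<open>X is the adjoint of U times H, and H is a sum of terms h_s h_s^*. So the left
    vectors are the images of the h_s under the adjoint of U, with the same lengths.\<close>
  define g where "g s i = (\<Sum>k<n. cnj (U $$ (k,i)) * h s k)" for s i
  have XH: "X = dagger U * H"
  proof -
    have "dagger U * U = 1\<^sub>m n"
      using mat_mult_left_right_inverse[OF Uc dagger_carrier[OF Uc]] U by (simp add: unitary_def)
    then show ?thesis
      using X Uc unfolding H_def
      by (simp add: assoc_mult_mat[of "dagger U" n n U n X n, symmetric])
  qed
  show ?thesis
  proof (rule that[of g h])
    fix i j assume ij: "i < n" "j < n"
    have "X $$ (i,j) = (\<Sum>k<n. cnj (U $$ (k,i)) * (\<Sum>s<n. h s k * cnj (h s j)))"
      unfolding XH mult_entry[OF dagger_carrier[OF Uc] Hc ij] using ij Uc by (simp add: h dagger_def)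
    also have "\<dots> = (\<Sum>k<n. \<Sum>s<n. cnj (U $$ (k,i)) * h s k * cnj (h s j))"
      by (simp add: sum_distrib_left mult.assoc)
    also have "\<dots> = (\<Sum>s<n. \<Sum>k<n. cnj (U $$ (k,i)) * h s k * cnj (h s j))"
      by (rule sum.swap)
    also have "\<dots> = (\<Sum>s<n. g s i * cnj (h s j))" by (simp add: g_def sum_distrib_right)
    finally show "X $$ (i,j) = (\<Sum>s<n. g s i * cnj (h s j))" .
  next
    fix s
    show "(\<Sum>i<n. (cmod (g s i))\<^sup>2) = (\<Sum>i<n. (cmod (h s i))\<^sup>2)"
      unfolding g_def
    proof (rule norm_sum_isometry)
      fix j k assume jk: "j < n" "k < n"
      then have "(\<Sum>i<n. U $$ (j,i) * cnj (U $$ (k,i))) = (if j = k then 1 else 0)"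
        using U unfolding unitary_iff by blast
      then show "(\<Sum>i<n. cnj (cnj (U $$ (j,i))) * cnj (U $$ (k,i))) = (if j = k then 1 else 0)" by simp
    qed
  next
    have "complex_of_real (\<Sum>s<n. \<Sum>i<n. (cmod (h s i))\<^sup>2) = (\<Sum>s<n. \<Sum>i<n. h s i * cnj (h s i))"
      unfolding of_real_sum complex_norm_square ..
    also have "\<dots> = trace H"
      unfolding trace_def using Hc h by (subst sum.swap) simp
    finally have "Re (complex_of_real (\<Sum>s<n. \<Sum>i<n. (cmod (h s i))\<^sup>2)) = Re (trace H)" by (rule arg_cong)
    then show "(\<Sum>s<n. \<Sum>i<n. (cmod (h s i))\<^sup>2) = tnorm n X"
      unfolding Re_complex_of_real using tU by (simp add: H_def)
  qed
qed

text \<open>Duality with unitaries, then the arithmetic-geometric mean. Any rank one decomposition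
  gives a bound, and that of \<open>tnorm_decomp\<close>, where g_s and h_s have equal length,
  attains it.\<close>

lemma tnorm_le_decomp:
  assumes X: "X \<in> carrier_mat n n"
    and dec: "\<And>i j. i < n \<Longrightarrow> j < n \<Longrightarrow> X $$ (i,j) = (\<Sum>r\<in>R. g r i * cnj (h r j))"
  shows "tnorm n X \<le> (\<Sum>r\<in>R. (\<Sum>i<n. (cmod (h r i))\<^sup>2) + (\<Sum>i<n. (cmod (g r i))\<^sup>2)) / 2"
proof (rule tnorm_least)
  fix U assume U: "unitary n U"
  have Uc: "U \<in> carrier_mat n n" using U by (simp add: unitary_def)
  have "trace (U * X) = (\<Sum>i<n. \<Sum>j<n. \<Sum>r\<in>R. cnj (h r i) * (U $$ (i,j) * g r j))"
    unfolding trace_mult[OF Uc X] by (intro sum.cong refl) (simp add: dec sum_distrib_left mult_ac)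
  also have "\<dots> = (\<Sum>r\<in>R. \<Sum>i<n. \<Sum>j<n. cnj (h r i) * (U $$ (i,j) * g r j))"
    by (rule trans[OF sum.cong[OF refl sum.swap] sum.swap])
  also have "\<dots> = (\<Sum>r\<in>R. \<Sum>i<n. cnj (h r i) * (\<Sum>j<n. U $$ (i,j) * g r j))"
    by (simp add: sum_distrib_left)
  finally have "Re (trace (U * X)) = (\<Sum>r\<in>R. \<Sum>i<n. Re (cnj (h r i) * (\<Sum>j<n. U $$ (i,j) * g r j)))"
    by (simp only: Re_sum)
  also have "\<dots> \<le> (\<Sum>r\<in>R. \<Sum>i<n. ((cmod (h r i))\<^sup>2 + (cmod (\<Sum>j<n. U $$ (i,j) * g r j))\<^sup>2) / 2)"
    by (intro sum_mono Re_cnj_mult_le)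
  also have "\<dots> = (\<Sum>r\<in>R. ((\<Sum>i<n. (cmod (h r i))\<^sup>2) + (\<Sum>i<n. (cmod (\<Sum>j<n. U $$ (i,j) * g r j))\<^sup>2)) / 2)"
    by (simp add: sum.distrib sum_divide_distrib[symmetric])
  also have "\<dots> = (\<Sum>r\<in>R. ((\<Sum>i<n. (cmod (h r i))\<^sup>2) + (\<Sum>i<n. (cmod (g r i))\<^sup>2)) / 2)"
    using norm_sum_isometry[OF unitary_cols[OF U]] by simp
  finally show "Re (trace (U * X)) \<le> (\<Sum>r\<in>R. (\<Sum>i<n. (cmod (h r i))\<^sup>2) + (\<Sum>i<n. (cmod (g r i))\<^sup>2)) / 2"
    by (simp add: sum_divide_distrib)
qed

lemma tnorm_psd_le:
  assumes "psd n Y"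
  shows "tnorm n Y \<le> Re (trace Y)"
proof -
  obtain h where h: "\<And>i j. i < n \<Longrightarrow> j < n \<Longrightarrow> Y $$ (i,j) = (\<Sum>r<n. h r i * cnj (h r j))"
    using psd_decomp[OF assms] by blast
  have "tnorm n Y \<le> (\<Sum>r<n. (\<Sum>i<n. (cmod (h r i))\<^sup>2) + (\<Sum>i<n. (cmod (h r i))\<^sup>2)) / 2"
    by (rule tnorm_le_decomp[OF psd_carrier[OF assms] h])
  also have "\<dots> = (\<Sum>i<n. \<Sum>r<n. (cmod (h r i))\<^sup>2)"
    by (subst sum.swap) (simp add: sum_divide_distrib)
  also have "\<dots> = (\<Sum>i<n. Re (Y $$ (i,i)))"
    by (intro sum.cong refl) (simp add: h cmod_power2, simp add: power2_eq_square)
  finally show ?thesis using psd_carrier[OF assms] by (simp add: trace_def)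
qed

text \<open>The contraction 2 T - 1 is tested against X. Since \<open>tnorm\<close> ranges over
  unitaries, the bound is taken from the rank one decomposition: 4 Re <h, T g> = <h+g, T (h+g)> -
  <h-g, T (h-g)>, and 0 \<le> T \<le> 1 bounds the right side by |h+g|^2.\<close>

lemma tnorm_effect:
  assumes T: "psd n T" "psd n (1\<^sub>m n - T)" and X: "X \<in> carrier_mat n n"
  shows "2 * Re (trace (T * X)) - Re (trace X) \<le> tnorm n X"
proof -
  have Tc: "T \<in> carrier_mat n n" using T by (simp add: psd_def)
  obtain g h where dec: "\<And>i j. i < n \<Longrightarrow> j < n \<Longrightarrow> X $$ (i,j) = (\<Sum>s<n. g s i * cnj (h s j))"
    and gh: "\<And>s. (\<Sum>i<n. (cmod (g s i))\<^sup>2) = (\<Sum>i<n. (cmod (h s i))\<^sup>2)"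
    and tn: "(\<Sum>s<n. \<Sum>i<n. (cmod (h s i))\<^sup>2) = tnorm n X"
    using tnorm_decomp[OF X] by blast
  define B where "B x y = (\<Sum>i<n. \<Sum>j<n. cnj (x i) * T $$ (i,j) * y j)" for x y
  have "trace (T * X) = (\<Sum>i<n. \<Sum>j<n. \<Sum>s<n. cnj (h s i) * T $$ (i,j) * g s j)"
    unfolding trace_mult[OF Tc X] by (intro sum.cong refl) (simp add: dec sum_distrib_left mult_ac)
  also have "\<dots> = (\<Sum>s<n. B (h s) (g s))"
    unfolding B_def by (rule trans[OF sum.cong[OF refl sum.swap] sum.swap])
  finally have 1: "Re (trace (T * X)) = (\<Sum>s<n. Re (B (h s) (g s)))" by simp
  have "trace X = (\<Sum>i<n. \<Sum>s<n. cnj (h s i) * g s i)"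
    unfolding trace_def using X by (simp add: dec mult.commute)
  also have "\<dots> = (\<Sum>s<n. \<Sum>i<n. cnj (h s i) * g s i)" by (rule sum.swap)
  finally have 2: "Re (trace X) = (\<Sum>s<n. \<Sum>i<n. Re (cnj (h s i) * g s i))" by (simp only: Re_sum)
  have 3: "2 * Re (B (h s) (g s)) - (\<Sum>i<n. Re (cnj (h s i) * g s i)) \<le> (\<Sum>i<n. (cmod (h s i))\<^sup>2)" for s
  proof -
    let ?x = "\<lambda>i. h s i + g s i" and ?y = "\<lambda>i. h s i - g s i"
    have herm: "B (g s) (h s) = cnj (B (h s) (g s))"
    proof -
      have "cnj (B (h s) (g s)) = (\<Sum>i<n. \<Sum>j<n. cnj (g s j) * T $$ (j,i) * h s i)"
        unfolding B_def cnj_sum using psd_herm[OF T(1)] by (intro sum.cong refl) (simp add: mult_ac)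
      also have "\<dots> = B (g s) (h s)" unfolding B_def by (rule sum.swap)
      finally show ?thesis by simp
    qed
    have "B ?x ?x - B ?y ?y = 2 * (B (h s) (g s) + B (g s) (h s))"
      unfolding B_def sum_subtractf[symmetric] sum_distrib_left sum.distrib[symmetric]
      by (intro sum.cong refl) (simp add: algebra_simps)
    then have d: "Re (B ?x ?x) - Re (B ?y ?y) = 4 * Re (B (h s) (g s))"
      unfolding herm by (metis (no_types, lifting) Re_complex_of_real complex_add_cnj minus_complex.sel(1) mult_2 mult_2_right numeral_Bit0 of_real_numeral of_real_mult mult.assoc distrib_right one_add_one)
    have y: "0 \<le> Re (B ?y ?y)" unfolding B_def by (rule psd_quadratic_form[OF T(1)])
    have "0 \<le> Re (\<Sum>i<n. \<Sum>j<n. cnj (?x i) * (1\<^sub>m n - T) $$ (i,j) * ?x j)"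
      by (rule psd_quadratic_form[OF T(2)])
    also have "(\<Sum>i<n. \<Sum>j<n. cnj (?x i) * (1\<^sub>m n - T) $$ (i,j) * ?x j)
        = (\<Sum>i<n. \<Sum>j<n. (if j = i then cnj (?x i) * ?x i else 0) - cnj (?x i) * T $$ (i,j) * ?x j)"
      using Tc by (intro sum.cong refl) (auto simp: algebra_simps)
    also have "\<dots> = (\<Sum>i<n. cnj (?x i) * ?x i) - B ?x ?x" by (simp add: sum_subtractf B_def)
    finally have x: "Re (B ?x ?x) \<le> (\<Sum>i<n. Re (cnj (?x i) * ?x i))" by (simp only: Re_sum minus_complex.sel diff_ge_0_iff_ge)
    also have "\<dots> = (\<Sum>i<n. (cmod (h s i))\<^sup>2 + (cmod (g s i))\<^sup>2 + 2 * Re (cnj (h s i) * g s i))"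
      unfolding cmod_power2 by (intro sum.cong refl) (simp add: algebra_simps power2_eq_square)
    also have "\<dots> = 2 * (\<Sum>i<n. (cmod (h s i))\<^sup>2) + 2 * (\<Sum>i<n. Re (cnj (h s i) * g s i))"
      by (simp add: sum.distrib gh sum_distrib_left del: times_complex.sel)
    finally show ?thesis using d y by linarith
  qed
  have "2 * Re (trace (T * X)) - Re (trace X)
      = (\<Sum>s<n. 2 * Re (B (h s) (g s)) - (\<Sum>i<n. Re (cnj (h s i) * g s i)))"
    unfolding 1 2 sum_distrib_left sum_subtractf ..
  also have "\<dots> \<le> tnorm n X" unfolding tn[symmetric] by (intro sum_mono 3)
  finally show ?thesis .
qed

text \<open>Each Kraus operator is applied to the vectors of a rank one decomposition of Y, which
  handles non-Hermitian Y; the trace hypothesis, used on v v^*, bounds the total squared length of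
  the images of v.\<close>

lemma tnorm_cp_le:
  assumes P: "cp n m P" and tr: "\<And>X. psd n X \<Longrightarrow> Re (trace (P X)) \<le> \<kappa> * Re (trace X)"
    and Y: "Y \<in> carrier_mat n n"
  shows "tnorm m (P Y) \<le> \<kappa> * tnorm n Y"
proof -
  note lin = cp_linmap[OF P]
  obtain a where a: "\<And>k l i j. k < m \<Longrightarrow> l < m \<Longrightarrow> i < n \<Longrightarrow> j < n \<Longrightarrow>
       P (unitmat n i j) $$ (k,l) = (\<Sum>r<m*n. a r k i * cnj (a r l j))"
    using cpE[OF P] by blast
  obtain g h where dec: "\<And>i j. i < n \<Longrightarrow> j < n \<Longrightarrow> Y $$ (i,j) = (\<Sum>s<n. g s i * cnj (h s j))"
    and gh: "\<And>s. (\<Sum>i<n. (cmod (g s i))\<^sup>2) = (\<Sum>i<n. (cmod (h s i))\<^sup>2)"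
    and tn: "(\<Sum>s<n. \<Sum>i<n. (cmod (h s i))\<^sup>2) = tnorm n Y"
    using tnorm_decomp[OF Y] by blast
  define G where "G v r k = (\<Sum>i<n. a r k i * v i)" for v r k
  have PY: "P Y $$ (k,l) = (\<Sum>rs\<in>{..<m*n} \<times> {..<n}. G (g (snd rs)) (fst rs) k * cnj (G (h (snd rs)) (fst rs) l))"
    if "k < m" "l < m" for k l
    using linmap_expand[OF lin Y that] that unfolding G_def kraus_sum[symmetric] by (simp add: a dec)
  have bound: "(\<Sum>r<m*n. \<Sum>k<m. (cmod (G v r k))\<^sup>2) \<le> \<kappa> * (\<Sum>i<n. (cmod (v i))\<^sup>2)" for v
  proof -
    define V where "V = mat n n (\<lambda>(i,j). v i * cnj (v j))"
    have Vc: "V \<in> carrier_mat n n" by (simp add: V_def)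
    have V: "psd n V" by (rule psd_gram[where R = "{()}" and h = "\<lambda>_. v"]) (auto simp: V_def)
    have PV: "P V $$ (k,k) = (\<Sum>r<m*n. G v r k * cnj (G v r k))" if "k < m" for k
    proof -
      have "P V $$ (k,k) = (\<Sum>i<n. \<Sum>j<n. (\<Sum>s\<in>{()}. v i * cnj (v j)) * (\<Sum>r<m*n. a r k i * cnj (a r k j)))"
        using linmap_expand[OF lin Vc that that] that by (simp add: a V_def)
      also have "\<dots> = (\<Sum>rs\<in>{..<m*n} \<times> {()}. G v (fst rs) k * cnj (G v (fst rs) k))"
        unfolding G_def
        by (rule kraus_sum[where a = a and k = k and l = k and g = "\<lambda>_. v" and h = "\<lambda>_. v" and S = "{()}"])
      also have "\<dots> = (\<Sum>r<m*n. G v r k * cnj (G v r k))"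
        by (rule sum.reindex_bij_witness[where i = "\<lambda>r. (r, ())" and j = fst]) auto
      finally show ?thesis .
    qed
    have "(\<Sum>r<m*n. \<Sum>k<m. (cmod (G v r k))\<^sup>2) = (\<Sum>k<m. \<Sum>r<m*n. (cmod (G v r k))\<^sup>2)"
      by (rule sum.swap)
    also have "\<dots> = (\<Sum>k<m. Re (P V $$ (k,k)))"
      by (intro sum.cong refl) (simp add: PV cmod_power2, simp add: power2_eq_square)
    also have "\<dots> = Re (trace (P V))" using linmap_carrier[OF lin Vc] by (simp add: trace_def)
    also have "\<dots> \<le> \<kappa> * Re (trace V)" by (rule tr[OF V])
    also have "Re (trace V) = (\<Sum>i<n. (cmod (v i))\<^sup>2)"
      unfolding cmod_power2 by (simp add: trace_def V_def power2_eq_square)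
    finally show ?thesis .
  qed
  have pull: "(\<Sum>rs\<in>{..<m*n} \<times> {..<n}. \<Sum>k<m. (cmod (G (v (snd rs)) (fst rs) k))\<^sup>2) \<le> (\<Sum>s<n. \<kappa> * (\<Sum>i<n. (cmod (v s i))\<^sup>2))" for v
  proof -
    have "(\<Sum>rs\<in>{..<m*n} \<times> {..<n}. \<Sum>k<m. (cmod (G (v (snd rs)) (fst rs) k))\<^sup>2)
        = (\<Sum>r<m*n. \<Sum>s<n. \<Sum>k<m. (cmod (G (v s) r k))\<^sup>2)"
      by (rule trans[OF _ sum.cartesian_product[symmetric]]) (simp add: case_prod_unfold)
    also have "\<dots> = (\<Sum>s<n. \<Sum>r<m*n. \<Sum>k<m. (cmod (G (v s) r k))\<^sup>2)" by (rule sum.swap)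
    also have "\<dots> \<le> (\<Sum>s<n. \<kappa> * (\<Sum>i<n. (cmod (v s i))\<^sup>2))" by (intro sum_mono bound)
    finally show ?thesis .
  qed
  have "tnorm m (P Y) \<le> (\<Sum>rs\<in>{..<m*n} \<times> {..<n}. (\<Sum>k<m. (cmod (G (h (snd rs)) (fst rs) k))\<^sup>2)
      + (\<Sum>k<m. (cmod (G (g (snd rs)) (fst rs) k))\<^sup>2)) / 2"
    by (rule tnorm_le_decomp[OF linmap_carrier[OF lin Y] PY])
  also have "\<dots> \<le> ((\<Sum>s<n. \<kappa> * (\<Sum>i<n. (cmod (h s i))\<^sup>2)) + (\<Sum>s<n. \<kappa> * (\<Sum>i<n. (cmod (g s i))\<^sup>2))) / 2"
    unfolding sum.distrib using pull[of h] pull[of g] by simp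
  also have "\<dots> = \<kappa> * tnorm n Y" unfolding gh tn[symmetric] sum_distrib_left[symmetric] by simp
  finally show ?thesis .
qed

lemma trace_mult_diff:
  assumes "U \<in> carrier_mat n n" "A \<in> carrier_mat n n" "B \<in> carrier_mat n n"
  shows "trace (U * (A - B)) = trace (U * A) - trace (U * B)"
  using assms by (subst (1 2 3) trace_mult[of _ n n]) (auto simp: right_diff_distrib sum_subtractf)

lemma tnorm_diff_le:
  assumes "A \<in> carrier_mat n n" "B \<in> carrier_mat n n"
  shows "tnorm n (A - B) \<le> tnorm n A + tnorm n B"
proof (rule tnorm_least)
  fix U assume U: "unitary n U"
  have Uc: "U \<in> carrier_mat n n" using U by (simp add: unitary_def)
  have mU: "unitary n ((-1) \<cdot>\<^sub>m U)" using U Uc unfolding unitary_iff by simp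
  have "trace (((-1) \<cdot>\<^sub>m U) * B) = - trace (U * B)"
    using Uc assms by (subst (1 2) trace_mult[of _ n n]) (auto simp: sum_negf)
  then have "Re (trace (U * (A - B))) = Re (trace (U * A)) + Re (trace (((-1) \<cdot>\<^sub>m U) * B))"
    using trace_mult_diff[OF Uc assms] by simp
  then show "Re (trace (U * (A - B))) \<le> tnorm n A + tnorm n B"
    using tnorm_upper[OF U assms(1)] tnorm_upper[OF mU assms(2)] by simp
qed

lemma tnorm_smult_le:
  assumes "A \<in> carrier_mat n n" "0 \<le> c"
  shows "tnorm n (of_real c \<cdot>\<^sub>m A) \<le> c * tnorm n A"
proof (rule tnorm_least)
  fix U assume U: "unitary n U"
  have Uc: "U \<in> carrier_mat n n" using U by (simp add: unitary_def)
  have "trace (U * (of_real c \<cdot>\<^sub>m A)) = of_real c * trace (U * A)"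
    using Uc assms by (subst (1 2) trace_mult[of _ n n]) (auto simp: sum_distrib_left mult_ac)
  then have "Re (trace (U * (of_real c \<cdot>\<^sub>m A))) = c * Re (trace (U * A))" by simp
  then show "Re (trace (U * (of_real c \<cdot>\<^sub>m A))) \<le> c * tnorm n A"
    using tnorm_upper[OF U assms(1)] assms(2) by (simp add: mult_left_mono)
qed

lemma tnorm_zero_le: "tnorm n (0\<^sub>m n n) \<le> 0"
  by (rule tnorm_least) (auto simp: trace_def unitary_def)

lemma tnorm_nonneg:
  assumes "X \<in> carrier_mat n n"
  shows "0 \<le> tnorm n X"
  using tnorm_decomp[OF assms] by (metis (no_types, lifting) sum_nonneg zero_le_power2)

section \<open>Choi kernels and the base norm\<close>

text \<open>The Choi matrix with its indices unflattened to pairs (output, input); a partial trace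
  over the output becomes a plain sum.\<close>

definition ckern :: "nat \<Rightarrow> (complex mat \<Rightarrow> complex mat) \<Rightarrow> nat \<times> nat \<Rightarrow> nat \<times> nat \<Rightarrow> complex" where
  "ckern n f x y = f (unitmat n (snd x) (snd y)) $$ (fst x, fst y)"

text \<open>Inverse to \<open>ckern\<close>: turns the kernels produced by separation and by
  twirling back into maps.\<close>

definition kmap :: "nat \<Rightarrow> nat \<Rightarrow> (nat \<times> nat \<Rightarrow> nat \<times> nat \<Rightarrow> complex) \<Rightarrow> complex mat \<Rightarrow> complex mat" where
  "kmap n m C X = mat m m (\<lambda>(k,l). \<Sum>i<n. \<Sum>j<n. X $$ (i,j) * C (k,i) (l,j))"

lemma sum_unitmat:
  assumes "a < n" "b < n"
  shows "(\<Sum>i<n. \<Sum>j<n. unitmat n a b $$ (i,j) * F i j) = F a b"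
proof -
  have "(\<Sum>i<n. \<Sum>j<n. unitmat n a b $$ (i,j) * F i j)
      = (\<Sum>i<n. \<Sum>j<n. if j = b then if i = a then F i j else 0 else 0)"
    by (intro sum.cong refl) (auto simp: unitmat_def)
  then show ?thesis using assms by simp
qed

lemma ckern_kmap:
  assumes "x \<in> {..<m} \<times> {..<n}" "y \<in> {..<m} \<times> {..<n}"
  shows "ckern n (kmap n m C) x y = C x y"
  using assms by (auto simp: ckern_def kmap_def sum_unitmat)

lemma linmap_kmap: "linmap n m (kmap n m C)"
  unfolding linmap_def
proof (intro conjI ballI allI)
  fix X :: "complex mat" assume X: "X \<in> carrier_mat n n"
  show "kmap n m C X \<in> carrier_mat m m" by (simp add: kmap_def)
  show "kmap n m C (X + Y) = kmap n m C X + kmap n m C Y" if "Y \<in> carrier_mat n n" for Y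
    using X that by (intro eq_matI) (auto simp: kmap_def distrib_right sum.distrib)
  show "kmap n m C (c \<cdot>\<^sub>m X) = c \<cdot>\<^sub>m kmap n m C X" for c
    using X by (intro eq_matI) (auto simp: kmap_def sum_distrib_left mult.assoc)
qed

lemma linmap_expand_ckern:
  assumes "linmap n m f" "X \<in> carrier_mat n n" "k < m" "l < m"
  shows "f X $$ (k,l) = (\<Sum>i<n. \<Sum>j<n. X $$ (i,j) * ckern n f (k,i) (l,j))"
  using linmap_expand[OF assms] by (simp add: ckern_def)

text \<open>Lets complete positivity be checked on kernels, where sums and multiples are
  pointwise.\<close>

lemma cp_iff_ckern:
  assumes "linmap n m f"
  shows "cp n m f \<longleftrightarrow> psd_on ({..<m} \<times> {..<n}) (ckern n f)"
proof
  assume "cp n m f"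
  then obtain h where h: "\<And>k l i j. k < m \<Longrightarrow> l < m \<Longrightarrow> i < n \<Longrightarrow> j < n \<Longrightarrow>
       f (unitmat n i j) $$ (k,l) = (\<Sum>r<m*n. h r k i * cnj (h r l j))"
    using cpE by blast
  show "psd_on ({..<m} \<times> {..<n}) (ckern n f)"
    by (rule psd_on_gram[where R = "{..<m*n}" and h = "\<lambda>r x. h r (fst x) (snd x)"])
      (auto simp: ckern_def h)
next
  assume "psd_on ({..<m} \<times> {..<n}) (ckern n f)"
  from psd_on_decomp[OF _ this] obtain h where
    h: "\<forall>x\<in>{..<m} \<times> {..<n}. \<forall>y\<in>{..<m} \<times> {..<n}. ckern n f x y = (\<Sum>r\<in>{..<m} \<times> {..<n}. h r x * cnj (h r y))"
    by auto
  show "cp n m f"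
  proof (rule cpI[OF assms, where R = "{..<m} \<times> {..<n}" and h = "\<lambda>r k i. h r (k,i)"])
    fix k l i j assume "k < m" "l < m" "i < n" "j < n"
    then show "f (unitmat n i j) $$ (k,l) = (\<Sum>r\<in>{..<m} \<times> {..<n}. h r (k,i) * cnj (h r (l,j)))"
      using h[rule_format, of "(k,i)" "(l,j)"] by (simp add: ckern_def)
  qed
qed

lemma channel_ckern_psd: "channel n m f \<Longrightarrow> psd_on ({..<m} \<times> {..<n}) (ckern n f)"
  using cp_iff_ckern channel_cp channel_linmap by blast

lemma channel_ckern_trace:
  assumes "channel n m f" "i < n" "j < n"
  shows "(\<Sum>k<m. ckern n f (k,i) (k,j)) = (if i = j then 1 else 0)"
proof -
  have "(\<Sum>k<m. ckern n f (k,i) (k,j)) = trace (f (unitmat n i j))"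
    using channel_carrier[OF assms(1), of "unitmat n i j"] by (simp add: trace_def ckern_def)
  also have "\<dots> = trace (unitmat n i j)" using assms by (simp add: channel_trace)
  also have "\<dots> = (\<Sum>a<n. if a = i then if i = j then 1 else 0 else 0)"
    unfolding trace_def by (intro sum.cong) (auto simp: unitmat_def)
  also have "\<dots> = (if i = j then 1 else 0)" using assms by simp
  finally show ?thesis .
qed

text \<open>A Choi kernel belongs to a channel when it is positive and its partial trace over the
  output is the identity. Mixtures, separation arguments and teleportation channels all enter
  through here.\<close>

lemma channel_kmap:
  assumes psd: "psd_on ({..<m} \<times> {..<n}) C"
    and tr: "\<And>i j. i < n \<Longrightarrow> j < n \<Longrightarrow> (\<Sum>k<m. C (k,i) (k,j)) = (if i = j then 1 else 0)"
  shows "channel n m (kmap n m C)"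
  unfolding channel_iff
proof (intro conjI ballI)
  have "psd_on ({..<m} \<times> {..<n}) (ckern n (kmap n m C)) \<longleftrightarrow> psd_on ({..<m} \<times> {..<n}) C"
    by (rule psd_on_cong) (rule ckern_kmap)
  then have "psd_on ({..<m} \<times> {..<n}) (ckern n (kmap n m C))" using psd by simp
  then show "cp n m (kmap n m C)" using cp_iff_ckern[OF linmap_kmap] by blast
  fix X :: "complex mat" assume X: "X \<in> carrier_mat n n"
  have "trace (kmap n m C X) = (\<Sum>k<m. \<Sum>i<n. \<Sum>j<n. X $$ (i,j) * C (k,i) (k,j))"
    by (simp add: trace_def kmap_def)
  also have "\<dots> = (\<Sum>i<n. \<Sum>k<m. \<Sum>j<n. X $$ (i,j) * C (k,i) (k,j))" by (rule sum.swap)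
  also have "\<dots> = (\<Sum>i<n. \<Sum>j<n. \<Sum>k<m. X $$ (i,j) * C (k,i) (k,j))"
    by (intro sum.cong[OF refl] sum.swap)
  also have "\<dots> = (\<Sum>i<n. \<Sum>j<n. X $$ (i,j) * (if i = j then 1 else 0))"
    by (intro sum.cong refl) (simp only: sum_distrib_left[symmetric] tr lessThan_iff)
  also have "\<dots> = (\<Sum>i<n. \<Sum>j<n. if j = i then X $$ (i,j) else 0)"
    by (intro sum.cong refl) auto
  also have "\<dots> = trace X" using X by (simp add: trace_def)
  finally show "trace (kmap n m C X) = trace X" .
qed

lemma tnorm_channel_le:
  assumes "channel n m f" "Y \<in> carrier_mat n n"
  shows "tnorm m (f Y) \<le> tnorm n Y"
  using tnorm_cp_le[OF channel_cp[OF assms(1)], of 1 Y] assms channel_trace[OF assms(1)] psd_carrier by auto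

text \<open>Base-norm distance at most \<open>c\<close>; up to slack in \<open>c\<close> this means diamond distance at most \<open>2 c\<close>.\<close>
definition base_close :: "real \<Rightarrow> nat \<Rightarrow> nat \<Rightarrow> (complex mat \<Rightarrow> complex mat) \<Rightarrow> (complex mat \<Rightarrow> complex mat) \<Rightarrow> bool" where
  "base_close c n m \<Psi> \<Phi> \<longleftrightarrow> (\<exists>\<Gamma>1 \<Gamma>2. channel n m \<Gamma>1 \<and> channel n m \<Gamma>2 \<and>
     (\<forall>X\<in>carrier_mat n n. \<forall>k<m. \<forall>l<m.
       \<Phi> X $$ (k,l) + of_real c * \<Gamma>2 X $$ (k,l) = \<Psi> X $$ (k,l) + of_real c * \<Gamma>1 X $$ (k,l)))"

text \<open>The difference is c times a difference of two channels, and each channel contracts the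
  trace norm even next to a spectator; hence the factor 2.\<close>

lemma base_close_tnorm_le:
  assumes bc: "base_close c n m \<Psi> \<Phi>" and ch: "channel n m \<Psi>" "channel n m \<Phi>" and c: "0 \<le> c"
    and Y: "Y \<in> carrier_mat (n*K) (n*K)" "tnorm (n*K) Y \<le> 1"
  shows "tnorm (m*K) (tid_right n m K (\<lambda>X. \<Psi> X - \<Phi> X) Y) \<le> 2 * c"
proof -
  obtain \<Gamma>1 \<Gamma>2 where g: "channel n m \<Gamma>1" "channel n m \<Gamma>2"
    and eq: "\<And>X k l. X \<in> carrier_mat n n \<Longrightarrow> k < m \<Longrightarrow> l < m \<Longrightarrow>
       \<Phi> X $$ (k,l) + of_real c * \<Gamma>2 X $$ (k,l) = \<Psi> X $$ (k,l) + of_real c * \<Gamma>1 X $$ (k,l)"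
    using bc unfolding base_close_def by blast
  let ?T = "\<lambda>f. tid_right n m K f Y"
  have "?T (\<lambda>X. \<Psi> X - \<Phi> X) = of_real c \<cdot>\<^sub>m ?T \<Gamma>2 - of_real c \<cdot>\<^sub>m ?T \<Gamma>1"
  proof (rule eq_matI)
    fix x y assume "x < dim_row (of_real c \<cdot>\<^sub>m ?T \<Gamma>2 - of_real c \<cdot>\<^sub>m ?T \<Gamma>1)"
      "y < dim_col (of_real c \<cdot>\<^sub>m ?T \<Gamma>2 - of_real c \<cdot>\<^sub>m ?T \<Gamma>1)"
    then have xy: "x < m*K" "y < m*K" by (auto simp: tid_right_def)
    obtain a z where az: "a < m" "z < K" "x = a*K + z" using xy(1) by (rule less_mult_indexE)
    obtain b w where bw: "b < m" "w < K" "y = b*K + w" using xy(2) by (rule less_mult_indexE)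
    let ?B = "mat n n (\<lambda>(p,q). Y $$ (p*K + z, q*K + w))"
    have c: "\<Psi> ?B \<in> carrier_mat m m" "\<Phi> ?B \<in> carrier_mat m m" using ch by (auto intro: channel_carrier)
    have "\<Psi> ?B $$ (a,b) - \<Phi> ?B $$ (a,b) = of_real c * \<Gamma>2 ?B $$ (a,b) - of_real c * \<Gamma>1 ?B $$ (a,b)"
      using eq[of ?B a b] az bw by (simp add: algebra_simps)
    then show "?T (\<lambda>X. \<Psi> X - \<Phi> X) $$ (x,y) = (of_real c \<cdot>\<^sub>m ?T \<Gamma>2 - of_real c \<cdot>\<^sub>m ?T \<Gamma>1) $$ (x,y)"
      using az bw xy c by (simp add: tid_right_entry carrier_matD[OF tid_right_carrier])
  qed (simp_all add: tid_right_def)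
  then have "tnorm (m*K) (?T (\<lambda>X. \<Psi> X - \<Phi> X)) \<le> tnorm (m*K) (of_real c \<cdot>\<^sub>m ?T \<Gamma>2) + tnorm (m*K) (of_real c \<cdot>\<^sub>m ?T \<Gamma>1)"
    using tnorm_diff_le[of "of_real c \<cdot>\<^sub>m ?T \<Gamma>2" "m*K" "of_real c \<cdot>\<^sub>m ?T \<Gamma>1"] by simp
  also have "\<dots> \<le> c * tnorm (m*K) (?T \<Gamma>2) + c * tnorm (m*K) (?T \<Gamma>1)"
    using c by (intro add_mono tnorm_smult_le tid_right_carrier)
  also have "\<dots> \<le> c * 1 + c * 1"
    using tnorm_channel_le[OF channel_tid_right[OF g(1)] Y(1)] tnorm_channel_le[OF channel_tid_right[OF g(2)] Y(1)] Y(2) c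
    by (intro add_mono mult_left_mono) auto
  finally show ?thesis by simp
qed

section \<open>Diamond norm of a difference of channels\<close>

lemma dnorm_set_ne: "{tnorm (m*n) (tid_right n m n \<Psi> Y) | Y. Y \<in> carrier_mat (n*n) (n*n) \<and> tnorm (n*n) Y \<le> 1} \<noteq> {}"
proof -
  have "0\<^sub>m (n*n) (n*n) \<in> carrier_mat (n*n) (n*n) \<and> tnorm (n*n) (0\<^sub>m (n*n) (n*n)) \<le> 1"
    using tnorm_zero_le[of "n*n"] by simp
  then show ?thesis by blast
qed

lemma dnorm_le_base_close:
  assumes "base_close c n m \<Psi> \<Phi>" "channel n m \<Psi>" "channel n m \<Phi>" "0 \<le> c"
  shows "dnorm n m (\<lambda>X. \<Psi> X - \<Phi> X) \<le> 2 * c"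
  unfolding dnorm_def
  by (rule cSup_least[OF dnorm_set_ne]) (use base_close_tnorm_le[OF assms] in auto)

lemma dnorm_upper:
  assumes "channel n m \<Psi>" "channel n m \<Phi>" "Y \<in> carrier_mat (n*n) (n*n)" "tnorm (n*n) Y \<le> 1"
  shows "tnorm (m*n) (tid_right n m n (\<lambda>X. \<Psi> X - \<Phi> X) Y) \<le> dnorm n m (\<lambda>X. \<Psi> X - \<Phi> X)"
proof -
  \<comment> \<open>Any two channels are close with constant 1, since \<Phi> + \<Psi> = \<Psi> +
    \<Phi>; this gives the bound 2 that makes the supremum finite.\<close>
  have "base_close 1 n m \<Psi> \<Phi>"
    unfolding base_close_def
    by (rule exI[of _ \<Phi>], rule exI[of _ \<Psi>]) (use assms in \<open>auto simp: add.commute\<close>)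
  then have "bdd_above {tnorm (m*n) (tid_right n m n (\<lambda>X. \<Psi> X - \<Phi> X) Y) | Y. Y \<in> carrier_mat (n*n) (n*n) \<and> tnorm (n*n) Y \<le> 1}"
    using base_close_tnorm_le[OF _ assms(1,2), of 1] by (intro bdd_aboveI[of _ 2]) auto
  then show ?thesis unfolding dnorm_def using assms(3,4) by (intro cSup_upper) auto
qed

lemma dnorm_nonneg:
  assumes "channel n m \<Psi>" "channel n m \<Phi>"
  shows "0 \<le> dnorm n m (\<lambda>X. \<Psi> X - \<Phi> X)"
proof -
  have "0 \<le> tnorm (m*n) (tid_right n m n (\<lambda>X. \<Psi> X - \<Phi> X) (0\<^sub>m (n*n) (n*n)))"
    by (intro tnorm_nonneg tid_right_carrier)
  also have "\<dots> \<le> dnorm n m (\<lambda>X. \<Psi> X - \<Phi> X)"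
    using tnorm_zero_le[of "n*n"] by (intro dnorm_upper assms) auto
  finally show ?thesis .
qed

lemma psd_on_delta:
  assumes "0 \<le> s" "finite S"
  shows "psd_on S (\<lambda>x y. if x = y then complex_of_real s else 0)"
proof (rule psd_on_gram[where R = S and h = "\<lambda>r x. if r = x then of_real (sqrt s) else 0"])
  fix x y assume xy: "x \<in> S" "y \<in> S"
  have "(\<Sum>r\<in>S. (if r = x then complex_of_real (sqrt s) else 0) * cnj (if r = y then of_real (sqrt s) else 0))
      = (\<Sum>r\<in>S. if r = x then if x = y then of_real s else 0 else 0)"
    using assms(1) by (intro sum.cong refl) (auto simp flip: of_real_mult)
  then show "(if x = y then complex_of_real s else 0) =
     (\<Sum>r\<in>S. (if r = x then complex_of_real (sqrt s) else 0) * cnj (if r = y then of_real (sqrt s) else 0))"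
    using xy assms(2) by simp
qed

text \<open>Turns the entrywise distance delivered by \<open>convex_separation\<close> into the
  positive order: an entrywise error \<eta> is repaired by adding \<eta> |S| times the identity,
  because |v_x| |v_y| \<le> (|v_x|^2 + |v_y|^2) / 2.\<close>

lemma psd_on_small_perturbation:
  fixes E :: "'a \<Rightarrow> 'a \<Rightarrow> complex"
  assumes fin: "finite S" and herm: "\<And>x y. x \<in> S \<Longrightarrow> y \<in> S \<Longrightarrow> E x y = cnj (E y x)"
    and small: "\<And>x y. x \<in> S \<Longrightarrow> y \<in> S \<Longrightarrow> cmod (E x y) \<le> \<eta>"
  shows "psd_on S (\<lambda>x y. E x y + (if x = y then of_real (\<eta> * card S) else 0))"
  unfolding psd_on_def
proof (intro conjI ballI allI)
  show "E x y + (if x = y then of_real (\<eta> * card S) else 0) = cnj (E y x + (if y = x then of_real (\<eta> * card S) else 0))"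
    if "x \<in> S" "y \<in> S" for x y using herm[OF that] by simp
  fix v :: "'a \<Rightarrow> complex"
  have "(\<Sum>x\<in>S. \<Sum>y\<in>S. cnj (v x) * (E x y + (if x = y then of_real (\<eta> * card S) else 0)) * v y)
     = (\<Sum>x\<in>S. \<Sum>y\<in>S. cnj (v x) * E x y * v y) + (\<Sum>x\<in>S. \<Sum>y\<in>S. if y = x then of_real (\<eta> * card S) * (cnj (v x) * v x) else 0)"
    unfolding sum.distrib[symmetric] by (intro sum.cong refl) (auto simp: algebra_simps)
  also have "(\<Sum>x\<in>S. \<Sum>y\<in>S. if y = x then of_real (\<eta> * card S) * (cnj (v x) * v x) else 0)
      = of_real (\<eta> * card S * (\<Sum>x\<in>S. (cmod (v x))\<^sup>2))"
    unfolding of_real_mult of_real_sum complex_norm_square sum_distrib_left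
    using fin by (simp add: mult_ac)
  finally have q: "Re (\<Sum>x\<in>S. \<Sum>y\<in>S. cnj (v x) * (E x y + (if x = y then of_real (\<eta> * card S) else 0)) * v y)
     = Re (\<Sum>x\<in>S. \<Sum>y\<in>S. cnj (v x) * E x y * v y) + \<eta> * card S * (\<Sum>x\<in>S. (cmod (v x))\<^sup>2)"
    by (simp only: plus_complex.sel Re_complex_of_real)
  have "cmod (\<Sum>x\<in>S. \<Sum>y\<in>S. cnj (v x) * E x y * v y) \<le> (\<Sum>x\<in>S. \<Sum>y\<in>S. \<eta> * (((cmod (v x))\<^sup>2 + (cmod (v y))\<^sup>2) / 2))"
  proof (intro order.trans[OF norm_sum] sum_mono)
    fix x y assume xy: "x \<in> S" "y \<in> S"
    have "0 \<le> \<eta>" using small[OF xy] norm_ge_zero order.trans by blast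
    have "cmod (v x) * cmod (v y) \<le> ((cmod (v x))\<^sup>2 + (cmod (v y))\<^sup>2) / 2"
      using sum_squares_bound[of "cmod (v x)" "cmod (v y)"] by simp
    then have "cmod (E x y) * (cmod (v x) * cmod (v y)) \<le> \<eta> * (((cmod (v x))\<^sup>2 + (cmod (v y))\<^sup>2) / 2)"
      using small[OF xy] \<open>0 \<le> \<eta>\<close> by (intro mult_mono) auto
    then show "cmod (cnj (v x) * E x y * v y) \<le> \<eta> * (((cmod (v x))\<^sup>2 + (cmod (v y))\<^sup>2) / 2)"
      by (simp add: norm_mult mult_ac)
  qed
  also have "\<dots> = \<eta> * card S * (\<Sum>x\<in>S. (cmod (v x))\<^sup>2)"
  proof -
    have "(\<Sum>x\<in>S. \<Sum>y\<in>S. \<eta> * (((cmod (v x))\<^sup>2 + (cmod (v y))\<^sup>2) / 2))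
        = \<eta> / 2 * ((\<Sum>x\<in>S. \<Sum>y\<in>S. (cmod (v x))\<^sup>2) + (\<Sum>x\<in>S. \<Sum>y\<in>S. (cmod (v y))\<^sup>2))"
      unfolding distrib_left sum_distrib_left sum.distrib[symmetric]
      by (intro sum.cong refl) (simp add: field_simps)
    also have "(\<Sum>x\<in>S. \<Sum>y\<in>S. (cmod (v x))\<^sup>2) = card S * (\<Sum>x\<in>S. (cmod (v x))\<^sup>2)"
      by (simp add: sum_distrib_left)
    also have "(\<Sum>x\<in>S. \<Sum>y\<in>S. (cmod (v y))\<^sup>2) = card S * (\<Sum>x\<in>S. (cmod (v x))\<^sup>2)"
      by simp
    finally show ?thesis by simp
  qed
  finally have "- (\<eta> * card S * (\<Sum>x\<in>S. (cmod (v x))\<^sup>2)) \<le> Re (\<Sum>x\<in>S. \<Sum>y\<in>S. cnj (v x) * E x y * v y)"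
    using abs_Re_le_cmod[of "\<Sum>x\<in>S. \<Sum>y\<in>S. cnj (v x) * E x y * v y"] by linarith
  then show "0 \<le> Re (\<Sum>x\<in>S. \<Sum>y\<in>S. cnj (v x) * (E x y + (if x = y then of_real (\<eta> * card S) else 0)) * v y)"
    unfolding q by linarith
qed

text \<open>The real Hilbert-Schmidt inner product of kernels, with W conjugated.\<close>

definition kpair :: "'a set \<Rightarrow> ('a \<Rightarrow> 'a \<Rightarrow> complex) \<Rightarrow> ('a \<Rightarrow> 'a \<Rightarrow> complex) \<Rightarrow> real" where
  "kpair S W A = Re (\<Sum>x\<in>S. \<Sum>y\<in>S. cnj (W x y) * A x y)"

lemma kpair_add: "kpair S W (\<lambda>x y. A x y + B x y) = kpair S W A + kpair S W B"
  by (simp add: kpair_def distrib_left sum.distrib del: times_complex.sel)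

lemma kpair_diff: "kpair S W (\<lambda>x y. A x y - B x y) = kpair S W A - kpair S W B"
  by (simp add: kpair_def right_diff_distrib sum_subtractf del: times_complex.sel)

lemma kpair_scale: "kpair S W (\<lambda>x y. of_real c * A x y) = c * kpair S W A"
proof -
  have "(\<Sum>x\<in>S. \<Sum>y\<in>S. cnj (W x y) * (of_real c * A x y)) = of_real c * (\<Sum>x\<in>S. \<Sum>y\<in>S. cnj (W x y) * A x y)"
    by (simp add: sum_distrib_left mult_ac)
  then show ?thesis by (simp add: kpair_def del: times_complex.sel) simp
qed

lemma kpair_scale_left: "kpair S (\<lambda>x y. of_real c * W x y) A = c * kpair S W A"
proof -
  have "(\<Sum>x\<in>S. \<Sum>y\<in>S. cnj (of_real c * W x y) * A x y) = of_real c * (\<Sum>x\<in>S. \<Sum>y\<in>S. cnj (W x y) * A x y)"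
    by (simp add: sum_distrib_left mult_ac)
  then show ?thesis by (simp add: kpair_def del: times_complex.sel) simp
qed

lemma kpair_cong:
  assumes "\<And>x y. x \<in> S \<Longrightarrow> y \<in> S \<Longrightarrow> W x y = W' x y" "\<And>x y. x \<in> S \<Longrightarrow> y \<in> S \<Longrightarrow> A x y = A' x y"
  shows "kpair S W A = kpair S W' A'"
  unfolding kpair_def using assms by (intro arg_cong[of _ _ Re] sum.cong) auto

lemma kpair_rank_one:
  assumes "\<And>x y. x \<in> S \<Longrightarrow> y \<in> S \<Longrightarrow> W x y = cnj (W y x)"
  shows "kpair S W (\<lambda>x y. v x * cnj (v y)) = Re (\<Sum>x\<in>S. \<Sum>y\<in>S. cnj (v x) * W x y * v y)"
proof -
  have "(\<Sum>x\<in>S. \<Sum>y\<in>S. cnj (W x y) * (v x * cnj (v y))) = (\<Sum>x\<in>S. \<Sum>y\<in>S. cnj (v y) * W y x * v x)"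
    using assms by (intro sum.cong refl) (metis mult.assoc mult.commute)
  also have "\<dots> = (\<Sum>x\<in>S. \<Sum>y\<in>S. cnj (v x) * W x y * v y)" by (rule sum.swap)
  finally show ?thesis by (simp add: kpair_def)
qed

lemma psd_on_rank_one: "psd_on S (\<lambda>x y. v x * cnj (v y))"
  by (rule psd_on_gram[where R = "{()}" and h = "\<lambda>_. v"]) simp

text \<open>Against Hermitian kernels, a functional acts through its Hermitian part.\<close>
lemma rdot_eq_kpair:
  assumes "finite S" and herm: "\<And>x y. x \<in> S \<Longrightarrow> y \<in> S \<Longrightarrow> A x y = cnj (A y x)"
  shows "rdot (S \<times> S) w (\<lambda>(x,y). A x y) = kpair S (\<lambda>x y. (w (x,y) + cnj (w (y,x))) / 2) A"
proof -
  let ?s = "\<Sum>x\<in>S. \<Sum>y\<in>S. cnj (w (x,y)) * A x y"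
  have "cnj ?s = (\<Sum>x\<in>S. \<Sum>y\<in>S. w (x,y) * A y x)"
    unfolding cnj_sum using herm by (intro sum.cong refl) (metis complex_cnj_cnj complex_cnj_mult)
  also have "\<dots> = (\<Sum>x\<in>S. \<Sum>y\<in>S. w (y,x) * A x y)" by (rule sum.swap)
  finally have "(\<Sum>x\<in>S. \<Sum>y\<in>S. cnj ((w (x,y) + cnj (w (y,x))) / 2) * A x y) = (?s + cnj ?s) / 2"
    by (simp add: add_divide_distrib sum.distrib distrib_right sum_divide_distrib)
  then have "kpair S (\<lambda>x y. (w (x,y) + cnj (w (y,x))) / 2) A = Re ?s"
    unfolding kpair_def complex_add_cnj by simp
  also have "\<dots> = rdot (S \<times> S) w (\<lambda>(x,y). A x y)"
    by (simp add: rdot_def sum.cartesian_product case_prod_unfold)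
  finally show ?thesis by simp
qed

text \<open>Applied along the rays of a cone, this turns boundedness of a separating functional into
  a sign.\<close>

lemma nonpos_if_multiples_bounded:
  fixes r b :: real
  assumes "\<And>t. 0 \<le> t \<Longrightarrow> t * r \<le> b"
  shows "r \<le> 0"
proof (rule ccontr)
  assume "\<not> r \<le> 0"
  then have "(\<bar>b\<bar> + 1) / r * r \<le> b" by (intro assms) simp
  then show False using \<open>\<not> r \<le> 0\<close> by simp
qed

text \<open>\<open>adj_map\<close> contributes a complex conjugation, so the trace is the conjugate
  of the kernel sum and only the real parts agree. In the arguments of \<rho>, rows and columns are
  exchanged, and the input index is the major one because \<rho> lives on S0 S1 while
  \<open>ckern\<close> lists the output first.\<close>

lemma pairing_eq_kpair:
  assumes \<rho>: "\<rho> \<in> carrier_mat (n*m) (n*m)"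
  shows "pairing n m \<rho> f = kpair ({..<m} \<times> {..<n}) (\<lambda>x y. \<rho> $$ (snd y * m + fst y, snd x * m + fst x)) (ckern n f)"
proof -
  have adj: "adj_map n m f (unitmat m k l) $$ (i,j) = cnj (f (unitmat n i j) $$ (k,l))"
    if "i < n" "j < n" "k < m" "l < m" for i j k l
    using that by (simp add: adj_map_def sum_unitmat)
  have tr: "trace (\<rho> * choi m n (adj_map n m f))
     = (\<Sum>i<n. \<Sum>k<m. \<Sum>j<n. \<Sum>l<m. \<rho> $$ (i*m+k, j*m+l) * cnj (ckern n f (l,j) (k,i)))"
    unfolding trace_mult[OF \<rho> choi_carrier] sum_lessThan_mult
    by (intro sum.cong refl) (simp add: choi_entry adj ckern_def)
  have "cnj (trace (\<rho> * choi m n (adj_map n m f)))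
      = (\<Sum>i<n. \<Sum>k<m. \<Sum>j<n. \<Sum>l<m. cnj (\<rho> $$ (i*m+k, j*m+l)) * ckern n f (l,j) (k,i))"
    unfolding tr by simp
  also have "\<dots> = (\<Sum>y\<in>{..<m} \<times> {..<n}. \<Sum>x\<in>{..<m} \<times> {..<n}.
      cnj (\<rho> $$ (snd y * m + fst y, snd x * m + fst x)) * ckern n f x y)"
  proof -
    have sw: "(\<Sum>i<n. \<Sum>k<m. F k i) = (\<Sum>y\<in>{..<m} \<times> {..<n}. F (fst y) (snd y))" for F :: "nat \<Rightarrow> nat \<Rightarrow> complex"
      by (rule trans[OF sum.swap]) (simp add: sum.cartesian_product case_prod_unfold)
    show ?thesis
      by (rule trans[OF sw[of "\<lambda>k i. \<Sum>j<n. \<Sum>l<m. cnj (\<rho> $$ (i*m+k, j*m+l)) * ckern n f (l,j) (k,i)"]])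
        (simp add: sw[of "\<lambda>l j. cnj (\<rho> $$ (_, j*m+l)) * ckern n f (l,j) _"])
  qed
  also have "\<dots> = (\<Sum>x\<in>{..<m} \<times> {..<n}. \<Sum>y\<in>{..<m} \<times> {..<n}.
      cnj (\<rho> $$ (snd y * m + fst y, snd x * m + fst x)) * ckern n f x y)" by (rule sum.swap)
  finally show ?thesis unfolding pairing_def kpair_def by (metis complex_cnj_cnj cnj.sel(1))
qed

lemma base_closeI_ckern:
  assumes "linmap n m \<Psi>" "linmap n m \<Phi>" "channel n m \<Gamma>1" "channel n m \<Gamma>2"
    and "\<And>x y. x \<in> {..<m} \<times> {..<n} \<Longrightarrow> y \<in> {..<m} \<times> {..<n} \<Longrightarrow>
       ckern n \<Phi> x y + of_real c * ckern n \<Gamma>2 x y = ckern n \<Psi> x y + of_real c * ckern n \<Gamma>1 x y"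
  shows "base_close c n m \<Psi> \<Phi>"
  unfolding base_close_def
proof (rule exI[of _ \<Gamma>1], rule exI[of _ \<Gamma>2], intro conjI ballI allI impI assms(3,4))
  fix X :: "complex mat" and k l assume X: "X \<in> carrier_mat n n" and kl: "k < m" "l < m"
  note ex = linmap_expand_ckern[OF _ X kl]
  have "\<Phi> X $$ (k,l) + of_real c * \<Gamma>2 X $$ (k,l)
      = (\<Sum>i<n. \<Sum>j<n. X $$ (i,j) * (ckern n \<Phi> (k,i) (l,j) + of_real c * ckern n \<Gamma>2 (k,i) (l,j)))"
    unfolding ex[OF assms(2)] ex[OF channel_linmap[OF assms(4)]]
    by (simp add: distrib_left sum.distrib sum_distrib_left mult_ac)
  also have "\<dots> = (\<Sum>i<n. \<Sum>j<n. X $$ (i,j) * (ckern n \<Psi> (k,i) (l,j) + of_real c * ckern n \<Gamma>1 (k,i) (l,j)))"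
    using assms(5) kl by (intro sum.cong refl) simp
  also have "\<dots> = \<Psi> X $$ (k,l) + of_real c * \<Gamma>1 X $$ (k,l)"
    unfolding ex[OF assms(1)] ex[OF channel_linmap[OF assms(3)]]
    by (simp add: distrib_left sum.distrib sum_distrib_left mult_ac)
  finally show "\<Phi> X $$ (k,l) + of_real c * \<Gamma>2 X $$ (k,l) = \<Psi> X $$ (k,l) + of_real c * \<Gamma>1 X $$ (k,l)" .
qed

section \<open>Separation of channels\<close>

lemma psd_on_scale_sum:
  assumes "psd_on S K" "psd_on S K'" "0 \<le> a" "0 \<le> b"
  shows "psd_on S (\<lambda>x y. of_real a * K x y + of_real b * K' x y)"
  using psd_on_add[OF psd_on_scale[OF assms(1,3)] psd_on_scale[OF assms(2,4)]] .

lemma psd_on_zero: "psd_on S (\<lambda>x y. 0)"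
  by (simp add: psd_on_def)

text \<open>Mixing kernels keeps both conditions of \<open>channel_kmap\<close>.\<close>

lemma channel_convex:
  assumes "channel n m f" "channel n m g" "0 \<le> t" "t \<le> 1"
  shows "\<exists>h. channel n m h \<and> (\<forall>x\<in>{..<m} \<times> {..<n}. \<forall>y\<in>{..<m} \<times> {..<n}.
    ckern n h x y = of_real (1 - t) * ckern n f x y + of_real t * ckern n g x y)"
proof (intro exI conjI ballI)
  let ?C = "\<lambda>x y. of_real (1 - t) * ckern n f x y + of_real t * ckern n g x y"
  show "channel n m (kmap n m ?C)"
  proof (rule channel_kmap)
    show "psd_on ({..<m} \<times> {..<n}) ?C"
      using assms by (intro psd_on_scale_sum channel_ckern_psd) auto
    fix i j assume "i < n" "j < n"
    then show "(\<Sum>k<m. ?C (k,i) (k,j)) = (if i = j then 1 else 0)"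
      using channel_ckern_trace[OF assms(1)] channel_ckern_trace[OF assms(2)]
      by (simp add: sum.distrib flip: sum_distrib_left)
  qed
  show "ckern n (kmap n m ?C) x y = ?C x y" if "x \<in> {..<m} \<times> {..<n}" "y \<in> {..<m} \<times> {..<n}" for x y
    by (rule ckern_kmap[OF that])
qed

text \<open>Lets the separating functional be normalised to a state.\<close>

lemma psd_on_trace_pos:
  assumes fin: "finite S" and psd: "psd_on S W" and nz: "x \<in> S" "y \<in> S" "W x y \<noteq> 0"
  shows "0 < (\<Sum>x\<in>S. Re (W x x))"
proof -
  obtain h where h: "\<forall>i\<in>S. \<forall>j\<in>S. W i j = (\<Sum>r\<in>S. h r i * cnj (h r j))"
    using psd_on_decomp[OF fin psd] by blast
  have d: "Re (W i i) = (\<Sum>r\<in>S. (cmod (h r i))\<^sup>2)" if "i \<in> S" for i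
    using h that by (simp add: cmod_power2) (simp add: power2_eq_square)
  obtain r where r: "r \<in> S" "h r x * cnj (h r y) \<noteq> 0"
    using h nz by (metis (no_types, lifting) sum.neutral)
  have "0 < (cmod (h r x))\<^sup>2" using r by simp
  also have "\<dots> \<le> (\<Sum>r\<in>S. (cmod (h r x))\<^sup>2)" using fin r by (intro member_le_sum) auto
  also have "\<dots> = Re (W x x)" using d nz by simp
  also have "\<dots> \<le> (\<Sum>x\<in>S. Re (W x x))"
    using fin nz d by (intro member_le_sum[of x S "\<lambda>x. Re (W x x)"]) (auto intro: sum_nonneg)
  finally show ?thesis .
qed

text \<open>Separate the Choi kernel of \<open>\<Phi>\<close> from the convex set of all \<open>\<Psi> + c \<Gamma> - P\<close> with \<open>P\<close> completely
  positive; the cone of the \<open>P\<close> forces the separating functional to be positive.\<close>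
lemma base_close_or_separated:
  assumes n: "0 < n" and m: "0 < m" and \<Phi>: "channel n m \<Phi>" and c: "0 \<le> c" "c < c'"
    and ch: "\<And>\<Psi>. \<Psi> \<in> S \<Longrightarrow> channel n m \<Psi>" and ne: "\<Psi>0 \<in> S"
    and conv: "\<And>\<Psi>1 \<Psi>2 t. \<Psi>1 \<in> S \<Longrightarrow> \<Psi>2 \<in> S \<Longrightarrow> 0 \<le> t \<Longrightarrow> t \<le> 1 \<Longrightarrow>
      \<exists>\<Psi>\<in>S. \<forall>x\<in>{..<m} \<times> {..<n}. \<forall>y\<in>{..<m} \<times> {..<n}.
        ckern n \<Psi> x y = of_real (1 - t) * ckern n \<Psi>1 x y + of_real t * ckern n \<Psi>2 x y"
    and far: "\<And>\<Psi>. \<Psi> \<in> S \<Longrightarrow> \<not> base_close c' n m \<Psi> \<Phi>"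
  shows "\<exists>\<rho> \<beta>. density (n*m) \<rho> \<and> 0 < \<beta> \<and> (\<forall>\<Psi>\<in>S. \<forall>\<Gamma>. channel n m \<Gamma> \<longrightarrow>
     pairing n m \<rho> \<Psi> + c * pairing n m \<rho> \<Gamma> + \<beta> \<le> pairing n m \<rho> \<Phi>)"
proof -
  define I where "I = {..<m} \<times> {..<n}"
  have fin: "finite I" by (simp add: I_def)
  have cardI: "card I = m*n" by (simp add: I_def)
  define z where "z = (\<lambda>(x,y). ckern n \<Phi> x y)"
  define C where "C = {f. \<exists>\<Psi> \<Gamma> P. \<Psi> \<in> S \<and> channel n m \<Gamma> \<and> psd_on I P \<and>
     (\<forall>x\<in>I. \<forall>y\<in>I. f (x,y) = ckern n \<Psi> x y + of_real c * ckern n \<Gamma> x y - P x y)}"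
  have CI: "f \<in> C" if "\<Psi> \<in> S" "channel n m \<Gamma>" "psd_on I P"
      "\<And>x y. x \<in> I \<Longrightarrow> y \<in> I \<Longrightarrow> f (x,y) = ckern n \<Psi> x y + of_real c * ckern n \<Gamma> x y - P x y" for f \<Psi> \<Gamma> P
    unfolding C_def using that by blast
  \<comment> \<open>An entrywise error \<eta> on the m*n index pairs costs s = \<eta> m n times the
    identity kernel, whose partial trace over the output is s m. This \<eta> makes c + s m equal to
    c'.\<close>
  define \<eta> where "\<eta> = (c' - c) / (real m * real (m*n))"
  have \<eta>: "0 < \<eta>" using c n m by (simp add: \<eta>_def)
  define s where "s = \<eta> * real (m*n)"
  have s1: "0 < s" using \<eta> n m by (simp add: s_def)
  have s2: "c + s * m = c'" using n m by (simp add: s_def \<eta>_def)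
  note s = s1 s2
  have farC: "\<exists>i\<in>I \<times> I. \<eta> \<le> cmod (z i - f i)" if "f \<in> C" for f
  proof (rule ccontr)
    assume near: "\<not> ?thesis"
    obtain \<Psi> \<Gamma> P where f: "\<Psi> \<in> S" "channel n m \<Gamma>" "psd_on I P"
      "\<And>x y. x \<in> I \<Longrightarrow> y \<in> I \<Longrightarrow> f (x,y) = ckern n \<Psi> x y + of_real c * ckern n \<Gamma> x y - P x y"
      using \<open>f \<in> C\<close> unfolding C_def by blast
    define E where "E x y = f (x,y) - ckern n \<Phi> x y" for x y
    note h\<Psi> = psd_on_herm[OF channel_ckern_psd[OF ch[OF f(1)]], folded I_def]
    note h\<Gamma> = psd_on_herm[OF channel_ckern_psd[OF f(2)], folded I_def]
    note h\<Phi> = psd_on_herm[OF channel_ckern_psd[OF \<Phi>], folded I_def]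
    have hE: "E x y = cnj (E y x)" if "x \<in> I" "y \<in> I" for x y
      using that f(4) by (simp add: E_def h\<Psi> h\<Gamma> h\<Phi> psd_on_herm[OF f(3)])
    have sE: "cmod (E x y) \<le> \<eta>" if "x \<in> I" "y \<in> I" for x y
    proof -
      have "\<not> \<eta> \<le> cmod (z (x,y) - f (x,y))" using near that by blast
      then show ?thesis by (simp add: E_def z_def norm_minus_commute)
    qed
    have pE: "psd_on I (\<lambda>x y. E x y + (if x = y then of_real s else 0))"
      using psd_on_small_perturbation[OF fin hE sE] unfolding cardI s_def by simp
    \<comment> \<open>Q is \<Psi> + c \<Gamma> - \<Phi> + s 1, positive and with partial trace c'.
      Hence \<Phi> + Q = \<Psi> + (c \<Gamma> + s 1), and dividing Q and the bracket by c' gives the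
      two channels of \<open>base_close\<close>.\<close>
    define Q where "Q x y = P x y + (E x y + (if x = y then of_real s else 0))" for x y
    have Q: "psd_on I Q" unfolding Q_def by (rule psd_on_add[OF f(3) pE])
    have Qeq: "Q x y = ckern n \<Psi> x y + of_real c * ckern n \<Gamma> x y - ckern n \<Phi> x y + (if x = y then of_real s else 0)"
      if "x \<in> I" "y \<in> I" for x y using that f(4) by (simp add: Q_def E_def)
    have c'0: "0 < c'" using c by simp
    define C1 where "C1 x y = of_real (1 / c') * (of_real c * ckern n \<Gamma> x y + (if x = y then of_real s else 0))" for x y :: "nat \<times> nat"
    define C2 where "C2 x y = of_real (1 / c') * Q x y" for x y
    have dl: "(\<Sum>k<m. (if (k,i) = (k,j) then complex_of_real s else 0)) = (if i = j then of_real (m * s) else 0)" for i j :: nat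
      by simp
    have c'c: "complex_of_real c + of_real m * of_real s = of_real c'"
      unfolding s(2)[symmetric] by (simp add: mult.commute)
    have "channel n m (kmap n m C1)"
    proof (rule channel_kmap)
      show "psd_on ({..<m} \<times> {..<n}) C1"
        unfolding C1_def using c'0 s(1) c fin channel_ckern_psd[OF f(2)]
        by (intro psd_on_scale psd_on_add psd_on_delta) (auto simp: I_def)
      fix i j assume ij: "i < n" "j < n"
      have "(\<Sum>k<m. C1 (k,i) (k,j)) = of_real (1 / c') * (of_real c * (\<Sum>k<m. ckern n \<Gamma> (k,i) (k,j)) + (if i = j then of_real (m * s) else 0))"
        unfolding C1_def dl[symmetric] by (simp add: sum_distrib_left sum.distrib distrib_left)
      then show "(\<Sum>k<m. C1 (k,i) (k,j)) = (if i = j then 1 else 0)"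
        using channel_ckern_trace[OF f(2) ij] c'0 c'c by simp
    qed
    moreover have "channel n m (kmap n m C2)"
    proof (rule channel_kmap)
      show "psd_on ({..<m} \<times> {..<n}) C2"
        unfolding C2_def using c'0 Q by (intro psd_on_scale) (auto simp: I_def)
      fix i j assume ij: "i < n" "j < n"
      have "(\<Sum>k<m. Q (k,i) (k,j)) = (\<Sum>k<m. ckern n \<Psi> (k,i) (k,j) + of_real c * ckern n \<Gamma> (k,i) (k,j) - ckern n \<Phi> (k,i) (k,j) + (if (k,i) = (k,j) then of_real s else 0))"
        using ij by (intro sum.cong refl Qeq) (auto simp: I_def)
      also have "\<dots> = (\<Sum>k<m. ckern n \<Psi> (k,i) (k,j)) + of_real c * (\<Sum>k<m. ckern n \<Gamma> (k,i) (k,j)) - (\<Sum>k<m. ckern n \<Phi> (k,i) (k,j)) + (if i = j then of_real (m * s) else 0)"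
        unfolding sum.distrib sum_subtractf dl sum_distrib_left ..
      also have "\<dots> = (if i = j then of_real c' else 0)"
        using channel_ckern_trace[OF f(2) ij] channel_ckern_trace[OF \<Phi> ij] channel_ckern_trace[OF ch[OF f(1)] ij] c'c by simp
      finally show "(\<Sum>k<m. C2 (k,i) (k,j)) = (if i = j then 1 else 0)"
        unfolding C2_def sum_distrib_left[symmetric] using c'0 by simp
    qed
    moreover have "ckern n \<Phi> x y + of_real c' * ckern n (kmap n m C2) x y = ckern n \<Psi> x y + of_real c' * ckern n (kmap n m C1) x y"
      if "x \<in> {..<m} \<times> {..<n}" "y \<in> {..<m} \<times> {..<n}" for x y
      using that c'0 by (simp add: ckern_kmap C1_def C2_def Qeq[unfolded I_def])
    ultimately have "base_close c' n m \<Psi> \<Phi>"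
      by (intro base_closeI_ckern[OF channel_linmap[OF ch[OF f(1)]] channel_linmap[OF \<Phi>]])
    then show False using far f(1) by blast
  qed
  have ne': "(\<lambda>(x,y). ckern n \<Psi>0 x y + of_real c * ckern n \<Phi> x y - 0) \<in> C"
    by (rule CI[OF ne \<Phi> psd_on_zero]) simp
  have "\<exists>w \<beta>. 0 < \<beta> \<and> (\<forall>f\<in>C. rdot (I \<times> I) w f + \<beta> \<le> rdot (I \<times> I) w z)"
  proof (rule convex_separation[OF _ ne' _ \<eta> farC])
    show "finite (I \<times> I)" using fin by simp
    fix f g and t :: real assume fg: "f \<in> C" "g \<in> C" and t: "0 \<le> t" "t \<le> 1"
    obtain \<Psi> \<Gamma> P where f: "\<Psi> \<in> S" "channel n m \<Gamma>" "psd_on I P"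
      "\<And>x y. x \<in> I \<Longrightarrow> y \<in> I \<Longrightarrow> f (x,y) = ckern n \<Psi> x y + of_real c * ckern n \<Gamma> x y - P x y"
      using fg(1) unfolding C_def by blast
    obtain \<Psi>' \<Gamma>' P' where g: "\<Psi>' \<in> S" "channel n m \<Gamma>'" "psd_on I P'"
      "\<And>x y. x \<in> I \<Longrightarrow> y \<in> I \<Longrightarrow> g (x,y) = ckern n \<Psi>' x y + of_real c * ckern n \<Gamma>' x y - P' x y"
      using fg(2) unfolding C_def by blast
    obtain \<Psi>'' where p: "\<Psi>'' \<in> S" "\<forall>x\<in>I. \<forall>y\<in>I. ckern n \<Psi>'' x y = of_real (1 - t) * ckern n \<Psi> x y + of_real t * ckern n \<Psi>' x y"
      using conv[OF f(1) g(1) t] unfolding I_def by blast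
    obtain \<Gamma>'' where ga: "channel n m \<Gamma>''" "\<forall>x\<in>I. \<forall>y\<in>I. ckern n \<Gamma>'' x y = of_real (1 - t) * ckern n \<Gamma> x y + of_real t * ckern n \<Gamma>' x y"
      using channel_convex[OF f(2) g(2) t] unfolding I_def by blast
    show "(\<lambda>i. of_real (1 - t) * f i + of_real t * g i) \<in> C"
    proof (rule CI[OF p(1) ga(1)])
      show "psd_on I (\<lambda>x y. of_real (1 - t) * P x y + of_real t * P' x y)"
        using t by (intro psd_on_scale_sum f g) auto
      fix x y assume xy: "x \<in> I" "y \<in> I"
      show "of_real (1 - t) * f (x,y) + of_real t * g (x,y) = ckern n \<Psi>'' x y + of_real c * ckern n \<Gamma>'' x y
          - (of_real (1 - t) * P x y + of_real t * P' x y)"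
        unfolding f(4)[OF xy] g(4)[OF xy] p(2)[rule_format, OF xy] ga(2)[rule_format, OF xy] by (simp add: algebra_simps)
    qed
  qed
  then obtain w \<beta> where \<beta>: "0 < \<beta>" and w: "\<And>f. f \<in> C \<Longrightarrow> rdot (I \<times> I) w f + \<beta> \<le> rdot (I \<times> I) w z" by blast
  define W where "W x y = (w (x,y) + cnj (w (y,x))) / 2" for x y
  have hW: "W x y = cnj (W y x)" for x y by (simp add: W_def add.commute)
  have ineq: "kpair I W (ckern n \<Psi>) + c * kpair I W (ckern n \<Gamma>) - kpair I W P + \<beta> \<le> kpair I W (ckern n \<Phi>)"
    if a: "\<Psi> \<in> S" "channel n m \<Gamma>" "psd_on I P" for \<Psi> \<Gamma> P
  proof -
    note h = psd_on_herm[OF channel_ckern_psd[OF ch[OF a(1)]], folded I_def]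
      psd_on_herm[OF channel_ckern_psd[OF a(2)], folded I_def] psd_on_herm[OF a(3)]
    have "rdot (I \<times> I) w (\<lambda>(x,y). ckern n \<Psi> x y + of_real c * ckern n \<Gamma> x y - P x y) + \<beta> \<le> rdot (I \<times> I) w z"
      by (rule w, rule CI[OF a]) simp
    also have "rdot (I \<times> I) w z = kpair I W (ckern n \<Phi>)"
      unfolding z_def W_def using psd_on_herm[OF channel_ckern_psd[OF \<Phi>], folded I_def]
      by (intro rdot_eq_kpair fin) simp
    also have "rdot (I \<times> I) w (\<lambda>(x,y). ckern n \<Psi> x y + of_real c * ckern n \<Gamma> x y - P x y)
        = kpair I W (\<lambda>x y. ckern n \<Psi> x y + of_real c * ckern n \<Gamma> x y - P x y)"
      unfolding W_def by (intro rdot_eq_kpair fin) (simp add: h)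
    finally show ?thesis by (simp add: kpair_add kpair_diff kpair_scale)
  qed
  \<comment> \<open>Moving P along the ray spanned by v v^*, with \<Psi> and \<Gamma> fixed, keeps
    the inequality, so the functional is nonnegative on v v^*.\<close>
  have W: "psd_on I W"
    unfolding psd_on_def
  proof (intro conjI ballI allI hW)
    fix v
    have "- kpair I W (\<lambda>x y. v x * cnj (v y)) \<le> 0"
    proof (rule nonpos_if_multiples_bounded)
      fix t :: real assume t: "0 \<le> t"
      show "t * - kpair I W (\<lambda>x y. v x * cnj (v y)) \<le> kpair I W (ckern n \<Phi>) - kpair I W (ckern n \<Psi>0) - c * kpair I W (ckern n \<Phi>) - \<beta>"
        using ineq[OF ne \<Phi> psd_on_scale[OF psd_on_rank_one[of I v] t]] by (simp add: kpair_scale)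
    qed
    moreover have "kpair I W (\<lambda>x y. v x * cnj (v y)) = Re (\<Sum>x\<in>I. \<Sum>y\<in>I. cnj (v x) * W x y * v y)"
      by (rule kpair_rank_one) (rule hW)
    ultimately show "0 \<le> Re (\<Sum>x\<in>I. \<Sum>y\<in>I. cnj (v x) * W x y * v y)" by linarith
  qed
  have ineq': "kpair I W (ckern n \<Psi>) + c * kpair I W (ckern n \<Gamma>) + \<beta> \<le> kpair I W (ckern n \<Phi>)"
    if "\<Psi> \<in> S" "channel n m \<Gamma>" for \<Psi> \<Gamma>
    using ineq[OF that psd_on_zero] by (simp add: kpair_def)
  \<comment> \<open>If W vanished, the separating inequality would read \<beta> \<le> 0.\<close>
  have "\<exists>x\<in>I. \<exists>y\<in>I. W x y \<noteq> 0"
  proof (rule ccontr)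
    assume "\<not> ?thesis"
    then have "kpair I W A = 0" for A by (simp add: kpair_def)
    then show False using ineq'[OF ne \<Phi>] \<beta> by simp
  qed
  then have \<tau>: "0 < (\<Sum>x\<in>I. Re (W x x))" using psd_on_trace_pos[OF fin W] by blast
  define \<tau> where "\<tau> = (\<Sum>x\<in>I. Re (W x x))"
  \<comment> \<open>Rows and columns are exchanged as in \<open>pairing_eq_kpair\<close>, and W is
    divided by its trace \<tau>; the gap becomes \<beta> / \<tau>.\<close>
  define \<rho> where "\<rho> = mat (n*m) (n*m) (\<lambda>(a,b). of_real (1/\<tau>) * W (b mod m, b div m) (a mod m, a div m))"
  have \<rho>c: "\<rho> \<in> carrier_mat (n*m) (n*m)" by (simp add: \<rho>_def)
  have \<rho>e: "\<rho> $$ (i*m+k, j*m+l) = of_real (1/\<tau>) * W (l,j) (k,i)" if "i < n" "j < n" "k < m" "l < m" for i j k l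
    using that by (simp add: \<rho>_def pair_index_less)
  obtain h where h: "\<forall>x\<in>I. \<forall>y\<in>I. W x y = (\<Sum>r\<in>I. h r x * cnj (h r y))"
    using psd_on_decomp[OF fin W] by blast
  have "psd (n*m) \<rho>"
  proof (rule psd_gram[OF \<rho>c, where R = I and h = "\<lambda>r a. of_real (sqrt (1/\<tau>)) * cnj (h r (a mod m, a div m))"])
    fix a b assume ab: "a < n*m" "b < n*m"
    have sq: "complex_of_real (sqrt (1/\<tau>)) * of_real (sqrt (1/\<tau>)) = of_real (1/\<tau>)"
      using \<tau> unfolding \<tau>_def[symmetric] by (simp flip: of_real_mult)
    have t: "of_real (sqrt (1/\<tau>)) * cnj x * cnj (of_real (sqrt (1/\<tau>)) * cnj y) = of_real (1/\<tau>) * (y * cnj x)" for x y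
      unfolding sq[symmetric] by (simp only: complex_cnj_mult complex_cnj_cnj complex_cnj_complex_of_real mult_ac)
    have "(b mod m, b div m) \<in> I" "(a mod m, a div m) \<in> I"
      using ab m by (auto simp: I_def less_mult_imp_div_less)
    then have "W (b mod m, b div m) (a mod m, a div m) = (\<Sum>r\<in>I. h r (b mod m, b div m) * cnj (h r (a mod m, a div m)))"
      using h by blast
    then show "\<rho> $$ (a,b) = (\<Sum>r\<in>I. of_real (sqrt (1/\<tau>)) * cnj (h r (a mod m, a div m)) *
       cnj (of_real (sqrt (1/\<tau>)) * cnj (h r (b mod m, b div m))))"
      unfolding t sum_distrib_left[symmetric] using ab by (simp add: \<rho>_def)
  qed
  moreover have "trace \<rho> = 1"
  proof -
    have "trace \<rho> = (\<Sum>i<n. \<Sum>k<m. of_real (1/\<tau>) * W (k,i) (k,i))"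
      using \<rho>c by (simp add: trace_def sum_lessThan_mult \<rho>e)
    also have "\<dots> = of_real (1/\<tau>) * (\<Sum>i<n. \<Sum>k<m. W (k,i) (k,i))" by (simp add: sum_distrib_left)
    also have "(\<Sum>i<n. \<Sum>k<m. W (k,i) (k,i)) = (\<Sum>x\<in>I. W x x)"
      unfolding I_def by (rule trans[OF sum.swap]) (simp add: sum.cartesian_product case_prod_unfold)
    also have "\<dots> = (\<Sum>x\<in>I. of_real (Re (W x x)))"
    proof (rule sum.cong[OF refl])
      fix x show "W x x = of_real (Re (W x x))" using hW[of x x] by (simp add: complex_eq_iff)
    qed
    also have "\<dots> = of_real \<tau>" by (simp add: \<tau>_def)
    finally show ?thesis using \<tau> unfolding \<tau>_def[symmetric] by simp
  qed
  moreover have "pairing n m \<rho> f = kpair I W (ckern n f) / \<tau>" for f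
  proof -
    have "pairing n m \<rho> f = kpair I (\<lambda>x y. of_real (1/\<tau>) * W x y) (ckern n f)"
      unfolding pairing_eq_kpair[OF \<rho>c] I_def
      by (rule kpair_cong) (auto simp: \<rho>e)
    then show ?thesis by (simp add: kpair_scale_left del: of_real_divide)
  qed
  ultimately show ?thesis
    using ineq' \<beta> \<tau>
    by (intro exI[of _ \<rho>] exI[of _ "\<beta> / \<tau>"])
      (auto simp: density_def \<tau>_def[symmetric] add_divide_distrib[symmetric] divide_le_cancel intro!: divide_right_mono)
qed


text \<open>Congruence of K by 1 \<otimes> E, where E is the matrix e acting on the input factor.
  The Gram vectors of K are transformed by the adjoint of E.\<close>

lemma psd_congruence:
  assumes "psd_on ({..<m} \<times> {..<n}) K"
  shows "psd (m*n) (mat (m*n) (m*n) (\<lambda>(x,y). \<Sum>j<n. \<Sum>i<n.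
    cnj (e j (x mod n)) * K (x div n, j) (y div n, i) * e i (y mod n)))"
proof -
  let ?S = "{..<m} \<times> {..<n}"
  obtain h where h: "\<forall>x\<in>?S. \<forall>y\<in>?S. K x y = (\<Sum>r\<in>?S. h r x * cnj (h r y))"
    using psd_on_decomp[OF _ assms] by auto
  show ?thesis
  proof (rule psd_gram[where R = ?S and h = "\<lambda>r x. \<Sum>j<n. cnj (e j (x mod n)) * h r (x div n, j)"])
    fix x y assume xy: "x < m*n" "y < m*n"
    then have d: "x div n < m" "y div n < m" by (auto simp: less_mult_imp_div_less)
    have "(\<Sum>j<n. \<Sum>i<n. cnj (e j (x mod n)) * K (x div n, j) (y div n, i) * e i (y mod n))
        = (\<Sum>j<n. \<Sum>i<n. \<Sum>r\<in>?S. (cnj (e j (x mod n)) * h r (x div n, j)) * cnj (cnj (e i (y mod n)) * h r (y div n, i)))"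
      using h d by (intro sum.cong refl) (simp add: sum_distrib_left sum_distrib_right mult_ac)
    also have "\<dots> = (\<Sum>r\<in>?S. \<Sum>j<n. \<Sum>i<n. (cnj (e j (x mod n)) * h r (x div n, j)) * cnj (cnj (e i (y mod n)) * h r (y div n, i)))"
      by (rule trans[OF sum.cong[OF refl sum.swap] sum.swap])
    also have "\<dots> = (\<Sum>r\<in>?S. (\<Sum>j<n. cnj (e j (x mod n)) * h r (x div n, j)) * cnj (\<Sum>j<n. cnj (e j (y mod n)) * h r (y div n, j)))"
      by (simp add: sum_product)
    finally show "mat (m*n) (m*n) (\<lambda>(x,y). \<Sum>j<n. \<Sum>i<n.
      cnj (e j (x mod n)) * K (x div n, j) (y div n, i) * e i (y mod n)) $$ (x,y) =
      (\<Sum>r\<in>?S. (\<Sum>j<n. cnj (e j (x mod n)) * h r (x div n, j)) * cnj (\<Sum>j<n. cnj (e j (y mod n)) * h r (y div n, j)))"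
      using xy by simp
  qed simp
qed

text \<open>Factorises \<Omega> + \<delta> as the adjoint of B times B, with E the inverse of B. The
  shift by \<delta> keeps B invertible when \<Omega> is singular.\<close>

lemma pos_def_factor:
  fixes n :: nat
  assumes psd: "psd_on {..<n} \<Omega>" and \<delta>: "0 < \<delta>"
  obtains b e where "\<And>i j. i < n \<Longrightarrow> j < n \<Longrightarrow> \<Omega> i j + (if i = j then of_real \<delta> else 0) = (\<Sum>p<n. cnj (b p i) * b p j)"
    and "\<And>p q. p < n \<Longrightarrow> q < n \<Longrightarrow> (\<Sum>i<n. b p i * e i q) = (if p = q then 1 else 0)"
    and "\<And>i j. i < n \<Longrightarrow> j < n \<Longrightarrow> (\<Sum>p<n. e i p * b p j) = (if i = j then 1 else 0)"
proof -
  let ?\<Omega> = "\<lambda>i j. \<Omega> i j + (if i = j then complex_of_real \<delta> else 0)"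
  have "psd_on {..<n} ?\<Omega>" using \<delta> by (intro psd_on_add psd psd_on_delta) auto
  from psd_on_decomp[OF _ this] obtain a where a: "\<forall>i\<in>{..<n}. \<forall>j\<in>{..<n}. ?\<Omega> i j = (\<Sum>r<n. a r i * cnj (a r j))"
    by auto
  define b where "b p i = cnj (a p i)" for p i
  have b: "?\<Omega> i j = (\<Sum>p<n. cnj (b p i) * b p j)" if "i < n" "j < n" for i j
    using a that by (simp add: b_def)
  define B where "B = mat n n (\<lambda>(p,i). b p i)"
  have Bc: "B \<in> carrier_mat n n" by (simp add: B_def)
  \<comment> \<open>A kernel vector v of B would give the form of \<Omega> + \<delta> the value 0,
    although that form is at least \<delta> |v|^2.\<close>
  have "det B \<noteq> 0"
  proof
    assume "det B = 0"
    then obtain v where v: "v \<in> carrier_vec n" "v \<noteq> 0\<^sub>v n" "B *\<^sub>v v = 0\<^sub>v n"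
      using det_0_iff_vec_prod_zero_field[OF Bc] by blast
    have Bv: "(\<Sum>j<n. b p j * v $ j) = 0" if "p < n" for p
    proof -
      have "(B *\<^sub>v v) $ p = (\<Sum>j<n. b p j * v $ j)"
        using that Bc v(1) by (simp add: B_def scalar_prod_def atLeast0LessThan)
      then show ?thesis using v(3) that by simp
    qed
    have "(\<Sum>i<n. \<Sum>j<n. cnj (v $ i) * ?\<Omega> i j * v $ j)
        = (\<Sum>i<n. \<Sum>j<n. \<Sum>p<n. cnj (v $ i) * cnj (b p i) * (b p j * v $ j))"
      by (intro sum.cong refl) (simp only: b lessThan_iff, simp add: sum_distrib_left sum_distrib_right mult_ac)
    also have "\<dots> = (\<Sum>i<n. \<Sum>p<n. \<Sum>j<n. cnj (v $ i) * cnj (b p i) * (b p j * v $ j))"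
      by (intro sum.cong[OF refl] sum.swap)
    also have "\<dots> = 0" by (simp add: sum_distrib_left[symmetric] Bv)
    finally have 0: "(\<Sum>i<n. \<Sum>j<n. cnj (v $ i) * ?\<Omega> i j * v $ j) = 0" .
    have "(\<Sum>i<n. \<Sum>j<n. cnj (v $ i) * ?\<Omega> i j * v $ j)
        = (\<Sum>i<n. \<Sum>j<n. cnj (v $ i) * \<Omega> i j * v $ j) + (\<Sum>i<n. \<Sum>j<n. if j = i then of_real \<delta> * (v $ i * cnj (v $ i)) else 0)"
      unfolding sum.distrib[symmetric] by (intro sum.cong refl) (auto simp: algebra_simps)
    also have "(\<Sum>i<n. \<Sum>j<n. if j = i then of_real \<delta> * (v $ i * cnj (v $ i)) else 0)
        = of_real (\<delta> * (\<Sum>i<n. (cmod (v $ i))\<^sup>2))"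
      unfolding of_real_mult of_real_sum complex_norm_square by (simp add: sum_distrib_left)
    finally have "Re 0 = Re ((\<Sum>i<n. \<Sum>j<n. cnj (v $ i) * \<Omega> i j * v $ j) + of_real (\<delta> * (\<Sum>i<n. (cmod (v $ i))\<^sup>2)))"
      unfolding 0 by (rule arg_cong)
    then have "\<delta> * (\<Sum>i<n. (cmod (v $ i))\<^sup>2) = - Re (\<Sum>i<n. \<Sum>j<n. cnj (v $ i) * \<Omega> i j * v $ j)"
      by (simp only: plus_complex.sel Re_complex_of_real zero_complex.sel)
    also have "\<dots> \<le> 0"
    proof -
      have "0 \<le> Re (\<Sum>i<n. \<Sum>j<n. cnj (v $ i) * \<Omega> i j * v $ j)" using psd unfolding psd_on_def by blast
      then show ?thesis by simp
    qed
    finally have "(\<Sum>i<n. (cmod (v $ i))\<^sup>2) \<le> 0" using \<delta> by (simp add: mult_le_0_iff)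
    then have "(\<Sum>i<n. (cmod (v $ i))\<^sup>2) = 0" by (intro antisym sum_nonneg) auto
    then have "v $ i = 0" if "i < n" for i using that by (simp add: sum_nonneg_eq_0_iff)
    then show False using v(1,2) by (auto intro!: eq_vecI)
  qed
  define F where "F = (1 / det B) \<cdot>\<^sub>m adj_mat B"
  have Fc: "F \<in> carrier_mat n n" using adj_mat[OF Bc] by (simp add: F_def)
  have BF: "B * F = 1\<^sub>m n"
    using adj_mat[OF Bc] Bc \<open>det B \<noteq> 0\<close> by (simp add: F_def mult_smult_distrib[OF Bc adj_mat(1)[OF Bc]]) (auto intro!: eq_matI)
  have FB: "F * B = 1\<^sub>m n" by (rule mat_mult_left_right_inverse[OF Bc Fc BF])
  show ?thesis
  proof (rule that[OF b, of "\<lambda>i p. F $$ (i,p)"])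
    fix p q assume pq: "p < n" "q < n"
    have "(B * F) $$ (p,q) = (\<Sum>i<n. b p i * F $$ (i,q))"
      unfolding mult_entry[OF Bc Fc pq] using pq by (simp add: B_def)
    then show "(\<Sum>i<n. b p i * F $$ (i,q)) = (if p = q then 1 else 0)" using BF pq by simp
  next
    fix i j assume ij: "i < n" "j < n"
    have "(F * B) $$ (i,j) = (\<Sum>p<n. F $$ (i,p) * b p j)"
      unfolding mult_entry[OF Fc Bc ij] using ij by (simp add: B_def)
    then show "(\<Sum>p<n. F $$ (i,p) * b p j) = (if i = j then 1 else 0)" using FB ij by simp
  qed
qed

section \<open>Duality for the diamond norm\<close>

lemma sum_swap_pairs:
  "(\<Sum>a\<in>A. \<Sum>b\<in>B. \<Sum>c\<in>C. \<Sum>d\<in>D. F a b c d) = (\<Sum>c\<in>C. \<Sum>d\<in>D. \<Sum>a\<in>A. \<Sum>b\<in>B. F a b c d)"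
proof -
  have "(\<Sum>a\<in>A. \<Sum>b\<in>B. \<Sum>c\<in>C. \<Sum>d\<in>D. F a b c d) = (\<Sum>a\<in>A. \<Sum>c\<in>C. \<Sum>b\<in>B. \<Sum>d\<in>D. F a b c d)"
    by (intro sum.cong[OF refl] sum.swap)
  also have "\<dots> = (\<Sum>c\<in>C. \<Sum>a\<in>A. \<Sum>d\<in>D. \<Sum>b\<in>B. F a b c d)"
    by (rule trans[OF sum.swap]) (intro sum.cong[OF refl] sum.swap)
  also have "\<dots> = (\<Sum>c\<in>C. \<Sum>d\<in>D. \<Sum>a\<in>A. \<Sum>b\<in>B. F a b c d)"
    by (intro sum.cong[OF refl] sum.swap)
  finally show ?thesis .
qed

lemma kpair_sum: "finite K \<Longrightarrow> kpair S W (\<lambda>x y. \<Sum>k\<in>K. A k x y) = (\<Sum>k\<in>K. kpair S W (A k))"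
proof (induction K rule: finite_induct)
  case empty
  then show ?case by (simp add: kpair_def)
next
  case (insert k K)
  then show ?case by (simp add: kpair_add)
qed

lemma tid_right_diff:
  assumes "\<And>X. X \<in> carrier_mat n n \<Longrightarrow> f X \<in> carrier_mat m m" "\<And>X. X \<in> carrier_mat n n \<Longrightarrow> g X \<in> carrier_mat m m"
  shows "tid_right n m K (\<lambda>X. f X - g X) Y = tid_right n m K f Y - tid_right n m K g Y"
proof (rule eq_matI)
  fix x y assume "x < dim_row (tid_right n m K f Y - tid_right n m K g Y)" "y < dim_col (tid_right n m K f Y - tid_right n m K g Y)"
  then have xy: "x < m*K" "y < m*K" by (auto simp: tid_right_def)
  obtain a z where az: "a < m" "z < K" "x = a*K + z" using xy(1) by (rule less_mult_indexE)
  obtain b w where bw: "b < m" "w < K" "y = b*K + w" using xy(2) by (rule less_mult_indexE)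
  show "tid_right n m K (\<lambda>X. f X - g X) Y $$ (x,y) = (tid_right n m K f Y - tid_right n m K g Y) $$ (x,y)"
    using az bw xy assms(1)[of "mat n n (\<lambda>(p,q). Y $$ (p*K + z, q*K + w))"] assms(2)[of "mat n n (\<lambda>(p,q). Y $$ (p*K + z, q*K + w))"]
    by (simp add: tid_right_entry carrier_matD[OF tid_right_carrier])
qed (auto simp: tid_right_def)

lemma linmap_diff:
  assumes "linmap n m f" "linmap n m g"
  shows "linmap n m (\<lambda>X. f X - g X)"
proof -
  have d: "dim_row (f X) = m" "dim_col (f X) = m" "dim_row (g X) = m" "dim_col (g X) = m"
    if "X \<in> carrier_mat n n" for X
    using linmap_carrier[OF assms(1) that] linmap_carrier[OF assms(2) that] by auto
  show ?thesis
    unfolding linmap_def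
  proof (intro conjI ballI allI)
    fix X :: "complex mat" assume X: "X \<in> carrier_mat n n"
    show "f X - g X \<in> carrier_mat m m" using d[OF X] by auto
    show "f (c \<cdot>\<^sub>m X) - g (c \<cdot>\<^sub>m X) = c \<cdot>\<^sub>m (f X - g X)" for c
    proof -
      have e: "f (c \<cdot>\<^sub>m X) = c \<cdot>\<^sub>m f X" "g (c \<cdot>\<^sub>m X) = c \<cdot>\<^sub>m g X" using assms X unfolding linmap_def by blast+
      show ?thesis unfolding e by (rule eq_matI) (simp_all add: d[OF X] right_diff_distrib)
    qed
    fix Y :: "complex mat" assume Y: "Y \<in> carrier_mat n n"
    have e: "f (X + Y) = f X + f Y" "g (X + Y) = g X + g Y" using assms X Y unfolding linmap_def by blast+
    show "f (X + Y) - g (X + Y) = f X - g X + (f Y - g Y)"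
      unfolding e by (rule eq_matI) (simp_all add: d[OF X] d[OF Y])
  qed
qed

text \<open>The factors e in T and b in X are mutually inverse, so they cancel in the trace and
  leave the pairing of W with D.\<close>

lemma trace_congruence:
  fixes b e :: "nat \<Rightarrow> nat \<Rightarrow> complex"
  assumes eb: "\<And>i j. i < n \<Longrightarrow> j < n \<Longrightarrow> (\<Sum>p<n. e i p * b p j) = (if i = j then 1 else 0)"
    and T: "T \<in> carrier_mat (m*n) (m*n)"
      "\<And>l q k p. l < m \<Longrightarrow> q < n \<Longrightarrow> k < m \<Longrightarrow> p < n \<Longrightarrow>
        T $$ (l*n+q, k*n+p) = (\<Sum>j<n. \<Sum>i<n. cnj (e j q) * W (l,j) (k,i) * e i p)"
    and X: "X \<in> carrier_mat (m*n) (m*n)"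
      "\<And>l q k p. l < m \<Longrightarrow> q < n \<Longrightarrow> k < m \<Longrightarrow> p < n \<Longrightarrow>
        X $$ (k*n+p, l*n+q) = (\<Sum>i<n. \<Sum>j<n. b p i * cnj (b q j) * D (k,i) (l,j))"
  shows "trace (T * X) = (\<Sum>x\<in>{..<m} \<times> {..<n}. \<Sum>y\<in>{..<m} \<times> {..<n}. W y x * D x y)"
proof -
  have inner: "(\<Sum>q<n. \<Sum>p<n. T $$ (l*n+q, k*n+p) * (b p i * cnj (b q j))) = W (l,j) (k,i)"
    if lk: "l < m" "k < m" and ij: "i < n" "j < n" for l k i j
  proof -
    have "(\<Sum>q<n. \<Sum>p<n. T $$ (l*n+q, k*n+p) * (b p i * cnj (b q j)))
        = (\<Sum>q<n. \<Sum>p<n. \<Sum>j'<n. \<Sum>i'<n. W (l,j') (k,i') * (cnj (e j' q * b q j) * (e i' p * b p i)))"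
      using lk by (intro sum.cong refl) (simp add: T(2) sum_distrib_right sum_distrib_left mult_ac)
    also have "\<dots> = (\<Sum>j'<n. \<Sum>i'<n. \<Sum>q<n. \<Sum>p<n. W (l,j') (k,i') * (cnj (e j' q * b q j) * (e i' p * b p i)))"
      by (rule sum_swap_pairs)
    also have "\<dots> = (\<Sum>j'<n. \<Sum>i'<n. W (l,j') (k,i') * (cnj (\<Sum>q<n. e j' q * b q j) * (\<Sum>p<n. e i' p * b p i)))"
      unfolding cnj_sum sum_product by (simp only: sum_distrib_left)
    also have "\<dots> = (\<Sum>j'<n. \<Sum>i'<n. if i' = i then if j' = j then W (l,j') (k,i') else 0 else 0)"
      using ij by (intro sum.cong refl) (simp add: eb)
    also have "\<dots> = W (l,j) (k,i)" using ij by simp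
    finally show ?thesis .
  qed
  have "trace (T * X) = (\<Sum>l<m. \<Sum>q<n. \<Sum>k<m. \<Sum>p<n. \<Sum>i<n. \<Sum>j<n. T $$ (l*n+q, k*n+p) * (b p i * cnj (b q j)) * D (k,i) (l,j))"
    unfolding trace_mult[OF T(1) X(1)] sum_lessThan_mult
    by (intro sum.cong refl) (simp add: X(2) sum_distrib_left mult.assoc)
  also have "\<dots> = (\<Sum>l<m. \<Sum>k<m. \<Sum>q<n. \<Sum>p<n. \<Sum>i<n. \<Sum>j<n. T $$ (l*n+q, k*n+p) * (b p i * cnj (b q j)) * D (k,i) (l,j))"
    by (intro sum.cong[OF refl] sum.swap)
  also have "\<dots> = (\<Sum>l<m. \<Sum>k<m. \<Sum>i<n. \<Sum>j<n. \<Sum>q<n. \<Sum>p<n. T $$ (l*n+q, k*n+p) * (b p i * cnj (b q j)) * D (k,i) (l,j))"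
    by (intro sum.cong[OF refl] sum_swap_pairs)
  also have "\<dots> = (\<Sum>l<m. \<Sum>k<m. \<Sum>i<n. \<Sum>j<n. W (l,j) (k,i) * D (k,i) (l,j))"
    by (intro sum.cong refl) (simp add: sum_distrib_right[symmetric] inner)
  also have "\<dots> = (\<Sum>k<m. \<Sum>i<n. \<Sum>l<m. \<Sum>j<n. W (l,j) (k,i) * D (k,i) (l,j))"
    by (rule trans[OF sum.swap]) (intro sum.cong[OF refl] sum.swap)
  also have "\<dots> = (\<Sum>x\<in>{..<m} \<times> {..<n}. \<Sum>y\<in>{..<m} \<times> {..<n}. W y x * D x y)"
  proof -
    have p: "(\<Sum>k<m. \<Sum>i<n. G (k,i)) = (\<Sum>x\<in>{..<m} \<times> {..<n}. G x)" for G :: "nat \<times> nat \<Rightarrow> complex"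
      by (simp add: sum.cartesian_product)
    show ?thesis by (simp only: p[symmetric])
  qed
  finally show ?thesis .
qed

text \<open>Witness turning a separating pair \<open>0 \<le> W \<le> 1 \<otimes> \<Omega>\<close> into an input state and an effect.\<close>
lemma dnorm_ge_kpair:
  fixes \<delta> :: real
  assumes n: "0 < n" and ch: "channel n m \<Psi>" "channel n m \<Phi>"
    and W: "psd_on ({..<m} \<times> {..<n}) W" and \<Omega>: "psd_on {..<n} \<Omega>"
    and le: "psd_on ({..<m} \<times> {..<n}) (\<lambda>x y. (if fst x = fst y then \<Omega> (snd x) (snd y) else 0) - W x y)"
    and \<delta>: "0 < \<delta>"
  shows "2 * kpair ({..<m} \<times> {..<n}) W (\<lambda>x y. ckern n \<Phi> x y - ckern n \<Psi> x y)
     \<le> dnorm n m (\<lambda>X. \<Psi> X - \<Phi> X) * ((\<Sum>i<n. Re (\<Omega> i i)) + \<delta> * n)"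
proof -
  let ?S = "{..<m} \<times> {..<n}"
  let ?\<Omega> = "\<lambda>i j. \<Omega> i j + (if i = j then complex_of_real \<delta> else 0)"
  obtain b e where b: "\<And>i j. i < n \<Longrightarrow> j < n \<Longrightarrow> ?\<Omega> i j = (\<Sum>p<n. cnj (b p i) * b p j)"
    and be: "\<And>p q. p < n \<Longrightarrow> q < n \<Longrightarrow> (\<Sum>i<n. b p i * e i q) = (if p = q then 1 else 0)"
    and eb: "\<And>i j. i < n \<Longrightarrow> j < n \<Longrightarrow> (\<Sum>p<n. e i p * b p j) = (if i = j then 1 else 0)"
    using pos_def_factor[OF \<Omega> \<delta>] by blast
  define L where "L x y = ((if fst x = fst y then \<Omega> (snd x) (snd y) else 0) - W x y) + (if x = y then complex_of_real \<delta> else 0)" for x y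
  have L: "psd_on ?S L" unfolding L_def using \<delta> by (intro psd_on_add le psd_on_delta) auto
  have L': "L x y = (if fst x = fst y then ?\<Omega> (snd x) (snd y) else 0) - W x y" for x y
    by (auto simp: L_def prod_eq_iff)
  define cg where "cg K = mat (m*n) (m*n) (\<lambda>(x,y). \<Sum>j<n. \<Sum>i<n.
    cnj (e j (x mod n)) * K (x div n, j) (y div n, i) * e i (y mod n))" for K :: "nat \<times> nat \<Rightarrow> nat \<times> nat \<Rightarrow> complex"
  \<comment> \<open>W \<le> 1 \<otimes> (\<Omega> + \<delta>), and \<Omega> + \<delta> factors
    through B; congruence by the inverse of B therefore turns W into an effect T between 0 and
    1.\<close>
  define T where "T = cg W"
  have Tc: "T \<in> carrier_mat (m*n) (m*n)" by (simp add: T_def cg_def)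
  have Te: "T $$ (l*n+q, k*n+p) = (\<Sum>j<n. \<Sum>i<n. cnj (e j q) * W (l,j) (k,i) * e i p)"
    if "l < m" "q < n" "k < m" "p < n" for l q k p
    using that by (simp add: T_def cg_def pair_index_less)
  have T: "psd (m*n) T" unfolding T_def cg_def by (rule psd_congruence[OF W])
  have "1\<^sub>m (m*n) - T = cg L"
  proof (rule eq_matI)
    fix x y assume "x < dim_row (cg L)" "y < dim_col (cg L)"
    then have xy: "x < m*n" "y < m*n" by (auto simp: cg_def)
    obtain l q where lq: "l < m" "q < n" "x = l*n + q" using xy(1) by (rule less_mult_indexE)
    obtain k p where kp: "k < m" "p < n" "y = k*n + p" using xy(2) by (rule less_mult_indexE)
    have "(\<Sum>j<n. \<Sum>i<n. cnj (e j q) * ?\<Omega> j i * e i p) = (\<Sum>j<n. \<Sum>i<n. \<Sum>r<n. cnj (b r j * e j q) * (b r i * e i p))"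
      by (intro sum.cong refl) (simp only: b lessThan_iff, simp add: sum_distrib_left sum_distrib_right mult_ac)
    also have "\<dots> = (\<Sum>r<n. \<Sum>j<n. \<Sum>i<n. cnj (b r j * e j q) * (b r i * e i p))"
      by (rule trans[OF sum.cong[OF refl sum.swap] sum.swap])
    also have "\<dots> = (\<Sum>r<n. cnj (\<Sum>j<n. b r j * e j q) * (\<Sum>i<n. b r i * e i p))"
      unfolding cnj_sum sum_product ..
    also have "\<dots> = (\<Sum>r<n. if r = q then if q = p then 1 else 0 else 0)"
      using lq kp by (intro sum.cong refl) (simp add: be)
    also have "\<dots> = (if q = p then 1 else 0)" using lq by simp
    finally have o: "(\<Sum>j<n. \<Sum>i<n. cnj (e j q) * ?\<Omega> j i * e i p) = (if q = p then 1 else 0)" .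
    have "cg L $$ (x,y) = (\<Sum>j<n. \<Sum>i<n. cnj (e j q) * L (l,j) (k,i) * e i p)"
      using lq kp by (simp add: cg_def pair_index_less)
    also have "\<dots> = (\<Sum>j<n. \<Sum>i<n. (if l = k then cnj (e j q) * ?\<Omega> j i * e i p else 0) - cnj (e j q) * W (l,j) (k,i) * e i p)"
      unfolding L' by (intro sum.cong refl) (auto simp: algebra_simps)
    also have "\<dots> = (if l = k then if q = p then 1 else 0 else 0) - T $$ (x,y)"
      unfolding sum_subtractf lq(3) kp(3) Te[OF lq(1,2) kp(1,2)] using o by auto
    finally show "(1\<^sub>m (m*n) - T) $$ (x,y) = cg L $$ (x,y)"
      using xy Tc lq kp by (auto simp: pair_index_eq_iff)
  qed (use Tc in \<open>auto simp: cg_def\<close>)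
  then have T1: "psd (m*n) (1\<^sub>m (m*n) - T)" using psd_congruence[OF L, of e] by (simp add: cg_def)
  \<comment> \<open>The diamond norm is taken of \<Psi> - \<Phi> while W detects \<Phi> - \<Psi>, so
    the test operator is 1 - T and its complement has to be positive too.\<close>
  have T2: "psd (m*n) (1\<^sub>m (m*n) - (1\<^sub>m (m*n) - T))"
  proof -
    have "1\<^sub>m (m*n) - (1\<^sub>m (m*n) - T) = T" using Tc by (intro eq_matI) auto
    then show ?thesis using T by simp
  qed
  \<comment> \<open>The unnormalised pure input state with coordinate b p i at (i,p). Its trace is
    tr \<Omega> + \<delta> n, the factor in the claim.\<close>
  define Y where "Y = mat (n*n) (n*n) (\<lambda>(x,y). b (x mod n) (x div n) * cnj (b (y mod n) (y div n)))"
  have Yc: "Y \<in> carrier_mat (n*n) (n*n)" by (simp add: Y_def)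
  have Y: "psd (n*n) Y"
    by (rule psd_gram[OF Yc, where R = "{()}" and h = "\<lambda>_ x. b (x mod n) (x div n)"]) (simp add: Y_def)
  define \<tau> where "\<tau> = (\<Sum>i<n. Re (\<Omega> i i)) + \<delta> * n"
  have trY: "Re (trace Y) = \<tau>"
  proof -
    have "trace Y = (\<Sum>i<n. \<Sum>p<n. cnj (b p i) * b p i)"
      unfolding trace_def using Yc by (simp add: Y_def sum_lessThan_mult pair_index_less mult.commute)
    also have "\<dots> = (\<Sum>i<n. ?\<Omega> i i)" by (intro sum.cong refl) (simp only: b lessThan_iff)
    finally show ?thesis by (simp add: sum.distrib \<tau>_def mult.commute)
  qed
  have "0 \<le> Re (\<Omega> i i)" if "i < n" for i
  proof -
    have "(\<Sum>a<n. \<Sum>c<n. cnj (if a = i then 1 else 0) * \<Omega> a c * (if c = i then 1 else 0))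
        = (\<Sum>a<n. \<Sum>c<n. if c = i then if a = i then \<Omega> a c else 0 else 0)"
      by (intro sum.cong refl) auto
    also have "\<dots> = \<Omega> i i" using that by simp
    finally have "\<Omega> i i = (\<Sum>a<n. \<Sum>c<n. cnj (if a = i then 1 else 0) * \<Omega> a c * (if c = i then 1 else 0))" by simp
    moreover have "0 \<le> Re (\<Sum>a<n. \<Sum>c<n. cnj (if a = i then 1 else 0) * \<Omega> a c * (if c = i then 1 else 0))"
      using conjunct2[OF \<Omega>[unfolded psd_on_def], THEN spec, of "\<lambda>a. if a = i then 1 else 0"] .
    ultimately show ?thesis by (simp only:)
  qed
  then have \<tau>: "0 < \<tau>" unfolding \<tau>_def using n \<delta> by (intro add_nonneg_pos sum_nonneg) auto
  let ?d = "\<lambda>X. \<Psi> X - \<Phi> X"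
  define X where "X = tid_right n m n ?d Y"
  have Xc: "X \<in> carrier_mat (m*n) (m*n)" by (simp add: X_def)
  have Xdiff: "X = tid_right n m n \<Psi> Y - tid_right n m n \<Phi> Y"
    unfolding X_def by (rule tid_right_diff) (use ch channel_carrier in blast)+
  have trX: "trace X = 0"
  proof -
    have "trace X = trace (tid_right n m n \<Psi> Y) - trace (tid_right n m n \<Phi> Y)"
      unfolding Xdiff by (simp add: trace_def carrier_matD[OF tid_right_carrier] sum_subtractf)
    then show ?thesis using channel_trace[OF channel_tid_right[OF ch(1)] Yc] channel_trace[OF channel_tid_right[OF ch(2)] Yc] by simp
  qed
  have Xe: "X $$ (k*n+p, l*n+q) = (\<Sum>i<n. \<Sum>j<n. b p i * cnj (b q j) * (ckern n \<Psi> (k,i) (l,j) - ckern n \<Phi> (k,i) (l,j)))"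
    if lk: "l < m" "q < n" "k < m" "p < n" for l q k p
  proof -
    let ?B = "mat n n (\<lambda>(i,j). Y $$ (i*n+p, j*n+q))"
    have B: "?B \<in> carrier_mat n n" by simp
    have Be: "?B $$ (i,j) = b p i * cnj (b q j)" if "i < n" "j < n" for i j
      using that lk by (simp add: Y_def pair_index_less)
    have "X $$ (k*n+p, l*n+q) = \<Psi> ?B $$ (k,l) - \<Phi> ?B $$ (k,l)"
      unfolding X_def using lk channel_carrier[OF ch(1) B] channel_carrier[OF ch(2) B] by (simp add: tid_right_entry)
    also have "\<dots> = (\<Sum>i<n. \<Sum>j<n. ?B $$ (i,j) * ckern n \<Psi> (k,i) (l,j) - ?B $$ (i,j) * ckern n \<Phi> (k,i) (l,j))"
      unfolding linmap_expand_ckern[OF channel_linmap[OF ch(1)] B lk(3,1)] linmap_expand_ckern[OF channel_linmap[OF ch(2)] B lk(3,1)]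
      by (simp only: sum_subtractf)
    also have "\<dots> = (\<Sum>i<n. \<Sum>j<n. b p i * cnj (b q j) * (ckern n \<Psi> (k,i) (l,j) - ckern n \<Phi> (k,i) (l,j)))"
      by (intro sum.cong refl) (simp only: Be lessThan_iff right_diff_distrib)
    finally show ?thesis .
  qed
  have "trace (T * X) = (\<Sum>x\<in>?S. \<Sum>y\<in>?S. W y x * (ckern n \<Psi> x y - ckern n \<Phi> x y))"
    using trace_congruence[OF eb Tc Te Xc, where D = "\<lambda>x y. ckern n \<Psi> x y - ckern n \<Phi> x y"] Xe by simp
  also have "\<dots> = (\<Sum>x\<in>?S. \<Sum>y\<in>?S. cnj (W x y) * (ckern n \<Psi> x y - ckern n \<Phi> x y))"
    using psd_on_herm[OF W] by (intro sum.cong refl) simp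
  finally have "Re (trace (T * X)) = kpair ?S W (\<lambda>x y. ckern n \<Psi> x y - ckern n \<Phi> x y)"
    unfolding kpair_def by (rule arg_cong)
  then have "Re (trace (T * X)) = - kpair ?S W (\<lambda>x y. ckern n \<Phi> x y - ckern n \<Psi> x y)"
    unfolding kpair_diff by simp
  moreover have "2 * Re (trace ((1\<^sub>m (m*n) - T) * X)) - Re (trace X) \<le> tnorm (m*n) X"
    by (rule tnorm_effect[OF T1 T2 Xc])
  moreover have "trace ((1\<^sub>m (m*n) - T) * X) = trace X - trace (T * X)"
  proof -
    have "(1\<^sub>m (m*n) - T) * X = X - T * X"
      using Tc Xc by (simp add: minus_mult_distrib_mat[of _ "m*n" "m*n" _ _ "m*n"])
    then show ?thesis using Tc Xc by (simp add: trace_def sum_subtractf)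
  qed
  ultimately have 1: "2 * kpair ?S W (\<lambda>x y. ckern n \<Phi> x y - ckern n \<Psi> x y) \<le> tnorm (m*n) X"
    using trX by simp
  define Y' where "Y' = of_real (1/\<tau>) \<cdot>\<^sub>m Y"
  have Y'c: "Y' \<in> carrier_mat (n*n) (n*n)" using Yc by (simp add: Y'_def)
  have "tnorm (n*n) Y' \<le> (1/\<tau>) * tnorm (n*n) Y"
    unfolding Y'_def using \<tau> by (intro tnorm_smult_le Yc) simp
  also have "\<dots> \<le> (1/\<tau>) * \<tau>"
    using tnorm_psd_le[OF Y] trY \<tau> by (intro mult_left_mono) auto
  finally have "tnorm (n*n) Y' \<le> 1" using \<tau> by simp
  then have d: "tnorm (m*n) (tid_right n m n ?d Y') \<le> dnorm n m ?d" by (rule dnorm_upper[OF ch Y'c])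
  have "X = of_real \<tau> \<cdot>\<^sub>m tid_right n m n ?d Y'"
  proof -
    have lin: "linmap n m ?d" by (intro linmap_diff channel_linmap ch)
    have "Y = of_real \<tau> \<cdot>\<^sub>m Y'" using \<tau> by (auto simp: Y'_def intro!: eq_matI)
    then show ?thesis
      unfolding X_def using linmap_tid_right[OF lin, of n] Y'c unfolding linmap_def by metis
  qed
  then have "tnorm (m*n) X \<le> \<tau> * tnorm (m*n) (tid_right n m n ?d Y')"
    using tnorm_smult_le[OF tid_right_carrier, of \<tau>] \<tau> by simp
  also have "\<dots> \<le> \<tau> * dnorm n m ?d" using d \<tau> by (intro mult_left_mono) auto
  finally show ?thesis using 1 by (simp add: \<tau>_def mult.commute)
qed


lemma rdot_Plus:
  "finite A \<Longrightarrow> finite B \<Longrightarrow> rdot (A <+> B) w f = rdot A (w \<circ> Inl) (f \<circ> Inl) + rdot B (w \<circ> Inr) (f \<circ> Inr)"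
  unfolding rdot_def by (subst sum.Plus) (auto simp: o_def)

definition ptrace1 :: "nat \<Rightarrow> (nat \<times> nat \<Rightarrow> nat \<times> nat \<Rightarrow> complex) \<Rightarrow> nat \<Rightarrow> nat \<Rightarrow> complex" where
  "ptrace1 m Q i j = (\<Sum>k<m. Q (k,i) (k,j))"

text \<open>Strong duality for the diamond norm: if no channel dominates \<open>(\<Phi> - \<Psi>) / c\<close>, then the pair of its Choi
  kernel and \<open>c 1\<close> is separated from the cone of all pairs \<open>(Q - P, tr\<^sub>1 Q + P')\<close>.\<close>
lemma base_close_if_dnorm_less:
  assumes n: "0 < n" and m: "0 < m" and ch: "channel n m \<Psi>" "channel n m \<Phi>"
    and less: "dnorm n m (\<lambda>X. \<Psi> X - \<Phi> X) < 2 * c"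
  shows "base_close c n m \<Psi> \<Phi>"
proof (rule ccontr)
  assume notclose: "\<not> base_close c n m \<Psi> \<Phi>"
  define c0 where "c0 = dnorm n m (\<lambda>X. \<Psi> X - \<Phi> X) / 2"
  \<comment> \<open>The room between c1 and c pays for the entrywise error \<eta> below; c1 itself
    is the constant of the separated point and lies above half the diamond norm.\<close>
  define c1 where "c1 = (c0 + c) / 2"
  have c0: "0 \<le> c0" using dnorm_nonneg[OF ch] by (simp add: c0_def)
  have c1: "c0 < c1" "c1 < c" using less by (auto simp: c0_def c1_def)
  define S where "S = {..<m} \<times> {..<n}"
  have finS: "finite S" by (simp add: S_def)
  have cardS: "card S = m*n" by (simp add: S_def)
  define D where "D x y = ckern n \<Phi> x y - ckern n \<Psi> x y" for x y
  have hD: "cnj (D y x) = D x y" if "x \<in> S" "y \<in> S" for x y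
    using psd_on_herm[OF channel_ckern_psd[OF ch(1)], folded S_def, OF that]
      psd_on_herm[OF channel_ckern_psd[OF ch(2)], folded S_def, OF that] by (simp add: D_def)
  have trD: "(\<Sum>k<m. D (k,i) (k,j)) = 0" if "i < n" "j < n" for i j
    unfolding D_def sum_subtractf using channel_ckern_trace[OF ch(1) that] channel_ckern_trace[OF ch(2) that] by simp
  \<comment> \<open>An error \<eta> on the kernel costs \<eta> m n times the identity, hence \<eta>
    m (m n) after the partial trace, and an error \<eta> on the marginal costs \<eta> n. Together
    they use up c - c1.\<close>
  define \<eta> where "\<eta> = (c - c1) / (real m * real (m*n) + real n)"
  have den: "0 < real m * real (m*n) + real n" using n by (intro add_nonneg_pos) auto
  have \<eta>: "0 < \<eta>" using c1 den by (simp add: \<eta>_def)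
  \<comment> \<open>Points are pairs of a kernel and a matrix on the input, joined over a disjoint
    union so that \<open>convex_separation\<close> applies to them as single vectors.\<close>
  define I where "I = (S \<times> S) <+> ({..<n} \<times> {..<n})"
  define one where "one i j = (if i = j then 1 else 0 :: complex)" for i j :: nat
  define z where "z = case_sum (\<lambda>(x,y). D x y) (\<lambda>(i,j). of_real c1 * one i j)"
  define pt where "pt Q P P' = case_sum (\<lambda>(x,y). Q x y - P x y) (\<lambda>(i,j). ptrace1 m Q i j + P' i j)"
    for Q P :: "nat \<times> nat \<Rightarrow> nat \<times> nat \<Rightarrow> complex" and P' :: "nat \<Rightarrow> nat \<Rightarrow> complex"
  \<comment> \<open>The pair (D, c1 1) lies in this cone exactly when some positive Q dominates D
    and has partial trace at most c1 times the identity.\<close>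
  define C where "C = {pt Q P P' | Q P P'. psd_on S Q \<and> psd_on S P \<and> psd_on {..<n} P'}"
  have CI: "pt Q P P' \<in> C" if "psd_on S Q" "psd_on S P" "psd_on {..<n} P'" for Q P P'
    unfolding C_def using that by blast
  have htr: "cnj (ptrace1 m Q j i) = ptrace1 m Q i j" if "psd_on S Q" "i < n" "j < n" for Q i j
    unfolding ptrace1_def cnj_sum using that by (intro sum.cong refl psd_on_herm[OF that(1)]) (auto simp: S_def)
  have far: "\<exists>i\<in>I. \<eta> \<le> cmod (z i - f i)" if "f \<in> C" for f
  proof (rule ccontr)
    assume near: "\<not> ?thesis"
    obtain Q P P' where f: "f = pt Q P P'" and Q: "psd_on S Q" and P: "psd_on S P" and P': "psd_on {..<n} P'"
      using \<open>f \<in> C\<close> unfolding C_def by blast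
    define E where "E x y = Q x y - P x y - D x y" for x y
    define F where "F i j = of_real c1 * one i j - (ptrace1 m Q i j + P' i j)" for i j
    have sE: "cmod (E x y) \<le> \<eta>" if "x \<in> S" "y \<in> S" for x y
    proof -
      have "Inl (x,y) \<in> I" using that by (auto simp: I_def)
      then have "\<not> \<eta> \<le> cmod (z (Inl (x,y)) - f (Inl (x,y)))" using near by blast
      then show ?thesis by (simp add: E_def z_def f pt_def norm_minus_commute)
    qed
    have sF: "cmod (F i j) \<le> \<eta>" if "i < n" "j < n" for i j
    proof -
      have "Inr (i,j) \<in> I" using that by (auto simp: I_def)
      then have "\<not> \<eta> \<le> cmod (z (Inr (i,j)) - f (Inr (i,j)))" using near by blast
      then show ?thesis by (simp add: F_def z_def f pt_def)
    qed
    have hE: "E x y = cnj (E y x)" if "x \<in> S" "y \<in> S" for x y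
      unfolding E_def using that by (simp add: hD psd_on_herm[OF Q] psd_on_herm[OF P])
    have hF: "F i j = cnj (F j i)" if "i < n" "j < n" for i j
      unfolding F_def using that by (simp add: htr[OF Q] psd_on_herm[OF P'] one_def)
    define s where "s = \<eta> * real (m*n)"
    have s0: "0 \<le> s" using \<eta> by (simp add: s_def)
    have pE: "psd_on S (\<lambda>x y. E x y + (if x = y then of_real s else 0))"
      using psd_on_small_perturbation[OF finS hE sE] unfolding cardS s_def by simp
    have pF: "psd_on {..<n} (\<lambda>i j. F i j + (if i = j then of_real (\<eta> * real n) else 0))"
    proof -
      have "psd_on {..<n} (\<lambda>i j. F i j + (if i = j then of_real (\<eta> * card {..<n}) else 0))"
        by (rule psd_on_small_perturbation) (auto intro: hF sF)
      then show ?thesis unfolding card_lessThan .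
    qed
    \<comment> \<open>Repairs an approximate membership: Q1 = Q + s 1 dominates D, and the defect R
      of its partial trace from c 1 is positive. Spreading R / m over the m output levels gives G
      with partial trace c 1, so G / c and (G - D) / c are the two channels required.\<close>
    define Q1 where "Q1 x y = Q x y + (if x = y then of_real s else 0)" for x y
    define R where "R i j = of_real c * one i j - ptrace1 m Q1 i j" for i j
    have R: "psd_on {..<n} R"
    proof -
      have eta: "c = c1 + \<eta> * (real m * real (m*n) + real n)" using den by (simp add: \<eta>_def)
      have "complex_of_real c = of_real c1 + of_real \<eta> * (of_nat m * of_nat (m*n) + of_nat n)"
        by (subst eta) simp
      then have "R i j = P' i j + (F i j + (if i = j then of_real (\<eta> * real n) else 0))" for i j
        unfolding R_def F_def Q1_def ptrace1_def by (simp add: one_def sum.distrib s_def algebra_simps)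
      then show ?thesis using psd_on_add[OF P' pF] by presburger
    qed
    define G where "G x y = Q1 x y + of_real (1/m) * ((if fst x = fst y then 1 else 0) * R (snd x) (snd y))" for x y
    have pR: "psd_on S (\<lambda>x y. (if fst x = fst y then 1 else 0) * R (snd x) (snd y))"
      using psd_on_prod[of "{..<m}" "{..<n}" "\<lambda>k l. if k = l then 1 else 0" R S fst snd] psd_on_delta[of 1 "{..<m}", unfolded of_real_1] R
      by (auto simp: S_def)
    have pG: "psd_on S G"
      unfolding G_def Q1_def using s0 finS by (intro psd_on_add Q psd_on_delta psd_on_scale pR) auto
    have pGD: "psd_on S (\<lambda>x y. G x y - D x y)"
    proof -
      have "G x y - D x y = P x y + (E x y + (if x = y then of_real s else 0)) + of_real (1/m) * ((if fst x = fst y then 1 else 0) * R (snd x) (snd y))" for x y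
        by (simp add: G_def Q1_def E_def)
      then show ?thesis using psd_on_add[OF psd_on_add[OF P pE] psd_on_scale[OF pR, of "1/m"]] by simp
    qed
    have trG: "(\<Sum>k<m. G (k,i) (k,j)) = of_real c * one i j" for i j
    proof -
      have "(\<Sum>k<m. G (k,i) (k,j)) = ptrace1 m Q1 i j + (\<Sum>k<m. of_real (1/m) * R i j)"
        by (simp add: G_def sum.distrib ptrace1_def)
      also have "(\<Sum>k<m. of_real (1/m) * R i j) = R i j" using m by simp
      finally show ?thesis by (simp add: R_def)
    qed
    have cpos: "0 < c" using c0 c1 by linarith
    have "channel n m (kmap n m (\<lambda>x y. of_real (1/c) * G x y))"
    proof (rule channel_kmap)
      show "psd_on ({..<m} \<times> {..<n}) (\<lambda>x y. of_real (1/c) * G x y)"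
        using pG cpos by (intro psd_on_scale) (auto simp: S_def)
      show "(\<Sum>k<m. of_real (1/c) * G (k,i) (k,j)) = (if i = j then 1 else 0)" for i j
        unfolding sum_distrib_left[symmetric] trG using cpos by (simp add: one_def)
    qed
    moreover have "channel n m (kmap n m (\<lambda>x y. of_real (1/c) * (G x y - D x y)))"
    proof (rule channel_kmap)
      show "psd_on ({..<m} \<times> {..<n}) (\<lambda>x y. of_real (1/c) * (G x y - D x y))"
        using pGD cpos by (intro psd_on_scale) (auto simp: S_def)
      show "(\<Sum>k<m. of_real (1/c) * (G (k,i) (k,j) - D (k,i) (k,j))) = (if i = j then 1 else 0)" if "i < n" "j < n" for i j
        unfolding sum_distrib_left[symmetric] sum_subtractf trG trD[OF that] using cpos by (simp add: one_def)
    qed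
    ultimately have "base_close c n m \<Psi> \<Phi>"
      by (rule base_closeI_ckern[OF channel_linmap[OF ch(1)] channel_linmap[OF ch(2)]])
        (use cpos in \<open>simp add: ckern_kmap D_def\<close>)
    then show False using notclose by blast
  qed
  have "\<exists>w \<beta>. 0 < \<beta> \<and> (\<forall>f\<in>C. rdot I w f + \<beta> \<le> rdot I w z)"
  proof (rule convex_separation[OF _ CI[OF psd_on_zero psd_on_zero psd_on_zero] _ \<eta> far])
    show "finite I" using finS by (simp add: I_def)
    fix f g and t :: real assume fg: "f \<in> C" "g \<in> C" and t: "0 \<le> t" "t \<le> 1"
    obtain Q P P' where f: "f = pt Q P P'" "psd_on S Q" "psd_on S P" "psd_on {..<n} P'"
      using fg(1) unfolding C_def by blast
    obtain Q2 P2 P2' where g: "g = pt Q2 P2 P2'" "psd_on S Q2" "psd_on S P2" "psd_on {..<n} P2'"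
      using fg(2) unfolding C_def by blast
    have "(\<lambda>i. of_real (1 - t) * f i + of_real t * g i) = pt (\<lambda>x y. of_real (1 - t) * Q x y + of_real t * Q2 x y)
        (\<lambda>x y. of_real (1 - t) * P x y + of_real t * P2 x y) (\<lambda>x y. of_real (1 - t) * P' x y + of_real t * P2' x y)"
    proof
      fix i
      show "of_real (1 - t) * f i + of_real t * g i = pt (\<lambda>x y. of_real (1 - t) * Q x y + of_real t * Q2 x y)
        (\<lambda>x y. of_real (1 - t) * P x y + of_real t * P2 x y) (\<lambda>x y. of_real (1 - t) * P' x y + of_real t * P2' x y) i"
        unfolding f(1) g(1) pt_def ptrace1_def
        by (cases i) (simp_all add: case_prod_unfold sum.distrib sum_subtractf sum_distrib_left algebra_simps)
    qed
    then show "(\<lambda>i. of_real (1 - t) * f i + of_real t * g i) \<in> C"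
      using t f g by (simp only:) (intro CI psd_on_scale_sum; simp)
  qed
  then obtain w \<beta> where \<beta>: "0 < \<beta>" and w: "\<And>f. f \<in> C \<Longrightarrow> rdot I w f + \<beta> \<le> rdot I w z" by blast
  define W where "W x y = (w (Inl (x,y)) + cnj (w (Inl (y,x)))) / 2" for x y
  define V where "V i j = (w (Inr (i,j)) + cnj (w (Inr (j,i)))) / 2" for i j
  have hW: "W x y = cnj (W y x)" for x y by (simp add: W_def add.commute)
  have hV: "V x y = cnj (V y x)" for x y by (simp add: V_def add.commute)
  \<comment> \<open>On pairs of Hermitian kernels the functional acts through its Hermitian parts W
    and V.\<close>
  have rd: "rdot I w (case_sum (\<lambda>(x,y). A x y) (\<lambda>(i,j). B i j)) = kpair S W A + kpair {..<n} V B"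
    if "\<And>x y. x \<in> S \<Longrightarrow> y \<in> S \<Longrightarrow> A x y = cnj (A y x)"
      "\<And>i j. i \<in> {..<n} \<Longrightarrow> j \<in> {..<n} \<Longrightarrow> B i j = cnj (B j i)" for A B
  proof -
    have 1: "rdot (S \<times> S) (w \<circ> Inl) (\<lambda>(x,y). A x y) = kpair S W A"
      unfolding W_def[abs_def]
      by (rule trans[OF rdot_eq_kpair[OF finS]]) (rule that(1), assumption+, simp only: o_def)
    have 2: "rdot ({..<n} \<times> {..<n}) (w \<circ> Inr) (\<lambda>(x,y). B x y) = kpair {..<n} V B"
      unfolding V_def[abs_def]
      by (rule trans[OF rdot_eq_kpair[OF finite_lessThan]]) (rule that(2), assumption+, simp only: o_def)
    show ?thesis
      unfolding I_def 1[symmetric] 2[symmetric]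
      by (subst rdot_Plus) (use finS in \<open>simp_all add: o_def\<close>)
  qed
  define r where "r Q P P' = kpair S W Q - kpair S W P + kpair {..<n} V (ptrace1 m Q) + kpair {..<n} V P'" for Q P P'
  have zval: "rdot I w z = kpair S W D + c1 * (\<Sum>i<n. Re (V i i))"
  proof -
    have "kpair {..<n} V (\<lambda>i j. of_real c1 * one i j) = c1 * kpair {..<n} V one" by (rule kpair_scale)
    also have "kpair {..<n} V one = Re (\<Sum>i<n. \<Sum>j<n. if j = i then cnj (V i j) else 0)"
      unfolding kpair_def by (intro arg_cong[of _ _ Re] sum.cong refl) (auto simp: one_def)
    also have "\<dots> = (\<Sum>i<n. Re (V i i))" by simp
    finally show ?thesis
      unfolding z_def by (subst rd) (auto simp: hD one_def)
  qed
  have ineq: "t * r Q P P' + \<beta> \<le> rdot I w z"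
    if t: "0 \<le> t" and psd: "psd_on S Q" "psd_on S P" "psd_on {..<n} P'" for t Q P P'
  proof -
    let ?s = "\<lambda>A x y. complex_of_real t * A x y"
    have "rdot I w (pt (?s Q) (?s P) (?s P')) + \<beta> \<le> rdot I w z"
      by (intro w CI psd_on_scale psd t)
    also have "rdot I w (pt (?s Q) (?s P) (?s P')) = kpair S W (\<lambda>x y. ?s Q x y - ?s P x y) + kpair {..<n} V (\<lambda>i j. ptrace1 m (?s Q) i j + ?s P' i j)"
      unfolding pt_def
      by (subst rd) (use htr[OF psd_on_scale[OF psd(1) t]] psd_on_herm[OF psd(1)] psd_on_herm[OF psd(2)] psd_on_herm[OF psd(3)] in auto)
    also have "(\<lambda>i j. ptrace1 m (?s Q) i j + ?s P' i j) = (\<lambda>i j. of_real t * ptrace1 m Q i j + ?s P' i j)"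
      by (simp add: ptrace1_def sum_distrib_left)
    finally show ?thesis
      by (simp add: r_def kpair_add kpair_diff kpair_scale algebra_simps)
  qed
  \<comment> \<open>C is a cone, so the functional is nonpositive on it. Testing P gives W \<ge> 0,
    testing P' gives V \<le> 0, and testing Q gives W + 1 \<otimes> V \<le> 0; with \<Omega> = - V
    this is 0 \<le> W \<le> 1 \<otimes> \<Omega>.\<close>
  have r_le: "r Q P P' \<le> 0" if "psd_on S Q" "psd_on S P" "psd_on {..<n} P'" for Q P P'
  proof (rule nonpos_if_multiples_bounded)
    show "t * r Q P P' \<le> rdot I w z - \<beta>" if "0 \<le> t" for t
      using ineq[OF that \<open>psd_on S Q\<close> \<open>psd_on S P\<close> \<open>psd_on {..<n} P'\<close>] by simp
  qed
  have k0: "kpair A B (\<lambda>x y. 0) = 0" for A :: "'x set" and B by (simp add: kpair_def)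
  have pt0: "ptrace1 m (\<lambda>x y. 0) = (\<lambda>i j. 0)" by (simp add: ptrace1_def fun_eq_iff)
  define qW where "qW v = Re (\<Sum>x\<in>S. \<Sum>y\<in>S. cnj (v x) * W x y * v y)" for v
  define qV where "qV v = Re (\<Sum>x<n. \<Sum>y<n. cnj (v x) * V x y * v y)" for v
  have kW: "kpair S W (\<lambda>x y. v x * cnj (v y)) = qW v" for v
    unfolding qW_def by (rule kpair_rank_one) (rule hW)
  have kV: "kpair {..<n} V (\<lambda>x y. v x * cnj (v y)) = qV v" for v
    unfolding qV_def by (rule kpair_rank_one) (rule hV)
  have qW0: "0 \<le> qW v" for v
    using r_le[OF psd_on_zero psd_on_rank_one[of S v] psd_on_zero] by (simp add: r_def kW k0 pt0)
  have qV0: "qV v \<le> 0" for v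
    using r_le[OF psd_on_zero psd_on_zero psd_on_rank_one[of "{..<n}" v]] by (simp add: r_def kV k0 pt0)
  have qWV: "qW v + (\<Sum>k<m. qV (\<lambda>i. v (k,i))) \<le> 0" for v
  proof -
    have "kpair {..<n} V (ptrace1 m (\<lambda>x y. v x * cnj (v y))) = (\<Sum>k<m. qV (\<lambda>i. v (k,i)))"
      unfolding ptrace1_def[abs_def] by (simp add: kpair_sum kV)
    then show ?thesis
      using r_le[OF psd_on_rank_one[of S v] psd_on_zero psd_on_zero] by (simp add: r_def kW k0)
  qed
  have W: "psd_on S W" unfolding psd_on_def using hW qW0 unfolding qW_def by blast
  define \<Omega> where "\<Omega> i j = - V i j" for i j
  have \<Omega>: "psd_on {..<n} \<Omega>"
    unfolding psd_on_def
  proof (intro conjI ballI allI)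
    show "\<Omega> i j = cnj (\<Omega> j i)" for i j unfolding \<Omega>_def by (subst hV) simp
    fix v
    have "(\<Sum>i<n. \<Sum>j<n. cnj (v i) * \<Omega> i j * v j) = - (\<Sum>i<n. \<Sum>j<n. cnj (v i) * V i j * v j)"
      by (simp add: \<Omega>_def sum_negf)
    then show "0 \<le> Re (\<Sum>i<n. \<Sum>j<n. cnj (v i) * \<Omega> i j * v j)"
      using qV0[of v] unfolding qV_def by (simp only: uminus_complex.sel neg_0_le_iff_le)
  qed
  have le: "psd_on S (\<lambda>x y. (if fst x = fst y then \<Omega> (snd x) (snd y) else 0) - W x y)"
    unfolding psd_on_def
  proof (intro conjI ballI allI)
    show "(if fst x = fst y then \<Omega> (snd x) (snd y) else 0) - W x y = cnj ((if fst y = fst x then \<Omega> (snd y) (snd x) else 0) - W y x)" for x y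
      using hW[of x y] hV[of "snd x" "snd y"] by (simp add: \<Omega>_def)
    fix v
    have "(\<Sum>x\<in>S. \<Sum>y\<in>S. cnj (v x) * ((if fst x = fst y then \<Omega> (snd x) (snd y) else 0) - W x y) * v y)
        = (\<Sum>x\<in>S. \<Sum>y\<in>S. if fst x = fst y then cnj (v x) * \<Omega> (snd x) (snd y) * v y else 0) - (\<Sum>x\<in>S. \<Sum>y\<in>S. cnj (v x) * W x y * v y)"
      unfolding sum_subtractf[symmetric] by (intro sum.cong refl) (auto simp: algebra_simps)
    moreover have "(\<Sum>x\<in>S. \<Sum>y\<in>S. if fst x = fst y then cnj (v x) * \<Omega> (snd x) (snd y) * v y else 0)
        = (\<Sum>k<m. - (\<Sum>i<n. \<Sum>j<n. cnj (v (k,i)) * V i j * v (k,j)))"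
    proof -
      have p: "(\<Sum>x\<in>S. G x) = (\<Sum>k<m. \<Sum>i<n. G (k,i))" for G :: "nat \<times> nat \<Rightarrow> complex"
        by (simp add: S_def sum.cartesian_product)
      have "(\<Sum>x\<in>S. \<Sum>y\<in>S. if fst x = fst y then cnj (v x) * \<Omega> (snd x) (snd y) * v y else 0)
          = (\<Sum>k<m. \<Sum>i<n. \<Sum>l<m. if l = k then \<Sum>j<n. cnj (v (k,i)) * \<Omega> i j * v (l,j) else 0)"
        unfolding p by (intro sum.cong refl) auto
      also have "\<dots> = (\<Sum>k<m. \<Sum>i<n. \<Sum>j<n. cnj (v (k,i)) * \<Omega> i j * v (k,j))"
        by (intro sum.cong[OF refl]) simp
      finally show ?thesis by (simp add: \<Omega>_def sum_negf)
    qed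
    ultimately have "Re (\<Sum>x\<in>S. \<Sum>y\<in>S. cnj (v x) * ((if fst x = fst y then \<Omega> (snd x) (snd y) else 0) - W x y) * v y)
        = (\<Sum>k<m. - qV (\<lambda>i. v (k,i))) - qW v"
      unfolding qV_def qW_def by (simp only: minus_complex.sel uminus_complex.sel Re_sum)
    then show "0 \<le> Re (\<Sum>x\<in>S. \<Sum>y\<in>S. cnj (v x) * ((if fst x = fst y then \<Omega> (snd x) (snd y) else 0) - W x y) * v y)"
      using qWV[of v] by (simp only: sum_negf)
  qed
  \<comment> \<open>The separating inequality at the apex 0 of the cone.\<close>
  have gap: "c1 * (\<Sum>i<n. Re (\<Omega> i i)) + \<beta> \<le> kpair S W D"
  proof -
    have "\<beta> \<le> rdot I w z" using ineq[OF order_refl psd_on_zero psd_on_zero psd_on_zero] by simp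
    then show ?thesis unfolding zval by (simp add: \<Omega>_def sum_negf)
  qed
  \<comment> \<open>Small enough that c1 \<delta> n < \<beta>, so regularising \<Omega> does not
    consume the gap.\<close>
  define \<delta> where "\<delta> = \<beta> / (2 * c1 * n + 1)"
  have c1p: "0 < c1" using c0 c1 by linarith
  have \<delta>: "0 < \<delta>" using \<beta> c1p by (simp add: \<delta>_def add_nonneg_pos)
  have \<delta>': "c1 * (\<delta> * n) < \<beta>"
    using \<beta> c1p by (simp add: \<delta>_def divide_less_eq add_nonneg_pos algebra_simps) (smt (verit) mult_nonneg_nonneg of_nat_0_le_iff)
  have \<tau>: "0 \<le> (\<Sum>i<n. Re (\<Omega> i i)) + \<delta> * n"
  proof -
    have "Re (\<Omega> i i) \<ge> 0" if "i < n" for i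
    proof -
      have "qV (\<lambda>a. if a = i then 1 else 0) = Re (\<Sum>a<n. \<Sum>c<n. if c = i then if a = i then V a c else 0 else 0)"
        unfolding qV_def by (intro arg_cong[of _ _ Re] sum.cong refl) auto
      also have "\<dots> = Re (V i i)" using that by simp
      finally show ?thesis using qV0[of "\<lambda>a. if a = i then 1 else 0"] by (simp add: \<Omega>_def)
    qed
    then show ?thesis using \<delta> by (intro add_nonneg_nonneg sum_nonneg) auto
  qed
  have "2 * kpair S W D \<le> (2 * c0) * ((\<Sum>i<n. Re (\<Omega> i i)) + \<delta> * n)"
    using dnorm_ge_kpair[OF n ch W[unfolded S_def] \<Omega> le[unfolded S_def] \<delta>] by (simp add: S_def D_def[abs_def] c0_def)
  also have "\<dots> \<le> (2 * c1) * ((\<Sum>i<n. Re (\<Omega> i i)) + \<delta> * n)"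
    using c1 \<tau> by (intro mult_right_mono) auto
  also have "\<dots> < 2 * (c1 * (\<Sum>i<n. Re (\<Omega> i i)) + \<beta>)" using \<delta>' by (simp add: algebra_simps)
  finally have "kpair S W D < c1 * (\<Sum>i<n. Re (\<Omega> i i)) + \<beta>" by (simp only: mult_less_cancel_left_pos zero_less_numeral)
  then show False using gap by (meson leD)
qed

section \<open>Superchannels\<close>

text \<open>A superchannel next to an idle ancilla of dimension v is again of the form pre, \<Phi>,
  post: the channel acts beside an ancilla of dimension v*u, and pre and post are tensored with the
  identity on v.\<close>

lemma tid_left_apply_sc:
  assumes "\<And>X. X \<in> carrier_mat (a0*b0) (a0*b0) \<Longrightarrow> \<Phi> X \<in> carrier_mat (a1*b1) (a1*b1)"
  shows "tid_left v (a0'*b0) (a1'*b1) (apply_sc a0 a1 a0' a1' b0 b1 u pre post \<Phi>) Z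
   = tid_right (v*(u*a1)) (v*a1') b1 (tid_left v (u*a1) a1' post)
       (tid_left (v*u) (a0*b0) (a1*b1) \<Phi>
         (tid_right (v*a0') (v*(u*a0)) b0 (tid_left v a0' (u*a0) pre) Z))"
proof -
  let ?f = "tid_right a0' (u*a0) b0 pre" and ?g = "tid_left u (a0*b0) (a1*b1) \<Phi>" and ?h = "tid_right (u*a1) a1' b1 post"
  have fc: "?f X \<in> carrier_mat (u*(a0*b0)) (u*(a0*b0))" for X
    using tid_right_carrier[of a0' "u*a0" b0 pre X] by (simp add: mult.assoc)
  have 1: "tid_left v (a0'*b0) (u*(a0*b0)) ?f Z = tid_right (v*a0') (v*(u*a0)) b0 (tid_left v a0' (u*a0) pre) Z"
    using tid_left_tid_right[of v a0' b0 "u*a0" pre Z] by (simp add: mult.assoc)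
  have 2: "tid_left v (u*(a0*b0)) (u*(a1*b1)) ?g Y = tid_left (v*u) (a0*b0) (a1*b1) \<Phi> Y" for Y
    by (rule tid_left_tid_left)
  have 3: "tid_left v (u*(a1*b1)) (a1'*b1) ?h Y = tid_right (v*(u*a1)) (v*a1') b1 (tid_left v (u*a1) a1' post) Y" for Y
    using tid_left_tid_right[of v "u*a1" b1 a1' post Y] by (simp add: mult.assoc)
  have "tid_left v (a0'*b0) (a1'*b1) (apply_sc a0 a1 a0' a1' b0 b1 u pre post \<Phi>) Z
      = tid_left v (a0'*b0) (a1'*b1) (\<lambda>X. ?h (?g (?f X))) Z"
    by (simp add: apply_sc_def[abs_def])
  also have "\<dots> = tid_left v (u*(a0*b0)) (a1'*b1) (\<lambda>X. ?h (?g X)) (tid_left v (a0'*b0) (u*(a0*b0)) ?f Z)"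
    by (rule tid_left_comp[symmetric]) (rule fc)
  also have "\<dots> = tid_left v (u*(a1*b1)) (a1'*b1) ?h (tid_left v (u*(a0*b0)) (u*(a1*b1)) ?g (tid_left v (a0'*b0) (u*(a0*b0)) ?f Z))"
    by (rule tid_left_comp[symmetric]) simp
  finally show ?thesis unfolding 1 2 3 .
qed

text \<open>The outer ancilla is carried along beside the inner one, so the composite has ancilla
  dimension v*u, preprocessing pre' followed by pre, and postprocessing post followed by
  post'.\<close>

lemma superchannel_comp:
  assumes s: "superchannel a0 a1 a0' a1' u pre post" and s': "superchannel a0' a1' r0 r1 v pre' post'"
    and \<Phi>: "channel (a0*b0) (a1*b1) \<Phi>"
  shows "\<exists>u'' pre'' post''. superchannel a0 a1 r0 r1 u'' pre'' post'' \<and>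
    (\<forall>X. apply_sc a0 a1 r0 r1 b0 b1 u'' pre'' post'' \<Phi> X =
       apply_sc a0' a1' r0 r1 b0 b1 v pre' post' (apply_sc a0 a1 a0' a1' b0 b1 u pre post \<Phi>) X)"
proof (intro exI conjI allI)
  let ?pre = "\<lambda>X. tid_left v a0' (u*a0) pre (pre' X)" and ?post = "\<lambda>X. post' (tid_left v (u*a1) a1' post X)"
  note c = s[unfolded superchannel_def] s'[unfolded superchannel_def]
  have "channel r0 (v*(u*a0)) ?pre"
    using channel_comp[of r0 "v*a0'" pre', OF _ channel_tid_left[of a0' "u*a0" pre v]] c by simp
  moreover have "channel (v*(u*a1)) r1 ?post"
    using channel_comp[of "v*(u*a1)" "v*a1'" "tid_left v (u*a1) a1' post" r1 post', OF channel_tid_left[of "u*a1" a1' post v]] c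
    by simp
  ultimately show "superchannel a0 a1 r0 r1 (v*u) ?pre ?post"
    using c by (simp add: superchannel_def mult.assoc)
  fix X
  have 1: "tid_right r0 (v*(u*a0)) b0 ?pre X
      = tid_right (v*a0') (v*(u*a0)) b0 (tid_left v a0' (u*a0) pre) (tid_right r0 (v*a0') b0 pre' X)"
    by (rule tid_right_comp[symmetric]) (use c channel_carrier[of r0 "v*a0'" pre'] in blast)
  have 2: "tid_right (v*(u*a1)) r1 b1 ?post Y
      = tid_right (v*a1') r1 b1 post' (tid_right (v*(u*a1)) (v*a1') b1 (tid_left v (u*a1) a1' post) Y)" for Y
    by (rule tid_right_comp[symmetric]) simp
  show "apply_sc a0 a1 r0 r1 b0 b1 (v*u) ?pre ?post \<Phi> X =
       apply_sc a0' a1' r0 r1 b0 b1 v pre' post' (apply_sc a0 a1 a0' a1' b0 b1 u pre post \<Phi>) X"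
    unfolding apply_sc_def[of a0 a1 r0] apply_sc_def[of a0' a1' r0] mult.assoc 1 2
    by (subst tid_left_apply_sc) (simp_all add: channel_carrier[OF \<Phi>])
qed

section \<open>Identity superchannel and existence of superchannels\<close>

lemma channel_id: "channel n n (\<lambda>X. X)"
  unfolding channel_iff
proof (intro conjI ballI)
  show "cp n n (\<lambda>X. X)"
    by (rule cpI[where R = "{()}" and h = "\<lambda>_ k i. if k = i then 1 else 0"])
      (auto simp: linmap_def unitmat_def)
qed simp

lemma superchannel_id: "superchannel a0 a1 a0 a1 1 (\<lambda>X. X) (\<lambda>X. X)"
  using channel_id by (simp add: superchannel_def)

lemma tid_right_id: "X \<in> carrier_mat (n*K) (n*K) \<Longrightarrow> tid_right n n K (\<lambda>X. X) X = X"
proof (rule eq_matI)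
  fix x y assume X: "X \<in> carrier_mat (n*K) (n*K)" and xy: "x < dim_row X" "y < dim_col X"
  then have xy: "x < n*K" "y < n*K" by auto
  obtain a z where az: "a < n" "z < K" "x = a*K + z" using xy(1) by (rule less_mult_indexE)
  obtain b w where bw: "b < n" "w < K" "y = b*K + w" using xy(2) by (rule less_mult_indexE)
  show "tid_right n n K (\<lambda>X. X) X $$ (x,y) = X $$ (x,y)"
    using az bw by (simp add: tid_right_entry)
qed (auto simp: tid_right_def)

lemma tid_left_1:
  assumes "X \<in> carrier_mat n n" "f X \<in> carrier_mat m m"
  shows "tid_left 1 n m f X = f X"
proof -
  have "mat n n (\<lambda>(p,q). X $$ (p, q)) = X" using assms by (intro eq_matI) auto
  then show ?thesis using assms(2) by (intro eq_matI) (auto simp: tid_left_def)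
qed

lemma apply_sc_id:
  assumes \<Phi>: "channel (a0*b0) (a1*b1) \<Phi>" and X: "X \<in> carrier_mat (a0*b0) (a0*b0)"
  shows "apply_sc a0 a1 a0 a1 b0 b1 1 (\<lambda>X. X) (\<lambda>X. X) \<Phi> X = \<Phi> X"
  using tid_right_id[OF X] tid_right_id[OF channel_carrier[OF \<Phi> X]] tid_left_1[of X "a0*b0" \<Phi> "a1*b1", OF X channel_carrier[OF \<Phi> X]]
  by (simp add: apply_sc_def)

text \<open>Discard the input and prepare the basis state 0. Its purpose is that the suprema and
  infima range over nonempty sets.\<close>

lemma channel_exists:
  assumes m: "0 < m"
  shows "\<exists>f. channel n m f"
proof -
  define C where "C x y = (\<Sum>r<n. (if fst x = 0 \<and> snd x = r then 1 else 0) * cnj (if fst y = 0 \<and> snd y = r then 1 else (0::complex)))"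
    for x y :: "nat \<times> nat"
  have "channel n m (kmap n m C)"
  proof (rule channel_kmap)
    show "psd_on ({..<m} \<times> {..<n}) C"
      unfolding C_def
      by (rule psd_on_gram[where R = "{..<n}" and h = "\<lambda>r x. if fst x = (0::nat) \<and> snd x = r then 1 else 0"]) simp
    fix i j assume ij: "i < n" "j < n"
    have "C (k,i) (k,j) = (if k = 0 then if i = j then 1 else 0 else 0)" for k :: nat
    proof -
      have "C (k,i) (k,j) = (\<Sum>r<n. if r = i then if k = 0 \<and> i = j then 1 else 0 else 0)"
        unfolding C_def by (intro sum.cong refl) auto
      then show ?thesis using ij by simp
    qed
    then show "(\<Sum>k<m. C (k,i) (k,j)) = (if i = j then 1 else 0)" using m by simp
  qed
  then show ?thesis by blast
qed

lemma superchannel_exists: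
  assumes "0 < a0" "0 < r1"
  shows "\<exists>u pre post. superchannel a0 a1 r0 r1 u pre post"
proof -
  obtain f g where "channel r0 (1*a0) f" "channel (1*a1) r1 g"
    using channel_exists[of "1*a0" r0] channel_exists[of r1 "1*a1"] assms by auto
  then have "superchannel a0 a1 r0 r1 1 f g" by (simp add: superchannel_def)
  then show ?thesis by blast
qed

section \<open>Sums, multiples and diagonal blocks, for mixing superchannels\<close>

lemma cp_add:
  assumes "cp n m f" "cp n m g"
  shows "cp n m (\<lambda>X. f X + g X)"
proof -
  have d: "dim_row (f X) = m" "dim_col (f X) = m" "dim_row (g X) = m" "dim_col (g X) = m"
    if "X \<in> carrier_mat n n" for X
    using linmap_carrier[OF cp_linmap[OF assms(1)] that] linmap_carrier[OF cp_linmap[OF assms(2)] that] by auto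
  have lin: "linmap n m (\<lambda>X. f X + g X)"
    unfolding linmap_def
  proof (intro conjI ballI allI)
    fix X :: "complex mat" assume X: "X \<in> carrier_mat n n"
    show "f X + g X \<in> carrier_mat m m" using d[OF X] by auto
    show "f (c \<cdot>\<^sub>m X) + g (c \<cdot>\<^sub>m X) = c \<cdot>\<^sub>m (f X + g X)" for c
    proof -
      have e: "f (c \<cdot>\<^sub>m X) = c \<cdot>\<^sub>m f X" "g (c \<cdot>\<^sub>m X) = c \<cdot>\<^sub>m g X"
        using assms X unfolding cp_def linmap_def by blast+
      show ?thesis unfolding e by (rule eq_matI) (simp_all add: d[OF X] distrib_left)
    qed
    fix Y :: "complex mat" assume Y: "Y \<in> carrier_mat n n"
    have e: "f (X + Y) = f X + f Y" "g (X + Y) = g X + g Y" using assms X Y unfolding cp_def linmap_def by blast+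
    show "f (X + Y) + g (X + Y) = f X + g X + (f Y + g Y)"
      unfolding e by (rule eq_matI) (simp_all add: d[OF X] d[OF Y])
  qed
  have "psd_on ({..<m} \<times> {..<n}) (\<lambda>x y. ckern n f x y + ckern n g x y)"
    using assms cp_iff_ckern[OF cp_linmap[OF assms(1)]] cp_iff_ckern[OF cp_linmap[OF assms(2)]]
    by (intro psd_on_add) auto
  moreover have "psd_on ({..<m} \<times> {..<n}) (ckern n (\<lambda>X. f X + g X)) \<longleftrightarrow> psd_on ({..<m} \<times> {..<n}) (\<lambda>x y. ckern n f x y + ckern n g x y)"
    by (rule psd_on_cong) (auto simp: ckern_def d)
  ultimately show ?thesis using cp_iff_ckern[OF lin] by blast
qed

lemma cp_scale:
  assumes "cp n m f" "0 \<le> c"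
  shows "cp n m (\<lambda>X. of_real c \<cdot>\<^sub>m f X)"
proof -
  have d: "dim_row (f X) = m" "dim_col (f X) = m" if "X \<in> carrier_mat n n" for X
    using linmap_carrier[OF cp_linmap[OF assms(1)] that] by auto
  have lin: "linmap n m (\<lambda>X. of_real c \<cdot>\<^sub>m f X)"
    unfolding linmap_def
  proof (intro conjI ballI allI)
    fix X :: "complex mat" assume X: "X \<in> carrier_mat n n"
    show "of_real c \<cdot>\<^sub>m f X \<in> carrier_mat m m" using d[OF X] by auto
    show "of_real c \<cdot>\<^sub>m f (a \<cdot>\<^sub>m X) = a \<cdot>\<^sub>m (of_real c \<cdot>\<^sub>m f X)" for a
    proof -
      have e: "f (a \<cdot>\<^sub>m X) = a \<cdot>\<^sub>m f X" using assms X unfolding cp_def linmap_def by blast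
      show ?thesis unfolding e by (rule eq_matI) (simp_all add: d[OF X])
    qed
    fix Y :: "complex mat" assume Y: "Y \<in> carrier_mat n n"
    have e: "f (X + Y) = f X + f Y" using assms X Y unfolding cp_def linmap_def by blast
    show "of_real c \<cdot>\<^sub>m f (X + Y) = of_real c \<cdot>\<^sub>m f X + of_real c \<cdot>\<^sub>m f Y"
      unfolding e by (rule eq_matI) (simp_all add: d[OF X] d[OF Y] distrib_left)
  qed
  have "psd_on ({..<m} \<times> {..<n}) (\<lambda>x y. of_real c * ckern n f x y)"
    using assms cp_iff_ckern[OF cp_linmap[OF assms(1)]] by (intro psd_on_scale) auto
  moreover have "psd_on ({..<m} \<times> {..<n}) (ckern n (\<lambda>X. of_real c \<cdot>\<^sub>m f X)) \<longleftrightarrow> psd_on ({..<m} \<times> {..<n}) (\<lambda>x y. of_real c * ckern n f x y)"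
    by (rule psd_on_cong) (auto simp: ckern_def d)
  ultimately show ?thesis using cp_iff_ckern[OF lin] by blast
qed

text \<open>Inclusion of a diagonal block at offset \<open>off\<close>; with
  \<open>sub_block\<close> it realises the direct sum of two ancilla spaces.\<close>

definition emb_block :: "nat \<Rightarrow> nat \<Rightarrow> nat \<Rightarrow> complex mat \<Rightarrow> complex mat" where
  "emb_block off n N X = mat N N (\<lambda>(i,j). if off \<le> i \<and> i < off + n \<and> off \<le> j \<and> j < off + n then X $$ (i - off, j - off) else 0)"

definition sub_block :: "nat \<Rightarrow> nat \<Rightarrow> complex mat \<Rightarrow> complex mat" where
  "sub_block off n X = mat n n (\<lambda>(i,j). X $$ (off + i, off + j))"

lemma cp_emb_block: "cp n N (emb_block off n N)"
proof (rule cpI[where R = "{()}" and h = "\<lambda>_ k i. if k = off + i then 1 else 0"])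
  show "linmap n N (emb_block off n N)"
    unfolding linmap_def
  proof (intro conjI ballI allI)
    fix X :: "complex mat" assume X: "X \<in> carrier_mat n n"
    show "emb_block off n N X \<in> carrier_mat N N" by (simp add: emb_block_def)
    show "emb_block off n N (X + Y) = emb_block off n N X + emb_block off n N Y" if "Y \<in> carrier_mat n n" for Y
      using X that by (intro eq_matI) (auto simp: emb_block_def)
    show "emb_block off n N (c \<cdot>\<^sub>m X) = c \<cdot>\<^sub>m emb_block off n N X" for c
      using X by (intro eq_matI) (auto simp: emb_block_def)
  qed
qed (auto simp: emb_block_def unitmat_def)

lemma trace_emb_block:
  assumes "X \<in> carrier_mat n n" "off + n \<le> N"
  shows "trace (emb_block off n N X) = trace X"
proof -
  have "trace (emb_block off n N X) = (\<Sum>i<N. if off \<le> i \<and> i < off + n then X $$ (i - off, i - off) else 0)"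
    unfolding trace_def by (auto simp: emb_block_def intro!: sum.cong)
  also have "\<dots> = (\<Sum>i\<in>{off..<off+n}. X $$ (i - off, i - off))"
    using assms(2) by (intro sum.mono_neutral_cong_right) auto
  also have "\<dots> = (\<Sum>i<n. X $$ (i,i))"
    by (rule sum.reindex_bij_witness[where i = "\<lambda>i. off + i" and j = "\<lambda>i. i - off"]) auto
  finally show ?thesis using assms(1) by (simp add: trace_def)
qed

lemma cp_sub_block:
  assumes "off + n \<le> N"
  shows "cp N n (sub_block off n)"
proof (rule cpI[where R = "{()}" and h = "\<lambda>_ k i. if i = off + k then 1 else 0"])
  show "linmap N n (sub_block off n)"
    unfolding linmap_def
  proof (intro conjI ballI allI)
    fix X :: "complex mat" assume X: "X \<in> carrier_mat N N"
    show "sub_block off n X \<in> carrier_mat n n" by (simp add: sub_block_def)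
    show "sub_block off n (X + Y) = sub_block off n X + sub_block off n Y" if "Y \<in> carrier_mat N N" for Y
      using X that assms by (intro eq_matI) (auto simp: sub_block_def)
    show "sub_block off n (c \<cdot>\<^sub>m X) = c \<cdot>\<^sub>m sub_block off n X" for c
      using X assms by (intro eq_matI) (auto simp: sub_block_def)
  qed
qed (use assms in \<open>auto simp: sub_block_def unitmat_def\<close>)

text \<open>Convex combinations of superchannels: the ancilla spaces are added, and the preprocessing prepares the
  block in which the postprocessing then acts.\<close>
lemma superchannel_convex:
  assumes s1: "superchannel a0 a1 r0 r1 u1 pre1 post1" and s2: "superchannel a0 a1 r0 r1 u2 pre2 post2"
    and \<Phi>: "channel (a0*b0) (a1*b1) \<Phi>" and t: "0 \<le> t" "t \<le> 1"
  shows "\<exists>u pre post. superchannel a0 a1 r0 r1 u pre post \<and>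
    (\<forall>X\<in>carrier_mat (r0*b0) (r0*b0). \<forall>k<r1*b1. \<forall>l<r1*b1. apply_sc a0 a1 r0 r1 b0 b1 u pre post \<Phi> X $$ (k,l) =
       of_real (1 - t) * apply_sc a0 a1 r0 r1 b0 b1 u1 pre1 post1 \<Phi> X $$ (k,l)
       + of_real t * apply_sc a0 a1 r0 r1 b0 b1 u2 pre2 post2 \<Phi> X $$ (k,l))"
proof -
  note c1 = s1[unfolded superchannel_def] note c2 = s2[unfolded superchannel_def]
  define u where "u = u1 + u2"
  have u: "0 < u" using c1 by (simp add: u_def)
  \<comment> \<open>The ancilla is the major index, so the levels of the second superchannel fill
    one contiguous range, starting at u1*a0 before the channel and at u1*a1 after it.\<close>
  define off0 where "off0 = u1*a0"
  define off1 where "off1 = u1*a1"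
  have ua0: "u*a0 = off0 + u2*a0" and ua1: "u*a1 = off1 + u2*a1"
    by (auto simp: u_def off0_def off1_def add_mult_distrib)
  define pre where "pre X = of_real (1 - t) \<cdot>\<^sub>m emb_block 0 (u1*a0) (u*a0) (pre1 X)
      + of_real t \<cdot>\<^sub>m emb_block off0 (u2*a0) (u*a0) (pre2 X)" for X
  define post where "post Y = post1 (sub_block 0 (u1*a1) Y) + post2 (sub_block off1 (u2*a1) Y)" for Y
  have pc1: "pre1 X \<in> carrier_mat (u1*a0) (u1*a0)" and pc2: "pre2 X \<in> carrier_mat (u2*a0) (u2*a0)"
    if "X \<in> carrier_mat r0 r0" for X using c1 c2 that by (auto intro: channel_carrier)
  have "channel r0 (u*a0) pre"
    unfolding channel_iff
  proof (intro conjI ballI)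
    show "cp r0 (u*a0) pre"
      unfolding pre_def using c1 c2 t
      by (intro cp_add cp_scale cp_comp[OF channel_cp cp_emb_block]) auto
    fix X :: "complex mat" assume X: "X \<in> carrier_mat r0 r0"
    have e: "emb_block a b (u*a0) Y \<in> carrier_mat (u*a0) (u*a0)" for a b Y by (simp add: emb_block_def)
    have "trace (pre X) = of_real (1 - t) * trace (pre1 X) + of_real t * trace (pre2 X)"
      unfolding pre_def trace_add[OF smult_carrier_mat[OF e] smult_carrier_mat[OF e]] trace_smult[OF e]
      using pc1[OF X] pc2[OF X] ua0 by (simp add: trace_emb_block off0_def)
    also have "\<dots> = trace X"
      using c1 c2 X by (simp add: channel_trace[of r0 "u1*a0" pre1] channel_trace[of r0 "u2*a0" pre2] algebra_simps)
    finally show "trace (pre X) = trace X" .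
  qed
  moreover have "channel (u*a1) r1 post"
    unfolding channel_iff
  proof (intro conjI ballI)
    show "cp (u*a1) r1 post"
      unfolding post_def using c1 c2 ua1
      by (intro cp_add cp_comp[OF cp_sub_block channel_cp]) (auto simp: off1_def)
    fix Y :: "complex mat" assume Y: "Y \<in> carrier_mat (u*a1) (u*a1)"
    have sc: "sub_block a b Y \<in> carrier_mat b b" for a b by (simp add: sub_block_def)
    have c: "post1 (sub_block 0 (u1*a1) Y) \<in> carrier_mat r1 r1" "post2 (sub_block off1 (u2*a1) Y) \<in> carrier_mat r1 r1"
      using c1 c2 sc by (auto intro: channel_carrier)
    have "trace (post Y) = trace (sub_block 0 (u1*a1) Y) + trace (sub_block off1 (u2*a1) Y)"
      unfolding post_def trace_add[OF c]
      using c1 c2 sc by (simp add: channel_trace[of "u1*a1" r1 post1] channel_trace[of "u2*a1" r1 post2])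
    also have "\<dots> = (\<Sum>i<off1. Y $$ (i,i)) + (\<Sum>i<u2*a1. Y $$ (off1+i,off1+i))"
      by (simp add: trace_def sub_block_def off1_def)
    also have "\<dots> = (\<Sum>i<off1 + u2*a1. Y $$ (i,i))"
    proof -
      have "(\<Sum>i<u2*a1. Y $$ (off1+i,off1+i)) = (\<Sum>i\<in>{off1..<off1+u2*a1}. Y $$ (i,i))"
        by (rule sum.reindex_bij_witness[where i = "\<lambda>i. i - off1" and j = "\<lambda>i. off1 + i"]) auto
      moreover have "{..<off1 + u2*a1} = {..<off1} \<union> {off1..<off1+u2*a1}" by auto
      ultimately show ?thesis by (simp add: sum.union_disjoint[symmetric] ivl_disj_int)
    qed
    also have "\<dots> = trace Y" using Y ua1 by (simp add: trace_def)
    finally show "trace (post Y) = trace Y" .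
  qed
  moreover have "apply_sc a0 a1 r0 r1 b0 b1 u pre post \<Phi> X $$ (k,l) =
       of_real (1 - t) * apply_sc a0 a1 r0 r1 b0 b1 u1 pre1 post1 \<Phi> X $$ (k,l)
       + of_real t * apply_sc a0 a1 r0 r1 b0 b1 u2 pre2 post2 \<Phi> X $$ (k,l)"
    if kl: "k < r1*b1" "l < r1*b1" for X k l
  proof -
    define Z where "Z = tid_right r0 (u*a0) b0 pre X"
    define Z1 where "Z1 = tid_right r0 (u1*a0) b0 pre1 X"
    define Z2 where "Z2 = tid_right r0 (u2*a0) b0 pre2 X"
    define M where "M = tid_left u (a0*b0) (a1*b1) \<Phi> Z"
    define M1 where "M1 = tid_left u1 (a0*b0) (a1*b1) \<Phi> Z1"
    define M2 where "M2 = tid_left u2 (a0*b0) (a1*b1) \<Phi> Z2"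
    have shift: "a*c + b < n*c" if "a < n" "b < c" for a b c n :: nat using that by (rule pair_index_less)
    \<comment> \<open>\<open>post\<close> reads only the two diagonal blocks, so Z and then M are
      followed there only.\<close>
    have Z1e: "Z $$ (\<upsilon>*(a0*b0) + p, \<upsilon>'*(a0*b0) + q) = of_real (1 - t) * Z1 $$ (\<upsilon>*(a0*b0) + p, \<upsilon>'*(a0*b0) + q)"
      if b: "\<upsilon> < u1" "\<upsilon>' < u1" "p < a0*b0" "q < a0*b0" for \<upsilon> \<upsilon>' p q
    proof -
      obtain p1 p2 where p: "p1 < a0" "p2 < b0" "p = p1*b0 + p2" using b(3) by (rule less_mult_indexE)
      obtain q1 q2 where q: "q1 < a0" "q2 < b0" "q = q1*b0 + q2" using b(4) by (rule less_mult_indexE)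
      let ?B = "mat r0 r0 (\<lambda>(i,j). X $$ (i*b0 + p2, j*b0 + q2))"
      have i: "\<upsilon>*a0 + p1 < u1*a0" "\<upsilon>'*a0 + q1 < u1*a0" using b p q by (auto intro: shift)
      have ip: "\<upsilon>*(a0*b0) + p = (\<upsilon>*a0 + p1)*b0 + p2" "\<upsilon>'*(a0*b0) + q = (\<upsilon>'*a0 + q1)*b0 + q2"
        using p q by (auto simp: algebra_simps)
      have "Z $$ (\<upsilon>*(a0*b0) + p, \<upsilon>'*(a0*b0) + q) = pre ?B $$ (\<upsilon>*a0 + p1, \<upsilon>'*a0 + q1)"
        unfolding ip Z_def using i p q ua0 by (intro tid_right_entry) (auto simp: off0_def)
      also have "\<dots> = of_real (1 - t) * pre1 ?B $$ (\<upsilon>*a0 + p1, \<upsilon>'*a0 + q1)"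
        using i ua0 by (simp add: pre_def emb_block_def off0_def)
      also have "pre1 ?B $$ (\<upsilon>*a0 + p1, \<upsilon>'*a0 + q1) = Z1 $$ (\<upsilon>*(a0*b0) + p, \<upsilon>'*(a0*b0) + q)"
        unfolding ip Z1_def using i p q by (intro tid_right_entry[symmetric])
      finally show ?thesis .
    qed
    have Z2e: "Z $$ ((u1+\<upsilon>)*(a0*b0) + p, (u1+\<upsilon>')*(a0*b0) + q) = of_real t * Z2 $$ (\<upsilon>*(a0*b0) + p, \<upsilon>'*(a0*b0) + q)"
      if b: "\<upsilon> < u2" "\<upsilon>' < u2" "p < a0*b0" "q < a0*b0" for \<upsilon> \<upsilon>' p q
    proof -
      obtain p1 p2 where p: "p1 < a0" "p2 < b0" "p = p1*b0 + p2" using b(3) by (rule less_mult_indexE)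
      obtain q1 q2 where q: "q1 < a0" "q2 < b0" "q = q1*b0 + q2" using b(4) by (rule less_mult_indexE)
      let ?B = "mat r0 r0 (\<lambda>(i,j). X $$ (i*b0 + p2, j*b0 + q2))"
      have i: "\<upsilon>*a0 + p1 < u2*a0" "\<upsilon>'*a0 + q1 < u2*a0" using b p q by (auto intro: shift)
      have ip: "\<upsilon>*(a0*b0) + p = (\<upsilon>*a0 + p1)*b0 + p2" "\<upsilon>'*(a0*b0) + q = (\<upsilon>'*a0 + q1)*b0 + q2"
        using p q by (auto simp: algebra_simps)
      have ip': "(u1+\<upsilon>)*(a0*b0) + p = (off0 + (\<upsilon>*a0 + p1))*b0 + p2" "(u1+\<upsilon>')*(a0*b0) + q = (off0 + (\<upsilon>'*a0 + q1))*b0 + q2"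
        using p q by (auto simp: algebra_simps off0_def)
      have "Z $$ ((u1+\<upsilon>)*(a0*b0) + p, (u1+\<upsilon>')*(a0*b0) + q) = pre ?B $$ (off0 + (\<upsilon>*a0 + p1), off0 + (\<upsilon>'*a0 + q1))"
        unfolding ip' Z_def using i p q ua0 by (intro tid_right_entry) auto
      also have "\<dots> = of_real t * pre2 ?B $$ (\<upsilon>*a0 + p1, \<upsilon>'*a0 + q1)"
        using i ua0 by (simp add: pre_def emb_block_def off0_def)
      also have "pre2 ?B $$ (\<upsilon>*a0 + p1, \<upsilon>'*a0 + q1) = Z2 $$ (\<upsilon>*(a0*b0) + p, \<upsilon>'*(a0*b0) + q)"
        unfolding ip Z2_def using i p q by (intro tid_right_entry[symmetric])
      finally show ?thesis .
    qed
    have scale: "\<Phi> (mat (a0*b0) (a0*b0) (\<lambda>(p,q). s * F p q)) $$ (a,b) = s * \<Phi> (mat (a0*b0) (a0*b0) (\<lambda>(p,q). F p q)) $$ (a,b)"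
      if "a < a1*b1" "b < a1*b1" for s F a b
    proof -
      have "mat (a0*b0) (a0*b0) (\<lambda>(p,q). s * F p q) = s \<cdot>\<^sub>m mat (a0*b0) (a0*b0) (\<lambda>(p,q). F p q)"
        by (intro eq_matI) auto
      then have "\<Phi> (mat (a0*b0) (a0*b0) (\<lambda>(p,q). s * F p q)) = s \<cdot>\<^sub>m \<Phi> (mat (a0*b0) (a0*b0) (\<lambda>(p,q). F p q))"
        using \<Phi> unfolding channel_def by simp
      then show ?thesis
        using that channel_carrier[OF \<Phi>, of "mat (a0*b0) (a0*b0) (\<lambda>(p,q). F p q)"] by simp
    qed
    have M1e: "M $$ (i, j) = of_real (1 - t) * M1 $$ (i, j)" if ij: "i < off1*b1" "j < off1*b1" for i j
    proof -
      have lt: "i < u1*(a1*b1)" "j < u1*(a1*b1)" using ij by (auto simp: off1_def mult.assoc)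
      obtain \<upsilon> a where i: "\<upsilon> < u1" "a < a1*b1" "i = \<upsilon>*(a1*b1) + a" using lt(1) by (rule less_mult_indexE)
      obtain \<upsilon>' b where j: "\<upsilon>' < u1" "b < a1*b1" "j = \<upsilon>'*(a1*b1) + b" using lt(2) by (rule less_mult_indexE)
      have "M $$ (i,j) = \<Phi> (mat (a0*b0) (a0*b0) (\<lambda>(p,q). Z $$ (\<upsilon>*(a0*b0)+p, \<upsilon>'*(a0*b0)+q))) $$ (a,b)"
        unfolding M_def i j using i j by (intro tid_left_entry) (auto simp: u_def)
      also have "mat (a0*b0) (a0*b0) (\<lambda>(p,q). Z $$ (\<upsilon>*(a0*b0)+p, \<upsilon>'*(a0*b0)+q))
          = mat (a0*b0) (a0*b0) (\<lambda>(p,q). of_real (1 - t) * Z1 $$ (\<upsilon>*(a0*b0)+p, \<upsilon>'*(a0*b0)+q))"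
        using i j by (intro eq_matI) (auto simp: Z1e)
      also have "\<Phi> \<dots> $$ (a,b) = of_real (1 - t) * \<Phi> (mat (a0*b0) (a0*b0) (\<lambda>(p,q). Z1 $$ (\<upsilon>*(a0*b0)+p, \<upsilon>'*(a0*b0)+q))) $$ (a,b)"
        by (rule scale[OF i(2) j(2)])
      also have "\<Phi> (mat (a0*b0) (a0*b0) (\<lambda>(p,q). Z1 $$ (\<upsilon>*(a0*b0)+p, \<upsilon>'*(a0*b0)+q))) $$ (a,b) = M1 $$ (i,j)"
        unfolding M1_def i(3) j(3) using i j by (intro tid_left_entry[symmetric])
      finally show ?thesis .
    qed
    have M2e: "M $$ (off1*b1 + i, off1*b1 + j) = of_real t * M2 $$ (i, j)" if ij: "i < (u2*a1)*b1" "j < (u2*a1)*b1" for i j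
    proof -
      have lt: "i < u2*(a1*b1)" "j < u2*(a1*b1)" using ij by (auto simp: mult.assoc)
      obtain \<upsilon> a where i: "\<upsilon> < u2" "a < a1*b1" "i = \<upsilon>*(a1*b1) + a" using lt(1) by (rule less_mult_indexE)
      obtain \<upsilon>' b where j: "\<upsilon>' < u2" "b < a1*b1" "j = \<upsilon>'*(a1*b1) + b" using lt(2) by (rule less_mult_indexE)
      have ij': "off1*b1 + i = (u1+\<upsilon>)*(a1*b1) + a" "off1*b1 + j = (u1+\<upsilon>')*(a1*b1) + b"
        using i j by (auto simp: off1_def algebra_simps)
      have "M $$ (off1*b1 + i, off1*b1 + j) = \<Phi> (mat (a0*b0) (a0*b0) (\<lambda>(p,q). Z $$ ((u1+\<upsilon>)*(a0*b0)+p, (u1+\<upsilon>')*(a0*b0)+q))) $$ (a,b)"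
        unfolding M_def ij' using i j by (intro tid_left_entry) (auto simp: u_def)
      also have "mat (a0*b0) (a0*b0) (\<lambda>(p,q). Z $$ ((u1+\<upsilon>)*(a0*b0)+p, (u1+\<upsilon>')*(a0*b0)+q))
          = mat (a0*b0) (a0*b0) (\<lambda>(p,q). of_real t * Z2 $$ (\<upsilon>*(a0*b0)+p, \<upsilon>'*(a0*b0)+q))"
        using i j by (intro eq_matI) (auto simp: Z2e)
      also have "\<Phi> \<dots> $$ (a,b) = of_real t * \<Phi> (mat (a0*b0) (a0*b0) (\<lambda>(p,q). Z2 $$ (\<upsilon>*(a0*b0)+p, \<upsilon>'*(a0*b0)+q))) $$ (a,b)"
        by (rule scale[OF i(2) j(2)])
      also have "\<Phi> (mat (a0*b0) (a0*b0) (\<lambda>(p,q). Z2 $$ (\<upsilon>*(a0*b0)+p, \<upsilon>'*(a0*b0)+q))) $$ (a,b) = M2 $$ (i,j)"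
        unfolding M2_def i(3) j(3) using i j by (intro tid_left_entry[symmetric])
      finally show ?thesis .
    qed
    obtain a y where a: "a < r1" "y < b1" "k = a*b1 + y" using kl(1) by (rule less_mult_indexE)
    obtain b y' where b: "b < r1" "y' < b1" "l = b*b1 + y'" using kl(2) by (rule less_mult_indexE)
    define B where "B = mat (u*a1) (u*a1) (\<lambda>(p,q). M $$ (p*b1 + y, q*b1 + y'))"
    define B1 where "B1 = mat (u1*a1) (u1*a1) (\<lambda>(p,q). M1 $$ (p*b1 + y, q*b1 + y'))"
    define B2 where "B2 = mat (u2*a1) (u2*a1) (\<lambda>(p,q). M2 $$ (p*b1 + y, q*b1 + y'))"
    have sB1: "sub_block 0 (u1*a1) B = of_real (1 - t) \<cdot>\<^sub>m B1"
      using a b ua1 by (intro eq_matI) (auto simp: sub_block_def B_def B1_def M1e off1_def pair_index_less)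
    have sB2: "sub_block off1 (u2*a1) B = of_real t \<cdot>\<^sub>m B2"
    proof (rule eq_matI)
      fix p q assume "p < dim_row (of_real t \<cdot>\<^sub>m B2)" "q < dim_col (of_real t \<cdot>\<^sub>m B2)"
      then have pq: "p < u2*a1" "q < u2*a1" by (auto simp: B2_def)
      have e: "(off1 + p)*b1 + y = off1*b1 + (p*b1 + y)" "(off1 + q)*b1 + y' = off1*b1 + (q*b1 + y')"
        by (auto simp: algebra_simps)
      have "sub_block off1 (u2*a1) B $$ (p,q) = M $$ (off1*b1 + (p*b1 + y), off1*b1 + (q*b1 + y'))"
        unfolding e[symmetric] using pq ua1 by (simp add: sub_block_def B_def)
      also have "\<dots> = of_real t * M2 $$ (p*b1 + y, q*b1 + y')"
        using pq a b by (intro M2e pair_index_less)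
      finally show "sub_block off1 (u2*a1) B $$ (p,q) = (of_real t \<cdot>\<^sub>m B2) $$ (p,q)" using pq by (simp add: B2_def)
    qed (auto simp: sub_block_def B2_def)
    have p1: "post1 (of_real (1 - t) \<cdot>\<^sub>m B1) = of_real (1 - t) \<cdot>\<^sub>m post1 B1"
      and p2: "post2 (of_real t \<cdot>\<^sub>m B2) = of_real t \<cdot>\<^sub>m post2 B2"
      using c1 c2 unfolding channel_def by (auto simp: B1_def B2_def)
    have pc: "post1 B1 \<in> carrier_mat r1 r1" "post2 B2 \<in> carrier_mat r1 r1"
      using c1 c2 channel_carrier[of "u1*a1" r1 post1 B1] channel_carrier[of "u2*a1" r1 post2 B2] by (auto simp: B1_def B2_def)
    have "apply_sc a0 a1 r0 r1 b0 b1 u pre post \<Phi> X $$ (k,l) = post B $$ (a,b)"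
      unfolding apply_sc_def Z_def[symmetric] M_def[symmetric] B_def a(3) b(3) using a b by (intro tid_right_entry)
    also have "\<dots> = of_real (1 - t) * post1 B1 $$ (a,b) + of_real t * post2 B2 $$ (a,b)"
      unfolding post_def sB1 sB2 p1 p2 using pc a b by simp
    also have "post1 B1 $$ (a,b) = apply_sc a0 a1 r0 r1 b0 b1 u1 pre1 post1 \<Phi> X $$ (k,l)"
      unfolding apply_sc_def Z1_def[symmetric] M1_def[symmetric] B1_def a(3) b(3) using a b by (intro tid_right_entry[symmetric])
    also have "post2 B2 $$ (a,b) = apply_sc a0 a1 r0 r1 b0 b1 u2 pre2 post2 \<Phi> X $$ (k,l)"
      unfolding apply_sc_def Z2_def[symmetric] M2_def[symmetric] B2_def a(3) b(3) using a b by (intro tid_right_entry[symmetric])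
    finally show ?thesis .
  qed
  ultimately show ?thesis using u unfolding superchannel_def by blast
qed

section \<open>The pairing condition\<close>

lemma psd_on_entry_bound:
  assumes fin: "finite S" and psd: "psd_on S K" and xy: "x \<in> S" "y \<in> S"
  shows "cmod (K x y) \<le> (Re (K x x) + Re (K y y)) / 2"
proof -
  obtain h where h: "\<forall>i\<in>S. \<forall>j\<in>S. K i j = (\<Sum>r\<in>S. h r i * cnj (h r j))"
    using psd_on_decomp[OF fin psd] by blast
  have d: "Re (K i i) = (\<Sum>r\<in>S. (cmod (h r i))\<^sup>2)" if "i \<in> S" for i
    using h that by (simp add: cmod_power2) (simp add: power2_eq_square)
  have "cmod (K x y) \<le> (\<Sum>r\<in>S. cmod (h r x) * cmod (h r y))"
    using h xy by (auto intro!: order.trans[OF norm_sum] simp: norm_mult)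
  also have "\<dots> \<le> (\<Sum>r\<in>S. ((cmod (h r x))\<^sup>2 + (cmod (h r y))\<^sup>2) / 2)"
  proof (rule sum_mono)
    fix r show "cmod (h r x) * cmod (h r y) \<le> ((cmod (h r x))\<^sup>2 + (cmod (h r y))\<^sup>2) / 2"
      using sum_squares_bound[of "cmod (h r x)" "cmod (h r y)"] by simp
  qed
  also have "\<dots> = (Re (K x x) + Re (K y y)) / 2"
    unfolding d[OF xy(1)] d[OF xy(2)] sum.distrib[symmetric] sum_divide_distrib ..
  finally show ?thesis .
qed

text \<open>Diagonal entries are nonnegative and sum to 1 over the output, and the diagonal bounds
  the rest. This makes all suprema of pairings finite.\<close>

lemma channel_ckern_le:
  assumes "channel n m f" and xy: "x \<in> {..<m} \<times> {..<n}" "y \<in> {..<m} \<times> {..<n}"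
  shows "cmod (ckern n f x y) \<le> 1"
proof -
  note psd = channel_ckern_psd[OF assms(1)]
  have d: "Re (ckern n f z z) \<le> 1" if z: "z \<in> {..<m} \<times> {..<n}" for z
  proof -
    obtain k i where ki: "z = (k,i)" "k < m" "i < n" using z by auto
    have pos: "0 \<le> Re (ckern n f (k',i) (k',i))" if "k' < m" for k'
    proof -
      have "0 \<le> cmod (ckern n f (k',i) (k',i))" by simp
      also have "\<dots> \<le> Re (ckern n f (k',i) (k',i))"
        using psd_on_entry_bound[OF _ psd, of "(k',i)" "(k',i)"] that ki by simp
      finally show ?thesis .
    qed
    have "Re (ckern n f z z) \<le> (\<Sum>k'<m. Re (ckern n f (k',i) (k',i)))"
      unfolding ki(1) using ki pos by (intro member_le_sum[of k _ "\<lambda>k'. Re (ckern n f (k',i) (k',i))"]) auto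
    also have "\<dots> = Re (\<Sum>k'<m. ckern n f (k',i) (k',i))" by simp
    also have "\<dots> = 1" unfolding channel_ckern_trace[OF assms(1) ki(3) ki(3)] by simp
    finally show ?thesis .
  qed
  have "cmod (ckern n f x y) \<le> (Re (ckern n f x x) + Re (ckern n f y y)) / 2"
    by (rule psd_on_entry_bound[OF _ psd xy]) simp
  also have "\<dots> \<le> (1 + 1) / 2" by (intro divide_right_mono add_mono d xy) simp
  finally show ?thesis by simp
qed

lemma kpair_psd_nonneg:
  assumes fin: "finite S" and W: "psd_on S W" and K: "psd_on S K"
  shows "0 \<le> kpair S W K"
proof -
  obtain h where h: "\<forall>i\<in>S. \<forall>j\<in>S. K i j = (\<Sum>r\<in>S. h r i * cnj (h r j))"
    using psd_on_decomp[OF fin K] by blast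
  have "kpair S W K = kpair S W (\<lambda>x y. \<Sum>r\<in>S. h r x * cnj (h r y))"
    using h by (intro kpair_cong) auto
  also have "\<dots> = (\<Sum>r\<in>S. kpair S W (\<lambda>x y. h r x * cnj (h r y)))" by (rule kpair_sum[OF fin])
  also have "\<dots> = (\<Sum>r\<in>S. Re (\<Sum>x\<in>S. \<Sum>y\<in>S. cnj (h r x) * W x y * h r y))"
    by (intro sum.cong[OF refl] kpair_rank_one) (rule psd_on_herm[OF W, symmetric])
  also have "0 \<le> \<dots>" using W unfolding psd_on_def by (intro sum_nonneg) blast
  finally show ?thesis .
qed

lemma pairing_nonneg:
  assumes \<rho>: "psd (n*m) \<rho>" and f: "channel n m f"
  shows "0 \<le> pairing n m \<rho> f"
proof -
  obtain g where g: "\<And>i j. i < n*m \<Longrightarrow> j < n*m \<Longrightarrow> \<rho> $$ (i,j) = (\<Sum>r<n*m. g r i * cnj (g r j))"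
    using psd_decomp[OF \<rho>] by blast
  have "psd_on ({..<m} \<times> {..<n}) (\<lambda>x y. \<rho> $$ (snd y * m + fst y, snd x * m + fst x))"
    by (rule psd_on_gram[where R = "{..<n*m}" and h = "\<lambda>r x. cnj (g r (snd x * m + fst x))"])
      (auto simp: g pair_index_less mult.commute[of "cnj _"])
  then show ?thesis
    unfolding pairing_eq_kpair[OF psd_carrier[OF \<rho>]]
    by (intro kpair_psd_nonneg channel_ckern_psd f) auto
qed

lemma pairing_bound:
  assumes \<rho>: "\<rho> \<in> carrier_mat (n*m) (n*m)" and f: "channel n m f"
  shows "pairing n m \<rho> f \<le> (\<Sum>x\<in>{..<m} \<times> {..<n}. \<Sum>y\<in>{..<m} \<times> {..<n}. cmod (\<rho> $$ (snd y * m + fst y, snd x * m + fst x)))"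
  unfolding pairing_eq_kpair[OF \<rho>] kpair_def
proof (rule order.trans[OF complex_Re_le_cmod], intro order.trans[OF norm_sum] sum_mono)
  fix x y assume xy: "x \<in> {..<m} \<times> {..<n}" "y \<in> {..<m} \<times> {..<n}"
  let ?r = "\<rho> $$ (snd y * m + fst y, snd x * m + fst x)"
  have "cmod ?r * cmod (ckern n f x y) \<le> cmod ?r * 1"
    using channel_ckern_le[OF f xy] by (intro mult_left_mono) auto
  then show "cmod (cnj ?r * ckern n f x y) \<le> cmod ?r" by (simp add: norm_mult)
qed

lemma pairing_le_dual_dnorm:
  assumes "\<rho> \<in> carrier_mat (n*m) (n*m)" "channel n m f"
  shows "pairing n m \<rho> f \<le> dual_dnorm n m \<rho>"
  unfolding dual_dnorm_def
proof (rule cSup_upper)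
  show "pairing n m \<rho> f \<in> {pairing n m \<rho> \<alpha> |\<alpha>. channel n m \<alpha>}" using assms(2) by blast
  show "bdd_above {pairing n m \<rho> \<alpha> |\<alpha>. channel n m \<alpha>}"
    using pairing_bound[OF assms(1)] by (intro bdd_aboveI) blast
qed

lemma pairing_cong:
  assumes "\<rho> \<in> carrier_mat (n*m) (n*m)"
    and "\<And>X k l. X \<in> carrier_mat n n \<Longrightarrow> k < m \<Longrightarrow> l < m \<Longrightarrow> f X $$ (k,l) = g X $$ (k,l)"
  shows "pairing n m \<rho> f = pairing n m \<rho> g"
  unfolding pairing_eq_kpair[OF assms(1)] by (rule kpair_cong) (auto simp: ckern_def assms(2))

lemma base_close_pairing:
  assumes bc: "base_close c n m \<Psi> \<Phi>" and c: "0 \<le> c" and \<rho>: "psd (n*m) \<rho>"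
  shows "pairing n m \<rho> \<Phi> \<le> pairing n m \<rho> \<Psi> + c * dual_dnorm n m \<rho>"
proof -
  obtain \<Gamma>1 \<Gamma>2 where g: "channel n m \<Gamma>1" "channel n m \<Gamma>2"
    and eq: "\<And>X k l. X \<in> carrier_mat n n \<Longrightarrow> k < m \<Longrightarrow> l < m \<Longrightarrow>
       \<Phi> X $$ (k,l) + of_real c * \<Gamma>2 X $$ (k,l) = \<Psi> X $$ (k,l) + of_real c * \<Gamma>1 X $$ (k,l)"
    using bc unfolding base_close_def by blast
  have \<rho>c: "\<rho> \<in> carrier_mat (n*m) (n*m)" by (rule psd_carrier[OF \<rho>])
  let ?k = "kpair ({..<m} \<times> {..<n}) (\<lambda>x y. \<rho> $$ (snd y * m + fst y, snd x * m + fst x))"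
  have "?k (\<lambda>x y. ckern n \<Phi> x y + of_real c * ckern n \<Gamma>2 x y) = ?k (\<lambda>x y. ckern n \<Psi> x y + of_real c * ckern n \<Gamma>1 x y)"
    by (rule kpair_cong) (auto simp: ckern_def eq)
  then have "pairing n m \<rho> \<Phi> + c * pairing n m \<rho> \<Gamma>2 = pairing n m \<rho> \<Psi> + c * pairing n m \<rho> \<Gamma>1"
    unfolding pairing_eq_kpair[OF \<rho>c] kpair_add kpair_scale .
  moreover have "0 \<le> c * pairing n m \<rho> \<Gamma>2" using c pairing_nonneg[OF \<rho> g(2)] by simp
  moreover have "c * pairing n m \<rho> \<Gamma>1 \<le> c * dual_dnorm n m \<rho>"
    using c pairing_le_dual_dnorm[OF \<rho>c g(1)] by (rule mult_left_mono[rotated])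
  ultimately show ?thesis by linarith
qed

lemma linmap_affine_relation:
  assumes f: "linmap n m f" and c: "A \<in> carrier_mat n n" "B \<in> carrier_mat n n" "C \<in> carrier_mat n n" "D \<in> carrier_mat n n"
    and eq: "\<And>i j. i < n \<Longrightarrow> j < n \<Longrightarrow> A $$ (i,j) + s * B $$ (i,j) = C $$ (i,j) + s * D $$ (i,j)"
    and kl: "k < m" "l < m"
  shows "f A $$ (k,l) + s * f B $$ (k,l) = f C $$ (k,l) + s * f D $$ (k,l)"
proof -
  have "A + s \<cdot>\<^sub>m B = C + s \<cdot>\<^sub>m D" using c eq by (intro eq_matI) auto
  then have "f A + s \<cdot>\<^sub>m f B = f C + s \<cdot>\<^sub>m f D"
    using f c unfolding linmap_def by (metis smult_carrier_mat)
  then have "(f A + s \<cdot>\<^sub>m f B) $$ (k,l) = (f C + s \<cdot>\<^sub>m f D) $$ (k,l)" by simp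
  then show ?thesis
    using linmap_carrier[OF f c(1)] linmap_carrier[OF f c(2)] linmap_carrier[OF f c(3)] linmap_carrier[OF f c(4)] kl by simp
qed

lemma tid_left_affine_relation:
  assumes eq: "\<And>X k l. X \<in> carrier_mat n n \<Longrightarrow> k < m \<Longrightarrow> l < m \<Longrightarrow>
       \<Phi> X $$ (k,l) + s * \<Gamma>2 X $$ (k,l) = \<Psi> X $$ (k,l) + s * \<Gamma>1 X $$ (k,l)"
    and ij: "i < u*m" "j < u*m"
  shows "tid_left u n m \<Phi> Z $$ (i,j) + s * tid_left u n m \<Gamma>2 Z $$ (i,j)
     = tid_left u n m \<Psi> Z $$ (i,j) + s * tid_left u n m \<Gamma>1 Z $$ (i,j)"
proof -
  obtain z a where az: "z < u" "a < m" "i = z*m + a" using ij(1) by (rule less_mult_indexE)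
  obtain w b where bw: "w < u" "b < m" "j = w*m + b" using ij(2) by (rule less_mult_indexE)
  show ?thesis using az bw by (simp add: tid_left_entry eq)
qed

text \<open>The witnesses are carried along as the images of \<Gamma>1 and \<Gamma>2, so the
  constant c survives without any norm estimate.\<close>

lemma base_close_apply_sc:
  assumes bc: "base_close c (a0*b0) (a1*b1) \<Psi> \<Phi>" and s: "superchannel a0 a1 r0 r1 u pre post"
  shows "base_close c (r0*b0) (r1*b1) (apply_sc a0 a1 r0 r1 b0 b1 u pre post \<Psi>) (apply_sc a0 a1 r0 r1 b0 b1 u pre post \<Phi>)"
proof -
  obtain \<Gamma>1 \<Gamma>2 where g: "channel (a0*b0) (a1*b1) \<Gamma>1" "channel (a0*b0) (a1*b1) \<Gamma>2"
    and eq: "\<And>X k l. X \<in> carrier_mat (a0*b0) (a0*b0) \<Longrightarrow> k < a1*b1 \<Longrightarrow> l < a1*b1 \<Longrightarrow>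
       \<Phi> X $$ (k,l) + of_real c * \<Gamma>2 X $$ (k,l) = \<Psi> X $$ (k,l) + of_real c * \<Gamma>1 X $$ (k,l)"
    using bc unfolding base_close_def by blast
  have lin: "linmap (u*(a1*b1)) (r1*b1) (tid_right (u*a1) r1 b1 post)"
    using linmap_tid_right[of "u*a1" r1 post b1] s unfolding superchannel_def by (simp add: channel_linmap mult.assoc)
  show ?thesis
    unfolding base_close_def
  proof (rule exI[of _ "apply_sc a0 a1 r0 r1 b0 b1 u pre post \<Gamma>1"], rule exI[of _ "apply_sc a0 a1 r0 r1 b0 b1 u pre post \<Gamma>2"],
      intro conjI ballI allI impI channel_apply_sc[OF s] g)
    fix X :: "complex mat" and k l assume "k < r1*b1" "l < r1*b1"
    then show "apply_sc a0 a1 r0 r1 b0 b1 u pre post \<Phi> X $$ (k,l) + of_real c * apply_sc a0 a1 r0 r1 b0 b1 u pre post \<Gamma>2 X $$ (k,l)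
       = apply_sc a0 a1 r0 r1 b0 b1 u pre post \<Psi> X $$ (k,l) + of_real c * apply_sc a0 a1 r0 r1 b0 b1 u pre post \<Gamma>1 X $$ (k,l)"
      unfolding apply_sc_def by (intro linmap_affine_relation[OF lin] tid_left_affine_relation eq tid_left_carrier)
  qed
qed

lemma le_if_le_eps:
  fixes L R d \<epsilon> :: real
  assumes "\<And>\<eta>. 0 < \<eta> \<Longrightarrow> L \<le> R + (\<epsilon> + \<eta>) / 2 * d"
  shows "L \<le> R + \<epsilon> / 2 * d"
proof (rule field_le_epsilon)
  fix e :: real assume e: "0 < e"
  \<comment> \<open>The denominator |d| + 1 covers d of either sign and d = 0.\<close>
  define \<eta> where "\<eta> = e / (\<bar>d\<bar> + 1)"
  have \<eta>: "0 < \<eta>" using e by (simp add: \<eta>_def add_nonneg_pos)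
  have "\<eta> / 2 * d \<le> \<eta> * (\<bar>d\<bar> + 1)"
  proof -
    have "\<eta> / 2 * d \<le> \<eta> / 2 * \<bar>d\<bar>" using \<eta> by (intro mult_left_mono) auto
    also have "\<dots> \<le> \<eta> * \<bar>d\<bar>" using \<eta> by (intro mult_right_mono) auto
    also have "\<dots> \<le> \<eta> * (\<bar>d\<bar> + 1)" using \<eta> by (intro mult_left_mono) auto
    finally show ?thesis .
  qed
  also have "\<dots> = e" by (simp add: \<eta>_def)
  finally show "L \<le> R + \<epsilon> / 2 * d + e" using assms[OF \<eta>] by (simp add: add_divide_distrib distrib_right)
qed

section \<open>Equivalence of (i) and (ii)\<close>

locale channel_pair =
  fixes a0 a1 a0' a1' b0 b1 :: nat and \<Phi>1 \<Phi>2 :: "complex mat \<Rightarrow> complex mat"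
  assumes pos: "0 < a0" "0 < a1" "0 < a0'" "0 < a1'" "0 < b0" "0 < b1"
    and ch1: "channel (a0*b0) (a1*b1) \<Phi>1" and ch2: "channel (a0'*b0) (a1'*b1) \<Phi>2"
begin

text \<open>The infimum supplies a superchannel with norm below \<epsilon> + \<eta>, and strong
  duality converts this norm bound into the order relation.\<close>

lemma delta_le_close:
  assumes "delta a0 a1 a0' a1' b0 b1 \<Phi>1 \<Phi>2 \<le> \<epsilon>" "0 < \<eta>"
  shows "\<exists>u pre post. superchannel a0 a1 a0' a1' u pre post \<and>
    base_close ((\<epsilon> + \<eta>) / 2) (a0'*b0) (a1'*b1) (apply_sc a0 a1 a0' a1' b0 b1 u pre post \<Phi>1) \<Phi>2"
proof -
  let ?D = "{dnorm (a0'*b0) (a1'*b1) (\<lambda>X. apply_sc a0 a1 a0' a1' b0 b1 u pre post \<Phi>1 X - \<Phi>2 X) | u pre post.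
       superchannel a0 a1 a0' a1' u pre post}"
  have "?D \<noteq> {}" using superchannel_exists[OF pos(1,4)] by blast
  moreover have "Inf ?D < \<epsilon> + \<eta>" using assms unfolding delta_def by simp
  ultimately obtain u pre post where s: "superchannel a0 a1 a0' a1' u pre post"
    and d: "dnorm (a0'*b0) (a1'*b1) (\<lambda>X. apply_sc a0 a1 a0' a1' b0 b1 u pre post \<Phi>1 X - \<Phi>2 X) < \<epsilon> + \<eta>"
    using cInf_lessD[of ?D "\<epsilon> + \<eta>"] by blast
  have "base_close ((\<epsilon> + \<eta>) / 2) (a0'*b0) (a1'*b1) (apply_sc a0 a1 a0' a1' b0 b1 u pre post \<Phi>1) \<Phi>2"
    by (rule base_close_if_dnorm_less) (use pos channel_apply_sc[OF s ch1] ch2 d in auto)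
  then show ?thesis using s by blast
qed

lemma delta_gt_separated:
  assumes gt: "\<not> delta a0 a1 a0' a1' b0 b1 \<Phi>1 \<Phi>2 \<le> \<epsilon>" and \<epsilon>: "0 \<le> \<epsilon>"
  shows "\<exists>\<rho> \<beta>. density (a0'*b0*(a1'*b1)) \<rho> \<and> 0 < \<beta> \<and>
    (\<forall>u pre post \<Gamma>. superchannel a0 a1 a0' a1' u pre post \<longrightarrow> channel (a0'*b0) (a1'*b1) \<Gamma> \<longrightarrow>
      pairing (a0'*b0) (a1'*b1) \<rho> (apply_sc a0 a1 a0' a1' b0 b1 u pre post \<Phi>1)
        + \<epsilon> / 2 * pairing (a0'*b0) (a1'*b1) \<rho> \<Gamma> + \<beta> \<le> pairing (a0'*b0) (a1'*b1) \<rho> \<Phi>2)"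
proof -
  let ?n = "a0'*b0" and ?m = "a1'*b1"
  let ?A = "\<lambda>u pre post. apply_sc a0 a1 a0' a1' b0 b1 u pre post \<Phi>1"
  let ?D = "{dnorm ?n ?m (\<lambda>X. ?A u pre post X - \<Phi>2 X) | u pre post. superchannel a0 a1 a0' a1' u pre post}"
  define S where "S = {?A u pre post | u pre post. superchannel a0 a1 a0' a1' u pre post}"
  \<comment> \<open>Strictly between \<epsilon> and \<open>delta\<close>: no image of
    \<open>\<Phi>1\<close> is close with constant \<epsilon>' / 2, and the drop to \<epsilon> / 2 is
    the gap that the separation lemma consumes.\<close>
  define \<epsilon>' where "\<epsilon>' = (\<epsilon> + delta a0 a1 a0' a1' b0 b1 \<Phi>1 \<Phi>2) / 2"
  have \<epsilon>': "\<epsilon> < \<epsilon>'" "\<epsilon>' < delta a0 a1 a0' a1' b0 b1 \<Phi>1 \<Phi>2" using gt by (auto simp: \<epsilon>'_def)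
  have chS: "channel ?n ?m \<Psi>" if "\<Psi> \<in> S" for \<Psi>
    using that channel_apply_sc[OF _ ch1] unfolding S_def by blast
  have bdd: "bdd_below ?D"
    using dnorm_nonneg[OF channel_apply_sc[OF _ ch1] ch2] by (intro bdd_belowI[of _ 0]) blast
  have far: "\<not> base_close (\<epsilon>' / 2) ?n ?m \<Psi> \<Phi>2" if \<Psi>: "\<Psi> \<in> S" for \<Psi>
  proof
    assume "base_close (\<epsilon>' / 2) ?n ?m \<Psi> \<Phi>2"
    then have "dnorm ?n ?m (\<lambda>X. \<Psi> X - \<Phi>2 X) \<le> 2 * (\<epsilon>' / 2)"
      using \<epsilon>' \<epsilon> by (intro dnorm_le_base_close chS[OF \<Psi>] ch2) auto
    moreover have "dnorm ?n ?m (\<lambda>X. \<Psi> X - \<Phi>2 X) \<in> ?D" using \<Psi> unfolding S_def by blast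
    then have "delta a0 a1 a0' a1' b0 b1 \<Phi>1 \<Phi>2 \<le> dnorm ?n ?m (\<lambda>X. \<Psi> X - \<Phi>2 X)"
      unfolding delta_def using bdd by (rule cInf_lower)
    ultimately show False using \<epsilon>'(2) by simp
  qed
  obtain \<Psi>0 where ne: "\<Psi>0 \<in> S" using superchannel_exists[OF pos(1,4)] unfolding S_def by blast
  have conv: "\<exists>\<Psi>\<in>S. \<forall>x\<in>{..<?m} \<times> {..<?n}. \<forall>y\<in>{..<?m} \<times> {..<?n}.
        ckern ?n \<Psi> x y = of_real (1 - t) * ckern ?n \<Psi>1 x y + of_real t * ckern ?n \<Psi>2 x y"
    if "\<Psi>1 \<in> S" "\<Psi>2 \<in> S" and t: "0 \<le> t" "t \<le> 1" for \<Psi>1 \<Psi>2 t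
  proof -
    obtain u1 pre1 post1 where 1: "\<Psi>1 = ?A u1 pre1 post1" "superchannel a0 a1 a0' a1' u1 pre1 post1"
      using \<open>\<Psi>1 \<in> S\<close> unfolding S_def by blast
    obtain u2 pre2 post2 where 2: "\<Psi>2 = ?A u2 pre2 post2" "superchannel a0 a1 a0' a1' u2 pre2 post2"
      using \<open>\<Psi>2 \<in> S\<close> unfolding S_def by blast
    obtain u pre post where s: "superchannel a0 a1 a0' a1' u pre post"
      and e: "\<forall>X\<in>carrier_mat ?n ?n. \<forall>k<?m. \<forall>l<?m. ?A u pre post X $$ (k,l) =
         of_real (1 - t) * ?A u1 pre1 post1 X $$ (k,l) + of_real t * ?A u2 pre2 post2 X $$ (k,l)"
      using superchannel_convex[OF 1(2) 2(2) ch1 t] by blast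
    show ?thesis
    proof (intro bexI ballI)
      show "?A u pre post \<in> S" using s unfolding S_def by blast
      fix x y assume "x \<in> {..<?m} \<times> {..<?n}" "y \<in> {..<?m} \<times> {..<?n}"
      then show "ckern ?n (?A u pre post) x y = of_real (1 - t) * ckern ?n \<Psi>1 x y + of_real t * ckern ?n \<Psi>2 x y"
        using e unfolding ckern_def 1(1) 2(1) by auto
    qed
  qed
  have "\<exists>\<rho> \<beta>. density (?n*?m) \<rho> \<and> 0 < \<beta> \<and> (\<forall>\<Psi>\<in>S. \<forall>\<Gamma>. channel ?n ?m \<Gamma> \<longrightarrow>
     pairing ?n ?m \<rho> \<Psi> + \<epsilon> / 2 * pairing ?n ?m \<rho> \<Gamma> + \<beta> \<le> pairing ?n ?m \<rho> \<Phi>2)"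
    by (rule base_close_or_separated[OF _ _ ch2 _ _ chS ne conv far]) (use pos \<epsilon> \<epsilon>' in auto)
  then show ?thesis unfolding S_def by blast
qed

lemma superchannel_pairing_upper:
  assumes "0 < r0" "0 < r1" and \<rho>: "\<rho> \<in> carrier_mat (r0*b0*(r1*b1)) (r0*b0*(r1*b1))"
    and "superchannel a0 a1 r0 r1 u pre post"
  shows "pairing (r0*b0) (r1*b1) \<rho> (apply_sc a0 a1 r0 r1 b0 b1 u pre post \<Phi>1)
     \<le> Sup {pairing (r0*b0) (r1*b1) \<rho> (apply_sc a0 a1 r0 r1 b0 b1 u pre post \<Phi>1) | u pre post.
              superchannel a0 a1 r0 r1 u pre post}" (is "_ \<le> Sup ?R")
proof (rule cSup_upper)
  show "bdd_above ?R"
    using pairing_bound[OF \<rho> channel_apply_sc[OF _ ch1]] by (intro bdd_aboveI) blast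
qed (use assms(4) in blast)

lemma cond_ii_if_delta_le:
  assumes d: "delta a0 a1 a0' a1' b0 b1 \<Phi>1 \<Phi>2 \<le> \<epsilon>" and \<epsilon>: "0 \<le> \<epsilon>" and r: "0 < r0" "0 < r1"
  shows "cond_ii a0 a1 a0' a1' b0 b1 \<Phi>1 \<Phi>2 \<epsilon> r0 r1"
  unfolding cond_ii_def
proof (intro allI impI, rule le_if_le_eps)
  fix \<rho> and \<eta> :: real assume "density (r0*b0*r1*b1) \<rho>" and \<eta>: "0 < \<eta>"
  then have \<rho>: "psd (r0*b0*(r1*b1)) \<rho>" by (simp add: density_def mult.assoc)
  obtain u pre post where s: "superchannel a0 a1 a0' a1' u pre post"
    and bc: "base_close ((\<epsilon> + \<eta>) / 2) (a0'*b0) (a1'*b1) (apply_sc a0 a1 a0' a1' b0 b1 u pre post \<Phi>1) \<Phi>2"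
    using delta_le_close[OF d \<eta>] by blast
  let ?R = "{pairing (r0*b0) (r1*b1) \<rho> (apply_sc a0 a1 r0 r1 b0 b1 u pre post \<Phi>1) | u pre post.
              superchannel a0 a1 r0 r1 u pre post}"
  show "Sup {pairing (r0*b0) (r1*b1) \<rho> (apply_sc a0' a1' r0 r1 b0 b1 u pre post \<Phi>2) | u pre post.
              superchannel a0' a1' r0 r1 u pre post}
       \<le> Sup ?R + (\<epsilon> + \<eta>) / 2 * dual_dnorm (r0*b0) (r1*b1) \<rho>"
  proof (rule cSup_least)
    show "{pairing (r0*b0) (r1*b1) \<rho> (apply_sc a0' a1' r0 r1 b0 b1 u pre post \<Phi>2) | u pre post.
              superchannel a0' a1' r0 r1 u pre post} \<noteq> {}"
      using superchannel_exists[OF pos(3) r(2)] by blast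
    fix x assume "x \<in> {pairing (r0*b0) (r1*b1) \<rho> (apply_sc a0' a1' r0 r1 b0 b1 u pre post \<Phi>2) | u pre post.
              superchannel a0' a1' r0 r1 u pre post}"
    then obtain v pre' post' where x: "x = pairing (r0*b0) (r1*b1) \<rho> (apply_sc a0' a1' r0 r1 b0 b1 v pre' post' \<Phi>2)"
      and s': "superchannel a0' a1' r0 r1 v pre' post'" by blast
    \<comment> \<open>Any superchannel for \<open>\<Phi>2\<close>, preceded by the nearly optimal
      one, becomes a competitor for \<open>\<Phi>1\<close> in the supremum on the right.\<close>
    obtain u'' pre'' post'' where s'': "superchannel a0 a1 r0 r1 u'' pre'' post''"
      and e: "\<forall>X. apply_sc a0 a1 r0 r1 b0 b1 u'' pre'' post'' \<Phi>1 X =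
       apply_sc a0' a1' r0 r1 b0 b1 v pre' post' (apply_sc a0 a1 a0' a1' b0 b1 u pre post \<Phi>1) X"
      using superchannel_comp[OF s s' ch1] by blast
    have "x \<le> pairing (r0*b0) (r1*b1) \<rho> (apply_sc a0' a1' r0 r1 b0 b1 v pre' post' (apply_sc a0 a1 a0' a1' b0 b1 u pre post \<Phi>1))
        + (\<epsilon> + \<eta>) / 2 * dual_dnorm (r0*b0) (r1*b1) \<rho>"
      unfolding x using \<epsilon> \<eta> by (intro base_close_pairing[OF base_close_apply_sc[OF bc s'] _ \<rho>]) simp
    also have "pairing (r0*b0) (r1*b1) \<rho> (apply_sc a0' a1' r0 r1 b0 b1 v pre' post' (apply_sc a0 a1 a0' a1' b0 b1 u pre post \<Phi>1))
        = pairing (r0*b0) (r1*b1) \<rho> (apply_sc a0 a1 r0 r1 b0 b1 u'' pre'' post'' \<Phi>1)"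
      by (rule pairing_cong[OF psd_carrier[OF \<rho>]]) (simp add: e)
    also have "\<dots> \<le> Sup ?R"
      by (rule superchannel_pairing_upper[OF r psd_carrier[OF \<rho>] s''])
    finally show "x \<le> Sup ?R + (\<epsilon> + \<eta>) / 2 * dual_dnorm (r0*b0) (r1*b1) \<rho>" by simp
  qed
qed

text \<open>The separating inequality holds for every pair of a superchannel and a channel \<Gamma>
  independently, so the two suprema can be taken one after the other; the second divides by
  \<epsilon> / 2, whence the case \<epsilon> = 0.\<close>

lemma separated_Sup_gap:
  assumes \<rho>: "density (a0'*b0*(a1'*b1)) \<rho>" and \<epsilon>: "0 \<le> \<epsilon>"
    and sep: "\<And>u pre post \<Gamma>. superchannel a0 a1 a0' a1' u pre post \<Longrightarrow> channel (a0'*b0) (a1'*b1) \<Gamma> \<Longrightarrow>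
      pairing (a0'*b0) (a1'*b1) \<rho> (apply_sc a0 a1 a0' a1' b0 b1 u pre post \<Phi>1)
        + \<epsilon> / 2 * pairing (a0'*b0) (a1'*b1) \<rho> \<Gamma> + \<beta> \<le> p"
  shows "Sup {pairing (a0'*b0) (a1'*b1) \<rho> (apply_sc a0 a1 a0' a1' b0 b1 u pre post \<Phi>1) | u pre post.
              superchannel a0 a1 a0' a1' u pre post} + \<epsilon> / 2 * dual_dnorm (a0'*b0) (a1'*b1) \<rho> + \<beta> \<le> p"
proof -
  let ?P = "pairing (a0'*b0) (a1'*b1) \<rho>"
  let ?R = "{?P (apply_sc a0 a1 a0' a1' b0 b1 u pre post \<Phi>1) | u pre post. superchannel a0 a1 a0' a1' u pre post}"
  have 1: "Sup ?R \<le> p - \<beta> - \<epsilon> / 2 * ?P \<Gamma>" if "channel (a0'*b0) (a1'*b1) \<Gamma>" for \<Gamma>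
  proof (rule cSup_least)
    show "?R \<noteq> {}" using superchannel_exists[OF pos(1,4)] by blast
    fix x assume "x \<in> ?R"
    then show "x \<le> p - \<beta> - \<epsilon> / 2 * ?P \<Gamma>" using sep[OF _ that] by fastforce
  qed
  obtain \<Gamma>0 where \<Gamma>0: "channel (a0'*b0) (a1'*b1) \<Gamma>0" using ch2 by blast
  have "\<epsilon> / 2 * dual_dnorm (a0'*b0) (a1'*b1) \<rho> \<le> p - \<beta> - Sup ?R"
  proof (cases "\<epsilon> = 0")
    case True
    then show ?thesis using 1[OF \<Gamma>0] by simp
  next
    case False
    then have e: "0 < \<epsilon> / 2" using \<epsilon> by simp
    have "dual_dnorm (a0'*b0) (a1'*b1) \<rho> \<le> (p - \<beta> - Sup ?R) / (\<epsilon> / 2)"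
      unfolding dual_dnorm_def
    proof (rule cSup_least)
      show "{?P \<alpha> |\<alpha>. channel (a0'*b0) (a1'*b1) \<alpha>} \<noteq> {}" using \<Gamma>0 by blast
      fix x assume "x \<in> {?P \<alpha> |\<alpha>. channel (a0'*b0) (a1'*b1) \<alpha>}"
      then obtain \<Gamma> where x: "x = ?P \<Gamma>" "channel (a0'*b0) (a1'*b1) \<Gamma>" by blast
      have "x * (\<epsilon> / 2) \<le> p - \<beta> - Sup ?R" using 1[OF x(2)] unfolding x(1) by (simp add: mult.commute)
      then show "x \<le> (p - \<beta> - Sup ?R) / (\<epsilon> / 2)" using e by (simp only: pos_le_divide_eq)
    qed
    then show ?thesis using e by (simp only: pos_le_divide_eq mult.commute)
  qed
  then show ?thesis by linarith
qed

lemma delta_le_if_cond_ii: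
  assumes ii: "cond_ii a0 a1 a0' a1' b0 b1 \<Phi>1 \<Phi>2 \<epsilon> a0' a1'" and \<epsilon>: "0 \<le> \<epsilon>"
  shows "delta a0 a1 a0' a1' b0 b1 \<Phi>1 \<Phi>2 \<le> \<epsilon>"
proof (rule ccontr)
  assume "\<not> ?thesis"
  then obtain \<rho> \<beta> where \<rho>: "density (a0'*b0*(a1'*b1)) \<rho>" and \<beta>: "0 < \<beta>"
    and sep: "\<And>u pre post \<Gamma>. superchannel a0 a1 a0' a1' u pre post \<Longrightarrow> channel (a0'*b0) (a1'*b1) \<Gamma> \<Longrightarrow>
      pairing (a0'*b0) (a1'*b1) \<rho> (apply_sc a0 a1 a0' a1' b0 b1 u pre post \<Phi>1)
        + \<epsilon> / 2 * pairing (a0'*b0) (a1'*b1) \<rho> \<Gamma> + \<beta> \<le> pairing (a0'*b0) (a1'*b1) \<rho> \<Phi>2"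
    using delta_gt_separated[OF _ \<epsilon>] by blast
  let ?L = "{pairing (a0'*b0) (a1'*b1) \<rho> (apply_sc a0' a1' a0' a1' b0 b1 u pre post \<Phi>2) | u pre post.
              superchannel a0' a1' a0' a1' u pre post}"
  have \<rho>c: "\<rho> \<in> carrier_mat (a0'*b0*(a1'*b1)) (a0'*b0*(a1'*b1))"
    using \<rho> by (simp add: density_def psd_carrier)
  \<comment> \<open>The identity superchannel is admissible for R = A', so the left side of (ii) is
    at least the pairing of \<rho> with \<open>\<Phi>2\<close> itself.\<close>
  have "pairing (a0'*b0) (a1'*b1) \<rho> \<Phi>2 = pairing (a0'*b0) (a1'*b1) \<rho> (apply_sc a0' a1' a0' a1' b0 b1 1 (\<lambda>X. X) (\<lambda>X. X) \<Phi>2)"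
    by (rule pairing_cong[OF \<rho>c]) (simp only: apply_sc_id[OF ch2])
  also have "\<dots> \<le> Sup ?L"
  proof (rule cSup_upper)
    show "bdd_above ?L"
      using pairing_bound[OF \<rho>c channel_apply_sc[OF _ ch2]] by (intro bdd_aboveI) blast
  qed (use superchannel_id in blast)
  also have "\<dots> \<le> Sup {pairing (a0'*b0) (a1'*b1) \<rho> (apply_sc a0 a1 a0' a1' b0 b1 u pre post \<Phi>1) | u pre post.
              superchannel a0 a1 a0' a1' u pre post} + \<epsilon> / 2 * dual_dnorm (a0'*b0) (a1'*b1) \<rho>"
    using ii \<rho> unfolding cond_ii_def by (simp add: mult.assoc)
  finally show False using separated_Sup_gap[OF \<rho> \<epsilon> sep] \<beta> by linarith
qed

end

section \<open>Guessing games\<close>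

lemma povm_psd: "povm d I M \<Longrightarrow> x \<in> I \<Longrightarrow> psd d (M x)"
  by (simp add: povm_def)

lemma povm_sum: "povm d I M \<Longrightarrow> a < d \<Longrightarrow> b < d \<Longrightarrow> (\<Sum>x\<in>I. M x $$ (a,b)) = (if a = b then 1 else 0)"
  by (simp add: povm_def)

text \<open>Used with dual maps, which are unital: applying a channel and then measuring is again a
  measurement.\<close>

lemma povm_image:
  assumes S: "povm n I S" and f: "cp n m f" "f (1\<^sub>m n) = 1\<^sub>m m"
  shows "povm m I (\<lambda>x. f (S x))"
  unfolding povm_def
proof (intro conjI ballI allI impI)
  note lin = cp_linmap[OF f(1)]
  show "psd m (f (S x))" if "x \<in> I" for x using psd_cp[OF f(1) povm_psd[OF S that]] .
  fix a b assume ab: "a < m" "b < m"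
  have "(\<Sum>x\<in>I. f (S x) $$ (a,b)) = (\<Sum>x\<in>I. \<Sum>i<n. \<Sum>j<n. S x $$ (i,j) * f (unitmat n i j) $$ (a,b))"
    using povm_psd[OF S] psd_carrier linmap_expand[OF lin _ ab] by (intro sum.cong refl) blast
  also have "\<dots> = (\<Sum>i<n. \<Sum>j<n. \<Sum>x\<in>I. S x $$ (i,j) * f (unitmat n i j) $$ (a,b))"
    by (rule trans[OF sum.swap sum.cong[OF refl sum.swap]])
  also have "\<dots> = (\<Sum>i<n. \<Sum>j<n. (1\<^sub>m n) $$ (i,j) * f (unitmat n i j) $$ (a,b))"
  proof (intro sum.cong refl)
    fix i j assume "i \<in> {..<n}" "j \<in> {..<n}"
    then show "(\<Sum>x\<in>I. S x $$ (i,j) * f (unitmat n i j) $$ (a,b)) = (1\<^sub>m n) $$ (i,j) * f (unitmat n i j) $$ (a,b)"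
      unfolding sum_distrib_right[symmetric] using povm_sum[OF S, of i j] by simp
  qed
  also have "\<dots> = f (1\<^sub>m n) $$ (a,b)" by (rule linmap_expand[OF lin one_carrier_mat ab, symmetric])
  finally show "(\<Sum>x\<in>I. f (S x) $$ (a,b)) = (if a = b then 1 else 0)" using f(2) ab by simp
qed

text \<open>Diagonal entries are at most 1 because the effects sum to the identity, and the diagonal
  bounds the rest. This makes \<open>psucc\<close> a supremum of a bounded set.\<close>

lemma povm_entry_le:
  assumes fin: "finite I" and M: "povm d I M" and x: "x \<in> I" and ab: "a < d" "b < d"
  shows "cmod (M x $$ (a,b)) \<le> 1"
proof -
  have psd: "psd_on {..<d} (\<lambda>i j. M y $$ (i,j))" if "y \<in> I" for y
    using povm_psd[OF M that] by (simp add: psd_iff_psd_on)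
  have d: "Re (M x $$ (c,c)) \<le> 1" if c: "c < d" for c
  proof -
    have p: "0 \<le> Re (M y $$ (c,c))" if "y \<in> I" for y
    proof -
      have "0 \<le> cmod (M y $$ (c,c))" by simp
      also have "\<dots> \<le> Re (M y $$ (c,c))" using psd_on_entry_bound[OF _ psd[OF that], of c c] c by simp
      finally show ?thesis .
    qed
    have "Re (M x $$ (c,c)) \<le> (\<Sum>y\<in>I. Re (M y $$ (c,c)))"
      using fin x p by (intro member_le_sum[of x _ "\<lambda>y. Re (M y $$ (c,c))"]) auto
    also have "\<dots> = Re (\<Sum>y\<in>I. M y $$ (c,c))" by simp
    also have "\<dots> = 1" unfolding povm_sum[OF M c c] by simp
    finally show ?thesis .
  qed
  have "cmod (M x $$ (a,b)) \<le> (Re (M x $$ (a,a)) + Re (M x $$ (b,b))) / 2"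
    using psd_on_entry_bound[OF _ psd[OF x], of a b] ab by simp
  also have "\<dots> \<le> (1 + 1) / 2" by (intro divide_right_mono add_mono d ab) simp
  finally show ?thesis by simp
qed

lemma psucc_bdd:
  fixes k l :: nat
  assumes "\<And>i j. i < k \<Longrightarrow> j < l \<Longrightarrow> rho i j \<in> carrier_mat d d \<and> 0 \<le> lam i j"
  shows "bdd_above {(\<Sum>i<k. \<Sum>j<l. lam i j * Re (trace (rho i j * M (i,j)))) | M. povm d ({..<k} \<times> {..<l}) M}"
proof (rule bdd_aboveI)
  fix v assume "v \<in> {(\<Sum>i<k. \<Sum>j<l. lam i j * Re (trace (rho i j * M (i,j)))) | M. povm d ({..<k} \<times> {..<l}) M}"
  then obtain M where v: "v = (\<Sum>i<k. \<Sum>j<l. lam i j * Re (trace (rho i j * M (i,j))))" and M: "povm d ({..<k} \<times> {..<l}) M"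
    by blast
  show "v \<le> (\<Sum>i<k. \<Sum>j<l. lam i j * (\<Sum>a<d. \<Sum>b<d. cmod (rho i j $$ (a,b))))"
    unfolding v
  proof (intro sum_mono mult_left_mono)
    fix i j assume ij: "i \<in> {..<k}" "j \<in> {..<l}"
    then have x: "(i,j) \<in> {..<k} \<times> {..<l}" by simp
    have c: "rho i j \<in> carrier_mat d d" "M (i,j) \<in> carrier_mat d d"
      using assms ij psd_carrier[OF povm_psd[OF M x]] by auto
    show "0 \<le> lam i j" using assms ij by simp
    have "Re (trace (rho i j * M (i,j))) = Re (\<Sum>a<d. \<Sum>b<d. rho i j $$ (a,b) * M (i,j) $$ (b,a))"
      unfolding trace_mult[OF c] ..
    also have "\<dots> \<le> (\<Sum>a<d. \<Sum>b<d. cmod (rho i j $$ (a,b)))"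
    proof (rule order.trans[OF complex_Re_le_cmod], intro order.trans[OF norm_sum] sum_mono)
      fix a b assume ab: "a \<in> {..<d}" "b \<in> {..<d}"
      have "cmod (rho i j $$ (a,b)) * cmod (M (i,j) $$ (b,a)) \<le> cmod (rho i j $$ (a,b)) * 1"
        using povm_entry_le[OF _ M x, of b a] ab by (intro mult_left_mono) auto
      then show "cmod (rho i j $$ (a,b) * M (i,j) $$ (b,a)) \<le> cmod (rho i j $$ (a,b))" by (simp add: norm_mult)
    qed
    finally show "Re (trace (rho i j * M (i,j))) \<le> (\<Sum>a<d. \<Sum>b<d. cmod (rho i j $$ (a,b)))" .
  qed
qed

lemma psucc_upper:
  assumes "ensemble d k l lam rho" "povm d ({..<k} \<times> {..<l}) M"
  shows "(\<Sum>i<k. \<Sum>j<l. lam i j * Re (trace (rho i j * M (i,j)))) \<le> psucc d k l lam rho"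
  unfolding psucc_def
proof (rule cSup_upper)
  have "rho i j \<in> carrier_mat d d \<and> 0 \<le> lam i j" if "i < k" "j < l" for i j
    using assms(1) that psd_carrier[of d "rho i j"] by (auto simp: ensemble_def density_def)
  then show "bdd_above {(\<Sum>i<k. \<Sum>j<l. lam i j * Re (trace (rho i j * M (i,j)))) | M. povm d ({..<k} \<times> {..<l}) M}"
    by (rule psucc_bdd)
qed (use assms(2) in blast)

lemma swap_kron_carrier[simp]: "swap_mid n r b c Z \<in> carrier_mat (n*b*(r*c)) (n*b*(r*c))"
  by (simp add: swap_mid_def mult.assoc)

text \<open>The systems arrive in the order U A1, output B1, R1, ensemble B1, with indices \<tau>,
  y, x, z. N sees the first and third, M the second and fourth.\<close>

lemma swap_kron_entry:
  assumes N: "N \<in> carrier_mat (n*r) (n*r)" and M: "M \<in> carrier_mat (b*b) (b*b)"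
    and bd: "\<tau> < n" "y < b" "x < r" "z < b" "\<tau>' < n" "y' < b" "x' < r" "z' < b"
  shows "swap_mid n r b b (kron N M) $$ ((\<tau>*b+y)*(r*b) + (x*b+z), (\<tau>'*b+y')*(r*b) + (x'*b+z'))
     = N $$ (\<tau>*r+x, \<tau>'*r+x') * M $$ (y*b+z, y'*b+z')"
proof -
  have idx: "sw_idx n r b b ((\<tau>*b+y)*(r*b) + (x*b+z)) = (\<tau>*r+x)*(b*b) + (y*b+z)"
    if "\<tau> < n" "y < b" "x < r" "z < b" for \<tau> y x z
  proof -
    have e: "(\<tau>*b+y)*(r*b) + (x*b+z) = ((\<tau>*b+y)*r + x)*b + z" by (simp add: algebra_simps)
    have "sw_idx n r b b ((\<tau>*b+y)*(r*b) + (x*b+z)) = ((\<tau>*r+x)*b+y)*b+z"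
      unfolding e sw_idx_def Let_def using that by simp
    then show ?thesis by (simp add: algebra_simps)
  qed
  have lt: "(\<tau>*b+y)*(r*b) + (x*b+z) < n*b*r*b" if "\<tau> < n" "y < b" "x < r" "z < b" for \<tau> y x z
    using pair_index_less[OF pair_index_less[OF that(1,2)] pair_index_less[OF that(3,4)]] by (simp add: mult.assoc)
  have lt2: "y*b+z < b*b" if "y < b" "z < b" for y z using that by (rule pair_index_less)
  have "swap_mid n r b b (kron N M) $$ ((\<tau>*b+y)*(r*b) + (x*b+z), (\<tau>'*b+y')*(r*b) + (x'*b+z'))
      = kron N M $$ ((\<tau>*r+x)*(b*b) + (y*b+z), (\<tau>'*r+x')*(b*b) + (y'*b+z'))"
    unfolding swap_mid_def using lt bd by (simp add: idx)
  also have "\<dots> = N $$ (\<tau>*r+x, \<tau>'*r+x') * M $$ (y*b+z, y'*b+z')"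
  proof -
    have "(\<tau>*r+x)*(b*b) + (y*b+z) < n*r*(b*b)" "(\<tau>'*r+x')*(b*b) + (y'*b+z') < n*r*(b*b)"
      using bd by (intro pair_index_less; simp add: lt2)+
    moreover have "((\<tau>*r+x)*(b*b) + (y*b+z)) div (b*b) = \<tau>*r+x" "((\<tau>*r+x)*(b*b) + (y*b+z)) mod (b*b) = y*b+z"
      "((\<tau>'*r+x')*(b*b) + (y'*b+z')) div (b*b) = \<tau>'*r+x'" "((\<tau>'*r+x')*(b*b) + (y'*b+z')) mod (b*b) = y'*b+z'"
      using lt2 bd by auto
    ultimately show ?thesis using N M by (simp add: kron_def)
  qed
  finally show ?thesis .
qed

lemma four_indexE:
  fixes i n b r c :: nat
  assumes "i < n*b*(r*c)"
  obtains \<tau> y x z where "\<tau> < n" "y < b" "x < r" "z < c" "i = (\<tau>*b+y)*(r*c) + (x*c+z)"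
proof -
  obtain p q where pq: "p < n*b" "q < r*c" "i = p*(r*c) + q" using assms by (rule less_mult_indexE)
  obtain \<tau> y where 1: "\<tau> < n" "y < b" "p = \<tau>*b + y" using pq(1) by (rule less_mult_indexE)
  obtain x z where 2: "x < r" "z < c" "q = x*c + z" using pq(2) by (rule less_mult_indexE)
  show ?thesis by (rule that[OF 1(1,2) 2(1,2)]) (simp add: pq 1 2)
qed

lemma povm_swap_kron:
  assumes N: "povm (n*r) I N" and M: "povm (b*b) J M"
  shows "povm (n*b*(r*b)) (I \<times> J) (\<lambda>ij. swap_mid n r b b (kron (N (fst ij)) (M (snd ij))))"
  unfolding povm_def
proof (intro conjI ballI allI impI)
  fix ij assume "ij \<in> I \<times> J"
  then have NM: "psd (n*r) (N (fst ij))" "psd (b*b) (M (snd ij))" using povm_psd[OF N] povm_psd[OF M] by auto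
  define p where "p i = (i div (r*b) div b)*r + (i mod (r*b)) div b" for i
  define q where "q i = (i div (r*b) mod b)*b + i mod (r*b) mod b" for i
  have pq: "p i < n*r \<and> q i < b*b" if i: "i < n*b*(r*b)" for i
  proof -
    obtain \<tau> y x z where 1: "\<tau> < n" "y < b" "x < r" "z < b" "i = (\<tau>*b+y)*(r*b) + (x*b+z)"
      using i by (rule four_indexE)
    then show ?thesis using pair_index_less[of x r z b] by (simp add: p_def q_def pair_index_less)
  qed
  have "psd_on {..<n*b*(r*b)} (\<lambda>i j. N (fst ij) $$ (p i, p j) * M (snd ij) $$ (q i, q j))"
    using NM pq by (intro psd_on_prod[of "{..<n*r}" "{..<b*b}" "\<lambda>i j. N (fst ij) $$ (i,j)" "\<lambda>i j. M (snd ij) $$ (i,j)"])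
      (auto simp: psd_iff_psd_on)
  moreover have "psd_on {..<n*b*(r*b)} (\<lambda>i j. swap_mid n r b b (kron (N (fst ij)) (M (snd ij))) $$ (i,j))
      \<longleftrightarrow> psd_on {..<n*b*(r*b)} (\<lambda>i j. N (fst ij) $$ (p i, p j) * M (snd ij) $$ (q i, q j))"
  proof (rule psd_on_cong)
    fix i j assume "i \<in> {..<n*b*(r*b)}" "j \<in> {..<n*b*(r*b)}"
    then have ij: "i < n*b*(r*b)" "j < n*b*(r*b)" by auto
    obtain \<tau> y x z where 1: "\<tau> < n" "y < b" "x < r" "z < b" "i = (\<tau>*b+y)*(r*b) + (x*b+z)"
      using ij(1) by (rule four_indexE)
    obtain \<tau>' y' x' z' where 2: "\<tau>' < n" "y' < b" "x' < r" "z' < b" "j = (\<tau>'*b+y')*(r*b) + (x'*b+z')"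
      using ij(2) by (rule four_indexE)
    have "p i = \<tau>*r+x" "q i = y*b+z" "p j = \<tau>'*r+x'" "q j = y'*b+z'"
      using 1 2 pair_index_less[of x r z b] pair_index_less[of x' r z' b] by (auto simp: p_def q_def)
    then show "swap_mid n r b b (kron (N (fst ij)) (M (snd ij))) $$ (i,j) = N (fst ij) $$ (p i, p j) * M (snd ij) $$ (q i, q j)"
      using swap_kron_entry[OF psd_carrier[OF NM(1)] psd_carrier[OF NM(2)] 1(1-4) 2(1-4)] 1(5) 2(5) by simp
  qed
  ultimately show "psd (n*b*(r*b)) (swap_mid n r b b (kron (N (fst ij)) (M (snd ij))))"
    by (simp add: psd_iff_psd_on)
next
  fix i j assume ij: "i < n*b*(r*b)" "j < n*b*(r*b)"
  obtain \<tau> y x z where 1: "\<tau> < n" "y < b" "x < r" "z < b" "i = (\<tau>*b+y)*(r*b) + (x*b+z)"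
    using ij(1) by (rule four_indexE)
  obtain \<tau>' y' x' z' where 2: "\<tau>' < n" "y' < b" "x' < r" "z' < b" "j = (\<tau>'*b+y')*(r*b) + (x'*b+z')"
    using ij(2) by (rule four_indexE)
  have "(\<Sum>st\<in>I \<times> J. swap_mid n r b b (kron (N (fst st)) (M (snd st))) $$ (i,j))
      = (\<Sum>st\<in>I \<times> J. N (fst st) $$ (\<tau>*r+x, \<tau>'*r+x') * M (snd st) $$ (y*b+z, y'*b+z'))"
  proof (rule sum.cong[OF refl])
    fix st assume "st \<in> I \<times> J"
    then have NM: "psd (n*r) (N (fst st))" "psd (b*b) (M (snd st))" using povm_psd[OF N] povm_psd[OF M] by auto
    show "swap_mid n r b b (kron (N (fst st)) (M (snd st))) $$ (i,j) = N (fst st) $$ (\<tau>*r+x, \<tau>'*r+x') * M (snd st) $$ (y*b+z, y'*b+z')"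
      using swap_kron_entry[OF psd_carrier[OF NM(1)] psd_carrier[OF NM(2)] 1(1-4) 2(1-4)] 1(5) 2(5) by simp
  qed
  also have "\<dots> = (\<Sum>s\<in>I. N s $$ (\<tau>*r+x, \<tau>'*r+x')) * (\<Sum>t\<in>J. M t $$ (y*b+z, y'*b+z'))"
    by (simp add: sum_product sum.cartesian_product case_prod_unfold)
  also have "\<dots> = (if \<tau>*r+x = \<tau>'*r+x' then 1 else 0) * (if y*b+z = y'*b+z' then 1 else 0)"
    using 1 2 by (simp add: povm_sum[OF N] povm_sum[OF M] pair_index_less)
  also have "\<dots> = (if i = j then 1 else 0)"
    using 1 2 pair_index_less[of x r z b] pair_index_less[of x' r z' b] by (auto simp: pair_index_eq_iff)
  finally show "(\<Sum>st\<in>I \<times> J. swap_mid n r b b (kron (N (fst st)) (M (snd st))) $$ (i,j)) = (if i = j then 1 else 0)" .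
qed

text \<open>A map on U A1 meets only the N factor. A postprocessing can thus be absorbed into the
  free measurement while M stays fixed.\<close>

lemma tid_right_swap_kron:
  assumes g: "linmap m n g" and N: "N \<in> carrier_mat (m*r) (m*r)" and M: "M \<in> carrier_mat (b*b) (b*b)"
  shows "tid_right m n (b*(r*b)) g (swap_mid m r b b (kron N M)) = swap_mid n r b b (kron (tid_right m n r g N) M)"
proof (rule eq_matI)
  have dim: "dim_row (swap_mid n r b b Z) = n*b*(r*b)" "dim_col (swap_mid n r b b Z) = n*b*(r*b)" for Z
    using carrier_matD[OF swap_kron_carrier[of n r b b Z]] by blast+
  fix i j assume "i < dim_row (swap_mid n r b b (kron (tid_right m n r g N) M))" "j < dim_col (swap_mid n r b b (kron (tid_right m n r g N) M))"
  then have ij: "i < n*b*(r*b)" "j < n*b*(r*b)" by (auto simp: dim)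
  obtain \<tau> y x z where 1: "\<tau> < n" "y < b" "x < r" "z < b" "i = (\<tau>*b+y)*(r*b) + (x*b+z)"
    using ij(1) by (rule four_indexE)
  obtain \<tau>' y' x' z' where 2: "\<tau>' < n" "y' < b" "x' < r" "z' < b" "j = (\<tau>'*b+y')*(r*b) + (x'*b+z')"
    using ij(2) by (rule four_indexE)
  define w where "w = y*(r*b) + (x*b+z)"
  define w' where "w' = y'*(r*b) + (x'*b+z')"
  have w: "w < b*(r*b)" "w' < b*(r*b)" unfolding w_def w'_def using 1 2 by (auto intro!: pair_index_less)
  have i: "i = \<tau>*(b*(r*b)) + w" and j: "j = \<tau>'*(b*(r*b)) + w'"
    using 1 2 by (auto simp: w_def w'_def algebra_simps)
  let ?B = "mat m m (\<lambda>(p,q). N $$ (p*r+x, q*r+x'))"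
  have "mat m m (\<lambda>(p,q). swap_mid m r b b (kron N M) $$ (p*(b*(r*b)) + w, q*(b*(r*b)) + w')) = M $$ (y*b+z, y'*b+z') \<cdot>\<^sub>m ?B"
  proof (rule eq_matI)
    fix p q assume "p < dim_row (M $$ (y*b+z, y'*b+z') \<cdot>\<^sub>m ?B)" "q < dim_col (M $$ (y*b+z, y'*b+z') \<cdot>\<^sub>m ?B)"
    then have pq: "p < m" "q < m" by auto
    have e: "p*(b*(r*b)) + w = (p*b+y)*(r*b) + (x*b+z)" "q*(b*(r*b)) + w' = (q*b+y')*(r*b) + (x'*b+z')"
      by (auto simp: w_def w'_def algebra_simps)
    show "mat m m (\<lambda>(p,q). swap_mid m r b b (kron N M) $$ (p*(b*(r*b)) + w, q*(b*(r*b)) + w')) $$ (p,q) = (M $$ (y*b+z, y'*b+z') \<cdot>\<^sub>m ?B) $$ (p,q)"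
      using pq swap_kron_entry[OF N M pq(1) 1(2-4) pq(2) 2(2-4)] unfolding e[symmetric] by (simp add: mult.commute)
  qed auto
  then have "tid_right m n (b*(r*b)) g (swap_mid m r b b (kron N M)) $$ (i,j) = g (M $$ (y*b+z, y'*b+z') \<cdot>\<^sub>m ?B) $$ (\<tau>,\<tau>')"
    unfolding i j using tid_right_entry[OF 1(1) 2(1) w] by simp
  also have "\<dots> = M $$ (y*b+z, y'*b+z') * g ?B $$ (\<tau>,\<tau>')"
  proof -
    have "g (M $$ (y*b+z, y'*b+z') \<cdot>\<^sub>m ?B) = M $$ (y*b+z, y'*b+z') \<cdot>\<^sub>m g ?B"
      using g unfolding linmap_def by simp
    then show ?thesis using linmap_carrier[OF g, of ?B] 1 2 by simp
  qed
  also have "\<dots> = swap_mid n r b b (kron (tid_right m n r g N) M) $$ (i,j)"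
    unfolding 1(5) 2(5) swap_kron_entry[OF tid_right_carrier M 1(1-4) 2(1-4)]
    using tid_right_entry[OF 1(1) 2(1) 1(3) 2(3), of m g N] by simp
  finally show "tid_right m n (b*(r*b)) g (swap_mid m r b b (kron N M)) $$ (i,j) = swap_mid n r b b (kron (tid_right m n r g N) M) $$ (i,j)" .
qed (simp_all add: tid_right_def swap_mid_def mult.assoc)

text \<open>\<open>apply_sc\<close> without its postprocessing, which in a guessing game is part of
  the measurement N.\<close>

definition strat :: "nat \<Rightarrow> nat \<Rightarrow> nat \<Rightarrow> nat \<Rightarrow> nat \<Rightarrow> nat \<Rightarrow> (complex mat \<Rightarrow> complex mat) \<Rightarrow> (complex mat \<Rightarrow> complex mat) \<Rightarrow> complex mat \<Rightarrow> complex mat" where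
  "strat a0 a1 b0 b1 r0 u \<Phi> \<alpha> X = tid_left u (a0*b0) (a1*b1) \<Phi> (tid_right r0 (u*a0) b0 \<alpha> X)"

definition strat_value :: "nat \<Rightarrow> nat \<Rightarrow> nat \<Rightarrow> nat \<Rightarrow> nat \<Rightarrow> nat \<Rightarrow> nat \<Rightarrow> nat \<Rightarrow>
    (complex mat \<Rightarrow> complex mat) \<Rightarrow> (nat \<Rightarrow> nat \<Rightarrow> real) \<Rightarrow> (nat \<Rightarrow> nat \<Rightarrow> complex mat) \<Rightarrow>
    (nat \<Rightarrow> complex mat) \<Rightarrow> nat \<Rightarrow> (complex mat \<Rightarrow> complex mat) \<Rightarrow> (nat \<Rightarrow> complex mat) \<Rightarrow> real" where
  "strat_value a0 a1 b0 b1 r0 r1 k l \<Phi> lam rho M u \<alpha> N = (\<Sum>i<k. \<Sum>j<l. lam i j *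
       Re (trace (tid_right (r0*b0) (u*a1*b1) (r1*b1) (strat a0 a1 b0 b1 r0 u \<Phi> \<alpha>) (rho i j)
                  * swap_mid (u*a1) r1 b1 b1 (kron (N i) (M j)))))"

lemma pM_eq: "pM a0 a1 b0 b1 r0 r1 k l \<Phi> lam rho M =
  Sup {strat_value a0 a1 b0 b1 r0 r1 k l \<Phi> lam rho M u \<alpha> N | u \<alpha> N.
       0 < u \<and> channel r0 (u*a0) \<alpha> \<and> povm (u*a1*r1) {..<k} N}"
  unfolding pM_def strat_value_def strat_def[abs_def] ..

lemma channel_strat:
  assumes "channel (a0*b0) (a1*b1) \<Phi>" "channel r0 (u*a0) \<alpha>"
  shows "channel (r0*b0) (u*a1*b1) (strat a0 a1 b0 b1 r0 u \<Phi> \<alpha>)"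
proof -
  have 1: "channel (r0*b0) (u*(a0*b0)) (tid_right r0 (u*a0) b0 \<alpha>)"
    using channel_tid_right[OF assms(2), of b0] by (simp add: mult.assoc)
  have "channel (r0*b0) (u*(a1*b1)) (\<lambda>X. tid_left u (a0*b0) (a1*b1) \<Phi> (tid_right r0 (u*a0) b0 \<alpha> X))"
    by (rule channel_comp[OF 1 channel_tid_left[OF assms(1)]])
  then show ?thesis by (simp add: strat_def[abs_def] mult.assoc)
qed

text \<open>In the Heisenberg picture a strategy together with M is one joint measurement of the
  ensemble, so its value is nonnegative and cannot exceed the optimal success probability.\<close>

lemma strat_value_bounds:
  assumes \<Gamma>: "channel (a0*b0) (a1*b1) \<Gamma>" and \<alpha>: "channel r0 (u*a0) \<alpha>" and N: "povm (u*a1*r1) {..<k} N"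
    and M: "povm (b1*b1) {..<l} M" and E: "ensemble (r0*b0*r1*b1) k l lam rho"
  shows "0 \<le> strat_value a0 a1 b0 b1 r0 r1 k l \<Gamma> lam rho M u \<alpha> N"
    and "strat_value a0 a1 b0 b1 r0 r1 k l \<Gamma> lam rho M u \<alpha> N \<le> psucc (r0*b0*r1*b1) k l lam rho"
proof -
  let ?f = "strat a0 a1 b0 b1 r0 u \<Gamma> \<alpha>" and ?n = "r0*b0" and ?m = "u*a1*b1" and ?K = "r1*b1"
  have f: "channel ?n ?m ?f" by (rule channel_strat[OF \<Gamma> \<alpha>])
  define S where "S ij = swap_mid (u*a1) r1 b1 b1 (kron (N (fst ij)) (M (snd ij)))" for ij
  have S: "povm (?m*?K) ({..<k} \<times> {..<l}) S" unfolding S_def by (rule povm_swap_kron[OF N M])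
  define Q where "Q ij = tid_right ?m ?n ?K (dual_map ?n ?m ?f) (S ij)" for ij
  have Q: "povm (?n*?K) ({..<k} \<times> {..<l}) Q"
    unfolding Q_def
    by (rule povm_image[OF S cp_tid_right[OF cp_dual_map[OF channel_cp[OF f]]]])
      (rule tid_right_unital[OF linmap_dual_map dual_map_unital[OF f]])
  have rho: "psd (?n*?K) (rho i j)" "0 \<le> lam i j" if "i < k" "j < l" for i j
    using E that by (auto simp: ensemble_def density_def mult.assoc)
  have tr: "trace (tid_right ?n ?m ?K ?f (rho i j) * swap_mid (u*a1) r1 b1 b1 (kron (N i) (M j))) = trace (rho i j * Q (i,j))"
    if "i < k" "j < l" for i j
    unfolding Q_def S_def fst_conv snd_conv
    by (rule trace_tid_right_dual[OF channel_linmap[OF f] psd_carrier[OF rho(1)[OF that]] swap_kron_carrier])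
  have v: "strat_value a0 a1 b0 b1 r0 r1 k l \<Gamma> lam rho M u \<alpha> N = (\<Sum>i<k. \<Sum>j<l. lam i j * Re (trace (rho i j * Q (i,j))))"
    unfolding strat_value_def by (intro sum.cong refl) (simp add: tr)
  show "0 \<le> strat_value a0 a1 b0 b1 r0 r1 k l \<Gamma> lam rho M u \<alpha> N"
    unfolding v
  proof (intro sum_nonneg mult_nonneg_nonneg)
    fix i j assume "i \<in> {..<k}" "j \<in> {..<l}"
    then show "0 \<le> lam i j" "0 \<le> Re (trace (rho i j * Q (i,j)))"
      using rho povm_psd[OF Q] by (auto intro!: trace_mult_psd_nonneg[of "?n*?K"])
  qed
  show "strat_value a0 a1 b0 b1 r0 r1 k l \<Gamma> lam rho M u \<alpha> N \<le> psucc (r0*b0*r1*b1) k l lam rho"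
    unfolding v using psucc_upper[OF E, of Q] Q by (simp add: mult.assoc)
qed

lemma pM_upper:
  assumes \<Phi>: "channel (a0*b0) (a1*b1) \<Phi>" and M: "povm (b1*b1) {..<l} M" and E: "ensemble (r0*b0*r1*b1) k l lam rho"
    and s: "0 < u" "channel r0 (u*a0) \<alpha>" "povm (u*a1*r1) {..<k} N"
  shows "strat_value a0 a1 b0 b1 r0 r1 k l \<Phi> lam rho M u \<alpha> N \<le> pM a0 a1 b0 b1 r0 r1 k l \<Phi> lam rho M"
  unfolding pM_eq
proof (rule cSup_upper)
  show "bdd_above {strat_value a0 a1 b0 b1 r0 r1 k l \<Phi> lam rho M u \<alpha> N | u \<alpha> N.
       0 < u \<and> channel r0 (u*a0) \<alpha> \<and> povm (u*a1*r1) {..<k} N}"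
    using strat_value_bounds(2)[OF \<Phi> _ _ M E] by (intro bdd_aboveI) blast
qed (use s in blast)

text \<open>The value of a strategy is linear in the channel, so the relation behind
  \<open>base_close\<close> passes to values.\<close>

lemma strat_value_affine:
  assumes eq: "\<And>X k l. X \<in> carrier_mat (a0*b0) (a0*b0) \<Longrightarrow> k < a1*b1 \<Longrightarrow> l < a1*b1 \<Longrightarrow>
       \<Phi> X $$ (k,l) + of_real c * \<Gamma>2 X $$ (k,l) = \<Psi> X $$ (k,l) + of_real c * \<Gamma>1 X $$ (k,l)"
  shows "strat_value a0 a1 b0 b1 r0 r1 k l \<Phi> lam rho M u \<alpha> N + c * strat_value a0 a1 b0 b1 r0 r1 k l \<Gamma>2 lam rho M u \<alpha> N
    = strat_value a0 a1 b0 b1 r0 r1 k l \<Psi> lam rho M u \<alpha> N + c * strat_value a0 a1 b0 b1 r0 r1 k l \<Gamma>1 lam rho M u \<alpha> N"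
proof -
  let ?F = "\<lambda>\<Phi>. tid_right (r0*b0) (u*a1*b1) (r1*b1) (strat a0 a1 b0 b1 r0 u \<Phi> \<alpha>)"
  let ?d = "u*a1*b1*(r1*b1)"
  have e: "?F \<Phi> Y $$ (i,j) + of_real c * ?F \<Gamma>2 Y $$ (i,j) = ?F \<Psi> Y $$ (i,j) + of_real c * ?F \<Gamma>1 Y $$ (i,j)"
    if ij: "i < ?d" "j < ?d" for i j Y
  proof -
    obtain a z where az: "a < u*a1*b1" "z < r1*b1" "i = a*(r1*b1) + z" using ij(1) by (rule less_mult_indexE)
    obtain b w where bw: "b < u*a1*b1" "w < r1*b1" "j = b*(r1*b1) + w" using ij(2) by (rule less_mult_indexE)
    show ?thesis
      unfolding az(3) bw(3) tid_right_entry[OF az(1) bw(1) az(2) bw(2)] strat_def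
      by (rule tid_left_affine_relation[OF eq]) (use az bw in \<open>simp_all add: mult.assoc\<close>)
  qed
  have t: "Re (trace (?F \<Phi> Y * Z)) + c * Re (trace (?F \<Gamma>2 Y * Z)) = Re (trace (?F \<Psi> Y * Z)) + c * Re (trace (?F \<Gamma>1 Y * Z))"
    if Z: "Z \<in> carrier_mat ?d ?d" for Y Z
  proof -
    have "trace (?F \<Phi> Y * Z) + of_real c * trace (?F \<Gamma>2 Y * Z)
        = (\<Sum>i<?d. \<Sum>j<?d. (?F \<Phi> Y $$ (i,j) + of_real c * ?F \<Gamma>2 Y $$ (i,j)) * Z $$ (j,i))"
      unfolding trace_mult[OF tid_right_carrier Z] by (simp add: sum_distrib_left sum.distrib distrib_right mult.assoc)
    also have "\<dots> = (\<Sum>i<?d. \<Sum>j<?d. (?F \<Psi> Y $$ (i,j) + of_real c * ?F \<Gamma>1 Y $$ (i,j)) * Z $$ (j,i))"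
      by (intro sum.cong refl) (simp add: e)
    also have "\<dots> = trace (?F \<Psi> Y * Z) + of_real c * trace (?F \<Gamma>1 Y * Z)"
      unfolding trace_mult[OF tid_right_carrier Z] by (simp add: sum_distrib_left sum.distrib distrib_right mult.assoc)
    finally have "Re (trace (?F \<Phi> Y * Z) + of_real c * trace (?F \<Gamma>2 Y * Z)) = Re (trace (?F \<Psi> Y * Z) + of_real c * trace (?F \<Gamma>1 Y * Z))"
      by (rule arg_cong)
    then show ?thesis by simp
  qed
  show ?thesis
    unfolding strat_value_def sum_distrib_left sum.distrib[symmetric]
  proof (intro sum.cong refl)
    fix i j
    let ?Z = "swap_mid (u*a1) r1 b1 b1 (kron (N i) (M j))"
    show "lam i j * Re (trace (?F \<Phi> (rho i j) * ?Z)) + c * (lam i j * Re (trace (?F \<Gamma>2 (rho i j) * ?Z)))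
        = lam i j * Re (trace (?F \<Psi> (rho i j) * ?Z)) + c * (lam i j * Re (trace (?F \<Gamma>1 (rho i j) * ?Z)))"
      using arg_cong[OF t[OF swap_kron_carrier, of "rho i j" "kron (N i) (M j)"], of "\<lambda>x. lam i j * x"]
      by (simp only: distrib_left mult.left_commute)
  qed
qed

text \<open>A strategy for the image of \<Phi> under a superchannel is a strategy for \<Phi>: pre is
  appended to \<alpha>, and the dual of post is absorbed into N.\<close>

lemma strat_value_comp:
  assumes s: "superchannel a0 a1 a0' a1' u pre post" and \<Phi>: "channel (a0*b0) (a1*b1) \<Phi>"
    and \<alpha>: "0 < v" "channel r0 (v*a0') \<alpha>" and N: "povm (v*a1'*r1) {..<k} N" and M: "povm (b1*b1) {..<l} M"
  shows "\<exists>w \<alpha>' N'. 0 < w \<and> channel r0 (w*a0) \<alpha>' \<and> povm (w*a1*r1) {..<k} N' \<and>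
    strat_value a0' a1' b0 b1 r0 r1 k l (apply_sc a0 a1 a0' a1' b0 b1 u pre post \<Phi>) lam rho M v \<alpha> N
     = strat_value a0 a1 b0 b1 r0 r1 k l \<Phi> lam rho M w \<alpha>' N'"
proof -
  note c = s[unfolded superchannel_def]
  let ?n = "v*u*a1" and ?m = "v*a1'"
  define P where "P = tid_left v (u*a1) a1' post"
  have P: "channel ?n ?m P" using channel_tid_left[of "u*a1" a1' post v] c by (simp add: P_def mult.assoc)
  define \<alpha>' where "\<alpha>' X = tid_left v a0' (u*a0) pre (\<alpha> X)" for X
  have \<alpha>': "channel r0 (v*u*a0) \<alpha>'"
    using channel_comp[OF \<alpha>(2) channel_tid_left[of a0' "u*a0" pre v]] c by (simp add: \<alpha>'_def[abs_def] mult.assoc)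
  define N' where "N' i = tid_right ?m ?n r1 (dual_map ?n ?m P) (N i)" for i
  have N': "povm (?n*r1) {..<k} N'"
    unfolding N'_def
    by (rule povm_image[OF N cp_tid_right[OF cp_dual_map[OF channel_cp[OF P]]]])
      (rule tid_right_unital[OF linmap_dual_map dual_map_unital[OF P]])
  let ?g = "strat a0 a1 b0 b1 r0 (v*u) \<Phi> \<alpha>'"
  have g: "channel (r0*b0) (?n*b1) ?g" by (rule channel_strat[OF \<Phi> \<alpha>'])
  have st: "strat a0' a1' b0 b1 r0 v (apply_sc a0 a1 a0' a1' b0 b1 u pre post \<Phi>) \<alpha> X = tid_right ?n ?m b1 P (?g X)" for X
  proof -
    have 1: "tid_right r0 (v*(u*a0)) b0 \<alpha>' X
      = tid_right (v*a0') (v*(u*a0)) b0 (tid_left v a0' (u*a0) pre) (tid_right r0 (v*a0') b0 \<alpha> X)"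
      unfolding \<alpha>'_def[abs_def] by (rule tid_right_comp[symmetric]) (rule channel_carrier[OF \<alpha>(2)])
    show ?thesis
      unfolding strat_def P_def mult.assoc 1
      by (rule tid_left_apply_sc) (rule channel_carrier[OF \<Phi>])
  qed
  have "trace (tid_right (r0*b0) (?m*b1) (r1*b1) (strat a0' a1' b0 b1 r0 v (apply_sc a0 a1 a0' a1' b0 b1 u pre post \<Phi>) \<alpha>) Y
          * swap_mid ?m r1 b1 b1 (kron (N i) (M j)))
      = trace (tid_right (r0*b0) (?n*b1) (r1*b1) ?g Y * swap_mid ?n r1 b1 b1 (kron (N' i) (M j)))"
    if ij: "i < k" "j < l" for i j Y
  proof -
    have Nc: "N i \<in> carrier_mat (?m*r1) (?m*r1)" and Mc: "M j \<in> carrier_mat (b1*b1) (b1*b1)"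
      using povm_psd[OF N, of i] povm_psd[OF M, of j] ij psd_carrier by auto
    let ?Y = "tid_right (r0*b0) (?n*b1) (r1*b1) ?g Y"
    have Yc: "?Y \<in> carrier_mat (?n*(b1*(r1*b1))) (?n*(b1*(r1*b1)))"
      using tid_right_carrier[of "r0*b0" "?n*b1" "r1*b1" ?g Y] by (simp only: mult.assoc)
    have Sc: "swap_mid ?m r1 b1 b1 (kron (N i) (M j)) \<in> carrier_mat (?m*(b1*(r1*b1))) (?m*(b1*(r1*b1)))"
      using swap_kron_carrier[of ?m r1 b1 b1 "kron (N i) (M j)"] by (simp only: mult.assoc)
    have "tid_right (r0*b0) (?m*b1) (r1*b1) (strat a0' a1' b0 b1 r0 v (apply_sc a0 a1 a0' a1' b0 b1 u pre post \<Phi>) \<alpha>) Y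
        = tid_right (r0*b0) (?m*b1) (r1*b1) (\<lambda>X. tid_right ?n ?m b1 P (?g X)) Y"
      using st by presburger
    also have "\<dots> = tid_right (?n*b1) (?m*b1) (r1*b1) (tid_right ?n ?m b1 P) ?Y"
      by (rule tid_right_comp[symmetric]) (rule channel_carrier[OF g])
    also have "\<dots> = tid_right ?n ?m (b1*(r1*b1)) P ?Y" by (rule tid_right_tid_right)
    finally have "trace (tid_right (r0*b0) (?m*b1) (r1*b1) (strat a0' a1' b0 b1 r0 v (apply_sc a0 a1 a0' a1' b0 b1 u pre post \<Phi>) \<alpha>) Y
          * swap_mid ?m r1 b1 b1 (kron (N i) (M j)))
        = trace (?Y * tid_right ?m ?n (b1*(r1*b1)) (dual_map ?n ?m P) (swap_mid ?m r1 b1 b1 (kron (N i) (M j))))"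
      using trace_tid_right_dual[OF channel_linmap[OF P] Yc Sc] by simp
    also have "tid_right ?m ?n (b1*(r1*b1)) (dual_map ?n ?m P) (swap_mid ?m r1 b1 b1 (kron (N i) (M j)))
        = swap_mid ?n r1 b1 b1 (kron (N' i) (M j))"
      unfolding N'_def by (rule tid_right_swap_kron[OF linmap_dual_map Nc Mc])
    finally show ?thesis .
  qed
  then have "strat_value a0' a1' b0 b1 r0 r1 k l (apply_sc a0 a1 a0' a1' b0 b1 u pre post \<Phi>) lam rho M v \<alpha> N
     = strat_value a0 a1 b0 b1 r0 r1 k l \<Phi> lam rho M (v*u) \<alpha>' N'"
    unfolding strat_value_def by (intro sum.cong refl) simp
  then show ?thesis using \<alpha>' N' \<alpha>(1) c by (intro exI[of _ "v*u"] exI[of _ \<alpha>'] exI[of _ N']) simp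
qed

lemma psd_one: "psd d (1\<^sub>m d)"
proof -
  have "psd_on {..<d} (\<lambda>i j. (1\<^sub>m d :: complex mat) $$ (i,j)) \<longleftrightarrow> psd_on {..<d} (\<lambda>i j. if i = j then complex_of_real 1 else 0)"
    by (rule psd_on_cong) auto
  then show ?thesis using psd_on_delta[of 1 "{..<d}"] by (simp add: psd_iff_psd_on)
qed

lemma povm_exists:
  fixes k :: nat
  assumes "0 < k"
  shows "\<exists>N. povm d {..<k} N"
proof (intro exI)
  have p0: "psd d (0\<^sub>m d d)" by (simp add: psd_def)
  show "povm d {..<k} (\<lambda>i. if i = 0 then 1\<^sub>m d else 0\<^sub>m d d)"
    unfolding povm_def
  proof (intro conjI ballI allI impI)
    fix a b assume ab: "a < d" "b < d"
    have "(\<Sum>x<k. (if x = 0 then 1\<^sub>m d else 0\<^sub>m d d) $$ (a,b)) = (\<Sum>x<k. if x = 0 then if a = b then 1 else 0 else (0::complex))"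
      using ab by (intro sum.cong) auto
    then show "(\<Sum>x<k. (if x = 0 then 1\<^sub>m d else 0\<^sub>m d d) $$ (a,b)) = (if a = b then 1 else (0::complex))"
      using assms by simp
  qed (simp add: p0 psd_one)
qed

section \<open>From (i) to (iii)\<close>

context channel_pair
begin

lemma cond_iii_if_delta_le:
  assumes d: "delta a0 a1 a0' a1' b0 b1 \<Phi>1 \<Phi>2 \<le> \<epsilon>" and \<epsilon>: "0 \<le> \<epsilon>"
  shows "cond_iii a0 a1 a0' a1' b0 b1 \<Phi>1 \<Phi>2 \<epsilon> r0 r1"
  unfolding cond_iii_def
proof (intro allI impI, rule le_if_le_eps)
  fix k l lam rho M and \<eta> :: real
  assume E: "ensemble (r0*b0*r1*b1) k l lam rho" and M: "povm (b1*b1) {..<l} M" and \<eta>: "0 < \<eta>"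
  obtain u pre post where s: "superchannel a0 a1 a0' a1' u pre post"
    and bc: "base_close ((\<epsilon> + \<eta>) / 2) (a0'*b0) (a1'*b1) (apply_sc a0 a1 a0' a1' b0 b1 u pre post \<Phi>1) \<Phi>2"
    using delta_le_close[OF d \<eta>] by blast
  let ?\<Psi> = "apply_sc a0 a1 a0' a1' b0 b1 u pre post \<Phi>1" and ?c = "(\<epsilon> + \<eta>) / 2"
  obtain \<Gamma>1 \<Gamma>2 where g: "channel (a0'*b0) (a1'*b1) \<Gamma>1" "channel (a0'*b0) (a1'*b1) \<Gamma>2"
    and eq: "\<And>X k l. X \<in> carrier_mat (a0'*b0) (a0'*b0) \<Longrightarrow> k < a1'*b1 \<Longrightarrow> l < a1'*b1 \<Longrightarrow>
       \<Phi>2 X $$ (k,l) + of_real ?c * \<Gamma>2 X $$ (k,l) = ?\<Psi> X $$ (k,l) + of_real ?c * \<Gamma>1 X $$ (k,l)"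
    using bc unfolding base_close_def by blast
  have c: "0 \<le> ?c" using \<epsilon> \<eta> by simp
  \<comment> \<open>Without outcomes no measurement N would be available in general; the weights of
    an ensemble sum to 1, which excludes this.\<close>
  have "k \<noteq> 0"
  proof
    assume "k = 0"
    then show False using E by (simp add: ensemble_def)
  qed
  show "pM a0' a1' b0 b1 r0 r1 k l \<Phi>2 lam rho M \<le> pM a0 a1 b0 b1 r0 r1 k l \<Phi>1 lam rho M + ?c * psucc (r0*b0*r1*b1) k l lam rho"
    unfolding pM_eq[of a0' a1']
  proof (rule cSup_least)
    obtain \<alpha> N where "0 < (1::nat)" "channel r0 (1*a0') \<alpha>" "povm (1*a1'*r1) {..<k} N"
      using channel_exists[of "1*a0'" r0] povm_exists[of k "1*a1'*r1"] pos \<open>k \<noteq> 0\<close> by auto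
    then show "{strat_value a0' a1' b0 b1 r0 r1 k l \<Phi>2 lam rho M u \<alpha> N | u \<alpha> N.
       0 < u \<and> channel r0 (u*a0') \<alpha> \<and> povm (u*a1'*r1) {..<k} N} \<noteq> {}"
      by blast
    fix x assume "x \<in> {strat_value a0' a1' b0 b1 r0 r1 k l \<Phi>2 lam rho M u \<alpha> N | u \<alpha> N.
       0 < u \<and> channel r0 (u*a0') \<alpha> \<and> povm (u*a1'*r1) {..<k} N}"
    then obtain v \<alpha> N where x: "x = strat_value a0' a1' b0 b1 r0 r1 k l \<Phi>2 lam rho M v \<alpha> N"
      and v: "0 < v" "channel r0 (v*a0') \<alpha>" "povm (v*a1'*r1) {..<k} N" by blast
    let ?V = "\<lambda>\<Gamma>. strat_value a0' a1' b0 b1 r0 r1 k l \<Gamma> lam rho M v \<alpha> N"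
    obtain w \<alpha>' N' where w: "0 < w" "channel r0 (w*a0) \<alpha>'" "povm (w*a1*r1) {..<k} N'"
      and eqV: "?V ?\<Psi> = strat_value a0 a1 b0 b1 r0 r1 k l \<Phi>1 lam rho M w \<alpha>' N'"
      using strat_value_comp[OF s ch1 v M] by blast
    \<comment> \<open>As for pairings: drop the nonnegative \<Gamma>2 term and bound the \<Gamma>1
      term, here by the success probability.\<close>
    have "?V \<Phi>2 + ?c * ?V \<Gamma>2 = ?V ?\<Psi> + ?c * ?V \<Gamma>1" by (rule strat_value_affine[OF eq])
    moreover have "0 \<le> ?c * ?V \<Gamma>2" using c strat_value_bounds(1)[OF g(2) v(2,3) M E] by simp
    moreover have "?c * ?V \<Gamma>1 \<le> ?c * psucc (r0*b0*r1*b1) k l lam rho"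
      using c strat_value_bounds(2)[OF g(1) v(2,3) M E] by (rule mult_left_mono[rotated])
    moreover have "?V ?\<Psi> \<le> pM a0 a1 b0 b1 r0 r1 k l \<Phi>1 lam rho M"
      unfolding eqV by (rule pM_upper[OF ch1 M E w])
    ultimately show "x \<le> pM a0 a1 b0 b1 r0 r1 k l \<Phi>1 lam rho M + ?c * psucc (r0*b0*r1*b1) k l lam rho"
      unfolding x by linarith
  qed
qed

end

section \<open>Bell measurements and rotated ensembles\<close>

text \<open>A unitary operator basis. For d*d operators orthogonality is equivalent to completeness,
  and completeness is the form that makes the Bell projectors sum to the identity.\<close>

definition unitary_basis :: "nat \<Rightarrow> (nat \<Rightarrow> nat \<Rightarrow> nat \<Rightarrow> complex) \<Rightarrow> bool" where
  "unitary_basis d U \<longleftrightarrow>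
     (\<forall>i<d*d. \<forall>a<d. \<forall>c<d. (\<Sum>b<d. cnj (U i b a) * U i b c) = (if a = c then 1 else 0)) \<and>
     (\<forall>a<d. \<forall>b<d. \<forall>c<d. \<forall>e<d. (\<Sum>i<d*d. U i a b * cnj (U i c e)) = (if a = c \<and> b = e then of_nat d else 0))"

lemma add_mod_eq_iff:
  fixes a b p d :: nat
  assumes "a < d" "b < d" "p < d"
  shows "(b + p) mod d = a \<longleftrightarrow> p = (a + d - b) mod d"
proof (cases "b + p < d")
  case True
  then show ?thesis using assms by (cases "b \<le> a") (auto simp: mod_if)
next
  case False
  then have "(b + p) mod d = b + p - d" using assms by (simp add: mod_if)
  then show ?thesis using assms False by (cases "b \<le> a") (auto simp: mod_if)
qed

text \<open>The Weyl operators \<open>X\<^sup>p Z\<^sup>q\<close>, indexed by \<open>p * d + q\<close>.\<close>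
lemma unitary_basis_exists:
  assumes d: "0 < d"
  shows "\<exists>U. unitary_basis d U"
proof -
  define z where "z b = cis (2 * pi * real b / real d)" for b
  have zn: "z b * cnj (z b) = 1" for b by (simp add: z_def cis_cnj cis_mult)
  have zd: "z b ^ d = 1" for b
    using d by (simp add: z_def DeMoivre mult.commute) (metis cis_2pi mult.commute DeMoivre power_one mult.left_commute)
  have inj: "z b \<noteq> z e" if "b < d" "e < d" "b \<noteq> e" for b e
    using bij_betw_roots_unity[OF d] that unfolding bij_betw_def inj_on_def z_def by blast
  define U where "U i a b = (if a = (b + i div d) mod d then z b ^ (i mod d) else 0)" for i a b
  have "(\<Sum>b<d. cnj (U i b a) * U i b c) = (if a = c then 1 else 0)" if i: "i < d*d" and ac: "a < d" "c < d" for i a c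
  proof -
    define p where "p = i div d"
    define q where "q = i mod d"
    have p: "p < d" using i by (simp add: p_def less_mult_imp_div_less)
    have eq: "(a + p) mod d = (c + p) mod d \<longleftrightarrow> a = c"
    proof
      assume h: "(a + p) mod d = (c + p) mod d"
      have "a = ((a + p) mod d + d - p) mod d" "c = ((c + p) mod d + d - p) mod d"
        using add_mod_eq_iff[of "(a + p) mod d" d p a] add_mod_eq_iff[of "(c + p) mod d" d p c] ac p d
        by (simp_all add: add.commute)
      then show "a = c" unfolding h by simp
    qed simp
    have "(\<Sum>b<d. cnj (U i b a) * U i b c) = (\<Sum>b<d. if b = (a + p) mod d then if a = c then 1 else 0 else 0)"
    proof (intro sum.cong refl)
      fix b
      show "cnj (U i b a) * U i b c = (if b = (a + p) mod d then if a = c then 1 else 0 else 0)"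
        using eq zn[of a] by (auto simp: U_def p_def[symmetric] power_mult_distrib[symmetric] mult.commute)
    qed
    then show ?thesis using d by simp
  qed
  moreover have "(\<Sum>i<d*d. U i a b * cnj (U i c e)) = (if a = c \<and> b = e then of_nat d else 0)"
    if ac: "a < d" "b < d" "c < d" "e < d" for a b c e
  proof -
    have "(\<Sum>i<d*d. U i a b * cnj (U i c e))
        = (\<Sum>p<d. \<Sum>q<d. (if (b + p) mod d = a \<and> (e + p) mod d = c then (z b * cnj (z e)) ^ q else 0))"
      unfolding sum_lessThan_mult by (intro sum.cong refl) (auto simp: U_def power_mult_distrib)
    also have "\<dots> = (\<Sum>p<d. if (b + p) mod d = a \<and> (e + p) mod d = c then \<Sum>q<d. (z b * cnj (z e)) ^ q else 0)"
      by (intro sum.cong refl) auto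
    also have "(\<Sum>q<d. (z b * cnj (z e)) ^ q) = (if b = e then of_nat d else 0)"
    proof (cases "b = e")
      case True
      then show ?thesis by (simp add: zn)
    next
      case False
      \<comment> \<open>The quotient of two distinct d-th roots of unity is a nontrivial one, so its
        geometric sum vanishes.\<close>
      have "z b * cnj (z e) \<noteq> 1"
      proof
        assume h: "z b * cnj (z e) = 1"
        have "z b = z b * (z e * cnj (z e))" unfolding zn by simp
        also have "\<dots> = (z b * cnj (z e)) * z e" by (simp only: mult_ac)
        finally have "z b = z e" unfolding h by simp
        then show False using inj ac False by blast
      qed
      moreover have "(z b * cnj (z e)) ^ d = 1" by (simp add: power_mult_distrib zd flip: complex_cnj_power)
      ultimately show ?thesis using geometric_sum[of "z b * cnj (z e)" d] False by simp
    qed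
    \<comment> \<open>Exactly one shift p carries b to a, and it carries e = b to c only if c =
      a.\<close>
    also have "(\<Sum>p<d. if (b + p) mod d = a \<and> (e + p) mod d = c then (if b = e then of_nat d else 0) else 0)
        = (\<Sum>p<d. if p = (a + d - b) mod d then if a = c \<and> b = e then complex_of_nat d else 0 else 0)"
      using ac by (intro sum.cong refl) (auto simp: add_mod_eq_iff[symmetric])
    also have "\<dots> = (if a = c \<and> b = e then of_nat d else 0)" using d by simp
    finally show ?thesis .
  qed
  ultimately have "unitary_basis d U" unfolding unitary_basis_def by blast
  then show ?thesis by blast
qed

lemma orthonormal_rows:
  fixes U :: "nat \<Rightarrow> nat \<Rightarrow> complex"
  assumes "\<And>a c. a < d \<Longrightarrow> c < d \<Longrightarrow> (\<Sum>b<d. cnj (U b a) * U b c) = (if a = c then 1 else 0)"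
    and "a < d" "c < d"
  shows "(\<Sum>b<d. U a b * cnj (U c b)) = (if a = c then 1 else 0)"
proof -
  let ?A = "mat d d (\<lambda>(a,b). cnj (U b a))"
  have "unitary d ?A" unfolding unitary_iff using assms(1) by simp
  from unitary_cols[OF this assms(2,3)] show ?thesis using assms(2,3) by simp
qed

text \<open>Conjugation of a matrix by W, given through its rank one Choi kernel.\<close>

definition conj_map :: "nat \<Rightarrow> (nat \<Rightarrow> nat \<Rightarrow> complex) \<Rightarrow> complex mat \<Rightarrow> complex mat" where
  "conj_map d W = kmap d d (\<lambda>x y. W (fst x) (snd x) * cnj (W (fst y) (snd y)))"

lemma channel_conj_map:
  assumes "\<And>a c. a < d \<Longrightarrow> c < d \<Longrightarrow> (\<Sum>b<d. cnj (W b a) * W b c) = (if a = c then 1 else 0)"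
  shows "channel d d (conj_map d W)"
  unfolding conj_map_def
proof (rule channel_kmap)
  show "psd_on ({..<d} \<times> {..<d}) (\<lambda>x y. W (fst x) (snd x) * cnj (W (fst y) (snd y)))"
    by (rule psd_on_rank_one)
  fix i j assume ij: "i < d" "j < d"
  show "(\<Sum>k<d. W (fst (k,i)) (snd (k,i)) * cnj (W (fst (k,j)) (snd (k,j)))) = (if i = j then 1 else 0)"
    using assms[OF ij(2,1)] by (auto simp: mult.commute)
qed

lemma dual_conj_map_entry:
  assumes "w < d" "w' < d"
  shows "dual_map d d (conj_map d W) Z $$ (w,w') = (\<Sum>k<d. \<Sum>l<d. W k w' * cnj (W l w) * Z $$ (l,k))"
  using assms ckern_kmap[of "(_, w')" d d "(_, w)"] by (simp add: dual_map_def conj_map_def kmap_def sum_unitmat)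

lemma trace_tid_left_dual:
  assumes f: "linmap n m f" and Y: "Y \<in> carrier_mat (K*n) (K*n)" and Z: "Z \<in> carrier_mat (K*m) (K*m)"
  shows "trace (tid_left K n m f Y * Z) = trace (Y * tid_left K m n (dual_map n m f) Z)"
proof -
  define By where "By z w = mat n n (\<lambda>(p,q). Y $$ (z*n + p, w*n + q))" for z w
  define Bz where "Bz z w = mat m m (\<lambda>(p,q). Z $$ (z*m + p, w*m + q))" for z w
  have c: "By z w \<in> carrier_mat n n" "Bz z w \<in> carrier_mat m m" for z w by (auto simp: By_def Bz_def)
  have reorder: "(\<Sum>z<K. \<Sum>a<p. \<Sum>w<K. \<Sum>b<p. F a z b w) = (\<Sum>z<K. \<Sum>w<K. \<Sum>a<p. \<Sum>b<p. F a z b w)"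
    for p :: nat and F :: "nat \<Rightarrow> nat \<Rightarrow> nat \<Rightarrow> nat \<Rightarrow> complex"
    by (intro sum.cong[OF refl] sum.swap)
  have "trace (tid_left K n m f Y * Z) = (\<Sum>z<K. \<Sum>a<m. \<Sum>w<K. \<Sum>b<m. f (By z w) $$ (a,b) * Bz w z $$ (b,a))"
    unfolding trace_mult[OF tid_left_carrier Z] sum_lessThan_mult
    by (intro sum.cong refl) (simp add: tid_left_entry By_def Bz_def)
  also have "\<dots> = (\<Sum>z<K. \<Sum>w<K. trace (f (By z w) * Bz w z))"
    unfolding reorder trace_mult[OF linmap_carrier[OF f c(1)] c(2)] ..
  also have "\<dots> = (\<Sum>z<K. \<Sum>w<K. trace (By z w * dual_map n m f (Bz w z)))"
    by (simp add: trace_dual_map[OF f c])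
  also have "\<dots> = (\<Sum>z<K. \<Sum>a<n. \<Sum>w<K. \<Sum>b<n. By z w $$ (a,b) * dual_map n m f (Bz w z) $$ (b,a))"
    unfolding reorder trace_mult[OF c(1) linmap_carrier[OF linmap_dual_map c(2)]] ..
  also have "\<dots> = trace (Y * tid_left K m n (dual_map n m f) Z)"
    unfolding trace_mult[OF Y tid_left_carrier] sum_lessThan_mult
    by (intro sum.cong refl) (simp add: tid_left_entry By_def Bz_def)
  finally show ?thesis .
qed

text \<open>Maps on different tensor factors commute; this lets a rotation of R1 B1 be postponed
  until after the strategy has acted on R0 B0.\<close>

lemma tid_right_tid_left_commute:
  assumes f: "linmap n m f" and g: "linmap s t g" and Y: "Y \<in> carrier_mat (n*s) (n*s)"
  shows "tid_right n m t f (tid_left n s t g Y) = tid_left m s t g (tid_right n m s f Y)"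
proof (rule eq_matI)
  fix i j assume "i < dim_row (tid_left m s t g (tid_right n m s f Y))" "j < dim_col (tid_left m s t g (tid_right n m s f Y))"
  then have ij: "i < m*t" "j < m*t" by (auto simp: tid_left_def)
  obtain k a where ka: "k < m" "a < t" "i = k*t + a" using ij(1) by (rule less_mult_indexE)
  obtain l b where lb: "l < m" "b < t" "j = l*t + b" using ij(2) by (rule less_mult_indexE)
  have e1: "tid_left n s t g Y $$ (p*t+a, q*t+b) = (\<Sum>w<s. \<Sum>w'<s. Y $$ (p*s+w, q*s+w') * g (unitmat s w w') $$ (a,b))"
    if "p < n" "q < n" for p q
    using that ka lb linmap_expand[OF g, of "mat s s (\<lambda>(w,w'). Y $$ (p*s+w, q*s+w'))" a b] by (simp add: tid_left_entry)
  have e2: "tid_right n m s f Y $$ (k*s+w, l*s+w') = (\<Sum>p<n. \<Sum>q<n. Y $$ (p*s+w, q*s+w') * f (unitmat n p q) $$ (k,l))"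
    if "w < s" "w' < s" for w w'
    using that ka lb linmap_expand[OF f, of "mat n n (\<lambda>(p,q). Y $$ (p*s+w, q*s+w'))" k l] by (simp add: tid_right_entry)
  have "tid_right n m t f (tid_left n s t g Y) $$ (i,j)
      = (\<Sum>p<n. \<Sum>q<n. tid_left n s t g Y $$ (p*t+a, q*t+b) * f (unitmat n p q) $$ (k,l))"
    unfolding ka(3) lb(3) tid_right_entry[OF ka(1) lb(1) ka(2) lb(2)]
    using linmap_expand[OF f, of "mat n n (\<lambda>(p,q). tid_left n s t g Y $$ (p*t+a, q*t+b))" k l] ka lb by simp
  also have "\<dots> = (\<Sum>p<n. \<Sum>q<n. \<Sum>w<s. \<Sum>w'<s. Y $$ (p*s+w, q*s+w') * g (unitmat s w w') $$ (a,b) * f (unitmat n p q) $$ (k,l))"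
    by (intro sum.cong refl) (simp add: e1 sum_distrib_right)
  also have "\<dots> = (\<Sum>w<s. \<Sum>w'<s. \<Sum>p<n. \<Sum>q<n. Y $$ (p*s+w, q*s+w') * g (unitmat s w w') $$ (a,b) * f (unitmat n p q) $$ (k,l))"
    by (rule sum_swap_pairs)
  also have "\<dots> = (\<Sum>w<s. \<Sum>w'<s. tid_right n m s f Y $$ (k*s+w, l*s+w') * g (unitmat s w w') $$ (a,b))"
    by (intro sum.cong refl) (simp add: e2 sum_distrib_left sum_distrib_right mult_ac)
  also have "\<dots> = tid_left m s t g (tid_right n m s f Y) $$ (i,j)"
    unfolding ka(3) lb(3) tid_left_entry[OF ka(2) lb(2) ka(1) lb(1)]
    using linmap_expand[OF g, of "mat s s (\<lambda>(p,q). tid_right n m s f Y $$ (k*s+p, l*s+q))" a b] ka lb by simp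
  finally show "tid_right n m t f (tid_left n s t g Y) $$ (i,j) = tid_left m s t g (tid_right n m s f Y) $$ (i,j)" .
qed (simp_all add: tid_left_def tid_right_def)

text \<open>The Choi kernel of a teleportation channel: measure N on the input and one half of a
  maximally entangled pair of dimension d, then correct the other half by the transpose of
  U_i.\<close>

definition twirl :: "nat \<Rightarrow> 'i set \<Rightarrow> ('i \<Rightarrow> nat \<Rightarrow> nat \<Rightarrow> complex) \<Rightarrow> ('i \<Rightarrow> complex mat) \<Rightarrow> nat \<times> nat \<Rightarrow> nat \<times> nat \<Rightarrow> complex" where
  "twirl d I U N x y = of_real (1 / d) * (\<Sum>i\<in>I. \<Sum>a<d. \<Sum>a'<d.
     U i a (fst x) * cnj (U i a' (fst y)) * N i $$ (snd y * d + a', snd x * d + a))"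

text \<open>For positivity the Gram vectors of the effects are contracted with the unitaries. In the
  partial trace the rows of each unitary contract, and what remains is the sum of the effects, the
  identity, traced over d levels, which 1/d normalises.\<close>

lemma channel_twirl:
  assumes d: "0 < d" and N: "povm (t*d) I N"
    and U: "\<And>i a c. i \<in> I \<Longrightarrow> a < d \<Longrightarrow> c < d \<Longrightarrow> (\<Sum>b<d. U i a b * cnj (U i c b)) = (if a = c then 1 else 0)"
  shows "channel t d (kmap t d (twirl d I U N))"
proof (rule channel_kmap)
  have "\<forall>i\<in>I. \<exists>h. \<forall>A<t*d. \<forall>B<t*d. N i $$ (A,B) = (\<Sum>r<t*d. h r A * cnj (h r B))"
    using psd_decomp[OF povm_psd[OF N]] by metis
  from bchoice[OF this] obtain h where h: "\<forall>i\<in>I. \<forall>A<t*d. \<forall>B<t*d. N i $$ (A,B) = (\<Sum>r<t*d. h i r A * cnj (h i r B))"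
    by blast
  define g where "g ir x = (\<Sum>a<d. cnj (h (fst ir) (snd ir) (snd x * d + a)) * U (fst ir) a (fst x))" for ir x
  show "psd_on ({..<d} \<times> {..<t}) (twirl d I U N)"
    unfolding twirl_def
  proof (rule psd_on_scale)
    show "psd_on ({..<d} \<times> {..<t}) (\<lambda>x y. \<Sum>i\<in>I. \<Sum>a<d. \<Sum>a'<d.
       U i a (fst x) * cnj (U i a' (fst y)) * N i $$ (snd y * d + a', snd x * d + a))"
    proof (rule psd_on_gram[where R = "I \<times> {..<t*d}" and h = g])
      fix x y assume xy: "x \<in> {..<d} \<times> {..<t}" "y \<in> {..<d} \<times> {..<t}"
      have "(\<Sum>ir\<in>I \<times> {..<t*d}. g ir x * cnj (g ir y)) = (\<Sum>i\<in>I. \<Sum>r<t*d. g (i,r) x * cnj (g (i,r) y))"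
        by (simp add: sum.cartesian_product)
      also have "\<dots> = (\<Sum>i\<in>I. \<Sum>r<t*d. \<Sum>a<d. \<Sum>a'<d. U i a (fst x) * cnj (U i a' (fst y)) * (h i r (snd y * d + a') * cnj (h i r (snd x * d + a))))"
        by (simp add: g_def sum_product mult_ac)
      also have "\<dots> = (\<Sum>i\<in>I. \<Sum>a<d. \<Sum>a'<d. \<Sum>r<t*d. U i a (fst x) * cnj (U i a' (fst y)) * (h i r (snd y * d + a') * cnj (h i r (snd x * d + a))))"
        by (intro sum.cong[OF refl] trans[OF sum.swap sum.cong[OF refl sum.swap]])
      also have "\<dots> = (\<Sum>i\<in>I. \<Sum>a<d. \<Sum>a'<d. U i a (fst x) * cnj (U i a' (fst y)) * N i $$ (snd y * d + a', snd x * d + a))"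
        using h xy by (intro sum.cong refl) (auto simp: sum_distrib_left[symmetric] pair_index_less)
      finally show "(\<Sum>i\<in>I. \<Sum>a<d. \<Sum>a'<d. U i a (fst x) * cnj (U i a' (fst y)) * N i $$ (snd y * d + a', snd x * d + a))
          = (\<Sum>ir\<in>I \<times> {..<t*d}. g ir x * cnj (g ir y))" by simp
    qed
  qed simp
  fix \<tau> \<tau>' assume tt: "\<tau> < t" "\<tau>' < t"
  have "(\<Sum>c<d. twirl d I U N (c,\<tau>) (c,\<tau>')) = of_real (1/d) * (\<Sum>c<d. \<Sum>i\<in>I. \<Sum>a<d. \<Sum>a'<d. U i a c * cnj (U i a' c) * N i $$ (\<tau>'*d+a', \<tau>*d+a))"
    by (simp add: twirl_def sum_distrib_left)
  also have "(\<Sum>c<d. \<Sum>i\<in>I. \<Sum>a<d. \<Sum>a'<d. U i a c * cnj (U i a' c) * N i $$ (\<tau>'*d+a', \<tau>*d+a))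
      = (\<Sum>i\<in>I. \<Sum>a<d. \<Sum>a'<d. \<Sum>c<d. U i a c * cnj (U i a' c) * N i $$ (\<tau>'*d+a', \<tau>*d+a))"
    by (rule trans[OF sum.swap]) (intro sum.cong[OF refl] trans[OF sum.swap sum.cong[OF refl sum.swap]])
  also have "\<dots> = (\<Sum>i\<in>I. \<Sum>a<d. \<Sum>a'<d. if a' = a then N i $$ (\<tau>'*d+a', \<tau>*d+a) else 0)"
    by (intro sum.cong refl) (simp add: sum_distrib_right[symmetric] U)
  also have "\<dots> = (\<Sum>i\<in>I. \<Sum>a<d. N i $$ (\<tau>'*d+a, \<tau>*d+a))"
    by (intro sum.cong refl) simp
  also have "\<dots> = (\<Sum>a<d. \<Sum>i\<in>I. N i $$ (\<tau>'*d+a, \<tau>*d+a))" by (rule sum.swap)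
  also have "\<dots> = (\<Sum>a<d. if \<tau> = \<tau>' then 1 else 0)"
    using tt by (intro sum.cong refl) (auto simp: povm_sum[OF N] pair_index_less pair_index_eq_iff)
  finally show "(\<Sum>c<d. twirl d I U N (c,\<tau>) (c,\<tau>')) = (if \<tau> = \<tau>' then 1 else 0)" using d by simp
qed

text \<open>Guessing which unitary was applied to the second factor of Y amounts to pairing Y with a
  teleportation channel. This trades a measurement for a postprocessing; the factor d undoes the 1/d
  in \<open>twirl\<close>.\<close>

lemma sum_trace_twirl:
  assumes d: "0 < d" and Y: "Y \<in> carrier_mat (t*d) (t*d)" and N: "\<And>i. i \<in> I \<Longrightarrow> N i \<in> carrier_mat (t*d) (t*d)"
  shows "(\<Sum>i\<in>I. trace (tid_left t d d (conj_map d (U i)) Y * N i))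
    = of_nat d * (\<Sum>\<tau><t. \<Sum>c<d. \<Sum>\<tau>'<t. \<Sum>c'<d. Y $$ (\<tau>*d+c, \<tau>'*d+c') * twirl d I U N (c,\<tau>) (c',\<tau>'))"
proof -
  have lin: "linmap d d (conj_map d (U i))" for i unfolding conj_map_def by (rule linmap_kmap)
  have "(\<Sum>i\<in>I. trace (tid_left t d d (conj_map d (U i)) Y * N i))
      = (\<Sum>i\<in>I. \<Sum>\<tau><t. \<Sum>c<d. \<Sum>\<tau>'<t. \<Sum>c'<d. Y $$ (\<tau>*d+c, \<tau>'*d+c') *
          (\<Sum>a<d. \<Sum>a'<d. U i a c * cnj (U i a' c') * N i $$ (\<tau>'*d+a', \<tau>*d+a)))"
  proof (rule sum.cong[OF refl])
    fix i assume i: "i \<in> I"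
    have "trace (tid_left t d d (conj_map d (U i)) Y * N i) = trace (Y * tid_left t d d (dual_map d d (conj_map d (U i))) (N i))"
      by (rule trace_tid_left_dual[OF lin Y N[OF i]])
    also have "\<dots> = (\<Sum>\<tau><t. \<Sum>c<d. \<Sum>\<tau>'<t. \<Sum>c'<d. Y $$ (\<tau>*d+c, \<tau>'*d+c') *
          (\<Sum>a<d. \<Sum>a'<d. U i a c * cnj (U i a' c') * N i $$ (\<tau>'*d+a', \<tau>*d+a)))"
      unfolding trace_mult[OF Y tid_left_carrier] sum_lessThan_mult
      by (intro sum.cong refl arg_cong2[of _ _ _ _ "(*)"]) (simp add: tid_left_entry dual_conj_map_entry)
    finally show "trace (tid_left t d d (conj_map d (U i)) Y * N i) = (\<Sum>\<tau><t. \<Sum>c<d. \<Sum>\<tau>'<t. \<Sum>c'<d. Y $$ (\<tau>*d+c, \<tau>'*d+c') *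
          (\<Sum>a<d. \<Sum>a'<d. U i a c * cnj (U i a' c') * N i $$ (\<tau>'*d+a', \<tau>*d+a)))" .
  qed
  also have "\<dots> = (\<Sum>\<tau><t. \<Sum>c<d. \<Sum>\<tau>'<t. \<Sum>c'<d. Y $$ (\<tau>*d+c, \<tau>'*d+c') *
          (\<Sum>i\<in>I. \<Sum>a<d. \<Sum>a'<d. U i a c * cnj (U i a' c') * N i $$ (\<tau>'*d+a', \<tau>*d+a)))"
  proof -
    have sw: "(\<Sum>i\<in>I. \<Sum>\<tau><t. \<Sum>c<d. \<Sum>\<tau>'<t. \<Sum>c'<d. F i \<tau> c \<tau>' c') = (\<Sum>\<tau><t. \<Sum>c<d. \<Sum>\<tau>'<t. \<Sum>c'<d. \<Sum>i\<in>I. F i \<tau> c \<tau>' c')"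
      for F :: "_ \<Rightarrow> nat \<Rightarrow> nat \<Rightarrow> nat \<Rightarrow> nat \<Rightarrow> complex"
    proof -
      have "(\<Sum>i\<in>I. \<Sum>\<tau><t. \<Sum>c<d. \<Sum>\<tau>'<t. \<Sum>c'<d. F i \<tau> c \<tau>' c') = (\<Sum>\<tau><t. \<Sum>i\<in>I. \<Sum>c<d. \<Sum>\<tau>'<t. \<Sum>c'<d. F i \<tau> c \<tau>' c')"
        by (rule sum.swap)
      also have "\<dots> = (\<Sum>\<tau><t. \<Sum>c<d. \<Sum>i\<in>I. \<Sum>\<tau>'<t. \<Sum>c'<d. F i \<tau> c \<tau>' c')"
        by (intro sum.cong[OF refl] sum.swap)
      also have "\<dots> = (\<Sum>\<tau><t. \<Sum>c<d. \<Sum>\<tau>'<t. \<Sum>c'<d. \<Sum>i\<in>I. F i \<tau> c \<tau>' c')"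
        by (intro sum.cong[OF refl] trans[OF sum.swap sum.cong[OF refl sum.swap]])
      finally show ?thesis .
    qed
    show ?thesis unfolding sw by (simp only: sum_distrib_left)
  qed
  also have "\<dots> = of_nat d * (\<Sum>\<tau><t. \<Sum>c<d. \<Sum>\<tau>'<t. \<Sum>c'<d. Y $$ (\<tau>*d+c, \<tau>'*d+c') * twirl d I U N (c,\<tau>) (c',\<tau>'))"
    unfolding sum_distrib_left[of "of_nat d"]
    by (intro sum.cong refl) (use d in \<open>simp add: twirl_def\<close>)
  finally show ?thesis .
qed

lemma pairing_sum:
  assumes \<rho>: "psd (n*m) \<rho>"
  shows "pairing n m \<rho> f = Re (\<Sum>\<tau><n. \<Sum>c<m. \<Sum>\<tau>'<n. \<Sum>c'<m. \<rho> $$ (\<tau>*m+c, \<tau>'*m+c') * ckern n f (c,\<tau>) (c',\<tau>'))"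
proof -
  have p: "(\<Sum>x\<in>{..<m} \<times> {..<n}. G x) = (\<Sum>\<tau><n. \<Sum>c<m. G (c,\<tau>))" for G :: "nat \<times> nat \<Rightarrow> complex"
    by (rule trans[OF _ sum.swap]) (simp add: sum.cartesian_product)
  have "pairing n m \<rho> f = Re (\<Sum>\<tau><n. \<Sum>c<m. \<Sum>\<tau>'<n. \<Sum>c'<m. cnj (\<rho> $$ (\<tau>'*m+c', \<tau>*m+c)) * ckern n f (c,\<tau>) (c',\<tau>'))"
    unfolding pairing_eq_kpair[OF psd_carrier[OF \<rho>]] kpair_def p by simp
  also have "\<dots> = Re (\<Sum>\<tau><n. \<Sum>c<m. \<Sum>\<tau>'<n. \<Sum>c'<m. \<rho> $$ (\<tau>*m+c, \<tau>'*m+c') * ckern n f (c,\<tau>) (c',\<tau>'))"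
    by (intro arg_cong[of _ _ Re] sum.cong refl) (simp add: psd_herm[OF \<rho>] pair_index_less)
  finally show ?thesis .
qed

text \<open>Apply f to the input part of \<rho>, then take the expectation in the unnormalised
  maximally entangled vector of the output and the second part of \<rho>.\<close>

lemma pairing_tid_right:
  assumes \<rho>: "psd (n*m) \<rho>" and f: "linmap n m f"
  shows "pairing n m \<rho> f = Re (\<Sum>c<m. \<Sum>c'<m. tid_right n m m f \<rho> $$ (c*m+c, c'*m+c'))"
proof -
  have e: "tid_right n m m f \<rho> $$ (c*m+c, c'*m+c') = (\<Sum>\<tau><n. \<Sum>\<tau>'<n. \<rho> $$ (\<tau>*m+c, \<tau>'*m+c') * ckern n f (c,\<tau>) (c',\<tau>'))"
    if "c < m" "c' < m" for c c'
    using that linmap_expand_ckern[OF f, of "mat n n (\<lambda>(p,q). \<rho> $$ (p*m+c, q*m+c'))" c c'] by (simp add: tid_right_entry)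
  have "(\<Sum>c<m. \<Sum>c'<m. tid_right n m m f \<rho> $$ (c*m+c, c'*m+c'))
      = (\<Sum>c<m. \<Sum>c'<m. \<Sum>\<tau><n. \<Sum>\<tau>'<n. \<rho> $$ (\<tau>*m+c, \<tau>'*m+c') * ckern n f (c,\<tau>) (c',\<tau>'))"
    by (intro sum.cong refl) (simp add: e)
  also have "\<dots> = (\<Sum>c<m. \<Sum>\<tau><n. \<Sum>c'<m. \<Sum>\<tau>'<n. \<rho> $$ (\<tau>*m+c, \<tau>'*m+c') * ckern n f (c,\<tau>) (c',\<tau>'))"
    by (intro sum.cong[OF refl] sum.swap)
  also have "\<dots> = (\<Sum>\<tau><n. \<Sum>c<m. \<Sum>\<tau>'<n. \<Sum>c'<m. \<rho> $$ (\<tau>*m+c, \<tau>'*m+c') * ckern n f (c,\<tau>) (c',\<tau>'))"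
    by (rule trans[OF sum.swap]) (intro sum.cong[OF refl] sum.swap)
  finally show ?thesis unfolding pairing_sum[OF \<rho>] by simp
qed

text \<open>For unitary V_j, the projection onto the normalised vector obtained by applying 1
  \<otimes> V_j to the maximally entangled one.\<close>

definition bell :: "nat \<Rightarrow> (nat \<Rightarrow> nat \<Rightarrow> nat \<Rightarrow> complex) \<Rightarrow> nat \<Rightarrow> complex mat" where
  "bell d V j = mat (d*d) (d*d) (\<lambda>(A,B). of_real (1/d) * (V j (A mod d) (A div d) * cnj (V j (B mod d) (B div d))))"

lemma bell_entry:
  assumes "y < d" "z < d" "y' < d" "z' < d"
  shows "bell d V j $$ (y*d+z, y'*d+z') = of_real (1/d) * (V j z y * cnj (V j z' y'))"
  using assms by (simp add: bell_def pair_index_less)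

lemma povm_bell:
  assumes d: "0 < d" and V: "unitary_basis d V"
  shows "povm (d*d) {..<d*d} (bell d V)"
  unfolding povm_def
proof (intro conjI ballI allI impI)
  fix j
  have "psd_on {..<d*d} (\<lambda>A B. of_real (1/d) * (V j (A mod d) (A div d) * cnj (V j (B mod d) (B div d))))"
    by (intro psd_on_scale psd_on_rank_one) simp
  moreover have "psd_on {..<d*d} (\<lambda>A B. bell d V j $$ (A,B)) \<longleftrightarrow>
      psd_on {..<d*d} (\<lambda>A B. of_real (1/d) * (V j (A mod d) (A div d) * cnj (V j (B mod d) (B div d))))"
    by (rule psd_on_cong) (simp add: bell_def)
  ultimately show "psd (d*d) (bell d V j)" by (simp add: psd_iff_psd_on bell_def)
next
  fix A B assume AB: "A < d*d" "B < d*d"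
  obtain y z where 1: "y < d" "z < d" "A = y*d+z" using AB(1) by (rule less_mult_indexE)
  obtain y' z' where 2: "y' < d" "z' < d" "B = y'*d+z'" using AB(2) by (rule less_mult_indexE)
  have "(\<Sum>j<d*d. bell d V j $$ (A,B)) = of_real (1/d) * (\<Sum>j<d*d. V j z y * cnj (V j z' y'))"
    unfolding 1(3) 2(3) bell_entry[OF 1(1,2) 2(1,2)] sum_distrib_left ..
  also have "(\<Sum>j<d*d. V j z y * cnj (V j z' y')) = (if z = z' \<and> y = y' then of_nat d else 0)"
    using V 1 2 unfolding unitary_basis_def by blast
  finally show "(\<Sum>j<d*d. bell d V j $$ (A,B)) = (if A = B then 1 else 0)"
    using d 1 2 by (auto simp: pair_index_eq_iff)
qed


lemma Re_of_nat_mult: "Re (of_nat k * z) = real k * Re z"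
  by simp

text \<open>The unitary U_i \<otimes> V_j on R1 B1. The two labels form one pair because a joint
  measurement guesses them together.\<close>

definition pair_unitary :: "nat \<Rightarrow> (nat \<Rightarrow> nat \<Rightarrow> nat \<Rightarrow> complex) \<Rightarrow> (nat \<Rightarrow> nat \<Rightarrow> nat \<Rightarrow> complex) \<Rightarrow>
    nat \<times> nat \<Rightarrow> nat \<Rightarrow> nat \<Rightarrow> complex" where
  "pair_unitary b U V ij A B = U (fst ij) (A div b) (B div b) * V (snd ij) (A mod b) (B mod b)"

lemma pair_unitary_entry:
  assumes "z < b" "z' < b"
  shows "pair_unitary b U V ij (x*b+z) (x'*b+z') = U (fst ij) x x' * V (snd ij) z z'"
  using assms by (simp add: pair_unitary_def)

lemma pair_unitary_cols:
  assumes U: "unitary_basis r U" and V: "unitary_basis b V" and ij: "ij \<in> {..<r*r} \<times> {..<b*b}" and ac: "A < r*b" "C < r*b"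
  shows "(\<Sum>B<r*b. cnj (pair_unitary b U V ij B A) * pair_unitary b U V ij B C) = (if A = C then 1 else 0)"
proof -
  obtain x z where 1: "x < r" "z < b" "A = x*b+z" using ac(1) by (rule less_mult_indexE)
  obtain x' z' where 2: "x' < r" "z' < b" "C = x'*b+z'" using ac(2) by (rule less_mult_indexE)
  have "(\<Sum>B<r*b. cnj (pair_unitary b U V ij B A) * pair_unitary b U V ij B C)
      = (\<Sum>w<r. \<Sum>v<b. (cnj (U (fst ij) w x) * U (fst ij) w x') * (cnj (V (snd ij) v z) * V (snd ij) v z'))"
    unfolding sum_lessThan_mult 1(3) 2(3)
    by (intro sum.cong refl) (simp add: pair_unitary_entry[OF _ 1(2)] pair_unitary_entry[OF _ 2(2)]; simp add: mult_ac)
  also have "\<dots> = (\<Sum>w<r. cnj (U (fst ij) w x) * U (fst ij) w x') * (\<Sum>v<b. cnj (V (snd ij) v z) * V (snd ij) v z')"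
    by (simp add: sum_product)
  also have "\<dots> = (if x = x' then 1 else 0) * (if z = z' then 1 else 0)"
  proof -
    have "(\<Sum>w<r. cnj (U (fst ij) w x) * U (fst ij) w x') = (if x = x' then 1 else 0)"
      using U ij 1 2 unfolding unitary_basis_def by auto
    moreover have "(\<Sum>v<b. cnj (V (snd ij) v z) * V (snd ij) v z') = (if z = z' then 1 else 0)"
      using V ij 1 2 unfolding unitary_basis_def by auto
    ultimately show ?thesis by simp
  qed
  also have "\<dots> = (if A = C then 1 else 0)" using 1 2 by (auto simp: pair_index_eq_iff)
  finally show ?thesis .
qed

text \<open>The Bell measurement on the \<open>B\<^sub>1\<close> systems undoes the unitaries \<open>V\<close> and projects onto the maximally
  entangled state.\<close>
lemma twirl_swap_bell:
  assumes r: "0 < r" and b: "0 < b" and V: "unitary_basis b V"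
    and N: "\<And>i. i < k \<Longrightarrow> N i \<in> carrier_mat (n*r) (n*r)"
    and bd: "x < r" "z < b" "\<tau> < n" "y < b" "x' < r" "z' < b" "\<tau>' < n" "y' < b"
  shows "twirl (r*b) ({..<k} \<times> {..<b*b}) (pair_unitary b U V)
      (\<lambda>ij. swap_mid n r b b (kron (N (fst ij)) (bell b V (snd ij)))) (x*b+z, \<tau>*b+y) (x'*b+z', \<tau>'*b+y')
    = twirl r {..<k} U N (x,\<tau>) (x',\<tau>') * ((if z = y then 1 else 0) * (if z' = y' then 1 else 0))"
proof -
  define FN where "FN i = (\<Sum>a<r. \<Sum>a'<r. U i a x * cnj (U i a' x') * N i $$ (\<tau>'*r+a', \<tau>*r+a))" for i
  have Bc: "bell b V j \<in> carrier_mat (b*b) (b*b)" for j by (simp add: bell_def)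
  have orth: "(\<Sum>v<b. cnj (V j v p) * V j v q) = (if p = q then 1 else 0)" if "j < b*b" "p < b" "q < b" for j p q
    using V that unfolding unitary_basis_def by blast
  \<comment> \<open>The Bell projector carries the same V_j as the rotation, so orthonormal columns
    leave the deltas with weight 1/b for every j. The b*b outcomes turn this into b, which reduces
    the 1/(r*b) of the large twirl to the 1/r of the small one.\<close>
  have FM: "(\<Sum>v<b. \<Sum>v'<b. V j v z * cnj (V j v' z') * bell b V j $$ (y'*b+v', y*b+v))
      = of_real (1/b) * ((if z = y then 1 else 0) * (if z' = y' then 1 else 0))" if j: "j < b*b" for j
  proof -
    have "(\<Sum>v<b. \<Sum>v'<b. V j v z * cnj (V j v' z') * bell b V j $$ (y'*b+v', y*b+v))
        = (\<Sum>v<b. \<Sum>v'<b. of_real (1/b) * ((cnj (V j v y) * V j v z) * (cnj (V j v' z') * V j v' y')))"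
      by (intro sum.cong refl) (simp add: bell_entry[OF bd(8) _ bd(4)]; simp add: mult_ac)
    also have "\<dots> = of_real (1/b) * ((\<Sum>v<b. cnj (V j v y) * V j v z) * (\<Sum>v'<b. cnj (V j v' z') * V j v' y'))"
      unfolding sum_product by (simp only: sum_distrib_left)
    also have "\<dots> = of_real (1/b) * ((if z = y then 1 else 0) * (if z' = y' then 1 else 0))"
      unfolding orth[OF j bd(4) bd(2)] orth[OF j bd(6) bd(8)] by (simp add: eq_commute)
    finally show ?thesis .
  qed
  have "(\<Sum>ij\<in>{..<k} \<times> {..<b*b}. \<Sum>A<r*b. \<Sum>A'<r*b. pair_unitary b U V ij A (x*b+z) * cnj (pair_unitary b U V ij A' (x'*b+z')) *
        swap_mid n r b b (kron (N (fst ij)) (bell b V (snd ij))) $$ ((\<tau>'*b+y')*(r*b) + A', (\<tau>*b+y)*(r*b) + A))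
     = (\<Sum>ij\<in>{..<k} \<times> {..<b*b}. FN (fst ij) * (of_real (1/b) * ((if z = y then 1 else 0) * (if z' = y' then 1 else 0))))"
  proof (rule sum.cong[OF refl])
    fix ij assume "ij \<in> {..<k} \<times> {..<b*b}"
    then have ij: "fst ij < k" "snd ij < b*b" by auto
    have "(\<Sum>A<r*b. \<Sum>A'<r*b. pair_unitary b U V ij A (x*b+z) * cnj (pair_unitary b U V ij A' (x'*b+z')) *
        swap_mid n r b b (kron (N (fst ij)) (bell b V (snd ij))) $$ ((\<tau>'*b+y')*(r*b) + A', (\<tau>*b+y)*(r*b) + A))
      = (\<Sum>a<r. \<Sum>v<b. \<Sum>a'<r. \<Sum>v'<b. (U (fst ij) a x * cnj (U (fst ij) a' x') * N (fst ij) $$ (\<tau>'*r+a', \<tau>*r+a)) *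
          (V (snd ij) v z * cnj (V (snd ij) v' z') * bell b V (snd ij) $$ (y'*b+v', y*b+v)))"
      unfolding sum_lessThan_mult
    proof (intro sum.cong refl)
      fix a v a' v' assume "a \<in> {..<r}" "v \<in> {..<b}" "a' \<in> {..<r}" "v' \<in> {..<b}"
      then have c: "a < r" "v < b" "a' < r" "v' < b" by auto
      show "pair_unitary b U V ij (a*b+v) (x*b+z) * cnj (pair_unitary b U V ij (a'*b+v') (x'*b+z')) *
          swap_mid n r b b (kron (N (fst ij)) (bell b V (snd ij))) $$ ((\<tau>'*b+y')*(r*b) + (a'*b+v'), (\<tau>*b+y)*(r*b) + (a*b+v))
        = (U (fst ij) a x * cnj (U (fst ij) a' x') * N (fst ij) $$ (\<tau>'*r+a', \<tau>*r+a)) *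
          (V (snd ij) v z * cnj (V (snd ij) v' z') * bell b V (snd ij) $$ (y'*b+v', y*b+v))"
        unfolding swap_kron_entry[OF N[OF ij(1)] Bc bd(7,8) c(3,4) bd(3,4) c(1,2)]
          pair_unitary_entry[OF c(2) bd(2)] pair_unitary_entry[OF c(4) bd(6)]
        by (simp add: mult_ac)
    qed
    also have "\<dots> = (\<Sum>a<r. \<Sum>a'<r. \<Sum>v<b. \<Sum>v'<b. (U (fst ij) a x * cnj (U (fst ij) a' x') * N (fst ij) $$ (\<tau>'*r+a', \<tau>*r+a)) *
          (V (snd ij) v z * cnj (V (snd ij) v' z') * bell b V (snd ij) $$ (y'*b+v', y*b+v)))"
      by (intro sum.cong[OF refl] sum.swap)
    also have "\<dots> = FN (fst ij) * (\<Sum>v<b. \<Sum>v'<b. V (snd ij) v z * cnj (V (snd ij) v' z') * bell b V (snd ij) $$ (y'*b+v', y*b+v))"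
      unfolding FN_def sum_distrib_right by (simp only: sum_distrib_left)
    finally show "(\<Sum>A<r*b. \<Sum>A'<r*b. pair_unitary b U V ij A (x*b+z) * cnj (pair_unitary b U V ij A' (x'*b+z')) *
        swap_mid n r b b (kron (N (fst ij)) (bell b V (snd ij))) $$ ((\<tau>'*b+y')*(r*b) + A', (\<tau>*b+y)*(r*b) + A))
       = FN (fst ij) * (of_real (1/b) * ((if z = y then 1 else 0) * (if z' = y' then 1 else 0)))"
      unfolding FM[OF ij(2)] .
  qed
  also have "\<dots> = (\<Sum>i<k. \<Sum>j<b*b. FN i * (of_real (1/b) * ((if z = y then 1 else 0) * (if z' = y' then 1 else 0))))"
    by (simp only: sum.cartesian_product case_prod_unfold)
  also have "\<dots> = of_nat b * ((\<Sum>i<k. FN i) * ((if z = y then 1 else 0) * (if z' = y' then 1 else 0)))"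
    using b by (simp add: sum_distrib_right sum_distrib_left)
  finally show ?thesis
    unfolding twirl_def fst_conv snd_conv FN_def[symmetric] using b r by simp
qed

text \<open>With s = r*b there are r*r labels for U and b*b for V, that is s*s pairs.\<close>

definition uniform_prob :: "nat \<Rightarrow> nat \<Rightarrow> nat \<Rightarrow> real" where
  "uniform_prob s i j = 1 / (real s * real s)"

definition rotated :: "nat \<Rightarrow> nat \<Rightarrow> nat \<Rightarrow> (nat \<Rightarrow> nat \<Rightarrow> nat \<Rightarrow> complex) \<Rightarrow> (nat \<Rightarrow> nat \<Rightarrow> nat \<Rightarrow> complex) \<Rightarrow>
    complex mat \<Rightarrow> nat \<Rightarrow> nat \<Rightarrow> complex mat" where
  "rotated n r b U V \<rho> i j = tid_left n (r*b) (r*b) (conj_map (r*b) (pair_unitary b U V (i,j))) \<rho>"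

lemma ensemble_rotated:
  assumes r: "0 < r" and b: "0 < b" and U: "unitary_basis r U" and V: "unitary_basis b V" and \<rho>: "density (n*(r*b)) \<rho>"
  shows "ensemble (n*(r*b)) (r*r) (b*b) (uniform_prob (r*b)) (rotated n r b U V \<rho>)"
  unfolding ensemble_def
proof (intro conjI allI impI)
  fix i j assume ij: "i < r*r" "j < b*b"
  show "0 \<le> uniform_prob (r*b) i j" by (simp add: uniform_prob_def)
  have ch: "channel (n*(r*b)) (n*(r*b)) (tid_left n (r*b) (r*b) (conj_map (r*b) (pair_unitary b U V (i,j))))"
    using ij by (intro channel_tid_left channel_conj_map pair_unitary_cols[OF U V]) auto
  show "density (n*(r*b)) (rotated n r b U V \<rho> i j)"
    using psd_cp[OF channel_cp[OF ch]] channel_trace[OF ch] psd_carrier \<rho> unfolding density_def rotated_def by metis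
next
  show "(\<Sum>i<r*r. \<Sum>j<b*b. uniform_prob (r*b) i j) = 1" using r b by (simp add: uniform_prob_def)
qed

text \<open>A joint measurement of the rotated states is the pairing of \<rho> with a teleportation
  channel. The uniform weight 1/(s*s) and the factor s of \<open>sum_trace_twirl\<close> leave 1/s,
  where s = r*b.\<close>

lemma psucc_rotated_le:
  assumes r: "0 < r" and b: "0 < b" and U: "unitary_basis r U" and V: "unitary_basis b V" and \<rho>: "density (n*(r*b)) \<rho>"
  shows "psucc (n*(r*b)) (r*r) (b*b) (uniform_prob (r*b)) (rotated n r b U V \<rho>) \<le> dual_dnorm n (r*b) \<rho> / real (r*b)"
  unfolding psucc_def
proof (rule cSup_least)
  let ?s = "r*b" and ?I = "{..<r*r} \<times> {..<b*b}"
  have s: "0 < ?s" using r b by simp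
  have p: "psd (n*?s) \<rho>" using \<rho> by (simp add: density_def)
  \<comment> \<open>Always answering (0,0) is a measurement, so the supremum is over a nonempty
    set.\<close>
  have "povm (n*?s) ?I (\<lambda>x. if x = (0,0) then 1\<^sub>m (n*?s) else 0\<^sub>m (n*?s) (n*?s))"
  proof -
    have "(\<Sum>x\<in>?I. (if x = (0,0) then 1\<^sub>m (n*?s) else 0\<^sub>m (n*?s) (n*?s)) $$ (a,c)) = (if a = c then 1 else (0::complex))"
      if "a < n*?s" "c < n*?s" for a c
    proof -
      have "(\<Sum>x\<in>?I. (if x = (0,0) then 1\<^sub>m (n*?s) else 0\<^sub>m (n*?s) (n*?s)) $$ (a,c))
          = (\<Sum>x\<in>?I. if x = (0,0) then if a = c then 1 else 0 else (0::complex))"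
        using that by (intro sum.cong) auto
      also have "\<dots> = (if a = c then 1 else 0)" using r b by (subst sum.delta) auto
      finally show ?thesis .
    qed
    then show ?thesis using psd_one by (simp add: povm_def psd_def[of _ "0\<^sub>m _ _"])
  qed
  then show "{(\<Sum>i<r*r. \<Sum>j<b*b. uniform_prob ?s i j * Re (trace (rotated n r b U V \<rho> i j * M (i,j)))) | M. povm (n*?s) ?I M} \<noteq> {}"
    by blast
  fix v assume "v \<in> {(\<Sum>i<r*r. \<Sum>j<b*b. uniform_prob ?s i j * Re (trace (rotated n r b U V \<rho> i j * M (i,j)))) | M. povm (n*?s) ?I M}"
  then obtain M where v: "v = (\<Sum>i<r*r. \<Sum>j<b*b. uniform_prob ?s i j * Re (trace (rotated n r b U V \<rho> i j * M (i,j))))"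
    and M: "povm (n*?s) ?I M" by blast
  let ?W = "pair_unitary b U V"
  let ?f = "kmap n ?s (twirl ?s ?I ?W M)"
  have f: "channel n ?s ?f"
    by (rule channel_twirl[OF s M]) (rule orthonormal_rows[OF pair_unitary_cols[OF U V]])
  have "(\<Sum>ij\<in>?I. trace (tid_left n ?s ?s (conj_map ?s (?W ij)) \<rho> * M ij))
      = of_nat ?s * (\<Sum>\<tau><n. \<Sum>c<?s. \<Sum>\<tau>'<n. \<Sum>c'<?s. \<rho> $$ (\<tau>*?s+c, \<tau>'*?s+c') * twirl ?s ?I ?W M (c,\<tau>) (c',\<tau>'))"
    by (rule sum_trace_twirl[OF s psd_carrier[OF p]]) (rule psd_carrier[OF povm_psd[OF M]])
  also have "(\<Sum>\<tau><n. \<Sum>c<?s. \<Sum>\<tau>'<n. \<Sum>c'<?s. \<rho> $$ (\<tau>*?s+c, \<tau>'*?s+c') * twirl ?s ?I ?W M (c,\<tau>) (c',\<tau>'))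
      = (\<Sum>\<tau><n. \<Sum>c<?s. \<Sum>\<tau>'<n. \<Sum>c'<?s. \<rho> $$ (\<tau>*?s+c, \<tau>'*?s+c') * ckern n ?f (c,\<tau>) (c',\<tau>'))"
    by (intro sum.cong refl) (simp add: ckern_kmap)
  finally have e: "Re (\<Sum>ij\<in>?I. trace (tid_left n ?s ?s (conj_map ?s (?W ij)) \<rho> * M ij)) = real ?s * pairing n ?s \<rho> ?f"
    unfolding pairing_sum[OF p] Re_of_nat_mult[symmetric] by (rule arg_cong)
  have "v = 1 / (real ?s * real ?s) * Re (\<Sum>ij\<in>?I. trace (tid_left n ?s ?s (conj_map ?s (?W ij)) \<rho> * M ij))"
    unfolding v uniform_prob_def rotated_def Re_sum sum_distrib_left sum.cartesian_product by (simp add: case_prod_unfold)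
  also have "\<dots> = pairing n ?s \<rho> ?f / real ?s" unfolding e using s by (simp add: field_simps)
  also have "\<dots> \<le> dual_dnorm n ?s \<rho> / real ?s"
    by (intro divide_right_mono pairing_le_dual_dnorm[OF psd_carrier[OF p] f]) simp
  finally show "v \<le> dual_dnorm n ?s \<rho> / real ?s" .
qed


text \<open>An exact translation of strategies into superchannels: \<alpha> remains the
  preprocessing, and N becomes the postprocessing that teleports into R1. Together with the Bell
  measurement, N teleports the output into R1 B1, with B1 passed through.\<close>

lemma strat_value_rotated:
  assumes pos: "0 < r0" "0 < r1" "0 < b1" and \<Phi>: "channel (a0*b0) (a1*b1) \<Phi>" and \<alpha>: "channel r0 (u*a0) \<alpha>"
    and U: "unitary_basis r1 U" and V: "unitary_basis b1 V" and N: "povm (u*a1*r1) {..<r1*r1} N"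
    and \<rho>: "density (r0*b0*(r1*b1)) \<rho>"
  shows "strat_value a0 a1 b0 b1 r0 r1 (r1*r1) (b1*b1) \<Phi> (uniform_prob (r1*b1)) (rotated (r0*b0) r1 b1 U V \<rho>) (bell b1 V) u \<alpha> N
    = pairing (r0*b0) (r1*b1) \<rho> (apply_sc a0 a1 r0 r1 b0 b1 u \<alpha> (kmap (u*a1) r1 (twirl r1 {..<r1*r1} U N)) \<Phi>) / real (r1*b1)"
proof -
  let ?R = "r0*b0" and ?s = "r1*b1" and ?n = "u*a1" and ?I = "{..<r1*r1} \<times> {..<b1*b1}"
  let ?W = "pair_unitary b1 U V" and ?post = "kmap (u*a1) r1 (twirl r1 {..<r1*r1} U N)"
  let ?f = "strat a0 a1 b0 b1 r0 u \<Phi> \<alpha>"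
  have s: "0 < ?s" using pos by simp
  have p: "psd (?R*?s) \<rho>" using \<rho> by (simp add: density_def)
  have f: "channel ?R (?n*b1) ?f" by (rule channel_strat[OF \<Phi> \<alpha>])
  have rowsU: "(\<Sum>b<r1. U i a b * cnj (U i c b)) = (if a = c then 1 else 0)" if "i \<in> {..<r1*r1}" "a < r1" "c < r1" for i a c
    by (rule orthonormal_rows) (use U that in \<open>auto simp: unitary_basis_def\<close>)
  have post: "channel ?n r1 ?post"
    by (rule channel_twirl[OF pos(2) N]) (rule rowsU)
  define Y where "Y = tid_right ?R (?n*b1) ?s ?f \<rho>"
  have Yc: "Y \<in> carrier_mat (?n*b1*?s) (?n*b1*?s)" by (simp add: Y_def)
  define S where "S ij = swap_mid ?n r1 b1 b1 (kron (N (fst ij)) (bell b1 V (snd ij)))" for ij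
  have Nc: "N i \<in> carrier_mat (?n*r1) (?n*r1)" if "i < r1*r1" for i using povm_psd[OF N, of i] that psd_carrier by auto
  \<comment> \<open>The rotations act on R1 B1 and the strategy on R0 B0, so one common Y serves all
    labels.\<close>
  have rot: "tid_right ?R (?n*b1) ?s ?f (rotated ?R r1 b1 U V \<rho> i j) = tid_left (?n*b1) ?s ?s (conj_map ?s (?W (i,j))) Y" for i j
    unfolding rotated_def Y_def
    by (rule tid_right_tid_left_commute[OF channel_linmap[OF f] _ psd_carrier[OF p]]) (simp add: conj_map_def linmap_kmap)
  have "(\<Sum>ij\<in>?I. trace (tid_left (?n*b1) ?s ?s (conj_map ?s (?W ij)) Y * S ij))
     = of_nat ?s * (\<Sum>\<sigma><?n*b1. \<Sum>c<?s. \<Sum>\<sigma>'<?n*b1. \<Sum>c'<?s. Y $$ (\<sigma>*?s+c, \<sigma>'*?s+c') * twirl ?s ?I ?W S (c,\<sigma>) (c',\<sigma>'))"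
    by (rule sum_trace_twirl[OF s Yc]) (simp add: S_def)
  also have "(\<Sum>\<sigma><?n*b1. \<Sum>c<?s. \<Sum>\<sigma>'<?n*b1. \<Sum>c'<?s. Y $$ (\<sigma>*?s+c, \<sigma>'*?s+c') * twirl ?s ?I ?W S (c,\<sigma>) (c',\<sigma>'))
     = (\<Sum>\<tau><?n. \<Sum>y<b1. \<Sum>x<r1. \<Sum>\<tau>'<?n. \<Sum>y'<b1. \<Sum>x'<r1.
         Y $$ ((\<tau>*b1+y)*?s+(x*b1+y), (\<tau>'*b1+y')*?s+(x'*b1+y')) * twirl r1 {..<r1*r1} U N (x,\<tau>) (x',\<tau>'))"
  proof -
    let ?G = "\<lambda>\<tau> y x z \<tau>' y' x' z'. Y $$ ((\<tau>*b1+y)*?s+(x*b1+z), (\<tau>'*b1+y')*?s+(x'*b1+z')) * twirl r1 {..<r1*r1} U N (x,\<tau>) (x',\<tau>')"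
    have "(\<Sum>\<sigma><?n*b1. \<Sum>c<?s. \<Sum>\<sigma>'<?n*b1. \<Sum>c'<?s. Y $$ (\<sigma>*?s+c, \<sigma>'*?s+c') * twirl ?s ?I ?W S (c,\<sigma>) (c',\<sigma>'))
      = (\<Sum>\<tau><?n. \<Sum>y<b1. \<Sum>x<r1. \<Sum>z<b1. \<Sum>\<tau>'<?n. \<Sum>y'<b1. \<Sum>x'<r1. \<Sum>z'<b1.
          if z' = y' then if z = y then ?G \<tau> y x z \<tau>' y' x' z' else 0 else 0)"
      unfolding sum_lessThan_mult[of _ ?n b1] sum_lessThan_mult[of _ r1 b1]
    proof (intro sum.cong refl)
      fix \<tau> y x z \<tau>' y' x' z'
      assume "\<tau> \<in> {..<?n}" "y \<in> {..<b1}" "x \<in> {..<r1}" "z \<in> {..<b1}" "\<tau>' \<in> {..<?n}" "y' \<in> {..<b1}" "x' \<in> {..<r1}" "z' \<in> {..<b1}"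
      then have c: "\<tau> < ?n" "y < b1" "x < r1" "z < b1" "\<tau>' < ?n" "y' < b1" "x' < r1" "z' < b1" by auto
      \<comment> \<open>The deltas identify the B1 index of the output with that of the ensemble;
        they are then written as nested conditionals so that the sums over z' and z collapse one at
        a time.\<close>
      have tw: "twirl ?s ?I ?W S (x*b1+z, \<tau>*b1+y) (x'*b1+z', \<tau>'*b1+y')
          = twirl r1 {..<r1*r1} U N (x,\<tau>) (x',\<tau>') * ((if z = y then 1 else 0) * (if z' = y' then 1 else 0))"
        unfolding S_def[abs_def] by (rule twirl_swap_bell[OF pos(2,3) V]) (rule Nc c, assumption?)+
      show "Y $$ ((\<tau>*b1+y)*?s+(x*b1+z), (\<tau>'*b1+y')*?s+(x'*b1+z')) * twirl ?s ?I ?W S (x*b1+z, \<tau>*b1+y) (x'*b1+z', \<tau>'*b1+y')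
         = (if z' = y' then if z = y then ?G \<tau> y x z \<tau>' y' x' z' else 0 else 0)"
        unfolding tw by simp
    qed
    also have "\<dots> = (\<Sum>\<tau><?n. \<Sum>y<b1. \<Sum>x<r1. \<Sum>z<b1. \<Sum>\<tau>'<?n. \<Sum>y'<b1. \<Sum>x'<r1. if z = y then ?G \<tau> y x z \<tau>' y' x' y' else 0)"
      by (intro sum.cong[OF refl]) simp
    also have "\<dots> = (\<Sum>\<tau><?n. \<Sum>y<b1. \<Sum>x<r1. \<Sum>z<b1. if z = y then \<Sum>\<tau>'<?n. \<Sum>y'<b1. \<Sum>x'<r1. ?G \<tau> y x z \<tau>' y' x' y' else 0)"
      by (intro sum.cong[OF refl]) auto
    also have "\<dots> = (\<Sum>\<tau><?n. \<Sum>y<b1. \<Sum>x<r1. \<Sum>\<tau>'<?n. \<Sum>y'<b1. \<Sum>x'<r1. ?G \<tau> y x y \<tau>' y' x' y')"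
      by (intro sum.cong[OF refl]) simp
    finally show ?thesis .
  qed
  finally have lhs: "(\<Sum>ij\<in>?I. trace (tid_left (?n*b1) ?s ?s (conj_map ?s (?W ij)) Y * S ij))
     = of_nat ?s * (\<Sum>\<tau><?n. \<Sum>y<b1. \<Sum>x<r1. \<Sum>\<tau>'<?n. \<Sum>y'<b1. \<Sum>x'<r1.
         Y $$ ((\<tau>*b1+y)*?s+(x*b1+y), (\<tau>'*b1+y')*?s+(x'*b1+y')) * twirl r1 {..<r1*r1} U N (x,\<tau>) (x',\<tau>'))" .
  have scv: "channel ?R ?s (apply_sc a0 a1 r0 r1 b0 b1 u \<alpha> ?post \<Phi>)"
  proof (cases "0 < u")
    case True
    then show ?thesis using \<alpha> post by (intro channel_apply_sc[OF _ \<Phi>]) (simp add: superchannel_def)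
  next
    case False
    have "channel ?R (?n*b1) ?f" by (rule f)
    moreover have "channel (?n*b1) ?s (tid_right ?n r1 b1 ?post)" by (rule channel_tid_right[OF post])
    ultimately have "channel ?R ?s (\<lambda>X. tid_right ?n r1 b1 ?post (?f X))" by (rule channel_comp)
    then show ?thesis by (simp add: apply_sc_def[abs_def] strat_def)
  qed
  have app: "tid_right ?R ?s ?s (apply_sc a0 a1 r0 r1 b0 b1 u \<alpha> ?post \<Phi>) \<rho> = tid_right ?n r1 (b1*?s) ?post Y"
  proof -
    have "tid_right ?R ?s ?s (apply_sc a0 a1 r0 r1 b0 b1 u \<alpha> ?post \<Phi>) \<rho> = tid_right ?R ?s ?s (\<lambda>X. tid_right ?n r1 b1 ?post (?f X)) \<rho>"
      by (simp add: apply_sc_def[abs_def] strat_def)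
    also have "\<dots> = tid_right (?n*b1) ?s ?s (tid_right ?n r1 b1 ?post) Y"
      unfolding Y_def by (rule tid_right_comp[symmetric]) (rule channel_carrier[OF f])
    also have "\<dots> = tid_right ?n r1 (b1*?s) ?post Y" by (rule tid_right_tid_right)
    finally show ?thesis .
  qed
  \<comment> \<open>\<open>?post\<close> does not touch B1: both copies of y are spectator
    coordinates, and only x is produced from \<tau>.\<close>
  have ent: "tid_right ?n r1 (b1*?s) ?post Y $$ ((x*b1+y)*?s+(x*b1+y), (x'*b1+y')*?s+(x'*b1+y'))
      = (\<Sum>\<tau><?n. \<Sum>\<tau>'<?n. Y $$ ((\<tau>*b1+y)*?s+(x*b1+y), (\<tau>'*b1+y')*?s+(x'*b1+y')) * twirl r1 {..<r1*r1} U N (x,\<tau>) (x',\<tau>'))"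
    if c: "x < r1" "y < b1" "x' < r1" "y' < b1" for x y x' y'
  proof -
    have e: "(q*b1+y)*?s+(x*b1+y) = q*(b1*?s) + (y*?s+(x*b1+y))" for q x y by (simp add: algebra_simps)
    have lt: "y*?s+(x*b1+y) < b1*?s" "y'*?s+(x'*b1+y') < b1*?s" using c by (auto intro!: pair_index_less)
    show ?thesis
      unfolding e tid_right_entry[OF c(1,3) lt] using c by (simp add: kmap_def)
  qed
  have "(\<Sum>c<?s. \<Sum>c'<?s. tid_right ?n r1 (b1*?s) ?post Y $$ (c*?s+c, c'*?s+c'))
     = (\<Sum>x<r1. \<Sum>y<b1. \<Sum>x'<r1. \<Sum>y'<b1. \<Sum>\<tau><?n. \<Sum>\<tau>'<?n.
         Y $$ ((\<tau>*b1+y)*?s+(x*b1+y), (\<tau>'*b1+y')*?s+(x'*b1+y')) * twirl r1 {..<r1*r1} U N (x,\<tau>) (x',\<tau>'))"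
    unfolding sum_lessThan_mult[of _ r1 b1] by (intro sum.cong refl) (simp only: ent lessThan_iff)
  also have "\<dots> = (\<Sum>\<tau><?n. \<Sum>y<b1. \<Sum>x<r1. \<Sum>\<tau>'<?n. \<Sum>y'<b1. \<Sum>x'<r1.
         Y $$ ((\<tau>*b1+y)*?s+(x*b1+y), (\<tau>'*b1+y')*?s+(x'*b1+y')) * twirl r1 {..<r1*r1} U N (x,\<tau>) (x',\<tau>'))"
    (is "?A = ?B")
  proof -
    let ?F = "\<lambda>x y x' y' \<tau> \<tau>'. Y $$ ((\<tau>*b1+y)*?s+(x*b1+y), (\<tau>'*b1+y')*?s+(x'*b1+y')) * twirl r1 {..<r1*r1} U N (x,\<tau>) (x',\<tau>')"
    have "?A = (\<Sum>x<r1. \<Sum>y<b1. \<Sum>\<tau><?n. \<Sum>\<tau>'<?n. \<Sum>y'<b1. \<Sum>x'<r1. ?F x y x' y' \<tau> \<tau>')"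
      by (intro sum.cong[OF refl], rule trans[OF sum_swap_pairs], intro sum.cong[OF refl] sum.swap)
    also have "\<dots> = (\<Sum>x<r1. \<Sum>\<tau><?n. \<Sum>y<b1. \<Sum>\<tau>'<?n. \<Sum>y'<b1. \<Sum>x'<r1. ?F x y x' y' \<tau> \<tau>')"
      by (intro sum.cong[OF refl] sum.swap)
    also have "\<dots> = (\<Sum>\<tau><?n. \<Sum>x<r1. \<Sum>y<b1. \<Sum>\<tau>'<?n. \<Sum>y'<b1. \<Sum>x'<r1. ?F x y x' y' \<tau> \<tau>')"
      by (rule sum.swap)
    also have "\<dots> = ?B"
      by (intro sum.cong[OF refl] sum.swap)
    finally show ?thesis .
  qed
  finally have rhs: "(\<Sum>c<?s. \<Sum>c'<?s. tid_right ?n r1 (b1*?s) ?post Y $$ (c*?s+c, c'*?s+c'))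
     = (\<Sum>\<tau><?n. \<Sum>y<b1. \<Sum>x<r1. \<Sum>\<tau>'<?n. \<Sum>y'<b1. \<Sum>x'<r1.
         Y $$ ((\<tau>*b1+y)*?s+(x*b1+y), (\<tau>'*b1+y')*?s+(x'*b1+y')) * twirl r1 {..<r1*r1} U N (x,\<tau>) (x',\<tau>'))" .
  have "strat_value a0 a1 b0 b1 r0 r1 (r1*r1) (b1*b1) \<Phi> (uniform_prob ?s) (rotated ?R r1 b1 U V \<rho>) (bell b1 V) u \<alpha> N
      = 1 / (real ?s * real ?s) * Re (\<Sum>ij\<in>?I. trace (tid_left (?n*b1) ?s ?s (conj_map ?s (?W ij)) Y * S ij))"
    unfolding strat_value_def uniform_prob_def rot Re_sum sum_distrib_left sum.cartesian_product S_def
    by (simp add: case_prod_unfold)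
  also have "\<dots> = 1 / (real ?s * real ?s) * (real ?s * pairing ?R ?s \<rho> (apply_sc a0 a1 r0 r1 b0 b1 u \<alpha> ?post \<Phi>))"
    unfolding pairing_tid_right[OF p channel_linmap[OF scv]] app lhs Re_of_nat_mult rhs ..
  also have "\<dots> = pairing ?R ?s \<rho> (apply_sc a0 a1 r0 r1 b0 b1 u \<alpha> ?post \<Phi>) / real ?s"
    using s by (simp add: field_simps)
  finally show ?thesis .
qed


section \<open>From (iii) back to (i)\<close>

context channel_pair
begin

text \<open>In the game built from the separating state, the success probability and the value of
  \<open>\<Phi>1\<close> are bounded above, and the value of \<open>\<Phi>2\<close> below, by the
  corresponding pairing quantities over \<open>a1'*b1\<close>. So (iii) would close the gap that
  separation left open.\<close>

lemma delta_le_if_cond_iii: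
  assumes iii: "cond_iii a0 a1 a0' a1' b0 b1 \<Phi>1 \<Phi>2 \<epsilon> a0' a1'" and \<epsilon>: "0 \<le> \<epsilon>"
  shows "delta a0 a1 a0' a1' b0 b1 \<Phi>1 \<Phi>2 \<le> \<epsilon>"
proof (rule ccontr)
  assume "\<not> ?thesis"
  then obtain \<rho> \<beta> where \<rho>: "density (a0'*b0*(a1'*b1)) \<rho>" and \<beta>: "0 < \<beta>"
    and sep: "\<And>u pre post \<Gamma>. superchannel a0 a1 a0' a1' u pre post \<Longrightarrow> channel (a0'*b0) (a1'*b1) \<Gamma> \<Longrightarrow>
      pairing (a0'*b0) (a1'*b1) \<rho> (apply_sc a0 a1 a0' a1' b0 b1 u pre post \<Phi>1)
        + \<epsilon> / 2 * pairing (a0'*b0) (a1'*b1) \<rho> \<Gamma> + \<beta> \<le> pairing (a0'*b0) (a1'*b1) \<rho> \<Phi>2"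
    using delta_gt_separated[OF _ \<epsilon>] by blast
  let ?n = "a0'*b0" and ?s = "a1'*b1" and ?k = "a1'*a1'" and ?l = "b1*b1"
  have s: "0 < ?s" using pos by simp
  have \<rho>c: "\<rho> \<in> carrier_mat (?n*?s) (?n*?s)" using \<rho> by (simp add: density_def psd_carrier)
  obtain U where U: "unitary_basis a1' U" using unitary_basis_exists[OF pos(4)] by blast
  obtain V where V: "unitary_basis b1 V" using unitary_basis_exists[OF pos(6)] by blast
  define lam where "lam = uniform_prob ?s"
  define rho where "rho = rotated ?n a1' b1 U V \<rho>"
  let ?M = "bell b1 V"
  have E: "ensemble (a0'*b0*a1'*b1) ?k ?l lam rho"
    using ensemble_rotated[OF pos(4,6) U V \<rho>] by (simp add: lam_def rho_def mult.assoc)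
  have M: "povm (b1*b1) {..<?l} ?M" by (rule povm_bell[OF pos(6) V])
  let ?R = "{pairing ?n ?s \<rho> (apply_sc a0 a1 a0' a1' b0 b1 u pre post \<Phi>1) | u pre post. superchannel a0 a1 a0' a1' u pre post}"
  have ps: "psucc (a0'*b0*a1'*b1) ?k ?l lam rho \<le> dual_dnorm ?n ?s \<rho> / real ?s"
    using psucc_rotated_le[OF pos(4,6) U V \<rho>] by (simp add: lam_def rho_def mult.assoc)
  \<comment> \<open>Every strategy for \<open>\<Phi>1\<close> is a pairing with an admissible
    superchannel, divided by \<open>?s\<close>.\<close>
  have p1: "pM a0 a1 b0 b1 a0' a1' ?k ?l \<Phi>1 lam rho ?M \<le> Sup ?R / real ?s"
    unfolding pM_eq
  proof (rule cSup_least)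
    have k0: "0 < ?k" using pos by simp
    obtain \<alpha> where "channel a0' (1*a0) \<alpha>" using channel_exists[of "1*a0" a0'] pos by auto
    moreover obtain N where "povm (1*a1*a1') {..<?k} N" using povm_exists[OF k0] by blast
    moreover have "0 < (1::nat)" by simp
    ultimately show "{strat_value a0 a1 b0 b1 a0' a1' ?k ?l \<Phi>1 lam rho ?M u \<alpha> N | u \<alpha> N.
       0 < u \<and> channel a0' (u*a0) \<alpha> \<and> povm (u*a1*a1') {..<?k} N} \<noteq> {}" by blast
    fix x assume "x \<in> {strat_value a0 a1 b0 b1 a0' a1' ?k ?l \<Phi>1 lam rho ?M u \<alpha> N | u \<alpha> N.
       0 < u \<and> channel a0' (u*a0) \<alpha> \<and> povm (u*a1*a1') {..<?k} N}"
    then obtain u \<alpha> N where x: "x = strat_value a0 a1 b0 b1 a0' a1' ?k ?l \<Phi>1 lam rho ?M u \<alpha> N"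
      and u: "0 < u" "channel a0' (u*a0) \<alpha>" and N: "povm (u*a1*a1') {..<?k} N" by blast
    let ?post = "kmap (u*a1) a1' (twirl a1' {..<?k} U N)"
    have "channel (u*a1) a1' ?post"
    proof (rule channel_twirl[OF pos(4) N])
      show "(\<Sum>b<a1'. U i a b * cnj (U i c b)) = (if a = c then 1 else 0)" if "i \<in> {..<?k}" "a < a1'" "c < a1'" for i a c
        by (rule orthonormal_rows) (use U that in \<open>auto simp: unitary_basis_def\<close>)
    qed
    then have sc: "superchannel a0 a1 a0' a1' u \<alpha> ?post" using u by (simp add: superchannel_def)
    have "x = pairing ?n ?s \<rho> (apply_sc a0 a1 a0' a1' b0 b1 u \<alpha> ?post \<Phi>1) / real ?s"
      unfolding x lam_def rho_def by (rule strat_value_rotated[OF pos(3,4,6) ch1 u(2) U V N \<rho>])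
    also have "\<dots> \<le> Sup ?R / real ?s"
      by (intro divide_right_mono superchannel_pairing_upper[OF pos(3,4) \<rho>c sc]) simp
    finally show "x \<le> Sup ?R / real ?s" .
  qed
  have p2: "pairing ?n ?s \<rho> \<Phi>2 / real ?s \<le> pM a0' a1' b0 b1 a0' a1' ?k ?l \<Phi>2 lam rho ?M"
  proof -
    \<comment> \<open>With trivial ancilla, no preprocessing and the Bell measurement for U on A1'
      R1, the resulting postprocessing is perfect teleportation, that is, the identity. This
      strategy attains the pairing with \<open>\<Phi>2\<close> itself.\<close>
    let ?N = "bell a1' U"
    have N: "povm (1*a1'*a1') {..<?k} ?N" using povm_bell[OF pos(4) U] by simp
    have id: "channel a0' (1*a0') (\<lambda>X. X)" using channel_id by simp
    let ?post = "kmap (1*a1') a1' (twirl a1' {..<?k} U ?N)"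
    have orth: "(\<Sum>a<a1'. cnj (U i a p) * U i a q) = (if p = q then 1 else 0)" if "i < ?k" "p < a1'" "q < a1'" for i p q
      using U that unfolding unitary_basis_def by blast
    \<comment> \<open>The projectors contain the unitaries used for the correction, so orthonormal
      columns reduce the sums to deltas; the 1/a1' of the projector and that of the twirl cancel the
      a1'*a1' outcomes.\<close>
    have tw: "twirl a1' {..<?k} U ?N (x,\<tau>) (x',\<tau>') = (if \<tau> = x then 1 else 0) * (if x' = \<tau>' then 1 else 0)"
      if c: "x < a1'" "\<tau> < a1'" "x' < a1'" "\<tau>' < a1'" for x \<tau> x' \<tau>'
    proof -
      have "(\<Sum>a<a1'. \<Sum>a'<a1'. U i a x * cnj (U i a' x') * ?N i $$ (\<tau>'*a1'+a', \<tau>*a1'+a))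
          = of_real (1/a1') * ((if \<tau> = x then 1 else 0) * (if x' = \<tau>' then 1 else 0))" if i: "i < ?k" for i
      proof -
        have "(\<Sum>a<a1'. \<Sum>a'<a1'. U i a x * cnj (U i a' x') * ?N i $$ (\<tau>'*a1'+a', \<tau>*a1'+a))
            = (\<Sum>a<a1'. \<Sum>a'<a1'. of_real (1/a1') * ((cnj (U i a \<tau>) * U i a x) * (cnj (U i a' x') * U i a' \<tau>')))"
          by (intro sum.cong refl) (simp add: bell_entry[OF c(4) _ c(2)]; simp add: mult_ac)
        also have "\<dots> = of_real (1/a1') * ((\<Sum>a<a1'. cnj (U i a \<tau>) * U i a x) * (\<Sum>a'<a1'. cnj (U i a' x') * U i a' \<tau>'))"
          unfolding sum_product by (simp only: sum_distrib_left)
        finally show ?thesis unfolding orth[OF i c(2,1)] orth[OF i c(3,4)] .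
      qed
      then have "twirl a1' {..<?k} U ?N (x,\<tau>) (x',\<tau>')
          = of_real (1/a1') * (\<Sum>i<?k. of_real (1/a1') * ((if \<tau> = x then 1 else 0) * (if x' = \<tau>' then 1 else 0)))"
        unfolding twirl_def fst_conv snd_conv by simp
      then show ?thesis using pos(4) by simp
    qed
    have post_id: "?post X = X" if X: "X \<in> carrier_mat a1' a1'" for X
    proof (rule eq_matI)
      fix i j assume "i < dim_row X" "j < dim_col X"
      then have ij: "i < a1'" "j < a1'" using X by auto
      have "?post X $$ (i,j) = (\<Sum>p<a1'. \<Sum>q<a1'. X $$ (p,q) * ((if p = i then 1 else 0) * (if j = q then 1 else 0)))"
        using ij by (simp add: kmap_def tw)
      also have "\<dots> = (\<Sum>p<a1'. \<Sum>q<a1'. if q = j then if p = i then X $$ (p,q) else 0 else 0)"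
        by (intro sum.cong refl) auto
      also have "\<dots> = X $$ (i,j)" using ij by simp
      finally show "?post X $$ (i,j) = X $$ (i,j)" .
    qed (use X in \<open>auto simp: kmap_def\<close>)
    have e: "pairing ?n ?s \<rho> \<Phi>2 = pairing ?n ?s \<rho> (apply_sc a0' a1' a0' a1' b0 b1 1 (\<lambda>X. X) ?post \<Phi>2)"
    proof (rule pairing_cong[OF \<rho>c])
      fix X :: "complex mat" and k l assume X: "X \<in> carrier_mat ?n ?n" and kl: "k < ?s" "l < ?s"
      have "tid_right (1*a1') a1' b1 ?post Z = tid_right (1*a1') a1' b1 (\<lambda>X. X) Z" for Z
        by (rule eq_matI) (auto simp: tid_right_def post_id[simplified])
      then have "apply_sc a0' a1' a0' a1' b0 b1 1 (\<lambda>X. X) ?post \<Phi>2 X = apply_sc a0' a1' a0' a1' b0 b1 1 (\<lambda>X. X) (\<lambda>X. X) \<Phi>2 X"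
        unfolding apply_sc_def by (simp only:)
      also have "\<dots> = \<Phi>2 X" by (rule apply_sc_id[OF ch2 X])
      finally show "\<Phi>2 X $$ (k,l) = apply_sc a0' a1' a0' a1' b0 b1 1 (\<lambda>X. X) ?post \<Phi>2 X $$ (k,l)" by simp
    qed
    have "pairing ?n ?s \<rho> \<Phi>2 / real ?s
        = strat_value a0' a1' b0 b1 a0' a1' ?k ?l \<Phi>2 lam rho ?M 1 (\<lambda>X. X) ?N"
      unfolding e lam_def rho_def by (rule strat_value_rotated[OF pos(3,4,6) ch2 id U V N \<rho>, symmetric])
    also have "\<dots> \<le> pM a0' a1' b0 b1 a0' a1' ?k ?l \<Phi>2 lam rho ?M"
      by (rule pM_upper[OF ch2 M E _ id N]) simp
    finally show ?thesis .
  qed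
  have "pairing ?n ?s \<rho> \<Phi>2 / real ?s \<le> pM a0 a1 b0 b1 a0' a1' ?k ?l \<Phi>1 lam rho ?M + \<epsilon> / 2 * psucc (a0'*b0*a1'*b1) ?k ?l lam rho"
    using p2 iii E M unfolding cond_iii_def by (meson order.trans)
  also have "\<dots> \<le> Sup ?R / real ?s + \<epsilon> / 2 * (dual_dnorm ?n ?s \<rho> / real ?s)"
    using p1 ps \<epsilon> by (intro add_mono mult_left_mono) auto
  also have "\<dots> = (Sup ?R + \<epsilon> / 2 * dual_dnorm ?n ?s \<rho>) / real ?s" by (simp add: add_divide_distrib)
  finally have "pairing ?n ?s \<rho> \<Phi>2 \<le> Sup ?R + \<epsilon> / 2 * dual_dnorm ?n ?s \<rho>"
    using s by (simp only: divide_le_cancel of_nat_0_less_iff)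
  then show False using separated_Sup_gap[OF \<rho> \<epsilon> sep] \<beta> by linarith
qed

end

theorem theorem8:
  fixes a0 a1 a0' a1' b0 b1 :: nat
    and \<Phi>1 \<Phi>2 :: "complex mat \<Rightarrow> complex mat"
    and \<epsilon> :: real
  assumes "0 < a0" "0 < a1" "0 < a0'" "0 < a1'" "0 < b0" "0 < b1"
    and "channel (a0*b0) (a1*b1) \<Phi>1"
    and "channel (a0'*b0) (a1'*b1) \<Phi>2"
    and "0 \<le> \<epsilon>"
  shows "(delta a0 a1 a0' a1' b0 b1 \<Phi>1 \<Phi>2 \<le> \<epsilon> \<longleftrightarrow>
            (\<forall>r0 r1. 0 < r0 \<longrightarrow> 0 < r1 \<longrightarrow> cond_ii a0 a1 a0' a1' b0 b1 \<Phi>1 \<Phi>2 \<epsilon> r0 r1))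
       \<and> (delta a0 a1 a0' a1' b0 b1 \<Phi>1 \<Phi>2 \<le> \<epsilon> \<longleftrightarrow>
            (\<forall>r0 r1. 0 < r0 \<longrightarrow> 0 < r1 \<longrightarrow> cond_iii a0 a1 a0' a1' b0 b1 \<Phi>1 \<Phi>2 \<epsilon> r0 r1))
       \<and> (delta a0 a1 a0' a1' b0 b1 \<Phi>1 \<Phi>2 \<le> \<epsilon> \<longleftrightarrow> cond_ii a0 a1 a0' a1' b0 b1 \<Phi>1 \<Phi>2 \<epsilon> a0' a1')
       \<and> (delta a0 a1 a0' a1' b0 b1 \<Phi>1 \<Phi>2 \<le> \<epsilon> \<longleftrightarrow> cond_iii a0 a1 a0' a1' b0 b1 \<Phi>1 \<Phi>2 \<epsilon> a0' a1')"
proof -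
  interpret channel_pair a0 a1 a0' a1' b0 b1 \<Phi>1 \<Phi>2
    using assms by unfold_locales
  let ?d = "delta a0 a1 a0' a1' b0 b1 \<Phi>1 \<Phi>2 \<le> \<epsilon>"
  let ?ii = "cond_ii a0 a1 a0' a1' b0 b1 \<Phi>1 \<Phi>2 \<epsilon>" and ?iii = "cond_iii a0 a1 a0' a1' b0 b1 \<Phi>1 \<Phi>2 \<epsilon>"
  \<comment> \<open>The restricted conditions close both cycles: (i) gives the condition for all R,
    this contains R = A', and R = A' gives (i).\<close>
  have 1: "?d \<longrightarrow> (\<forall>r0 r1. 0 < r0 \<longrightarrow> 0 < r1 \<longrightarrow> ?ii r0 r1)"
    by (intro impI allI cond_ii_if_delta_le assms(9))
  have 2: "?d \<longrightarrow> (\<forall>r0 r1. 0 < r0 \<longrightarrow> 0 < r1 \<longrightarrow> ?iii r0 r1)"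
    by (intro impI allI cond_iii_if_delta_le assms(9))
  have 3: "?ii a0' a1' \<longrightarrow> ?d" by (intro impI delta_le_if_cond_ii assms(9))
  have 4: "?iii a0' a1' \<longrightarrow> ?d" by (intro impI delta_le_if_cond_iii assms(9))
  have 5: "(\<forall>r0 r1. 0 < r0 \<longrightarrow> 0 < r1 \<longrightarrow> P r0 r1) \<longrightarrow> P a0' a1'" for P :: "nat \<Rightarrow> nat \<Rightarrow> bool"
    using assms(3,4) by simp
  show ?thesis using 1 2 3 4 5[of ?ii] 5[of ?iii] by argo
qed

end
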